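(* Let $(\Lambda,\le)$, $R$, $F$, $M$, the basic subset $D$, the function $f$, the basic module $V(D,f)$, the subgroups $H\unlhd I\le M$, the linear character $\lambda:H\to F^*$ and the $1$-dimensional $H$-module $W$ be as in the context. Suppose $R$ is finite, $F$ is a splitting field for the (finite) group $S=I/H$ and $D$ has no special triple. Assume, in addition, that $I$ is a strongly ascendant subgroup of $M$. Then $V(D,f)$ has the following decomposition as the direct sum of irreducible non-isomorphic $M$-modules with indicated multiplicities: $$V(D,f)\cong\bigoplus_{\chi\in\mathrm{Irr}(S)}\chi(1)\;\mathrm{ind}_I^M(U_\chi\otimes W_1),$$ where $U_\chi$ is an irreducible $S$-module (viewed as an $I$-module) affording $\chi$, and $W_1$ is the vector space $W$ acted upon by $I$ via an extension of $\lambda$ to a homomorphism $I\to F^*$.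
   Context: Representation theory conventions: $F$ is a field; a $G$-module is a left $FG$-module, possibly infinite dimensional; $\mathrm{ind}_H^GW=FG\otimes_{FH}W$; $kV$ denotes the direct sum of $k$ copies of $V$. For the finite group $S$, $\mathrm{Irr}(S)$ is the set of irreducible characters of $S$ over $F$, $\chi(1)$ denotes the degree of $\chi$ (the integer $\dim_FU_\chi$), and $F$ is a splitting field for $S$ if $\mathrm{End}_{FS}(U)=F$ for every irreducible $FS$-module $U$. McLain group: $R$ is a ring with $1\ne0$ (not necessarily commutative), $(\Lambda,\leq)$ is a non-empty totally ordered set, $\Phi=\{(\alpha,\beta)\in\Lambda\times\Lambda:\alpha<\beta\}$. $J$ is the free left $R$-module with basis $e_{\alpha\beta}$, $(\alpha,\beta)\in\Phi$, made into a ring by $(re_{\alpha\beta})(se_{\beta\gamma})=rs\,e_{\alpha\gamma}$ and $(re_{\alpha\beta})(se_{\gamma\delta})=0$ if $\beta\neq\gamma$, extended additively. $J$ is nil, and $M=\{1+x:x\in J\}$ is a group under multiplication. $M_{\alpha\beta}=\{1+re_{\alpha\beta}:r\in R\}$. A subset $\Delta\subseteq\Phi$ is closed if $(\alpha,\beta),(\beta,\gamma)\in\Delta$ implies $(\alpha,\gamma)\in\Delta$; then $M(\Delta)=\langle M_{\alpha\beta}:(\alpha,\beta)\in\Delta\rangle$. A linear character (group homomorphism) $R^+\to F^*$ is right primitive if its kernel contains no right ideal of $R$ other than $(0)$. It is assumed throughout that $R$ admits a right primitive linear character $R^+\to F^*$. Elementary modules: let $(\alpha,\beta)\in\Phi$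 and let $\mu:R^+\to F^*$ be right primitive. Let $L$ be the subgroup generated by all $M_{\gamma\delta}$ with $\alpha\le\gamma<\delta\le\beta$; let $P$ be the subgroup of $L$ generated by all $M_{\gamma\beta}$ with $\alpha\le\gamma<\beta$ and all $M_{\gamma\delta}$ with $\alpha<\gamma<\delta<\beta$. There is a $1$-dimensional $P$-module on which $1+re_{\alpha\beta}$ acts as $\mu(r)$ and all the other listed generators act trivially; $V(\alpha,\beta,\mu)$ is the $L$-module induced from it, viewed as an $M$-module through $M=N\rtimes L$, where $N$ is the normal subgroup generated by all $M_{\gamma\delta}$ with $\gamma<\alpha$ or $\delta>\beta$, and $N$ acts trivially. Basic modules: $D=\{(\alpha_1,\beta_1),\dots,(\alpha_m,\beta_m)\}\subseteq\Phi$ ($m\ge1$) is basic if the $\alpha_i$ are distinct and the $\beta_i$ are distinct. $f$ assigns to each $(\alpha_i,\beta_i)$ a right primitive linear character $\lambda_i:R^+\to F^*$. The basic $M$-module is $V(D,f)=V(\alpha_m,\beta_m,\lambda_m)\otimes_F\cdots\otimes_FV(\alpha_1,\beta_1,\lambda_1)$ with diagonal action. Notation attached to $(D,f)$: $\Gamma=\Phi\setminus\bigcup_i\{(\alpha_i,\gamma)\in\Phi:\gamma<\beta_i\}$ and $H=M(\Gamma)$. For each $i$, $H_i=M(\Phi\setminus\{(\alpha_i,\gamma)\in\Phi:\gamma<\beta_i\})$ and $\widehat{\lambda_i}:H_i\to F^*$ is the homomorphism with $1+re_{\alpha_i\beta_i}\mapsto\lambda_i(r)$ that is trivial on all $M_{\alpha\beta}$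 with $(\alpha,\beta)\in\Phi\setminus\{(\alpha_i,\gamma)\in\Phi:\gamma\le\beta_i\}$. Then $H=\bigcap_iH_i$, $\lambda=\widehat{\lambda_1}|_H\cdots\widehat{\lambda_m}|_H$, and $W=Fw$ is the $1$-dimensional $H$-module on which $H$ acts via $\lambda$. $\Omega=\{(\alpha,\gamma)\in\Phi:\exists\,(\alpha,\beta),(\gamma,\delta)\in D\text{ with }\alpha<\gamma<\beta<\delta\}$, $\Gamma_1=\Gamma\cup\Omega$ (a closed subset of $\Phi$), and $I=M(\Gamma_1)$; $H$ is normal in $I$. $D$ has a special triple if it contains three elements $(a_1,b_1),(a_2,b_2),(a_3,b_3)$ with $a_1<a_2<a_3=b_1<b_2<b_3$. When $D$ has no special triple, $\lambda$ does extend to a homomorphism $I\to F^*$. A subgroup $S_0$ of a group $T$ is strongly ascendant (relative to $\mathrm{char}(F)$) if there is a well-ordered set $(X,\leq)$ with first element $x_0$ and last element $x_1$, and subgroups $S_x$, $x\in X$, of $T$ such that: $S_{x_0}=S_0$; $S_{x_1}=T$; for every $x\in X$, $x\neq x_1$, with successor $x'\in X$, $S_x$ is normal of finite index in $S_{x'}$ with $\mathrm{char}(F)\nmid[S_{x'}:S_x]$ (vacuous in characteristic $0$); and if $x\in X$, $x\neq x_0$, has no immediate predecessor in $X$, then $S_x=\bigcup_{y<x}S_y$. (For $x=x_0$, $S_{x_0}$ is the given subgroup.) *)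

theory Defs
  imports
    "HOL-Algebra.Generated_Groups"
    "HOL-Algebra.AbelCoset"
    "HOL-Library.Poly_Mapping"
    "Jordan_Normal_Form.VS_Connect"
begin

hide_const (open) Multiset.mult Polynomial.smult Modules.module

section \<open>Modules over group algebras\<close>

text \<open>
  The field \<open>F\<close> is a type of class \<^class>\<open>field\<close>, seen as a ring record via \<^term>\<open>class_ring\<close>.
  A \<open>G\<close>-module is an \<open>F\<close>-space in the sense of \<^locale>\<open>vectorspace\<close> with a linear action of
  \<open>G\<close>.  The fields \<^const>\<open>mult\<close> and \<^const>\<open>one\<close> inherited from \<open>module\<close> records
  play no role, except for the group algebra.
\<close>

record ('f, 'v, 'g) gmodule = "('f, 'v) module" +
  act :: "'g \<Rightarrow> 'v \<Rightarrow> 'v"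

locale gmodule = G: group G + V: vectorspace "class_ring :: 'f::field ring" V
  for G :: "('g, 'a) monoid_scheme" and V :: "('f::field, 'v, 'g, 'b) gmodule_scheme" +
  assumes act_closed: "\<lbrakk>g \<in> carrier G; v \<in> carrier V\<rbrakk> \<Longrightarrow> act V g v \<in> carrier V"
    and act_add: "\<lbrakk>g \<in> carrier G; v \<in> carrier V; w \<in> carrier V\<rbrakk> \<Longrightarrow>
        act V g (v \<oplus>\<^bsub>V\<^esub> w) = act V g v \<oplus>\<^bsub>V\<^esub> act V g w"
    and act_smult: "\<lbrakk>g \<in> carrier G; v \<in> carrier V\<rbrakk> \<Longrightarrow>
        act V g (c \<odot>\<^bsub>V\<^esub> v) = c \<odot>\<^bsub>V\<^esub> act V g v"
    and act_one: "v \<in> carrier V \<Longrightarrow> act V \<one>\<^bsub>G\<^esub> v = v"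
    and act_mult: "\<lbrakk>g \<in> carrier G; h \<in> carrier G; v \<in> carrier V\<rbrakk> \<Longrightarrow>
        act V (g \<otimes>\<^bsub>G\<^esub> h) v = act V g (act V h v)"

definition gmod_hom ::
    "('g, 'a) monoid_scheme \<Rightarrow> ('f::field, 'v, 'g, 'b) gmodule_scheme \<Rightarrow>
     ('f, 'w, 'g, 'c) gmodule_scheme \<Rightarrow> ('v \<Rightarrow> 'w) set" where
  "gmod_hom G V W = {T \<in> LinearCombinations.module_hom class_ring V W.
     \<forall>g\<in>carrier G. \<forall>v\<in>carrier V. T (act V g v) = act W g (T v)}"

definition gmod_isomorphic ::
    "('g, 'a) monoid_scheme \<Rightarrow> ('f::field, 'v, 'g, 'b) gmodule_scheme \<Rightarrow>
     ('f, 'w, 'g, 'c) gmodule_scheme \<Rightarrow> bool" where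
  "gmod_isomorphic G V W \<longleftrightarrow> (\<exists>T\<in>gmod_hom G V W. bij_betw T (carrier V) (carrier W))"

definition irreducible_gmodule ::
    "('g, 'a) monoid_scheme \<Rightarrow> ('f::field, 'v, 'g, 'b) gmodule_scheme \<Rightarrow> bool" where
  "irreducible_gmodule G V \<longleftrightarrow> gmodule G V \<and> carrier V \<noteq> {\<zero>\<^bsub>V\<^esub>} \<and>
     (\<forall>N. VectorSpace.subspace class_ring N V \<and> (\<forall>g\<in>carrier G. \<forall>v\<in>N. act V g v \<in> N)
        \<longrightarrow> N = {\<zero>\<^bsub>V\<^esub>} \<or> N = carrier V)"

text \<open>Restriction of the action along a map \<open>\<pi>\<close> of groups (inflation if \<open>\<pi>\<close> is a quotient map).\<close>

definition pullback :: "('h \<Rightarrow> 'g) \<Rightarrow> ('f, 'v, 'g) gmodule \<Rightarrow> ('f, 'v, 'h) gmodule" where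
  "pullback \<pi> V = \<lparr>carrier = carrier V, mult = mult V, one = one V, zero = zero V,
     add = add V, smult = smult V, act = (\<lambda>h. act V (\<pi> h))\<rparr>"

definition char_module :: "('g \<Rightarrow> 'f) \<Rightarrow> ('f::field, 'f, 'g) gmodule" where
  "char_module \<psi> = \<lparr>carrier = UNIV, mult = (*), one = 1, zero = 0, add = (+), smult = (*),
     act = (\<lambda>g v. \<psi> g * v)\<rparr>"

definition direct_sum_gmod ::
    "'i set \<Rightarrow> ('i \<Rightarrow> ('f, 'v, 'g) gmodule) \<Rightarrow> ('f, 'i \<Rightarrow> 'v, 'g) gmodule" where
  "direct_sum_gmod J V =
     \<lparr>carrier = {\<phi> \<in> (\<Pi>\<^sub>E i\<in>J. carrier (V i)). finite {i \<in> J. \<phi> i \<noteq> \<zero>\<^bsub>V i\<^esub>}},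
      mult = undefined, one = undefined,
      zero = (\<lambda>i\<in>J. \<zero>\<^bsub>V i\<^esub>),
      add = (\<lambda>\<phi> \<psi>. \<lambda>i\<in>J. \<phi> i \<oplus>\<^bsub>V i\<^esub> \<psi> i),
      smult = (\<lambda>c \<phi>. \<lambda>i\<in>J. c \<odot>\<^bsub>V i\<^esub> \<phi> i),
      act = (\<lambda>g \<phi>. \<lambda>i\<in>J. act (V i) g (\<phi> i))\<rparr>"

definition copies :: "nat \<Rightarrow> ('f, 'v, 'g) gmodule \<Rightarrow> ('f, nat \<Rightarrow> 'v, 'g) gmodule" where
  "copies k V = direct_sum_gmod {..<k} (\<lambda>_. V)"


subsection \<open>Tensor products and induction\<close>

definition free_space :: "'x set \<Rightarrow> ('f::field, 'x \<Rightarrow>\<^sub>0 'f) module" where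
  "free_space X = \<lparr>carrier = {p. Poly_Mapping.keys p \<subseteq> X}, mult = undefined, one = undefined,
     zero = 0, add = (+), smult = (\<lambda>c. Poly_Mapping.map ((*) c))\<rparr>"

definition linear_extension :: "('x \<Rightarrow> 'y) \<Rightarrow> ('x \<Rightarrow>\<^sub>0 'f::field) \<Rightarrow> ('y \<Rightarrow>\<^sub>0 'f)" where
  "linear_extension a p =
     (\<Sum>x\<in>Poly_Mapping.keys p. Poly_Mapping.single (a x) (Poly_Mapping.lookup p x))"

text \<open>
  The quotient of the free \<open>F\<close>-space on the symbols \<open>X\<close> by the span of the relations \<open>rels\<close>;
  \<open>a g\<close> is the map on symbols from which the action of \<open>g\<close> is induced.
\<close>

definition presented_gmod ::
    "'x set \<Rightarrow> ('x \<Rightarrow>\<^sub>0 'f) set \<Rightarrow> ('g \<Rightarrow> 'x \<Rightarrow> 'x) \<Rightarrow> ('f::field, ('x \<Rightarrow>\<^sub>0 'f) set, 'g) gmodule" where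
  "presented_gmod X rels a =
     (let E = free_space X; N = LinearCombinations.module.span class_ring E rels in
     \<lparr>carrier = a_rcosets\<^bsub>E\<^esub> N, mult = undefined, one = undefined,
      zero = N,
      add = (\<lambda>A B. A <+>\<^bsub>E\<^esub> B),
      smult = (\<lambda>c A. \<Union>p\<in>A. N +>\<^bsub>E\<^esub> (c \<odot>\<^bsub>E\<^esub> p)),
      act = (\<lambda>g A. \<Union>p\<in>A. N +>\<^bsub>E\<^esub> linear_extension (a g) p)\<rparr>)"

abbreviation symb :: "'x \<Rightarrow> ('x \<Rightarrow>\<^sub>0 'f::field)" where
  "symb x \<equiv> Poly_Mapping.single x 1"

definition bilinear_rels ::
    "('f::field, 'v, 'a) module_scheme \<Rightarrow> ('f, 'w, 'b) module_scheme \<Rightarrow> ('v \<times> 'w \<Rightarrow>\<^sub>0 'f) set" where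
  "bilinear_rels V W =
     {symb (v \<oplus>\<^bsub>V\<^esub> v', w) - symb (v, w) - symb (v', w) |
        v v' w. v \<in> carrier V \<and> v' \<in> carrier V \<and> w \<in> carrier W} \<union>
     {symb (v, w \<oplus>\<^bsub>W\<^esub> w') - symb (v, w) - symb (v, w') |
        v w w'. v \<in> carrier V \<and> w \<in> carrier W \<and> w' \<in> carrier W} \<union>
     {symb (c \<odot>\<^bsub>V\<^esub> v, w) - Poly_Mapping.single (v, w) c |
        c v w. v \<in> carrier V \<and> w \<in> carrier W} \<union>
     {symb (v, c \<odot>\<^bsub>W\<^esub> w) - Poly_Mapping.single (v, w) c |
        c v w. v \<in> carrier V \<and> w \<in> carrier W}"

definition tensor_gmod ::
    "('f::field, 'v, 'g) gmodule \<Rightarrow> ('f, 'w, 'g) gmodule \<Rightarrow>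
     ('f, ('v \<times> 'w \<Rightarrow>\<^sub>0 'f) set, 'g) gmodule" where
  "tensor_gmod V W = presented_gmod (carrier V \<times> carrier W) (bilinear_rels V W)
     (\<lambda>g (v, w). (act V g v, act W g w))"

text \<open>
  The tensor product over \<open>F\<close> of a finite family.  It is a quotient of the free space on
  \<open>\<Pi>\<^sub>E i\<in>J. carrier (V i)\<close>, since iterating the binary product would change the type of
  the module at each step.
\<close>

definition multilinear_rels ::
    "'i set \<Rightarrow> ('i \<Rightarrow> ('f::field, 'v, 'a) module_scheme) \<Rightarrow> (('i \<Rightarrow> 'v) \<Rightarrow>\<^sub>0 'f) set" where
  "multilinear_rels J V =
     {symb (\<phi>(i := v \<oplus>\<^bsub>V i\<^esub> v')) - symb (\<phi>(i := v)) - symb (\<phi>(i := v')) |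
        \<phi> i v v'. \<phi> \<in> (\<Pi>\<^sub>E j\<in>J. carrier (V j)) \<and> i \<in> J \<and> v \<in> carrier (V i) \<and> v' \<in> carrier (V i)} \<union>
     {symb (\<phi>(i := c \<odot>\<^bsub>V i\<^esub> v)) - Poly_Mapping.single (\<phi>(i := v)) c |
        \<phi> i c v. \<phi> \<in> (\<Pi>\<^sub>E j\<in>J. carrier (V j)) \<and> i \<in> J \<and> v \<in> carrier (V i)}"

definition tensor_family ::
    "'i set \<Rightarrow> ('i \<Rightarrow> ('f::field, 'v, 'g) gmodule) \<Rightarrow>
     ('f, (('i \<Rightarrow> 'v) \<Rightarrow>\<^sub>0 'f) set, 'g) gmodule" where
  "tensor_family J V = presented_gmod (\<Pi>\<^sub>E i\<in>J. carrier (V i)) (multilinear_rels J V)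
     (\<lambda>g \<phi>. \<lambda>i\<in>J. act (V i) g (\<phi> i))"

definition group_algebra :: "('g, 'a) monoid_scheme \<Rightarrow> ('f::field, 'g \<Rightarrow>\<^sub>0 'f) module" where
  "group_algebra G =
     \<lparr>carrier = {x. Poly_Mapping.keys x \<subseteq> carrier G},
      mult = (\<lambda>x y. \<Sum>g\<in>Poly_Mapping.keys x. \<Sum>h\<in>Poly_Mapping.keys y.
                Poly_Mapping.single (g \<otimes>\<^bsub>G\<^esub> h) (Poly_Mapping.lookup x g * Poly_Mapping.lookup y h)),
      one = symb \<one>\<^bsub>G\<^esub>,
      zero = 0, add = (+), smult = (\<lambda>c. Poly_Mapping.map ((*) c))\<rparr>"

definition algebra_act :: "('f::field, 'v, 'g, 'b) gmodule_scheme \<Rightarrow> ('g \<Rightarrow>\<^sub>0 'f) \<Rightarrow> 'v \<Rightarrow> 'v" where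
  "algebra_act V x v =
     (\<Oplus>\<^bsub>V\<^esub>g\<in>Poly_Mapping.keys x. Poly_Mapping.lookup x g \<odot>\<^bsub>V\<^esub> act V g v)"

text \<open>\<open>FG \<otimes>\<^bsub>FH\<^esub> W\<close> for a subgroup \<open>H\<close> of \<open>G\<close> and an \<open>H\<close>-module \<open>W\<close>.\<close>

definition induced ::
    "('g, 'a) monoid_scheme \<Rightarrow> 'g set \<Rightarrow> ('f::field, 'w, 'g) gmodule \<Rightarrow>
     ('f, (('g \<Rightarrow>\<^sub>0 'f) \<times> 'w \<Rightarrow>\<^sub>0 'f) set, 'g) gmodule" where
  "induced G H W =
     (let FG = group_algebra G; FH = group_algebra (G\<lparr>carrier := H\<rparr>) in
      presented_gmod (carrier FG \<times> carrier W)
        (bilinear_rels FG W \<union>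
         {symb (x \<otimes>\<^bsub>FG\<^esub> b, w) - symb (x, algebra_act W b w) |
            x b w. x \<in> carrier FG \<and> b \<in> carrier FH \<and> w \<in> carrier W})
        (\<lambda>g (x, w). (symb g \<otimes>\<^bsub>FG\<^esub> x, w)))"


subsection \<open>Irreducible characters and splitting fields of finite groups\<close>

definition trace_on :: "('f::field, 'v, 'a) module_scheme \<Rightarrow> ('v \<Rightarrow> 'v) \<Rightarrow> 'f" where
  "trace_on V T = (THE t. \<exists>B a. finite B \<and> vectorspace.basis class_ring V B \<and>
     (\<forall>b\<in>B. T b = LinearCombinations.module.lincomb V (a b) B) \<and> t = (\<Sum>b\<in>B. a b b))"

definition character_of ::
    "('g, 'a) monoid_scheme \<Rightarrow> ('f::field, 'v, 'g, 'b) gmodule_scheme \<Rightarrow> 'g \<Rightarrow> 'f" where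
  "character_of G V = (\<lambda>g\<in>carrier G. trace_on V (act V g))"

text \<open>
  For a finite group all irreducible modules are finite dimensional, hence isomorphic to modules
  whose elements lie in \<^typ>\<open>'f vec\<close>; so it is no restriction to quantify only over these.
\<close>

definition Irr :: "('g, 'a) monoid_scheme \<Rightarrow> ('g \<Rightarrow> 'f::field) set" where
  "Irr S = {character_of S U | U :: ('f, 'f vec, 'g) gmodule. irreducible_gmodule S U}"

definition splitting_field :: "'f::field itself \<Rightarrow> ('g, 'a) monoid_scheme \<Rightarrow> bool" where
  "splitting_field _ S \<longleftrightarrow> (\<forall>U :: ('f, 'f vec, 'g) gmodule. irreducible_gmodule S U \<longrightarrow>
     (\<forall>T\<in>gmod_hom S U U. \<exists>c. \<forall>v\<in>carrier U. T v = c \<odot>\<^bsub>U\<^esub> v))"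


section \<open>Strongly ascendant subgroups\<close>

text \<open>
  The well-ordered index set is a subset \<open>X\<close> of the type \<^typ>\<open>'x\<close>, so a hypothesis
  \<open>strongly_ascendant TYPE('x) p T S\<^sub>0\<close> with a free type variable covers all well-ordered sets.
  Here \<open>p\<close> is the characteristic of the field; for \<open>p = 0\<close> the divisibility condition holds
  automatically.
\<close>

definition immediate_succ :: "('x \<times> 'x) set \<Rightarrow> 'x \<Rightarrow> 'x \<Rightarrow> bool" where
  "immediate_succ r x x' \<longleftrightarrow> (x, x') \<in> r \<and> x \<noteq> x' \<and>
     (\<forall>y. (x, y) \<in> r \<and> (y, x') \<in> r \<longrightarrow> y = x \<or> y = x')"

definition strongly_ascendant ::
    "'x itself \<Rightarrow> nat \<Rightarrow> ('g, 'a) monoid_scheme \<Rightarrow> 'g set \<Rightarrow> bool" where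
  "strongly_ascendant _ p T S\<^sub>0 \<longleftrightarrow>
     (\<exists>(X :: 'x set) r x\<^sub>0 x\<^sub>1 A.
        well_order_on X r \<and> x\<^sub>0 \<in> X \<and> x\<^sub>1 \<in> X \<and> (\<forall>x\<in>X. (x\<^sub>0, x) \<in> r \<and> (x, x\<^sub>1) \<in> r) \<and>
        (\<forall>x\<in>X. subgroup (A x) T) \<and>
        A x\<^sub>0 = S\<^sub>0 \<and> A x\<^sub>1 = carrier T \<and>
        (\<forall>x\<in>X. \<forall>x'\<in>X. immediate_succ r x x' \<longrightarrow>
           A x \<lhd> T\<lparr>carrier := A x'\<rparr> \<and>
           finite (rcosets\<^bsub>T\<lparr>carrier := A x'\<rparr>\<^esub> A x) \<and>
           \<not> p dvd card (rcosets\<^bsub>T\<lparr>carrier := A x'\<rparr>\<^esub> A x)) \<and>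
        (\<forall>x\<in>X. x \<noteq> x\<^sub>0 \<and> (\<nexists>y. y \<in> X \<and> immediate_succ r y x) \<longrightarrow>
           A x = (\<Union>y\<in>{y \<in> X. (y, x) \<in> r \<and> y \<noteq> x}. A y)))"


section \<open>McLain groups\<close>

text \<open>
  \<open>\<Lambda>\<close> is a type of class \<^class>\<open>linorder\<close> and \<open>R\<close> a type of class \<^class>\<open>ring_1\<close>.  An element
  \<open>\<Sum> r e\<^sub>\<alpha>\<^sub>\<beta>\<close> of \<open>J\<close> is the finitely supported function \<open>(\<alpha>, \<beta>) \<mapsto> r\<close>.  The element
  \<open>1 + x\<close> of \<open>M\<close> is represented by \<open>x \<in> J\<close>; so multiplication is
  \<open>(1 + x)(1 + y) = 1 + (x + y + xy)\<close> and the identity is \<open>0\<close>.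
\<close>

type_synonym ('l, 'r) mclain_elt = "('l \<times> 'l) \<Rightarrow>\<^sub>0 'r"

definition Phi :: "('l::linorder \<times> 'l) set" where
  "Phi = {(\<alpha>, \<beta>). \<alpha> < \<beta>}"

definition J_mult ::
    "('l, 'r) mclain_elt \<Rightarrow> ('l, 'r) mclain_elt \<Rightarrow> ('l::linorder, 'r::ring_1) mclain_elt" where
  "J_mult x y = (\<Sum>(\<alpha>, \<beta>)\<in>Poly_Mapping.keys x. \<Sum>(\<gamma>, \<delta>)\<in>Poly_Mapping.keys y.
     if \<beta> = \<gamma>
     then Poly_Mapping.single (\<alpha>, \<delta>) (Poly_Mapping.lookup x (\<alpha>, \<beta>) * Poly_Mapping.lookup y (\<gamma>, \<delta>))
     else 0)"

definition mclain :: "('l::linorder, 'r::ring_1) mclain_elt monoid" where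
  "mclain = \<lparr>carrier = {x. Poly_Mapping.keys x \<subseteq> Phi},
     mult = (\<lambda>x y. x + y + J_mult x y), one = 0\<rparr>"

definition root_elt :: "'l \<times> 'l \<Rightarrow> 'r \<Rightarrow> ('l::linorder, 'r::ring_1) mclain_elt" where
  "root_elt d r = Poly_Mapping.single d r"

definition mclain_sub :: "('l \<times> 'l) set \<Rightarrow> ('l::linorder, 'r::ring_1) mclain_elt set" where
  "mclain_sub \<Delta> = generate mclain (\<Union>d\<in>\<Delta>. range (root_elt d))"


subsection \<open>Linear characters\<close>

abbreviation F_star :: "'f::field monoid" where
  "F_star \<equiv> units_of class_ring"

definition right_ideal :: "'r::ring_1 set \<Rightarrow> bool" where
  "right_ideal A \<longleftrightarrow> subgroup A (add_monoid class_ring) \<and> (\<forall>x\<in>A. \<forall>r. x * r \<in> A)"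

definition right_primitive :: "('r::ring_1 \<Rightarrow> 'f::field) \<Rightarrow> bool" where
  "right_primitive \<mu> \<longleftrightarrow> \<mu> \<in> hom (add_monoid class_ring) F_star \<and>
     (\<forall>A. right_ideal A \<and> A \<subseteq> {r. \<mu> r = 1} \<longrightarrow> A = {0})"

text \<open>
  The homomorphism \<open>M(\<Delta>) \<rightarrow> F*\<close> that sends \<open>1 + r e\<^sub>d\<close> to \<open>\<mu> r\<close> and is trivial on the root
  subgroups of all other roots in \<open>\<Delta>\<close>.  It is unique, as \<open>M(\<Delta>)\<close> is generated by these root
  subgroups, and it is only used for \<open>\<Delta>\<close> and \<open>d\<close> for which it exists.
\<close>

definition root_char ::
    "('l \<times> 'l) set \<Rightarrow> 'l \<times> 'l \<Rightarrow> ('r \<Rightarrow> 'f) \<Rightarrow> ('l::linorder, 'r::ring_1) mclain_elt \<Rightarrow> 'f::field" where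
  "root_char \<Delta> d \<mu> = (THE \<psi>.
     \<psi> \<in> hom (mclain\<lparr>carrier := mclain_sub \<Delta>\<rparr>) F_star \<and> \<psi> \<in> extensional (mclain_sub \<Delta>) \<and>
     (\<forall>r. \<psi> (root_elt d r) = \<mu> r) \<and>
     (\<forall>e\<in>\<Delta> - {d}. \<forall>r. \<psi> (root_elt e r) = 1))"


subsection \<open>Elementary and basic modules\<close>

definition elem_L :: "'l \<times> 'l \<Rightarrow> ('l::linorder, 'r::ring_1) mclain_elt set" where
  "elem_L = (\<lambda>(\<alpha>, \<beta>). mclain_sub {(\<gamma>, \<delta>). \<alpha> \<le> \<gamma> \<and> \<gamma> < \<delta> \<and> \<delta> \<le> \<beta>})"

definition elem_P_roots :: "'l::linorder \<times> 'l \<Rightarrow> ('l \<times> 'l) set" where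
  "elem_P_roots = (\<lambda>(\<alpha>, \<beta>). {(\<gamma>, \<beta>) | \<gamma>. \<alpha> \<le> \<gamma> \<and> \<gamma> < \<beta>} \<union>
     {(\<gamma>, \<delta>). \<alpha> < \<gamma> \<and> \<gamma> < \<delta> \<and> \<delta> < \<beta>})"

definition elem_N :: "'l \<times> 'l \<Rightarrow> ('l::linorder, 'r::ring_1) mclain_elt set" where
  "elem_N = (\<lambda>(\<alpha>, \<beta>). generate mclain
     {g \<otimes>\<^bsub>mclain\<^esub> x \<otimes>\<^bsub>mclain\<^esub> inv\<^bsub>mclain\<^esub> g | g x. g \<in> carrier mclain \<and>
        (\<exists>(\<gamma>, \<delta>)\<in>Phi. (\<gamma> < \<alpha> \<or> \<delta> > \<beta>) \<and> x \<in> range (root_elt (\<gamma>, \<delta>)))})"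

definition elem_proj ::
    "'l \<times> 'l \<Rightarrow> ('l::linorder, 'r::ring_1) mclain_elt \<Rightarrow> ('l, 'r) mclain_elt" where
  "elem_proj d g = (THE l. l \<in> elem_L d \<and> (\<exists>n\<in>elem_N d. g = n \<otimes>\<^bsub>mclain\<^esub> l))"

definition elementary_module where
  "elementary_module d (\<mu> :: 'r::ring_1 \<Rightarrow> 'f::field) =
     pullback (elem_proj d)
       (induced (mclain\<lparr>carrier := elem_L d\<rparr> :: ('l::linorder, 'r) mclain_elt monoid)
          (mclain_sub (elem_P_roots d))
          (char_module (root_char (elem_P_roots d) d \<mu>)))"

definition basic_set :: "('l::linorder \<times> 'l) set \<Rightarrow> bool" where
  "basic_set D \<longleftrightarrow> finite D \<and> D \<noteq> {} \<and> D \<subseteq> Phi \<and> inj_on fst D \<and> inj_on snd D"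

definition basic_module where
  "basic_module (D :: ('l::linorder \<times> 'l) set) (f :: 'l \<times> 'l \<Rightarrow> 'r::ring_1 \<Rightarrow> 'f::field) =
     tensor_family D (\<lambda>d. elementary_module d (f d))"


subsection \<open>Subgroups and characters attached to a basic set\<close>

definition Gamma :: "('l::linorder \<times> 'l) set \<Rightarrow> ('l \<times> 'l) set" where
  "Gamma D = Phi - (\<Union>(\<alpha>, \<beta>)\<in>D. {(\<alpha>, \<gamma>) | \<gamma>. (\<alpha>, \<gamma>) \<in> Phi \<and> \<gamma> < \<beta>})"

definition Omega :: "('l::linorder \<times> 'l) set \<Rightarrow> ('l \<times> 'l) set" where
  "Omega D = {(\<alpha>, \<gamma>). (\<alpha>, \<gamma>) \<in> Phi \<and>
     (\<exists>\<beta> \<delta>. (\<alpha>, \<beta>) \<in> D \<and> (\<gamma>, \<delta>) \<in> D \<and> \<alpha> < \<gamma> \<and> \<gamma> < \<beta> \<and> \<beta> < \<delta>)}"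

definition H_sub :: "('l \<times> 'l) set \<Rightarrow> ('l::linorder, 'r::ring_1) mclain_elt set" where
  "H_sub D = mclain_sub (Gamma D)"

definition I_sub :: "('l \<times> 'l) set \<Rightarrow> ('l::linorder, 'r::ring_1) mclain_elt set" where
  "I_sub D = mclain_sub (Gamma D \<union> Omega D)"

definition S_quot :: "('l \<times> 'l) set \<Rightarrow> ('l::linorder, 'r::ring_1) mclain_elt set monoid" where
  "S_quot D = mclain\<lparr>carrier := I_sub D\<rparr> Mod H_sub D"

text \<open>\<open>lambda_hat d\<close> is defined on \<open>H\<^sub>d = M(\<Phi> - {(\<alpha>, \<gamma>). \<gamma> < \<beta>}) \<supseteq> H\<close>, for \<open>d = (\<alpha>, \<beta>)\<close>.\<close>

definition lambda_hat ::
    "'l \<times> 'l \<Rightarrow> ('r \<Rightarrow> 'f) \<Rightarrow> ('l::linorder, 'r::ring_1) mclain_elt \<Rightarrow> 'f::field" where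
  "lambda_hat d \<mu> = root_char (Phi - {(\<alpha>, \<gamma>). \<alpha> = fst d \<and> \<gamma> < snd d}) d \<mu>"

definition lambda_char ::
    "('l \<times> 'l) set \<Rightarrow> ('l \<times> 'l \<Rightarrow> 'r \<Rightarrow> 'f) \<Rightarrow>
     ('l::linorder, 'r::ring_1) mclain_elt \<Rightarrow> 'f::field" where
  "lambda_char D f = (\<lambda>x\<in>H_sub D. \<Prod>d\<in>D. lambda_hat d (f d) x)"

definition special_triple :: "('l::linorder \<times> 'l) set \<Rightarrow> bool" where
  "special_triple D \<longleftrightarrow> (\<exists>a\<^sub>1 b\<^sub>1 a\<^sub>2 b\<^sub>2 a\<^sub>3 b\<^sub>3.
     (a\<^sub>1, b\<^sub>1) \<in> D \<and> (a\<^sub>2, b\<^sub>2) \<in> D \<and> (a\<^sub>3, b\<^sub>3) \<in> D \<and>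
     a\<^sub>1 < a\<^sub>2 \<and> a\<^sub>2 < a\<^sub>3 \<and> a\<^sub>3 = b\<^sub>1 \<and> b\<^sub>1 < b\<^sub>2 \<and> b\<^sub>2 < b\<^sub>3)"

text \<open>\<open>ind\<^sub>I\<^sup>M (U \<otimes> W\<^sub>1)\<close>, for an \<open>S\<close>-module \<open>U\<close> inflated to \<open>I\<close> and \<open>W\<^sub>1\<close> given by \<open>lam1 : I \<rightarrow> F*\<close>.\<close>

definition constituent where
  "constituent (D :: ('l::linorder \<times> 'l) set)
     (U :: ('f::field, 'u, ('l, 'r::ring_1) mclain_elt set) gmodule) lam1 =
     induced mclain (I_sub D)
       (tensor_gmod (pullback (\<lambda>x. H_sub D #>\<^bsub>mclain\<^esub> x) U) (char_module lam1))"

end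

theory Submission
  imports Defs "HOL-Algebra.Sylow"
begin

text \<open>
  A \<open>G\<close>-module \<open>V\<close> is \<open>ind\<^sub>H\<^sup>G W\<close> as soon as there are linear maps \<open>\<iota> : W \<rightarrow> V\<close> and \<open>p : V \<rightarrow> W\<close>
  such that \<open>\<iota>\<close> commutes with \<open>H\<close>, the \<open>g \<iota>(w)\<close> span \<open>V\<close>, and \<open>p(g \<iota>(w))\<close> is \<open>g w\<close> or \<open>0\<close> according to
  whether \<open>g \<in> H\<close>.  Both sides of the decomposition are recognised in this way as \<open>ind\<^sub>H\<^sup>M W\<close>.
  The elementary factors of \<open>V(D, f)\<close> are induced from the \<open>H\<^sub>i\<close>, and \<open>M\<close> acts transitively on the
  product of the coset spaces \<open>M/H\<^sub>i\<close>, so their tensor product is induced from \<open>H = \<Inter>\<^sub>i H\<^sub>i\<close>.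
  The right-hand side is induced from the regular module of \<open>S = I/H\<close> twisted by the extension of \<open>\<lambda>\<close>,
  and the orthogonality relations show that the vector with components \<open>\<iota>\<^sub>\<chi>(b\<^sub>\<chi>\<^sub>j)\<close>, for bases \<open>b\<^sub>\<chi>\<^sub>j\<close>
  of the \<open>U\<^sub>\<chi>\<close>, generates it.

  For \<open>g \<notin> I\<close> there are \<open>k, k' \<in> H\<close> with \<open>k g = g k'\<close> and \<open>\<lambda>(k) \<noteq> \<lambda>(k')\<close>.  As \<open>H\<close> is a directed union
  of finite subgroups \<open>K\<close> whose orders are powers of \<open>|R|\<close>, hence nonzero in \<open>F\<close>, averaging
  \<open>\<lambda>(k)\<^sup>-\<^sup>1 k v\<close> over a large \<open>K\<close> maps any \<open>v \<in> ind\<^sub>I\<^sup>M X\<close> to its component in \<open>X\<close>.  Submodules of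
  \<open>ind\<^sub>I\<^sup>M X\<close>, and isomorphisms between such modules, are therefore determined on \<open>X = U\<^sub>\<chi> \<otimes> W\<^sub>1\<close>.
\<close>

hide_const (open) Multiset.mult

section \<open>Linear maps and subspaces of module records\<close>

text \<open>M/I may be infinite and the modules infinite dimensional, so dimension counts are out of
  reach and induced modules are compared through the pair (\<iota>, p). The finite objects are S =
  I/H and the subgroups K of H, whose orders are powers of |R|. If p = char F divided |R|, the
  elements of R killed by p would form a nonzero right ideal; its image under a linear character
  consists of p-th roots of unity in F, all equal to 1, against right primitivity. Hence both orders
  can be divided by. Transitivity on the product of the M/H_i holds because membership in H_i
  constrains row \<alpha>_i only and the \<alpha>_i are distinct. The functional belonging to the
  generator of the right-hand side is the sum of the traces on the U_\<chi>, weighted by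
  1/\<kappa>_\<chi>, where \<kappa>_\<chi> \<chi>(1) = |S|. That it vanishes on I outside H is the
  expansion of 1 in FS by central idempotents. This expansion rests on the fact that no nonzero
  element of FS acts as zero on all U_\<chi>.\<close>

definition lin_closed :: "('f::field, 'v, 'a) module_scheme \<Rightarrow> 'v set \<Rightarrow> bool" where
  "lin_closed V Q \<longleftrightarrow> Q \<subseteq> carrier V \<and> \<zero>\<^bsub>V\<^esub> \<in> Q \<and> (\<forall>v\<in>Q. \<forall>w\<in>Q. v \<oplus>\<^bsub>V\<^esub> w \<in> Q) \<and>
     (\<forall>c. \<forall>v\<in>Q. c \<odot>\<^bsub>V\<^esub> v \<in> Q)"

lemma lin_closedI:
  assumes "Q \<subseteq> carrier V" "\<zero>\<^bsub>V\<^esub> \<in> Q" "\<And>v w. v \<in> Q \<Longrightarrow> w \<in> Q \<Longrightarrow> v \<oplus>\<^bsub>V\<^esub> w \<in> Q"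
    "\<And>c v. v \<in> Q \<Longrightarrow> c \<odot>\<^bsub>V\<^esub> v \<in> Q"
  shows "lin_closed V Q"
  using assms by (auto simp: lin_closed_def)

lemma lin_closedD:
  assumes "lin_closed V Q"
  shows "Q \<subseteq> carrier V" "\<zero>\<^bsub>V\<^esub> \<in> Q" "v \<in> Q \<Longrightarrow> w \<in> Q \<Longrightarrow> v \<oplus>\<^bsub>V\<^esub> w \<in> Q"
    "v \<in> Q \<Longrightarrow> c \<odot>\<^bsub>V\<^esub> v \<in> Q"
  using assms by (auto simp: lin_closed_def)

text \<open>\<open>VectorSpace.subspace\<close> contains the vector space axioms for V, whereas
  \<open>lin_closed\<close> speaks of Q alone. With it, spanning statements take the form of
  induction rules over sets Q.\<close>

lemma lin_closed_if_subspace: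
  assumes "VectorSpace.subspace class_ring Q V"
  shows "lin_closed V Q"
  using assms by (auto simp: lin_closed_def VectorSpace.subspace_def submodule_def)

abbreviation lin_hom ::
    "('f::field, 'v, 'a) module_scheme \<Rightarrow> ('f, 'w, 'b) module_scheme \<Rightarrow> ('v \<Rightarrow> 'w) set" where
  "lin_hom V W \<equiv> LinearCombinations.module_hom class_ring V W"

lemma lin_homI:
  assumes "\<And>v. v \<in> carrier V \<Longrightarrow> T v \<in> carrier W"
    "\<And>v w. v \<in> carrier V \<Longrightarrow> w \<in> carrier V \<Longrightarrow> T (v \<oplus>\<^bsub>V\<^esub> w) = T v \<oplus>\<^bsub>W\<^esub> T w"
    "\<And>c v. v \<in> carrier V \<Longrightarrow> T (c \<odot>\<^bsub>V\<^esub> v) = c \<odot>\<^bsub>W\<^esub> T v"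
  shows "T \<in> lin_hom V W"
  using assms by (auto simp: LinearCombinations.module_hom_def)

lemma lin_homD:
  assumes "T \<in> lin_hom V W"
  shows "v \<in> carrier V \<Longrightarrow> T v \<in> carrier W"
    "v \<in> carrier V \<Longrightarrow> w \<in> carrier V \<Longrightarrow> T (v \<oplus>\<^bsub>V\<^esub> w) = T v \<oplus>\<^bsub>W\<^esub> T w"
    "v \<in> carrier V \<Longrightarrow> T (c \<odot>\<^bsub>V\<^esub> v) = c \<odot>\<^bsub>W\<^esub> T v"
  using assms by (auto simp: LinearCombinations.module_hom_def)

text \<open>The scalars fill a whole type, so the primed rules below carry no membership conditions
  for scalars.\<close>

locale fvs = vectorspace "class_ring :: ('f::field) ring" V
  for V :: "('f::field, 'v, 'a) module_scheme" (structure)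
begin

lemma subspace_if_lin_closed:
  assumes "lin_closed V Q"
  shows "VectorSpace.subspace class_ring Q V"
  using assms vectorspace_axioms module_axioms
  by (auto simp: lin_closed_def VectorSpace.subspace_def submodule_def)

lemma smult_closed': "v \<in> carrier V \<Longrightarrow> c \<odot>\<^bsub>V\<^esub> v \<in> carrier V"
  using smult_closed[of c v] by simp

lemma smult_l_distr': "v \<in> carrier V \<Longrightarrow> (c + d) \<odot>\<^bsub>V\<^esub> v = c \<odot>\<^bsub>V\<^esub> v \<oplus>\<^bsub>V\<^esub> d \<odot>\<^bsub>V\<^esub> v"
  using smult_l_distr[of c d v] by simp

lemma smult_r_distr': "v \<in> carrier V \<Longrightarrow> w \<in> carrier V \<Longrightarrow>
    c \<odot>\<^bsub>V\<^esub> (v \<oplus>\<^bsub>V\<^esub> w) = c \<odot>\<^bsub>V\<^esub> v \<oplus>\<^bsub>V\<^esub> c \<odot>\<^bsub>V\<^esub> w"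
  using smult_r_distr[of c v w] by simp

lemma smult_assoc': "v \<in> carrier V \<Longrightarrow> c \<odot>\<^bsub>V\<^esub> (d \<odot>\<^bsub>V\<^esub> v) = (c * d) \<odot>\<^bsub>V\<^esub> v"
  using smult_assoc1[of c d v] by simp

lemma smult_one': "v \<in> carrier V \<Longrightarrow> 1 \<odot>\<^bsub>V\<^esub> v = v"
  using smult_one[of v] by simp

lemma smult_zero': "v \<in> carrier V \<Longrightarrow> 0 \<odot>\<^bsub>V\<^esub> v = \<zero>\<^bsub>V\<^esub>"
  using lmult_0[of v] by simp

lemma smult_rzero': "c \<odot>\<^bsub>V\<^esub> \<zero>\<^bsub>V\<^esub> = \<zero>\<^bsub>V\<^esub>"
  using rmult_0[of c] by simp

lemma smult_eq_zero':
  assumes "v \<in> carrier V" "c \<odot>\<^bsub>V\<^esub> v = \<zero>\<^bsub>V\<^esub>" "c \<noteq> 0"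
  shows "v = \<zero>\<^bsub>V\<^esub>"
proof -
  have "v = (inverse c * c) \<odot>\<^bsub>V\<^esub> v" using assms smult_one' by simp
  also have "\<dots> = inverse c \<odot>\<^bsub>V\<^esub> (c \<odot>\<^bsub>V\<^esub> v)" using assms(1) smult_assoc' by metis
  finally show ?thesis using assms(2) smult_rzero' by metis
qed

lemmas vsimps = smult_closed' smult_l_distr' smult_r_distr' smult_assoc' smult_one' smult_zero'
  smult_rzero'

lemma finsum_in_lin_closed:
  assumes "lin_closed V Q" "finite A" "\<And>x. x \<in> A \<Longrightarrow> f x \<in> Q"
  shows "(\<Oplus>\<^bsub>V\<^esub>x\<in>A. f x) \<in> Q"
  using assms(2,3)
proof (induction A)
  case empty
  then show ?case using lin_closedD(2)[OF assms(1)] by simp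
next
  case (insert x A)
  then have "f x \<in> carrier V" "f \<in> A \<rightarrow> carrier V" using lin_closedD(1)[OF assms(1)] by auto
  with insert show ?case using lin_closedD(3)[OF assms(1)] by (simp add: insert)
qed

lemma smult_finsum:
  assumes "finite A" "\<And>x. x \<in> A \<Longrightarrow> f x \<in> carrier V"
  shows "c \<odot>\<^bsub>V\<^esub> (\<Oplus>\<^bsub>V\<^esub>x\<in>A. f x) = (\<Oplus>\<^bsub>V\<^esub>x\<in>A. c \<odot>\<^bsub>V\<^esub> f x)"
  using assms by (induction A) (auto simp: vsimps Pi_def)

lemma finsum_smult_left:
  assumes "finite A" "v \<in> carrier V"
  shows "(\<Oplus>\<^bsub>V\<^esub>x\<in>A. c x \<odot>\<^bsub>V\<^esub> v) = (\<Sum>x\<in>A. c x) \<odot>\<^bsub>V\<^esub> v"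
  using assms by (induction A) (auto simp: vsimps Pi_def)

end

lemma fvs_if_vectorspace: "vectorspace class_ring V \<Longrightarrow> fvs V"
  by (simp add: fvs_def)

lemma fvsI:
  assumes "\<zero>\<^bsub>V\<^esub> \<in> carrier V"
    "\<And>v w. v \<in> carrier V \<Longrightarrow> w \<in> carrier V \<Longrightarrow> v \<oplus>\<^bsub>V\<^esub> w \<in> carrier V"
    "\<And>v w. v \<in> carrier V \<Longrightarrow> w \<in> carrier V \<Longrightarrow> v \<oplus>\<^bsub>V\<^esub> w = w \<oplus>\<^bsub>V\<^esub> v"
    "\<And>u v w. u \<in> carrier V \<Longrightarrow> v \<in> carrier V \<Longrightarrow> w \<in> carrier V \<Longrightarrow>
       (u \<oplus>\<^bsub>V\<^esub> v) \<oplus>\<^bsub>V\<^esub> w = u \<oplus>\<^bsub>V\<^esub> (v \<oplus>\<^bsub>V\<^esub> w)"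
    "\<And>v. v \<in> carrier V \<Longrightarrow> v \<oplus>\<^bsub>V\<^esub> \<zero>\<^bsub>V\<^esub> = v"
    "\<And>c v. v \<in> carrier V \<Longrightarrow> c \<odot>\<^bsub>V\<^esub> v \<in> carrier V"
    "\<And>c d v. v \<in> carrier V \<Longrightarrow> (c * d) \<odot>\<^bsub>V\<^esub> v = c \<odot>\<^bsub>V\<^esub> (d \<odot>\<^bsub>V\<^esub> v)"
    "\<And>v. v \<in> carrier V \<Longrightarrow> 1 \<odot>\<^bsub>V\<^esub> v = v"
    "\<And>v. v \<in> carrier V \<Longrightarrow> 0 \<odot>\<^bsub>V\<^esub> v = \<zero>\<^bsub>V\<^esub>"
    "\<And>c d v. v \<in> carrier V \<Longrightarrow> (c + d) \<odot>\<^bsub>V\<^esub> v = c \<odot>\<^bsub>V\<^esub> v \<oplus>\<^bsub>V\<^esub> d \<odot>\<^bsub>V\<^esub> v"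
    "\<And>c v w. v \<in> carrier V \<Longrightarrow> w \<in> carrier V \<Longrightarrow>
       c \<odot>\<^bsub>V\<^esub> (v \<oplus>\<^bsub>V\<^esub> w) = c \<odot>\<^bsub>V\<^esub> v \<oplus>\<^bsub>V\<^esub> c \<odot>\<^bsub>V\<^esub> w"
  shows "fvs (V :: ('f::field, 'v, 'a) module_scheme)"
proof -
  \<comment> \<open>The assumptions list no additive inverses; multiplication by -1 supplies
    them.\<close>
  have neg: "v \<oplus>\<^bsub>V\<^esub> (- 1) \<odot>\<^bsub>V\<^esub> v = \<zero>\<^bsub>V\<^esub>" if "v \<in> carrier V" for v
    using assms(8)[OF that] assms(10)[OF that, of 1 "- 1"] assms(9)[OF that] by simp
  have "Module.module (class_ring :: 'f ring) V"
  proof (rule module_criteria)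
    show "\<forall>v\<in>carrier V. \<exists>n\<in>carrier V. v \<oplus>\<^bsub>V\<^esub> n = \<zero>\<^bsub>V\<^esub>"
      using assms(6) neg by blast
  qed (use assms in \<open>auto intro: class_cring.is_cring\<close>)
  then show ?thesis
    by (simp add: fvs_def vectorspace_def class_field)
qed

lemma lin_hom_zero:
  assumes "T \<in> lin_hom V W" "fvs V" "fvs W"
  shows "T \<zero>\<^bsub>V\<^esub> = \<zero>\<^bsub>W\<^esub>"
proof -
  interpret V: fvs V by fact
  interpret W: fvs W by fact
  have "T \<zero>\<^bsub>V\<^esub> = T (0 \<odot>\<^bsub>V\<^esub> \<zero>\<^bsub>V\<^esub>)" by (simp add: V.vsimps)
  also have "\<dots> = 0 \<odot>\<^bsub>W\<^esub> T \<zero>\<^bsub>V\<^esub>" by (rule lin_homD(3)[OF assms(1)]) simp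
  finally show ?thesis using lin_homD(1)[OF assms(1)] by (simp add: W.vsimps)
qed

lemma lin_hom_finsum:
  assumes "T \<in> lin_hom V W" "fvs V" "fvs W" "finite A" "\<And>x. x \<in> A \<Longrightarrow> f x \<in> carrier V"
  shows "T (\<Oplus>\<^bsub>V\<^esub>x\<in>A. f x) = (\<Oplus>\<^bsub>W\<^esub>x\<in>A. T (f x))"
proof -
  interpret V: fvs V by fact
  interpret W: fvs W by fact
  show ?thesis using assms(4,5)
  proof (induction A)
    case empty
    then show ?case using lin_hom_zero[OF assms(1-3)] by simp
  next
    case (insert x A)
    then show ?case using lin_homD[OF assms(1)] by (simp add: Pi_def)
  qed
qed

lemma lin_closed_vimage:
  assumes "T \<in> lin_hom V W" "fvs V" "fvs W" "lin_closed W Q"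
  shows "lin_closed V {v \<in> carrier V. T v \<in> Q}"
proof -
  interpret V: fvs V by fact
  interpret W: fvs W by fact
  show ?thesis using lin_closedD[OF assms(4)] lin_homD[OF assms(1)] lin_hom_zero[OF assms(1-3)]
    by (auto intro!: lin_closedI simp: V.vsimps)
qed

section \<open>Free spaces and presented modules\<close>

abbreviation pscale :: "'f::field \<Rightarrow> ('x \<Rightarrow>\<^sub>0 'f) \<Rightarrow> ('x \<Rightarrow>\<^sub>0 'f)" where
  "pscale c \<equiv> Poly_Mapping.map ((*) c)"

lemma lookup_pscale: "Poly_Mapping.lookup (pscale c p) x = c * Poly_Mapping.lookup p x"
  by (simp add: Poly_Mapping.map.rep_eq when_def)

lemma keys_pscale: "Poly_Mapping.keys (pscale c p) \<subseteq> Poly_Mapping.keys p"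
  by (auto simp: in_keys_iff lookup_pscale)

lemma pscale_simps:
  "pscale c (p + q) = pscale c p + pscale c q" "pscale (c + d) p = pscale c p + pscale d p"
  "pscale c (pscale d p) = pscale (c * d) p" "pscale 1 p = p" "pscale 0 p = 0" "pscale c 0 = 0"
  "pscale c (Poly_Mapping.single x d) = Poly_Mapping.single x (c * d)"
  "pscale c (p - q) = pscale c p - pscale c q" "pscale (- 1) p = - p"
  by (auto intro!: poly_mapping_eqI
      simp: lookup_pscale lookup_add lookup_minus lookup_single when_def algebra_simps)

text \<open>The key x of the step may already occur in p, so predicates stable under adding one term
  can be proved without tracking supports.\<close>

lemma poly_mapping_single_induct [consumes 1, case_names zero add]:
  assumes "Poly_Mapping.keys p \<subseteq> X" and zero: "P 0"
    and add: "\<And>p x c. Poly_Mapping.keys p \<subseteq> X \<Longrightarrow> x \<in> X \<Longrightarrow> P p \<Longrightarrow>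
      P (p + Poly_Mapping.single x c)"
  shows "P (p :: 'x \<Rightarrow>\<^sub>0 'f::ab_group_add)"
  using assms(1)
proof (induction "card (Poly_Mapping.keys p)" arbitrary: p)
  case 0
  then show ?case using zero by simp
next
  case (Suc n)
  then obtain x where x: "x \<in> Poly_Mapping.keys p" by fastforce
  define q where "q = p - Poly_Mapping.single x (Poly_Mapping.lookup p x)"
  have q: "Poly_Mapping.keys q = Poly_Mapping.keys p - {x}"
    by (auto simp: q_def in_keys_iff lookup_minus lookup_single when_def split: if_splits)
  then have "P q" using Suc x by (intro Suc(1)) auto
  then have "P (q + Poly_Mapping.single x (Poly_Mapping.lookup p x))"
    using q x Suc by (intro add) auto
  then show ?case by (simp add: q_def)
qed

text \<open>Besides extending maps on symbols linearly, this is the action of the group algebra: for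
  \<open>\<tau> = (\<lambda>s. act V s v)\<close> the value is p applied to v.\<close>

definition ext :: "('f::field, 'v, 'a) module_scheme \<Rightarrow> ('x \<Rightarrow> 'v) \<Rightarrow> ('x \<Rightarrow>\<^sub>0 'f) \<Rightarrow> 'v" where
  "ext W \<tau> p = (\<Oplus>\<^bsub>W\<^esub>x\<in>Poly_Mapping.keys p. Poly_Mapping.lookup p x \<odot>\<^bsub>W\<^esub> \<tau> x)"

lemma free_space_sel [simp]:
  "carrier (free_space X) = {p. Poly_Mapping.keys p \<subseteq> X}" "zero (free_space X) = 0"
  "add (free_space X) = (+)" "smult (free_space X) = pscale"
  by (auto simp: free_space_def)

lemma keys_add_subset: "Poly_Mapping.keys p \<subseteq> X \<Longrightarrow> Poly_Mapping.keys q \<subseteq> X \<Longrightarrow>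
    Poly_Mapping.keys (p + q) \<subseteq> X"
  using Poly_Mapping.keys_add[of p q] by blast

lemma keys_diff_subset: "Poly_Mapping.keys p \<subseteq> X \<Longrightarrow> Poly_Mapping.keys q \<subseteq> X \<Longrightarrow>
    Poly_Mapping.keys (p - q) \<subseteq> X" for p :: "'x \<Rightarrow>\<^sub>0 'f::ab_group_add"
  by (auto simp: in_keys_iff lookup_minus subset_iff) (metis diff_self)

lemma keys_pscale_subset: "Poly_Mapping.keys p \<subseteq> X \<Longrightarrow> Poly_Mapping.keys (pscale c p) \<subseteq> X"
  using keys_pscale[of c p] by blast

lemma keys_single_subset: "x \<in> X \<Longrightarrow> Poly_Mapping.keys (Poly_Mapping.single x c) \<subseteq> X"
  by simp

lemmas keys_subsets = keys_add_subset keys_diff_subset keys_pscale_subset keys_single_subset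

lemma fvs_free_space: "fvs (free_space X)"
  by (intro fvsI) (auto simp: pscale_simps keys_subsets algebra_simps del: subsetI)

context fvs
begin

lemma ext_superset:
  assumes "finite A" "Poly_Mapping.keys p \<subseteq> A" "\<And>x. x \<in> A \<Longrightarrow> \<tau> x \<in> carrier V"
  shows "ext V \<tau> p = (\<Oplus>\<^bsub>V\<^esub>x\<in>A. Poly_Mapping.lookup p x \<odot>\<^bsub>V\<^esub> \<tau> x)"
  unfolding ext_def
  by (rule add.finprod_mono_neutral_cong_left) (use assms in \<open>auto simp: vsimps in_keys_iff\<close>)

lemma ext_closed:
  assumes "\<And>x. x \<in> X \<Longrightarrow> \<tau> x \<in> carrier V" "Poly_Mapping.keys p \<subseteq> X"
  shows "ext V \<tau> p \<in> carrier V"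
  unfolding ext_def using assms by (intro finsum_closed) (auto simp: vsimps)

lemma ext_zero: "ext V \<tau> 0 = \<zero>\<^bsub>V\<^esub>"
  by (simp add: ext_def)

lemma ext_single:
  assumes "\<tau> x \<in> carrier V"
  shows "ext V \<tau> (Poly_Mapping.single x c) = c \<odot>\<^bsub>V\<^esub> \<tau> x"
  using ext_superset[of "{x}" "Poly_Mapping.single x c" \<tau>] assms by (simp add: vsimps)

lemma ext_add:
  assumes "\<And>x. x \<in> X \<Longrightarrow> \<tau> x \<in> carrier V" "Poly_Mapping.keys p \<subseteq> X" "Poly_Mapping.keys q \<subseteq> X"
  shows "ext V \<tau> (p + q) = ext V \<tau> p \<oplus>\<^bsub>V\<^esub> ext V \<tau> q"
proof -
  let ?A = "Poly_Mapping.keys p \<union> Poly_Mapping.keys q"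
  have A: "finite ?A" "\<And>x. x \<in> ?A \<Longrightarrow> \<tau> x \<in> carrier V" using assms by auto
  have "ext V \<tau> (p + q) = (\<Oplus>\<^bsub>V\<^esub>x\<in>?A. Poly_Mapping.lookup (p + q) x \<odot>\<^bsub>V\<^esub> \<tau> x)"
    by (rule ext_superset[OF A(1) Poly_Mapping.keys_add A(2)])
  also have "\<dots> = (\<Oplus>\<^bsub>V\<^esub>x\<in>?A. Poly_Mapping.lookup p x \<odot>\<^bsub>V\<^esub> \<tau> x \<oplus>\<^bsub>V\<^esub>
      Poly_Mapping.lookup q x \<odot>\<^bsub>V\<^esub> \<tau> x)"
    using A(2) by (intro finsum_cong') (auto simp: lookup_add vsimps)
  also have "\<dots> = ext V \<tau> p \<oplus>\<^bsub>V\<^esub> ext V \<tau> q"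
    unfolding ext_superset[of ?A p \<tau>, OF A(1) _ A(2), simplified]
      ext_superset[of ?A q \<tau>, OF A(1) _ A(2), simplified]
    using A(2) by (intro finsum_addf) (auto simp: vsimps)
  finally show ?thesis .
qed

lemma ext_scale:
  assumes "\<And>x. x \<in> X \<Longrightarrow> \<tau> x \<in> carrier V" "Poly_Mapping.keys p \<subseteq> X"
  shows "ext V \<tau> (pscale c p) = c \<odot>\<^bsub>V\<^esub> ext V \<tau> p"
proof -
  have "ext V \<tau> (pscale c p) =
      (\<Oplus>\<^bsub>V\<^esub>x\<in>Poly_Mapping.keys p. Poly_Mapping.lookup (pscale c p) x \<odot>\<^bsub>V\<^esub> \<tau> x)"
    by (rule ext_superset) (use assms keys_pscale[of c p] in auto)
  also have "\<dots> = (\<Oplus>\<^bsub>V\<^esub>x\<in>Poly_Mapping.keys p. c \<odot>\<^bsub>V\<^esub> (Poly_Mapping.lookup p x \<odot>\<^bsub>V\<^esub> \<tau> x))"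
    by (rule finsum_cong') (use assms in \<open>auto simp: lookup_pscale vsimps\<close>)
  finally show ?thesis
    unfolding ext_def using assms by (subst smult_finsum) (auto simp: vsimps)
qed

lemma ext_lin_hom:
  assumes "\<And>x. x \<in> X \<Longrightarrow> \<tau> x \<in> carrier V"
  shows "ext V \<tau> \<in> lin_hom (free_space X) V"
  by (rule lin_homI) (use assms in \<open>simp_all add: ext_closed[of X] ext_add[of X] ext_scale[of X]\<close>)

end

lemma linear_extension_superset:
  assumes "finite A" "Poly_Mapping.keys p \<subseteq> A"
  shows "linear_extension a p = (\<Sum>x\<in>A. Poly_Mapping.single (a x) (Poly_Mapping.lookup p x))"
  unfolding linear_extension_def
  by (rule sum.mono_neutral_left) (use assms in \<open>auto simp: in_keys_iff\<close>)

lemma linear_extension_add: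
  "linear_extension a (p + q) = linear_extension a p + linear_extension a q"
proof -
  let ?A = "Poly_Mapping.keys p \<union> Poly_Mapping.keys q"
  have "linear_extension a (p + q) =
      (\<Sum>x\<in>?A. Poly_Mapping.single (a x) (Poly_Mapping.lookup (p + q) x))"
    by (rule linear_extension_superset) (simp_all add: Poly_Mapping.keys_add)
  also have "\<dots> = linear_extension a p + linear_extension a q"
    by (subst (1 2) linear_extension_superset[where A = ?A])
      (auto simp: lookup_add single_add sum.distrib)
  finally show ?thesis .
qed

lemma linear_extension_0 [simp]: "linear_extension a 0 = 0"
  by (simp add: linear_extension_def)

lemma linear_extension_single [simp]:
  "linear_extension a (Poly_Mapping.single x c) = Poly_Mapping.single (a x) c"
  using linear_extension_superset[of "{x}" "Poly_Mapping.single x c" a] by simp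

lemma linear_extension_scale: "linear_extension a (pscale c p) = pscale c (linear_extension a p)"
proof -
  have "Poly_Mapping.keys p \<subseteq> UNIV" by simp
  then show ?thesis
    by (induction rule: poly_mapping_single_induct)
      (auto simp: pscale_simps linear_extension_add)
qed

lemma linear_extension_diff:
  "linear_extension a (p - q) = linear_extension a p - linear_extension a q"
  using linear_extension_add[of a "p - q" q] by simp

lemma linear_extension_cong:
  assumes "Poly_Mapping.keys p \<subseteq> X" "\<And>x. x \<in> X \<Longrightarrow> a x = b x"
  shows "linear_extension a p = linear_extension b p"
  using assms by (auto simp: linear_extension_def intro!: sum.cong)

lemma linear_extension_ident: "linear_extension (\<lambda>x. x) p = p"
proof -
  have "Poly_Mapping.keys p \<subseteq> UNIV" by simp
  then show ?thesis
    by (induction rule: poly_mapping_single_induct) (auto simp: linear_extension_add)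
qed

lemma linear_extension_comp:
  "linear_extension a (linear_extension b p) = linear_extension (\<lambda>x. a (b x)) p"
proof -
  have "Poly_Mapping.keys p \<subseteq> UNIV" by simp
  then show ?thesis
    by (induction rule: poly_mapping_single_induct) (auto simp: linear_extension_add)
qed

lemma keys_linear_extension:
  assumes "Poly_Mapping.keys p \<subseteq> X" "\<And>x. x \<in> X \<Longrightarrow> a x \<in> Y"
  shows "Poly_Mapping.keys (linear_extension a p) \<subseteq> Y"
  using assms(1)
  by (induction rule: poly_mapping_single_induct)
    (use assms(2) in \<open>auto simp: linear_extension_add keys_subsets simp del: keys_single del: subsetI\<close>)

definition null_space :: "'x set \<Rightarrow> ('x \<Rightarrow>\<^sub>0 'f::field) set \<Rightarrow> ('x \<Rightarrow>\<^sub>0 'f) set" where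
  "null_space X rels = LinearCombinations.module.span class_ring (free_space X) rels"

definition pcls :: "'x set \<Rightarrow> ('x \<Rightarrow>\<^sub>0 'f::field) set \<Rightarrow> ('x \<Rightarrow>\<^sub>0 'f) \<Rightarrow> ('x \<Rightarrow>\<^sub>0 'f) set" where
  "pcls X rels p = (\<lambda>n. n + p) ` null_space X rels"

text \<open>Relations are required to go to relations under the action; their span, being the least
  closed set containing them, is then invariant, and the action descends to the quotient.\<close>

locale presentation =
  fixes G :: "('g, 'm) monoid_scheme" and X :: "'x set" and rels :: "('x \<Rightarrow>\<^sub>0 'f::field) set"
    and a :: "'g \<Rightarrow> 'x \<Rightarrow> 'x"
  assumes group: "group G"
    and a_closed: "\<lbrakk>g \<in> carrier G; x \<in> X\<rbrakk> \<Longrightarrow> a g x \<in> X"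
    and a_one: "x \<in> X \<Longrightarrow> a \<one>\<^bsub>G\<^esub> x = x"
    and a_mult: "\<lbrakk>g \<in> carrier G; h \<in> carrier G; x \<in> X\<rbrakk> \<Longrightarrow> a (g \<otimes>\<^bsub>G\<^esub> h) x = a g (a h x)"
    and rels_keys: "\<rho> \<in> rels \<Longrightarrow> Poly_Mapping.keys \<rho> \<subseteq> X"
    and rels_inv: "\<lbrakk>g \<in> carrier G; \<rho> \<in> rels\<rbrakk> \<Longrightarrow> linear_extension (a g) \<rho> \<in> rels"
begin

abbreviation "E \<equiv> free_space X :: ('f, 'x \<Rightarrow>\<^sub>0 'f) module"
abbreviation "N \<equiv> null_space X rels"
abbreviation "cls \<equiv> pcls X rels"
abbreviation "P \<equiv> presented_gmod X rels a"

sublocale E: fvs E by (rule fvs_free_space)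

lemma null_lin_closed: "lin_closed E N"
proof -
  have "submodule class_ring N E"
    unfolding null_space_def using rels_keys by (intro E.span_is_submodule) auto
  then show ?thesis by (auto simp: submodule_def lin_closed_def)
qed

lemma null_rels: "\<rho> \<in> rels \<Longrightarrow> \<rho> \<in> N"
  unfolding null_space_def using E.in_own_span[of rels] rels_keys by auto

lemma null_minimal:
  assumes "lin_closed E Q" "rels \<subseteq> Q"
  shows "N \<subseteq> Q"
proof -
  have "submodule class_ring Q E"
    using E.subspace_if_lin_closed[OF assms(1)] by (simp add: VectorSpace.subspace_def)
  then show ?thesis unfolding null_space_def by (rule E.span_is_subset[OF assms(2)])
qed

lemma null_props:
  "n \<in> N \<Longrightarrow> Poly_Mapping.keys n \<subseteq> X" "0 \<in> N" "n \<in> N \<Longrightarrow> m \<in> N \<Longrightarrow> n + m \<in> N"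
  "n \<in> N \<Longrightarrow> pscale c n \<in> N" "n \<in> N \<Longrightarrow> m \<in> N \<Longrightarrow> n - m \<in> N" "n \<in> N \<Longrightarrow> - n \<in> N"
proof -
  note * = lin_closedD[OF null_lin_closed]
  show "n \<in> N \<Longrightarrow> Poly_Mapping.keys n \<subseteq> X" "0 \<in> N" "n \<in> N \<Longrightarrow> m \<in> N \<Longrightarrow> n + m \<in> N"
    "n \<in> N \<Longrightarrow> pscale c n \<in> N"
    using * by auto
  show neg: "n \<in> N \<Longrightarrow> - n \<in> N" for n
    using *(4)[of n "- 1"] by (simp add: pscale_simps)
  show "n \<in> N \<Longrightarrow> m \<in> N \<Longrightarrow> n - m \<in> N"
    using *(3)[of n "- m"] neg by simp
qed

lemma null_inv:
  assumes "g \<in> carrier G" "n \<in> N"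
  shows "linear_extension (a g) n \<in> N"
proof -
  have "lin_closed E {n \<in> carrier E. linear_extension (a g) n \<in> N}"
    by (rule lin_closedI)
      (simp_all add: null_props keys_subsets linear_extension_add linear_extension_scale Collect_mono)
  moreover have "rels \<subseteq> {n \<in> carrier E. linear_extension (a g) n \<in> N}"
    using rels_inv[OF assms(1)] null_rels rels_keys by auto
  ultimately show ?thesis using null_minimal assms(2) by blast
qed

lemma cls_eq_iff: "cls p = cls q \<longleftrightarrow> p - q \<in> N"
proof
  assume "cls p = cls q"
  then have "p \<in> cls q" using null_props(2) unfolding pcls_def by force
  then show "p - q \<in> N" unfolding pcls_def by auto
next
  have sub: "cls p \<subseteq> cls q" if "p - q \<in> N" for p q
    unfolding pcls_def
  proof clarify
    fix n assume "n \<in> N"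
    then have "n + (p - q) \<in> N" using that null_props by blast
    then show "n + p \<in> (\<lambda>n. n + q) ` N" by (intro image_eqI[where x = "n + (p - q)"]) auto
  qed
  assume "p - q \<in> N"
  moreover then have "q - p \<in> N" using null_props(6) by fastforce
  ultimately show "cls p = cls q" using sub by blast
qed

lemma cls_self: "p \<in> cls p"
  unfolding pcls_def using null_props(2) by force

lemma cls_coset: "N +>\<^bsub>E\<^esub> p = cls p"
  by (auto simp: a_r_coset_def r_coset_def pcls_def)

lemma carrier_P: "carrier P = cls ` {p. Poly_Mapping.keys p \<subseteq> X}"
  using cls_coset
  by (auto simp: presented_gmod_def Let_def A_RCOSETS_def RCOSETS_def a_r_coset_def
      null_space_def[symmetric])

lemma zero_P: "\<zero>\<^bsub>P\<^esub> = cls 0"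
  by (auto simp: presented_gmod_def Let_def null_space_def[symmetric] pcls_def)

lemma add_P:
  shows "cls p \<oplus>\<^bsub>P\<^esub> cls q = cls (p + q)"
proof -
  have "cls p \<oplus>\<^bsub>P\<^esub> cls q = {x + y | x y. x \<in> cls p \<and> y \<in> cls q}"
    by (auto simp: presented_gmod_def Let_def set_add_def set_mult_def)
  also have "\<dots> = cls (p + q)"
  proof safe
    fix x y assume "x \<in> cls p" "y \<in> cls q"
    then obtain n m where "n \<in> N" "m \<in> N" "x = n + p" "y = m + q" by (auto simp: pcls_def)
    then show "x + y \<in> cls (p + q)"
      unfolding pcls_def using null_props(3)
      by (intro image_eqI[where x = "n + m"]) (auto simp: algebra_simps)
  next
    fix z assume "z \<in> cls (p + q)"
    then obtain n where "n \<in> N" "z = n + (p + q)" by (auto simp: pcls_def)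
    then have "z = (n + p) + q" "n + p \<in> cls p" "q \<in> cls q"
      using cls_self[of q] by (auto simp: pcls_def algebra_simps)
    then show "\<exists>x y. z = x + y \<and> x \<in> cls p \<and> y \<in> cls q" by blast
  qed
  finally show ?thesis .
qed

text \<open>Scaling and action in \<open>presented_gmod\<close> are unions over all representatives
  of a coset. Under this condition every representative contributes the same coset.\<close>

lemma UN_cls:
  assumes "\<And>n. n \<in> N \<Longrightarrow> F (n + p) - F p \<in> N"
  shows "(\<Union>x\<in>cls p. N +>\<^bsub>E\<^esub> F x) = cls (F p)"
proof -
  have "N +>\<^bsub>E\<^esub> F x = cls (F p)" if "x \<in> cls p" for x
    using that assms unfolding cls_coset cls_eq_iff by (auto simp: pcls_def)
  then show ?thesis using cls_self[of p] by blast
qed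

lemma smult_P: "c \<odot>\<^bsub>P\<^esub> cls p = cls (pscale c p)"
proof -
  have "c \<odot>\<^bsub>P\<^esub> cls p = (\<Union>x\<in>cls p. N +>\<^bsub>E\<^esub> pscale c x)"
    by (simp add: presented_gmod_def Let_def null_space_def)
  also have "\<dots> = cls (pscale c p)"
    by (rule UN_cls) (simp add: pscale_simps null_props)
  finally show ?thesis .
qed

lemma act_P:
  assumes "g \<in> carrier G"
  shows "act P g (cls p) = cls (linear_extension (a g) p)"
proof -
  have "act P g (cls p) = (\<Union>x\<in>cls p. N +>\<^bsub>E\<^esub> linear_extension (a g) x)"
    by (simp add: presented_gmod_def Let_def null_space_def)
  also have "\<dots> = cls (linear_extension (a g) p)"
    by (rule UN_cls) (simp add: linear_extension_add null_inv assms)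
  finally show ?thesis .
qed

lemma fvs_P: "fvs P"
  by (rule fvsI)
    (auto simp: carrier_P zero_P add_P smult_P pscale_simps algebra_simps
      intro!: imageI keys_subsets del: subsetI)

lemma gmodule_P: "gmodule G P"
proof -
  interpret Pv: fvs P by (rule fvs_P)
  have inj: "linear_extension (a \<one>\<^bsub>G\<^esub>) p = p" if "Poly_Mapping.keys p \<subseteq> X" for p :: "'x \<Rightarrow>\<^sub>0 'f"
    by (rule trans[OF linear_extension_cong[OF that] linear_extension_ident]) (rule a_one)
  have mul: "linear_extension (a (g \<otimes>\<^bsub>G\<^esub> h)) p = linear_extension (a g) (linear_extension (a h) p)"
    if "Poly_Mapping.keys p \<subseteq> X" "g \<in> carrier G" "h \<in> carrier G" for p :: "'x \<Rightarrow>\<^sub>0 'f" and g h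
    unfolding linear_extension_comp using that a_mult by (intro linear_extension_cong) auto
  interpret G: group G by (rule group)
  show ?thesis
    unfolding gmodule_def gmodule_axioms_def
    using group Pv.vectorspace_axioms a_closed inj mul
    by (auto simp: carrier_P add_P smult_P act_P linear_extension_add linear_extension_scale
      intro!: imageI keys_linear_extension[where X = X] del: subsetI)
qed

lemma cls_symb_closed: "x \<in> X \<Longrightarrow> cls (Poly_Mapping.single x c) \<in> carrier P"
  by (auto simp: carrier_P)

lemma act_symb: "g \<in> carrier G \<Longrightarrow> act P g (cls (symb x)) = cls (symb (a g x))"
  by (simp add: act_P)

lemma smult_symb: "c \<odot>\<^bsub>P\<^esub> cls (symb x) = cls (Poly_Mapping.single x c)"
  by (simp add: smult_P pscale_simps)

lemma cls_rel_add:
  assumes "symb x - symb y - symb z \<in> rels"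
  shows "cls (symb x) = cls (symb y) \<oplus>\<^bsub>P\<^esub> cls (symb z)"
  unfolding add_P cls_eq_iff using null_rels[OF assms] by (simp add: algebra_simps)

lemma cls_rel_smult:
  assumes "symb x - Poly_Mapping.single y c \<in> rels"
  shows "cls (symb x) = c \<odot>\<^bsub>P\<^esub> cls (symb y)"
  unfolding smult_symb cls_eq_iff using null_rels[OF assms] .

lemma span_P:
  assumes "lin_closed P Q" "\<And>x. x \<in> X \<Longrightarrow> cls (symb x) \<in> Q"
  shows "Q = carrier P"
proof -
  have "cls p \<in> Q" if "Poly_Mapping.keys p \<subseteq> X" for p
    using that
  proof (induction rule: poly_mapping_single_induct)
    case zero
    then show ?case using lin_closedD(2)[OF assms(1)] zero_P by simp
  next
    case (add p x c)
    then show ?case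
      using lin_closedD(3,4)[OF assms(1)] assms(2)[of x] add_P smult_symb by metis
  qed
  then show ?thesis using lin_closedD(1)[OF assms(1)] by (auto simp: carrier_P)
qed

text \<open>Universal property of the presentation: \<open>ext\<close> kills the relations and so
  their span, hence its value at a chosen representative depends on the coset only.\<close>

lemma hom_P:
  fixes W :: "('f, 'w, 'b) module_scheme"
  assumes "fvs W" "\<And>x. x \<in> X \<Longrightarrow> \<tau> x \<in> carrier W"
    and "\<And>\<rho>. \<rho> \<in> rels \<Longrightarrow> ext W \<tau> \<rho> = \<zero>\<^bsub>W\<^esub>"
  obtains T where "T \<in> lin_hom P W" "\<And>x. x \<in> X \<Longrightarrow> T (cls (symb x)) = \<tau> x"
proof -
  interpret W: fvs W by fact
  define T where "T A = ext W \<tau> (SOME p. p \<in> A)" for A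
  have hom: "ext W \<tau> \<in> lin_hom E W" using W.ext_lin_hom assms(2) by blast
  have "lin_closed E {n \<in> carrier E. ext W \<tau> n \<in> {\<zero>\<^bsub>W\<^esub>}}"
    by (rule lin_closed_vimage[OF hom fvs_free_space assms(1)])
      (auto intro!: lin_closedI simp: W.vsimps)
  then have "N \<subseteq> {n \<in> carrier E. ext W \<tau> n \<in> {\<zero>\<^bsub>W\<^esub>}}"
    by (rule null_minimal) (use assms(3) rels_keys in auto)
  then have null: "ext W \<tau> n = \<zero>\<^bsub>W\<^esub>" if "n \<in> N" for n using that by auto
  have T: "T (cls p) = ext W \<tau> p" if "Poly_Mapping.keys p \<subseteq> X" for p
  proof -
    have "(SOME q. q \<in> cls p) \<in> cls p" by (rule someI) (rule cls_self)
    then obtain n where n: "n \<in> N" "(SOME q. q \<in> cls p) = n + p" by (auto simp: pcls_def)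
    have "T (cls p) = ext W \<tau> n \<oplus>\<^bsub>W\<^esub> ext W \<tau> p"
      unfolding T_def n(2) by (rule W.ext_add[where X = X]) (simp_all add: assms(2) that null_props(1)[OF n(1)])
    also have "\<dots> = ext W \<tau> p"
      unfolding null[OF n(1)] by (rule W.l_zero) (rule W.ext_closed[OF assms(2) that])
    finally show ?thesis .
  qed
  show thesis
  proof
    show "T \<in> lin_hom P W"
      using lin_homD[OF hom]
      by (intro lin_homI) (auto simp: carrier_P add_P smult_P T keys_subsets del: subsetI)
    show "T (cls (symb x)) = \<tau> x" if "x \<in> X" for x
      using that assms(2) W.ext_single[of \<tau> x 1] by (simp add: T W.vsimps)
  qed
qed

end

context fvs
begin

text \<open>The relations used below have the two shapes x - y - z and x - c y. This rule and the
  next turn the hypothesis of \<open>hom_P\<close> into identities between values of \<tau>.\<close>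

lemma ext_rel_add:
  assumes "\<tau> x \<in> carrier V" "\<tau> y \<in> carrier V" "\<tau> z \<in> carrier V" "\<tau> x = \<tau> y \<oplus>\<^bsub>V\<^esub> \<tau> z"
  shows "ext V \<tau> (symb x - symb y - symb z) = \<zero>\<^bsub>V\<^esub>"
proof -
  let ?X = "{x, y, z}"
  have k: "x \<in> ?X" "y \<in> ?X" "z \<in> ?X" by auto
  have *: "\<And>u. u \<in> ?X \<Longrightarrow> \<tau> u \<in> carrier V" using assms by auto
  have "\<tau> x = ext V \<tau> ((symb x - symb y - symb z) + (symb y + symb z))"
    using assms(1) ext_single[of \<tau> x 1] by (simp add: vsimps algebra_simps)
  also have "\<dots> = ext V \<tau> (symb x - symb y - symb z) \<oplus>\<^bsub>V\<^esub> (ext V \<tau> (symb y) \<oplus>\<^bsub>V\<^esub> ext V \<tau> (symb z))"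
    by (simp only: ext_add[where X = ?X, OF *] k keys_subsets)
  also have "\<dots> = ext V \<tau> (symb x - symb y - symb z) \<oplus>\<^bsub>V\<^esub> \<tau> x"
    using assms by (simp add: ext_single vsimps)
  finally have "\<tau> x = ext V \<tau> (symb x - symb y - symb z) \<oplus>\<^bsub>V\<^esub> \<tau> x" .
  moreover have "ext V \<tau> (symb x - symb y - symb z) \<in> carrier V"
    by (intro ext_closed[where X = ?X, OF *] keys_subsets k)
  ultimately show ?thesis using assms(1) add.r_cancel_one' by (metis)
qed

lemma ext_rel_smult:
  assumes "\<tau> x \<in> carrier V" "\<tau> y \<in> carrier V" "\<tau> x = c \<odot>\<^bsub>V\<^esub> \<tau> y"
  shows "ext V \<tau> (symb x - Poly_Mapping.single y c) = \<zero>\<^bsub>V\<^esub>"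
proof -
  let ?X = "{x, y}"
  have k: "x \<in> ?X" "y \<in> ?X" by auto
  have *: "\<And>u. u \<in> ?X \<Longrightarrow> \<tau> u \<in> carrier V" using assms by auto
  have "\<tau> x = ext V \<tau> ((symb x - Poly_Mapping.single y c) + Poly_Mapping.single y c)"
    using assms(1) ext_single[of \<tau> x 1] by (simp add: vsimps algebra_simps)
  also have "\<dots> = ext V \<tau> (symb x - Poly_Mapping.single y c) \<oplus>\<^bsub>V\<^esub> ext V \<tau> (Poly_Mapping.single y c)"
    by (simp only: ext_add[where X = ?X, OF *] k keys_subsets)
  also have "\<dots> = ext V \<tau> (symb x - Poly_Mapping.single y c) \<oplus>\<^bsub>V\<^esub> \<tau> x"
    using assms by (simp add: ext_single vsimps)
  finally have "\<tau> x = ext V \<tau> (symb x - Poly_Mapping.single y c) \<oplus>\<^bsub>V\<^esub> \<tau> x" .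
  moreover have "ext V \<tau> (symb x - Poly_Mapping.single y c) \<in> carrier V"
    by (intro ext_closed[where X = ?X, OF *] keys_subsets k)
  ultimately show ?thesis using assms(1) add.r_cancel_one' by (metis)
qed

end

section \<open>Induced modules\<close>

sublocale gmodule \<subseteq> V: fvs V
  by (rule fvs_if_vectorspace) (rule V.vectorspace_axioms)

lemma gmodule_fvs: "gmodule G V \<Longrightarrow> fvs V"
  by (simp add: gmodule_def fvs_def)

lemma gmodI:
  assumes "group G" "fvs V"
    and "\<And>g v. g \<in> carrier G \<Longrightarrow> v \<in> carrier V \<Longrightarrow> act V g v \<in> carrier V"
    and "\<And>g v w. g \<in> carrier G \<Longrightarrow> v \<in> carrier V \<Longrightarrow> w \<in> carrier V \<Longrightarrow>
        act V g (v \<oplus>\<^bsub>V\<^esub> w) = act V g v \<oplus>\<^bsub>V\<^esub> act V g w"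
    and "\<And>g c v. g \<in> carrier G \<Longrightarrow> v \<in> carrier V \<Longrightarrow> act V g (c \<odot>\<^bsub>V\<^esub> v) = c \<odot>\<^bsub>V\<^esub> act V g v"
    and "\<And>v. v \<in> carrier V \<Longrightarrow> act V \<one>\<^bsub>G\<^esub> v = v"
    and "\<And>g h v. g \<in> carrier G \<Longrightarrow> h \<in> carrier G \<Longrightarrow> v \<in> carrier V \<Longrightarrow>
        act V (g \<otimes>\<^bsub>G\<^esub> h) v = act V g (act V h v)"
  shows "gmodule G V"
  using assms by (auto simp: gmodule_def gmodule_axioms_def fvs_def)

context gmodule
begin

lemma act_lin_hom: "g \<in> carrier G \<Longrightarrow> act V g \<in> lin_hom V V"
  by (rule lin_homI) (auto simp: act_closed act_add act_smult)

lemma act_zero: "g \<in> carrier G \<Longrightarrow> act V g \<zero>\<^bsub>V\<^esub> = \<zero>\<^bsub>V\<^esub>"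
  by (rule lin_hom_zero[OF act_lin_hom V.fvs_axioms V.fvs_axioms])

lemma act_finsum:
  assumes "g \<in> carrier G" "finite A" "\<And>x. x \<in> A \<Longrightarrow> f x \<in> carrier V"
  shows "act V g (\<Oplus>\<^bsub>V\<^esub>x\<in>A. f x) = (\<Oplus>\<^bsub>V\<^esub>x\<in>A. act V g (f x))"
  by (rule lin_hom_finsum[OF act_lin_hom V.fvs_axioms V.fvs_axioms]) (use assms in auto)

lemma act_inv_act [simp]:
  "g \<in> carrier G \<Longrightarrow> v \<in> carrier V \<Longrightarrow> act V (inv\<^bsub>G\<^esub> g) (act V g v) = v"
  "g \<in> carrier G \<Longrightarrow> v \<in> carrier V \<Longrightarrow> act V g (act V (inv\<^bsub>G\<^esub> g) v) = v"
  by (simp_all add: act_mult[symmetric] act_one)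

end

lemma gmod_homI:
  assumes "T \<in> lin_hom V W" "\<And>g v. g \<in> carrier G \<Longrightarrow> v \<in> carrier V \<Longrightarrow> T (act V g v) = act W g (T v)"
  shows "T \<in> gmod_hom G V W"
  using assms by (auto simp: gmod_hom_def)

lemma gmod_homD:
  assumes "T \<in> gmod_hom G V W"
  shows "T \<in> lin_hom V W" "g \<in> carrier G \<Longrightarrow> v \<in> carrier V \<Longrightarrow> T (act V g v) = act W g (T v)"
  using assms by (auto simp: gmod_hom_def)

lemma lin_hom_comp: "S \<in> lin_hom U V \<Longrightarrow> T \<in> lin_hom V W \<Longrightarrow> (\<lambda>x. T (S x)) \<in> lin_hom U W"
  by (auto intro!: lin_homI simp: lin_homD)

lemma lin_hom_inv_into:
  assumes "T \<in> lin_hom V W" "bij_betw T (carrier V) (carrier W)" "fvs V"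
  shows "inv_into (carrier V) T \<in> lin_hom W V"
proof -
  interpret V: fvs V by fact
  let ?S = "inv_into (carrier V) T"
  have S: "\<And>w. w \<in> carrier W \<Longrightarrow> ?S w \<in> carrier V" "\<And>w. w \<in> carrier W \<Longrightarrow> T (?S w) = w"
    using assms(2) by (auto simp: bij_betw_def intro: inv_into_into f_inv_into_f)
  have eq: "?S w = v" if "v \<in> carrier V" "T v = w" for v w
    using assms(2) that by (auto simp: bij_betw_def)
  show ?thesis
    by (rule lin_homI) (auto intro!: eq simp: S V.vsimps lin_homD[OF assms(1)])
qed

text \<open>These axioms make V the direct sum of the translates of \<iota>(W) over the cosets gH:
  \<open>span\<close> gives the sum, in the form of an induction rule, and \<open>p_act\<close> its
  directness, since v -> p(g^-1 v) reads off the component in gH.\<close>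

locale ind_struct =
  V: gmodule G V + W: gmodule "G\<lparr>carrier := H\<rparr>" W
  for G :: "('g, 'm) monoid_scheme" and H :: "'g set"
    and W :: "('f::field, 'w, 'g, 'c) gmodule_scheme" and V :: "('f, 'v, 'g, 'b) gmodule_scheme" +
  fixes \<iota> :: "'w \<Rightarrow> 'v" and p :: "'v \<Rightarrow> 'w"
  assumes sub: "subgroup H G"
    and \<iota>_hom: "\<iota> \<in> lin_hom W V"
    and p_hom: "p \<in> lin_hom V W"
    and \<iota>_act: "\<lbrakk>h \<in> H; w \<in> carrier W\<rbrakk> \<Longrightarrow> act V h (\<iota> w) = \<iota> (act W h w)"
    and span: "\<lbrakk>lin_closed V Q; \<And>g w. g \<in> carrier G \<Longrightarrow> w \<in> carrier W \<Longrightarrow> act V g (\<iota> w) \<in> Q\<rbrakk> \<Longrightarrow>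
        v \<in> carrier V \<Longrightarrow> v \<in> Q"
    and p_act: "\<lbrakk>g \<in> carrier G; w \<in> carrier W\<rbrakk> \<Longrightarrow>
        p (act V g (\<iota> w)) = (if g \<in> H then act W g w else \<zero>\<^bsub>W\<^esub>)"
begin

lemma p_\<iota>: "w \<in> carrier W \<Longrightarrow> p (\<iota> w) = w"
  using p_act[of "\<one>\<^bsub>G\<^esub>" w] subgroup.one_closed[OF sub] V.act_one[of "\<iota> w"] W.act_one[of w]
    lin_homD(1)[OF \<iota>_hom, of w]
  by simp

lemmas \<iota>_closed = lin_homD(1)[OF \<iota>_hom] and p_closed = lin_homD(1)[OF p_hom]

lemma sub_closed: "h \<in> H \<Longrightarrow> h \<in> carrier G"
  using subgroup.subset[OF sub] by auto

text \<open>The predicate depends on k only through the left coset kH, so all elements of a coset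
  receive the same representative (\<open>rep_eq\<close>).\<close>

definition rep :: "'g \<Rightarrow> 'g" where
  "rep k = (SOME g. g \<in> carrier G \<and> inv\<^bsub>G\<^esub> g \<otimes>\<^bsub>G\<^esub> k \<in> H)"

lemma rep: "k \<in> carrier G \<Longrightarrow> rep k \<in> carrier G" "k \<in> carrier G \<Longrightarrow> inv\<^bsub>G\<^esub> (rep k) \<otimes>\<^bsub>G\<^esub> k \<in> H"
proof -
  assume k: "k \<in> carrier G"
  then have "k \<in> carrier G \<and> inv\<^bsub>G\<^esub> k \<otimes>\<^bsub>G\<^esub> k \<in> H" using subgroup.one_closed[OF sub] by simp
  then have "rep k \<in> carrier G \<and> inv\<^bsub>G\<^esub> (rep k) \<otimes>\<^bsub>G\<^esub> k \<in> H" unfolding rep_def by (rule someI)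
  then show "rep k \<in> carrier G" "inv\<^bsub>G\<^esub> (rep k) \<otimes>\<^bsub>G\<^esub> k \<in> H" by auto
qed

lemma H_inv_mult:
  assumes "a \<in> carrier G" "b \<in> carrier G" "c \<in> carrier G" "inv\<^bsub>G\<^esub> a \<otimes>\<^bsub>G\<^esub> b \<in> H"
  shows "inv\<^bsub>G\<^esub> c \<otimes>\<^bsub>G\<^esub> a \<in> H \<longleftrightarrow> inv\<^bsub>G\<^esub> c \<otimes>\<^bsub>G\<^esub> b \<in> H"
proof -
  have "inv\<^bsub>G\<^esub> c \<otimes>\<^bsub>G\<^esub> b = (inv\<^bsub>G\<^esub> c \<otimes>\<^bsub>G\<^esub> a) \<otimes>\<^bsub>G\<^esub> (inv\<^bsub>G\<^esub> a \<otimes>\<^bsub>G\<^esub> b)"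
  proof -
    have "b = a \<otimes>\<^bsub>G\<^esub> (inv\<^bsub>G\<^esub> a \<otimes>\<^bsub>G\<^esub> b)"
      using assms(1-3) by (simp add: V.G.m_assoc[symmetric])
    then show ?thesis using assms(1-3) by (metis V.G.inv_closed V.G.m_assoc V.G.m_closed)
  qed
  then show ?thesis
    using assms subgroup.m_closed[OF sub] subgroup.m_inv_closed[OF sub]
    by (metis V.G.inv_closed V.G.m_closed V.G.inv_solve_right)
qed

lemma rep_eq:
  assumes "k \<in> carrier G" "l \<in> carrier G" "inv\<^bsub>G\<^esub> (rep l) \<otimes>\<^bsub>G\<^esub> k \<in> H"
  shows "rep l = rep k"
proof -
  have "inv\<^bsub>G\<^esub> g \<otimes>\<^bsub>G\<^esub> l \<in> H \<longleftrightarrow> inv\<^bsub>G\<^esub> g \<otimes>\<^bsub>G\<^esub> k \<in> H" if "g \<in> carrier G" for g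
    using H_inv_mult[of "rep l" l g] H_inv_mult[of "rep l" k g] rep[of l] assms that by blast
  then show ?thesis unfolding rep_def by (metis (mono_tags, lifting))
qed

text \<open>The component of v in the coset gH, carried back to W by g^-1.\<close>

definition coeff :: "'v \<Rightarrow> 'g \<Rightarrow> 'w" where
  "coeff v g = p (act V (inv\<^bsub>G\<^esub> g) v)"

lemma coeff_lin_hom: "g \<in> carrier G \<Longrightarrow> (\<lambda>v. coeff v g) \<in> lin_hom V W"
  unfolding coeff_def by (rule lin_hom_comp[OF V.act_lin_hom p_hom]) simp

lemma coeff_gen:
  assumes "g \<in> carrier G" "k \<in> carrier G" "w \<in> carrier W"
  shows "coeff (act V k (\<iota> w)) g =
    (if inv\<^bsub>G\<^esub> g \<otimes>\<^bsub>G\<^esub> k \<in> H then act W (inv\<^bsub>G\<^esub> g \<otimes>\<^bsub>G\<^esub> k) w else \<zero>\<^bsub>W\<^esub>)"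
  using assms p_act[of "inv\<^bsub>G\<^esub> g \<otimes>\<^bsub>G\<^esub> k" w] V.act_mult[of "inv\<^bsub>G\<^esub> g" k "\<iota> w"] \<iota>_closed
  by (simp add: coeff_def)

definition supp :: "'v \<Rightarrow> 'g set" where
  "supp v = {g \<in> rep ` carrier G. coeff v g \<noteq> \<zero>\<^bsub>W\<^esub>}"

lemma supp_gen:
  assumes "k \<in> carrier G" "w \<in> carrier W"
  shows "supp (act V k (\<iota> w)) \<subseteq> {rep k}"
proof
  fix g assume "g \<in> supp (act V k (\<iota> w))"
  then obtain l where l: "l \<in> carrier G" "g = rep l" "coeff (act V k (\<iota> w)) (rep l) \<noteq> \<zero>\<^bsub>W\<^esub>"
    by (auto simp: supp_def)
  then have "inv\<^bsub>G\<^esub> (rep l) \<otimes>\<^bsub>G\<^esub> k \<in> H"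
    using assms rep(1)[of l] by (auto simp: coeff_gen split: if_splits)
  then show "g \<in> {rep k}" using rep_eq[of k l] assms l by simp
qed

lemma finite_supp:
  assumes "v \<in> carrier V"
  shows "finite (supp v)"
proof -
  have "lin_closed V {v \<in> carrier V. finite (supp v)}"
  proof (rule lin_closedI)
    have "supp \<zero>\<^bsub>V\<^esub> = {}"
      using rep lin_hom_zero[OF coeff_lin_hom V.V.fvs_axioms W.V.fvs_axioms]
      by (auto simp: supp_def)
    then show "\<zero>\<^bsub>V\<^esub> \<in> {v \<in> carrier V. finite (supp v)}" by simp
  next
    fix v w assume vw: "v \<in> {v \<in> carrier V. finite (supp v)}" "w \<in> {v \<in> carrier V. finite (supp v)}"
    have "supp (v \<oplus>\<^bsub>V\<^esub> w) \<subseteq> supp v \<union> supp w"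
      using vw rep lin_homD[OF coeff_lin_hom] by (auto simp: supp_def)
    then show "v \<oplus>\<^bsub>V\<^esub> w \<in> {v \<in> carrier V. finite (supp v)}"
      using vw finite_subset by auto
  next
    fix c v assume v: "v \<in> {v \<in> carrier V. finite (supp v)}"
    have "supp (c \<odot>\<^bsub>V\<^esub> v) \<subseteq> supp v"
      using v rep lin_homD[OF coeff_lin_hom] by (auto simp: supp_def W.V.vsimps)
    then show "c \<odot>\<^bsub>V\<^esub> v \<in> {v \<in> carrier V. finite (supp v)}"
      using v finite_subset by (auto simp: V.V.vsimps)
  qed auto
  moreover have "act V g (\<iota> w) \<in> {v \<in> carrier V. finite (supp v)}"
    if "g \<in> carrier G" "w \<in> carrier W" for g w
    using supp_gen[OF that] that finite_subset[of _ "{rep g}"] V.act_closed \<iota>_closed by auto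
  ultimately show ?thesis using span assms by blast
qed

text \<open>Frobenius reciprocity. T v is the sum of g \<kappa>(v_g) over coset representatives g,
  with v_g the component of v at g. The last conclusion records that T sees v only through its
  components; \<open>eq_zeroI\<close> rests on it.\<close>

lemma universal:
  fixes Y :: "('f, 'y, 'g, 'd) gmodule_scheme"
  assumes "gmodule G Y" "\<kappa> \<in> lin_hom W Y"
    and \<kappa>_act: "\<And>h w. h \<in> H \<Longrightarrow> w \<in> carrier W \<Longrightarrow> act Y h (\<kappa> w) = \<kappa> (act W h w)"
  obtains T where "T \<in> gmod_hom G V Y" "\<forall>w\<in>carrier W. T (\<iota> w) = \<kappa> w"
    "\<forall>v. supp v = {} \<longrightarrow> T v = \<zero>\<^bsub>Y\<^esub>"
proof -
  interpret Y: gmodule G Y by fact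
  have \<kappa>0: "\<kappa> \<zero>\<^bsub>W\<^esub> = \<zero>\<^bsub>Y\<^esub>" by (rule lin_hom_zero[OF assms(2) W.V.fvs_axioms Y.V.fvs_axioms])
  define T where "T v = (\<Oplus>\<^bsub>Y\<^esub>g\<in>supp v. act Y g (\<kappa> (coeff v g)))" for v
  have c_closed: "coeff v g \<in> carrier W" if "v \<in> carrier V" "g \<in> carrier G" for v g
    using lin_homD(1)[OF coeff_lin_hom] that by blast
  have t_closed: "act Y g (\<kappa> (coeff v g)) \<in> carrier Y" if "v \<in> carrier V" "g \<in> carrier G" for v g
    using Y.act_closed lin_homD(1)[OF assms(2)] c_closed that by blast
  \<comment> \<open>Linearity compares vectors with different supports, so the defining sum is first
    extended to arbitrary finite sets of representatives containing the support.\<close>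
  have T_sup: "T v = (\<Oplus>\<^bsub>Y\<^esub>g\<in>B. act Y g (\<kappa> (coeff v g)))"
    if "v \<in> carrier V" "finite B" "supp v \<subseteq> B" "B \<subseteq> rep ` carrier G" for v B
    unfolding T_def
  proof (rule Y.V.add.finprod_mono_neutral_cong_left)
    show "act Y i (\<kappa> (coeff v i)) = \<zero>\<^bsub>Y\<^esub>" if "i \<in> B - supp v" for i
      using that \<open>B \<subseteq> _\<close> rep(1) \<kappa>0 Y.act_zero by (auto simp: supp_def)
    show "(\<lambda>g. act Y g (\<kappa> (coeff v g))) \<in> B \<rightarrow> carrier Y" using that t_closed rep(1) by blast
  qed (use that in auto)
  have supp_sub: "supp v \<subseteq> rep ` carrier G" for v by (auto simp: supp_def)
  have T_lin: "T \<in> lin_hom V Y"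
  proof (rule lin_homI)
    show "T v \<in> carrier Y" if "v \<in> carrier V" for v
      unfolding T_def using t_closed[OF that] supp_sub rep(1) by (intro Y.V.finsum_closed) blast
  next
    fix v w assume vw: "v \<in> carrier V" "w \<in> carrier V"
    let ?B = "supp v \<union> supp w \<union> supp (v \<oplus>\<^bsub>V\<^esub> w)"
    have B: "finite ?B" "?B \<subseteq> rep ` carrier G" using vw finite_supp supp_sub by auto
    have Bc: "g \<in> carrier G" if "g \<in> ?B" for g using that B(2) rep(1) by auto
    have eq: "act Y g (\<kappa> (coeff (v \<oplus>\<^bsub>V\<^esub> w) g)) = act Y g (\<kappa> (coeff v g)) \<oplus>\<^bsub>Y\<^esub> act Y g (\<kappa> (coeff w g))"
      if "g \<in> ?B" for g
      using Bc[OF that] vw c_closed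
      by (simp add: lin_homD(2)[OF coeff_lin_hom] lin_homD[OF assms(2)] Y.act_add)
    have "T (v \<oplus>\<^bsub>V\<^esub> w) = (\<Oplus>\<^bsub>Y\<^esub>g\<in>?B. act Y g (\<kappa> (coeff (v \<oplus>\<^bsub>V\<^esub> w) g)))"
      by (rule T_sup) (use vw B in auto)
    also have "\<dots> = (\<Oplus>\<^bsub>Y\<^esub>g\<in>?B. act Y g (\<kappa> (coeff v g)) \<oplus>\<^bsub>Y\<^esub> act Y g (\<kappa> (coeff w g)))"
      by (rule Y.V.finsum_cong') (use eq vw t_closed Bc in auto)
    also have "\<dots> = (\<Oplus>\<^bsub>Y\<^esub>g\<in>?B. act Y g (\<kappa> (coeff v g))) \<oplus>\<^bsub>Y\<^esub> (\<Oplus>\<^bsub>Y\<^esub>g\<in>?B. act Y g (\<kappa> (coeff w g)))"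
      by (rule Y.V.finsum_addf) (use vw t_closed Bc in auto)
    also have "\<dots> = T v \<oplus>\<^bsub>Y\<^esub> T w"
      by (subst (1 2) T_sup[of _ ?B]) (use vw B in auto)
    finally show "T (v \<oplus>\<^bsub>V\<^esub> w) = T v \<oplus>\<^bsub>Y\<^esub> T w" .
  next
    fix c v assume v: "v \<in> carrier V"
    let ?B = "supp v \<union> supp (c \<odot>\<^bsub>V\<^esub> v)"
    have B: "finite ?B" "?B \<subseteq> rep ` carrier G" using v finite_supp supp_sub by (auto simp: V.V.vsimps)
    have Bc: "g \<in> carrier G" if "g \<in> ?B" for g using that B(2) rep(1) by auto
    have eq: "act Y g (\<kappa> (coeff (c \<odot>\<^bsub>V\<^esub> v) g)) = c \<odot>\<^bsub>Y\<^esub> act Y g (\<kappa> (coeff v g))"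
      if "g \<in> ?B" for g
      using Bc[OF that] v c_closed
      by (simp add: lin_homD(3)[OF coeff_lin_hom] lin_homD[OF assms(2)] Y.act_smult)
    have "T (c \<odot>\<^bsub>V\<^esub> v) = (\<Oplus>\<^bsub>Y\<^esub>g\<in>?B. act Y g (\<kappa> (coeff (c \<odot>\<^bsub>V\<^esub> v) g)))"
      by (rule T_sup) (use v B in \<open>auto simp: V.V.vsimps\<close>)
    also have "\<dots> = (\<Oplus>\<^bsub>Y\<^esub>g\<in>?B. c \<odot>\<^bsub>Y\<^esub> act Y g (\<kappa> (coeff v g)))"
      by (rule Y.V.finsum_cong') (use eq v t_closed Bc in \<open>auto simp: Y.V.vsimps\<close>)
    also have "\<dots> = c \<odot>\<^bsub>Y\<^esub> T v"
      using T_sup[of v ?B] Y.V.smult_finsum[of ?B "\<lambda>g. act Y g (\<kappa> (coeff v g))" c] v B t_closed Bc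
      by simp
    finally show "T (c \<odot>\<^bsub>V\<^esub> v) = c \<odot>\<^bsub>Y\<^esub> T v" .
  qed
  have T_gen: "T (act V k (\<iota> w)) = act Y k (\<kappa> w)" if k: "k \<in> carrier G" "w \<in> carrier W" for k w
  proof -
    \<comment> \<open>k is its representative times an element of H, and \<kappa> commutes with that
      element.\<close>
    let ?r = "rep k" and ?h = "inv\<^bsub>G\<^esub> (rep k) \<otimes>\<^bsub>G\<^esub> k"
    have "T (act V k (\<iota> w)) = (\<Oplus>\<^bsub>Y\<^esub>g\<in>{?r}. act Y g (\<kappa> (coeff (act V k (\<iota> w)) g)))"
      by (rule T_sup) (use k supp_gen V.act_closed \<iota>_closed in auto)
    also have "\<dots> = act Y ?r (\<kappa> (coeff (act V k (\<iota> w)) ?r))"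
      using t_closed k rep V.act_closed \<iota>_closed by (simp add: Y.V.finsum_insert)
    also have "\<dots> = act Y ?r (act Y ?h (\<kappa> w))"
      using k rep by (simp add: coeff_gen \<kappa>_act)
    also have "\<dots> = act Y k (\<kappa> w)"
      using k rep lin_homD(1)[OF assms(2)]
      by (simp add: Y.act_mult[symmetric] V.G.m_assoc[symmetric])
    finally show ?thesis .
  qed
  have T_act: "T (act V g v) = act Y g (T v)" if g: "g \<in> carrier G" and v: "v \<in> carrier V" for g v
  proof -
    have "lin_closed V {v \<in> carrier V. T (act V g v) = act Y g (T v)}"
      using g lin_hom_zero[OF T_lin V.V.fvs_axioms Y.V.fvs_axioms]
      by (intro lin_closedI) (auto simp: V.V.vsimps V.act_closed V.act_add V.act_smult V.act_zero
          Y.act_zero Y.act_add Y.act_smult lin_homD[OF T_lin])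
    moreover have "act V k (\<iota> w) \<in> {v \<in> carrier V. T (act V g v) = act Y g (T v)}"
      if "k \<in> carrier G" "w \<in> carrier W" for k w
      using that g T_gen \<iota>_closed V.act_closed lin_homD(1)[OF assms(2)]
      by (simp add: V.act_mult[symmetric] Y.act_mult[symmetric])
    ultimately show ?thesis using span v by blast
  qed
  show thesis
  proof
    show "T \<in> gmod_hom G V Y" using T_lin T_act by (rule gmod_homI)
    show "\<forall>v. supp v = {} \<longrightarrow> T v = \<zero>\<^bsub>Y\<^esub>" by (simp add: T_def)
    show "\<forall>w\<in>carrier W. T (\<iota> w) = \<kappa> w"
      using T_gen[of "\<one>\<^bsub>G\<^esub>"] V.act_one Y.act_one \<iota>_closed lin_homD(1)[OF assms(2)] by simp
  qed
qed

lemma hom_eqI: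
  assumes "gmodule G Y" "S \<in> gmod_hom G V Y" "T \<in> gmod_hom G V Y"
    and "\<And>w. w \<in> carrier W \<Longrightarrow> S (\<iota> w) = T (\<iota> w)" "v \<in> carrier V"
  shows "S v = T v"
proof -
  interpret Y: gmodule G Y by fact
  note S = gmod_homD[OF assms(2)] and T = gmod_homD[OF assms(3)]
  have "lin_closed V {v \<in> carrier V. S v = T v}"
    using lin_hom_zero[OF S(1) V.V.fvs_axioms Y.V.fvs_axioms]
      lin_hom_zero[OF T(1) V.V.fvs_axioms Y.V.fvs_axioms]
    by (intro lin_closedI) (auto simp: V.V.vsimps lin_homD[OF S(1)] lin_homD[OF T(1)])
  moreover have "act V k (\<iota> w) \<in> {v \<in> carrier V. S v = T v}"
    if "k \<in> carrier G" "w \<in> carrier W" for k w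
    using that \<iota>_closed V.act_closed assms(4) by (simp add: S(2) T(2))
  ultimately show ?thesis using span assms(5) by blast
qed

text \<open>The endomorphism that \<open>universal\<close> yields for \<kappa> = \<iota> agrees with
  the identity on \<iota>(W), hence is the identity; on a vector all of whose components vanish it
  is zero.\<close>

lemma eq_zeroI:
  assumes v: "v \<in> carrier V" and "\<And>g. g \<in> carrier G \<Longrightarrow> p (act V g v) = \<zero>\<^bsub>W\<^esub>"
  shows "v = \<zero>\<^bsub>V\<^esub>"
proof -
  obtain T where T: "T \<in> gmod_hom G V V" "\<forall>w\<in>carrier W. T (\<iota> w) = \<iota> w"
    "\<forall>v. supp v = {} \<longrightarrow> T v = \<zero>\<^bsub>V\<^esub>"
    by (rule universal[OF V.gmodule_axioms \<iota>_hom \<iota>_act])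
  have "(\<lambda>v. v) \<in> gmod_hom G V V" by (rule gmod_homI) (auto intro: lin_homI)
  then have "T v = v" by (rule hom_eqI[OF V.gmodule_axioms T(1) _ _ v]) (simp add: T(2))
  moreover have "supp v = {}" using assms(2) rep(1) by (auto simp: supp_def coeff_def)
  ultimately show ?thesis using T(3) by simp
qed

end

lemma gmod_hom_comp: "S \<in> gmod_hom G U V \<Longrightarrow> T \<in> gmod_hom G V W \<Longrightarrow> (\<lambda>x. T (S x)) \<in> gmod_hom G U W"
  by (rule gmod_homI[OF lin_hom_comp[OF gmod_homD(1) gmod_homD(1)]])
    (simp_all add: gmod_homD(2) lin_homD(1)[OF gmod_homD(1)])

lemma gmod_hom_id: "gmodule G V \<Longrightarrow> (\<lambda>x. x) \<in> gmod_hom G V V"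
  by (auto intro!: gmod_homI lin_homI)

theorem ind_struct_unique:
  assumes "ind_struct G H W V \<iota> p" "ind_struct G H W V' \<iota>' p'"
  shows "gmod_isomorphic G V V'"
proof -
  interpret A: ind_struct G H W V \<iota> p by fact
  interpret B: ind_struct G H W V' \<iota>' p' by fact
  obtain T where T: "T \<in> gmod_hom G V V'" "\<And>w. w \<in> carrier W \<Longrightarrow> T (\<iota> w) = \<iota>' w"
    using A.universal[OF B.V.gmodule_axioms B.\<iota>_hom] B.\<iota>_act by metis
  obtain S where S: "S \<in> gmod_hom G V' V" "\<And>w. w \<in> carrier W \<Longrightarrow> S (\<iota>' w) = \<iota> w"
    using B.universal[OF A.V.gmodule_axioms A.\<iota>_hom] A.\<iota>_act by metis
  have "S (T v) = v" if "v \<in> carrier V" for v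
    by (rule A.hom_eqI[OF A.V.gmodule_axioms gmod_hom_comp[OF T(1) S(1)] gmod_hom_id])
      (use that T S A.V.gmodule_axioms in auto)
  moreover have "T (S v) = v" if "v \<in> carrier V'" for v
    by (rule B.hom_eqI[OF B.V.gmodule_axioms gmod_hom_comp[OF S(1) T(1)] gmod_hom_id])
      (use that T S B.V.gmodule_axioms in auto)
  ultimately have "bij_betw T (carrier V) (carrier V')"
    using lin_homD(1)[OF gmod_homD(1)[OF T(1)]] lin_homD(1)[OF gmod_homD(1)[OF S(1)]]
    by (intro bij_betw_byWitness[where f' = S]) auto
  then show ?thesis using T(1) by (auto simp: gmod_isomorphic_def)
qed

text \<open>Lets the coefficient module be exchanged for a more convenient isomorphic one, such as
  \<open>twist\<close> for a tensor product with a one-dimensional module.\<close>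

lemma ind_struct_iso:
  assumes "ind_struct G H W V \<iota> p" "gmodule (G\<lparr>carrier := H\<rparr>) W'"
    and \<theta>: "\<theta> \<in> gmod_hom (G\<lparr>carrier := H\<rparr>) W' W" "bij_betw \<theta> (carrier W') (carrier W)"
  shows "ind_struct G H W' V (\<lambda>w. \<iota> (\<theta> w)) (\<lambda>v. inv_into (carrier W') \<theta> (p v))"
proof -
  interpret A: ind_struct G H W V \<iota> p by fact
  interpret W': gmodule "G\<lparr>carrier := H\<rparr>" W' by fact
  let ?\<eta> = "inv_into (carrier W') \<theta>"
  note t = gmod_homD[OF \<theta>(1)]
  have \<eta>: "?\<eta> \<in> lin_hom W W'" by (rule lin_hom_inv_into[OF t(1) \<theta>(2) W'.V.fvs_axioms])
  have \<eta>\<theta>: "?\<eta> (\<theta> w) = w" if "w \<in> carrier W'" for w using \<theta>(2) that by (auto simp: bij_betw_def)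
  have \<theta>\<eta>: "\<theta> (?\<eta> w) = w" if "w \<in> carrier W" for w
    using \<theta>(2) that by (auto simp: bij_betw_def intro: f_inv_into_f)
  have cl: "\<theta> w \<in> carrier W" if "w \<in> carrier W'" for w using lin_homD(1)[OF t(1) that] .
  have cl': "?\<eta> w \<in> carrier W'" if "w \<in> carrier W" for w using lin_homD(1)[OF \<eta> that] .
  have \<eta>0: "?\<eta> \<zero>\<^bsub>W\<^esub> = \<zero>\<^bsub>W'\<^esub>" by (rule lin_hom_zero[OF \<eta> A.W.V.fvs_axioms W'.V.fvs_axioms])
  show ?thesis
  proof (intro ind_struct.intro ind_struct_axioms.intro)
    show "gmodule G V" "gmodule (G\<lparr>carrier := H\<rparr>) W'"
      by (rule A.V.gmodule_axioms) (rule assms(2))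
    show "subgroup H G" by (rule A.sub)
    show "(\<lambda>w. \<iota> (\<theta> w)) \<in> lin_hom W' V" by (rule lin_hom_comp[OF t(1) A.\<iota>_hom])
    show "(\<lambda>v. ?\<eta> (p v)) \<in> lin_hom V W'" by (rule lin_hom_comp[OF A.p_hom \<eta>])
    show "act V h (\<iota> (\<theta> w)) = \<iota> (\<theta> (act W' h w))" if "h \<in> H" "w \<in> carrier W'" for h w
      using that A.\<iota>_act cl t(2) by simp
    show "v \<in> Q" if Q: "lin_closed V Q"
      "\<And>g w. \<lbrakk>g \<in> carrier G; w \<in> carrier W'\<rbrakk> \<Longrightarrow> act V g (\<iota> (\<theta> w)) \<in> Q" "v \<in> carrier V" for v Q
    proof (rule A.span[OF Q(1) _ Q(3)])
      show "act V g (\<iota> w) \<in> Q" if "g \<in> carrier G" "w \<in> carrier W" for g w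
        using Q(2)[OF that(1) cl'[OF that(2)]] \<theta>\<eta>[OF that(2)] by simp
    qed
    show "?\<eta> (p (act V g (\<iota> (\<theta> w)))) = (if g \<in> H then act W' g w else \<zero>\<^bsub>W'\<^esub>)"
      if "g \<in> carrier G" "w \<in> carrier W'" for g w
      using that A.p_act cl \<eta>0 \<eta>\<theta> W'.act_closed t(2)[symmetric] by auto
  qed
qed

section \<open>Induced modules and inflation along a surjection\<close>

lemma pullback_sel [simp]:
  "carrier (pullback \<pi> V) = carrier V" "zero (pullback \<pi> V) = zero V" "add (pullback \<pi> V) = add V"
  "smult (pullback \<pi> V) = smult V" "act (pullback \<pi> V) h = act V (\<pi> h)"
  by (auto simp: pullback_def)

lemma fvs_pullback: "fvs (pullback \<pi> V)" if "fvs V"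
proof -
  interpret fvs V by fact
  show ?thesis
    by (rule fvsI) (auto simp: vsimps add.m_comm add.m_lcomm add.m_assoc)
qed

lemma gmodule_pullback:
  assumes "gmodule G V" "group G'" "\<pi> \<in> hom G' G"
  shows "gmodule G' (pullback \<pi> V)"
proof -
  interpret V: gmodule G V by fact
  interpret \<pi>: group_hom G' G \<pi> using assms by (simp add: group_hom_def group_hom_axioms_def V.G.is_group)
  show ?thesis
    by (rule gmodI)
      (auto simp: assms(2) fvs_pullback V.V.fvs_axioms V.act_closed V.act_add V.act_smult V.act_one V.act_mult)
qed

lemma lin_hom_pullback [simp]: "lin_hom (pullback \<pi> V) (pullback \<pi> W) = lin_hom V W"
  "lin_closed (pullback \<pi> V) = lin_closed V"
  by (auto simp: LinearCombinations.module_hom_def lin_closed_def fun_eq_iff)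

text \<open>As \<pi> is onto, it identifies the coset spaces of H' in G' and of H in G, so the same
  maps \<iota> and p serve for both.\<close>

lemma ind_struct_pullback:
  assumes "ind_struct G H W V \<iota> p" "group G'" "\<pi> \<in> hom G' G" "\<pi> ` carrier G' = carrier G"
    and H': "H' = {g \<in> carrier G'. \<pi> g \<in> H}"
  shows "ind_struct G' H' (pullback \<pi> W) (pullback \<pi> V) \<iota> p"
proof -
  interpret A: ind_struct G H W V \<iota> p by fact
  interpret \<pi>: group_hom G' G \<pi>
    using assms by (simp add: group_hom_def group_hom_axioms_def A.V.G.is_group)
  interpret V': gmodule G' "pullback \<pi> V"
    by (rule gmodule_pullback[OF A.V.gmodule_axioms assms(2,3)])
  have sub: "subgroup H' G'"
    unfolding H' using subgroup.m_closed[OF A.sub] subgroup.one_closed[OF A.sub]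
      subgroup.m_inv_closed[OF A.sub]
    by (intro subgroup.intro) auto
  interpret W': gmodule "G'\<lparr>carrier := H'\<rparr>" "pullback \<pi> W"
  proof (rule gmodule_pullback[OF A.W.gmodule_axioms])
    show "group (G'\<lparr>carrier := H'\<rparr>)" by (rule subgroup.subgroup_is_group[OF sub assms(2)])
    show "\<pi> \<in> hom (G'\<lparr>carrier := H'\<rparr>) (G\<lparr>carrier := H\<rparr>)" using assms(3) by (auto simp: hom_def H')
  qed
  show ?thesis
  proof (intro ind_struct.intro ind_struct_axioms.intro)
    fix v Q assume "lin_closed (pullback \<pi> V) Q"
      and gen: "\<And>g w. \<lbrakk>g \<in> carrier G'; w \<in> carrier (pullback \<pi> W)\<rbrakk> \<Longrightarrow> act (pullback \<pi> V) g (\<iota> w) \<in> Q"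
      and "v \<in> carrier (pullback \<pi> V)"
    then have Q: "lin_closed V Q" and v: "v \<in> carrier V" by simp_all
    have gen': "act V g (\<iota> w) \<in> Q" if g: "g \<in> carrier G" and w: "w \<in> carrier W" for g w
    proof -
      obtain g' where "g' \<in> carrier G'" "g = \<pi> g'" using g assms(4) by blast
      then show ?thesis using gen[of g' w] w by simp
    qed
    show "v \<in> Q" using A.span[OF Q gen' v] .
  next
    show "p (act (pullback \<pi> V) g (\<iota> w)) = (if g \<in> H' then act (pullback \<pi> W) g w else \<zero>\<^bsub>pullback \<pi> W\<^esub>)"
      if "g \<in> carrier G'" "w \<in> carrier (pullback \<pi> W)" for g w
      using that(2) A.p_act[OF \<pi>.hom_closed[OF that(1)]] that(1) by (simp add: H')
  qed (use sub A.\<iota>_hom A.p_hom A.\<iota>_act V'.gmodule_axioms W'.gmodule_axioms in \<open>simp_all add: H'\<close>)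
qed

section \<open>Modules induced from a one-dimensional module\<close>

lemma char_module_sel [simp]:
  "carrier (char_module \<psi>) = UNIV" "zero (char_module \<psi>) = 0" "add (char_module \<psi>) = (+)"
  "smult (char_module \<psi>) = (*)" "act (char_module \<psi>) g v = \<psi> g * v"
  by (auto simp: char_module_def)

lemma fvs_char_module: "fvs (char_module \<psi>)"
  by (rule fvsI) (auto simp: algebra_simps)

lemma F_star_sel [simp]:
  "carrier (F_star :: 'f::field monoid) = - {0}" "mult (F_star :: 'f monoid) = (*)"
  "one (F_star :: 'f monoid) = 1"
proof -
  have "x \<in> Units (class_ring :: 'f ring)" if "x \<noteq> 0" for x
    using that unfolding Units_def by (auto intro!: exI[of _ "inverse x"])
  moreover have "(0 :: 'f) \<notin> Units class_ring" by (auto simp: Units_def)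
  ultimately show "carrier (F_star :: 'f::field monoid) = - {0}" by (auto simp: units_of_def)
qed (auto simp: units_of_def)

lemma F_star_homD:
  assumes "\<psi> \<in> hom G F_star"
  shows "g \<in> carrier G \<Longrightarrow> \<psi> g \<noteq> 0"
    "g \<in> carrier G \<Longrightarrow> h \<in> carrier G \<Longrightarrow> \<psi> (g \<otimes>\<^bsub>G\<^esub> h) = \<psi> g * \<psi> h"
    "group G \<Longrightarrow> \<psi> \<one>\<^bsub>G\<^esub> = 1"
proof -
  show n: "g \<in> carrier G \<Longrightarrow> \<psi> g \<noteq> 0" for g
    using assms by (auto simp: hom_def)
  show m: "g \<in> carrier G \<Longrightarrow> h \<in> carrier G \<Longrightarrow> \<psi> (g \<otimes>\<^bsub>G\<^esub> h) = \<psi> g * \<psi> h" for g h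
    using assms by (auto simp: hom_def)
  assume "group G"
  then interpret group G .
  show "\<psi> \<one>\<^bsub>G\<^esub> = 1"
    using m[of "\<one>\<^bsub>G\<^esub>" "\<one>\<^bsub>G\<^esub>"] n[of "\<one>\<^bsub>G\<^esub>"] by simp
qed

lemma gmodule_char_module:
  assumes "group G" "\<psi> \<in> hom G F_star"
  shows "gmodule G (char_module \<psi>)"
  using assms F_star_homD[OF assms(2)] fvs_char_module by (intro gmodI) (auto simp: algebra_simps)

text \<open>For a one-dimensional coefficient module all data come from v = \<iota>(1): an
  eigenvector of H whose translates span V, and a functional \<epsilon> that separates the coset H
  from the others.\<close>

lemma ind_struct_charI:
  assumes "gmodule G V" "subgroup H G" "\<psi> \<in> hom (G\<lparr>carrier := H\<rparr>) F_star" "v \<in> carrier V"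
    and h: "\<And>h. h \<in> H \<Longrightarrow> act V h v = \<psi> h \<odot>\<^bsub>V\<^esub> v"
    and span: "\<And>Q. lin_closed V Q \<Longrightarrow> (\<And>g. g \<in> carrier G \<Longrightarrow> act V g v \<in> Q) \<Longrightarrow> carrier V \<subseteq> Q"
    and \<epsilon>: "\<epsilon> \<in> lin_hom V (char_module \<psi>)"
    "\<And>g. g \<in> carrier G \<Longrightarrow> \<epsilon> (act V g v) = (if g \<in> H then \<psi> g else 0)"
  shows "ind_struct G H (char_module \<psi>) V (\<lambda>c. c \<odot>\<^bsub>V\<^esub> v) \<epsilon>"
proof -
  interpret V: gmodule G V by fact
  interpret W: gmodule "G\<lparr>carrier := H\<rparr>" "char_module \<psi>"
    by (rule gmodule_char_module[OF subgroup.subgroup_is_group[OF assms(2) V.G.is_group] assms(3)])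
  have sub: "g \<in> H \<Longrightarrow> g \<in> carrier G" for g using subgroup.subset[OF assms(2)] by auto
  have \<iota>: "(\<lambda>c. c \<odot>\<^bsub>V\<^esub> v) \<in> lin_hom (char_module \<psi>) V"
    by (rule lin_homI) (use assms(4) in \<open>simp_all add: V.V.vsimps\<close>)
  show ?thesis
  proof (intro ind_struct.intro ind_struct_axioms.intro)
    show "w \<in> Q" if Q: "lin_closed V Q"
      "\<And>g w. \<lbrakk>g \<in> carrier G; w \<in> carrier (char_module \<psi>)\<rbrakk> \<Longrightarrow> act V g (w \<odot>\<^bsub>V\<^esub> v) \<in> Q"
      "w \<in> carrier V" for w Q
      using span[OF Q(1)] Q(2)[of _ 1] Q(3) assms(4) V.V.vsimps by auto
  qed (use assms sub \<iota> V.gmodule_axioms W.gmodule_axioms in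
    \<open>auto simp: V.V.vsimps V.act_smult V.act_closed lin_homD(3)[OF \<epsilon>(1)] mult.commute\<close>)
qed

lemma ind_struct_char_gen:
  assumes "ind_struct G H (char_module \<psi>) V \<iota> p"
  shows "\<iota> 1 \<in> carrier V" "h \<in> H \<Longrightarrow> act V h (\<iota> 1) = \<psi> h \<odot>\<^bsub>V\<^esub> \<iota> 1"
    "lin_closed V Q \<Longrightarrow> (\<And>g. g \<in> carrier G \<Longrightarrow> act V g (\<iota> 1) \<in> Q) \<Longrightarrow> carrier V \<subseteq> Q"
    "g \<in> carrier G \<Longrightarrow> p (act V g (\<iota> 1)) = (if g \<in> H then \<psi> g else 0)"
proof -
  interpret A: ind_struct G H "char_module \<psi>" V \<iota> p by fact
  show 1: "\<iota> 1 \<in> carrier V" using A.\<iota>_closed by simp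
  have i: "\<iota> c = c \<odot>\<^bsub>V\<^esub> \<iota> 1" for c using lin_homD(3)[OF A.\<iota>_hom, of 1 c] by simp
  show "h \<in> H \<Longrightarrow> act V h (\<iota> 1) = \<psi> h \<odot>\<^bsub>V\<^esub> \<iota> 1" using A.\<iota>_act[of h 1] i[of "\<psi> h"] by simp
  show "carrier V \<subseteq> Q" if Q: "lin_closed V Q" "\<And>g. g \<in> carrier G \<Longrightarrow> act V g (\<iota> 1) \<in> Q"
  proof
    fix v assume "v \<in> carrier V"
    show "v \<in> Q"
    proof (rule A.span[OF Q(1) _ \<open>v \<in> carrier V\<close>])
      show "act V g (\<iota> w) \<in> Q" if "g \<in> carrier G" for g w
        using Q(2)[OF that] lin_closedD(4)[OF Q(1)] 1 that i[of w] A.V.act_smult by metis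
    qed
  qed
  show "g \<in> carrier G \<Longrightarrow> p (act V g (\<iota> 1)) = (if g \<in> H then \<psi> g else 0)"
    using A.p_act[of g 1] by simp
qed

section \<open>Convolution in group algebras and the presentation of induced modules\<close>

definition conv :: "('g \<Rightarrow> 'g \<Rightarrow> 'g) \<Rightarrow> ('g \<Rightarrow>\<^sub>0 'f::field) \<Rightarrow> ('g \<Rightarrow>\<^sub>0 'f) \<Rightarrow> ('g \<Rightarrow>\<^sub>0 'f)" where
  "conv m x y = (\<Sum>g\<in>Poly_Mapping.keys x. \<Sum>h\<in>Poly_Mapping.keys y.
     Poly_Mapping.single (m g h) (Poly_Mapping.lookup x g * Poly_Mapping.lookup y h))"

text \<open>The product refers to the group operation and not to the carrier, so one function
  \<open>conv\<close> serves both FG and FH.\<close>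

lemma group_algebra_sel [simp]:
  "carrier (group_algebra G) = {x. Poly_Mapping.keys x \<subseteq> carrier G}"
  "mult (group_algebra G) = conv (mult G)" "one (group_algebra G) = symb \<one>\<^bsub>G\<^esub>"
  "zero (group_algebra G) = 0" "add (group_algebra G) = (+)" "smult (group_algebra G) = pscale"
  by (auto simp: group_algebra_def conv_def fun_eq_iff)

lemma pscale_sum: "pscale c (\<Sum>x\<in>A. f x) = (\<Sum>x\<in>A. pscale c (f x))"
  by (induction A rule: infinite_finite_induct) (auto simp: pscale_simps)

lemma conv_superset:
  assumes "finite A" "Poly_Mapping.keys x \<subseteq> A"
  shows "conv m x y = (\<Sum>g\<in>A. pscale (Poly_Mapping.lookup x g) (linear_extension (m g) y))"
proof -
  have "conv m x y = (\<Sum>g\<in>Poly_Mapping.keys x. pscale (Poly_Mapping.lookup x g) (linear_extension (m g) y))"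
    by (simp add: conv_def linear_extension_def pscale_sum pscale_simps)
  also have "\<dots> = (\<Sum>g\<in>A. pscale (Poly_Mapping.lookup x g) (linear_extension (m g) y))"
    by (rule sum.mono_neutral_left) (use assms in \<open>auto simp: in_keys_iff pscale_simps\<close>)
  finally show ?thesis .
qed

lemma conv_add: "conv m (x + y) z = conv m x z + conv m y z"
proof -
  let ?A = "Poly_Mapping.keys x \<union> Poly_Mapping.keys y"
  have "conv m (x + y) z =
      (\<Sum>g\<in>?A. pscale (Poly_Mapping.lookup (x + y) g) (linear_extension (m g) z))"
    by (rule conv_superset) (simp_all add: Poly_Mapping.keys_add)
  also have "\<dots> = conv m x z + conv m y z"
    by (subst (1 2) conv_superset[where A = ?A])
      (auto simp: lookup_add pscale_simps sum.distrib)
  finally show ?thesis .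
qed

lemma conv_zero: "conv m 0 z = 0"
  by (simp add: conv_def)

lemma conv_single: "conv m (Poly_Mapping.single g c) y = pscale c (linear_extension (m g) y)"
  using conv_superset[of "{g}" "Poly_Mapping.single g c" m y] by simp

lemma keys_conv:
  assumes "Poly_Mapping.keys x \<subseteq> A" "Poly_Mapping.keys y \<subseteq> A" "\<And>g h. g \<in> A \<Longrightarrow> h \<in> A \<Longrightarrow> m g h \<in> A"
  shows "Poly_Mapping.keys (conv m x y) \<subseteq> A"
  using assms(1)
proof (induction rule: poly_mapping_single_induct)
  case (add p g c)
  then show ?case unfolding conv_add conv_single
    by (intro keys_subsets keys_linear_extension[OF assms(2)] assms(3)) auto
qed (simp add: conv_zero)

context fvs
begin

lemma ext_add_fun:
  assumes "\<And>x. x \<in> Poly_Mapping.keys q \<Longrightarrow> \<sigma> x \<in> carrier V"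
    "\<And>x. x \<in> Poly_Mapping.keys q \<Longrightarrow> \<tau> x \<in> carrier V"
  shows "ext V (\<lambda>x. \<sigma> x \<oplus>\<^bsub>V\<^esub> \<tau> x) q = ext V \<sigma> q \<oplus>\<^bsub>V\<^esub> ext V \<tau> q"
proof -
  have "ext V (\<lambda>x. \<sigma> x \<oplus>\<^bsub>V\<^esub> \<tau> x) q =
      (\<Oplus>\<^bsub>V\<^esub>x\<in>Poly_Mapping.keys q. Poly_Mapping.lookup q x \<odot>\<^bsub>V\<^esub> \<sigma> x \<oplus>\<^bsub>V\<^esub> Poly_Mapping.lookup q x \<odot>\<^bsub>V\<^esub> \<tau> x)"
    unfolding ext_def by (rule finsum_cong') (use assms in \<open>auto simp: vsimps\<close>)
  also have "\<dots> = ext V \<sigma> q \<oplus>\<^bsub>V\<^esub> ext V \<tau> q"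
    unfolding ext_def by (rule finsum_addf) (use assms in \<open>auto simp: vsimps\<close>)
  finally show ?thesis .
qed

lemma ext_smult_fun:
  assumes "\<And>x. x \<in> Poly_Mapping.keys q \<Longrightarrow> \<sigma> x \<in> carrier V"
  shows "ext V (\<lambda>x. c \<odot>\<^bsub>V\<^esub> \<sigma> x) q = c \<odot>\<^bsub>V\<^esub> ext V \<sigma> q"
proof -
  have "ext V (\<lambda>x. c \<odot>\<^bsub>V\<^esub> \<sigma> x) q =
      (\<Oplus>\<^bsub>V\<^esub>x\<in>Poly_Mapping.keys q. c \<odot>\<^bsub>V\<^esub> (Poly_Mapping.lookup q x \<odot>\<^bsub>V\<^esub> \<sigma> x))"
    unfolding ext_def by (rule finsum_cong') (use assms in \<open>auto simp: vsimps mult.commute\<close>)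
  also have "\<dots> = c \<odot>\<^bsub>V\<^esub> ext V \<sigma> q"
    unfolding ext_def
    using smult_finsum[of "Poly_Mapping.keys q" "\<lambda>x. Poly_Mapping.lookup q x \<odot>\<^bsub>V\<^esub> \<sigma> x" c] assms
    by (simp add: vsimps)
  finally show ?thesis .
qed

end

locale induction_data =
  W: gmodule "G\<lparr>carrier := H\<rparr>" W + G: group G
  for G :: "('g, 'm) monoid_scheme" and H :: "'g set" and W :: "('f::field, 'w, 'g) gmodule" +
  assumes sub: "subgroup H G"
begin

lemma H_G: "h \<in> H \<Longrightarrow> h \<in> carrier G"
  using subgroup.subset[OF sub] by auto

abbreviation "symbols \<equiv> {x :: 'g \<Rightarrow>\<^sub>0 'f. Poly_Mapping.keys x \<subseteq> carrier G} \<times> carrier W"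

definition "ind_rels = bilinear_rels (group_algebra G) W \<union>
   {symb (conv (mult G) x b, w) - symb (x, algebra_act W b w) | x b w.
      Poly_Mapping.keys x \<subseteq> carrier G \<and> Poly_Mapping.keys b \<subseteq> H \<and> w \<in> carrier W}"

abbreviation "shift g \<equiv> \<lambda>(x, w :: 'w). (linear_extension (mult G g) x :: 'g \<Rightarrow>\<^sub>0 'f, w)"

lemma induced_eq: "induced G H W = presented_gmod symbols ind_rels shift"
proof -
  have "(\<lambda>g (x, w :: 'w). (conv (mult G) (symb g) x, w)) = shift"
    by (auto simp: fun_eq_iff conv_single pscale_simps)
  then show ?thesis unfolding induced_def Let_def ind_rels_def by simp
qed

lemma ind_relsI:
  "\<lbrakk>Poly_Mapping.keys x \<subseteq> carrier G; Poly_Mapping.keys x' \<subseteq> carrier G; w \<in> carrier W\<rbrakk> \<Longrightarrow>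
     symb (x + x', w) - symb (x, w) - symb (x', w) \<in> ind_rels"
  "\<lbrakk>Poly_Mapping.keys x \<subseteq> carrier G; w \<in> carrier W; w' \<in> carrier W\<rbrakk> \<Longrightarrow>
     symb (x, w \<oplus>\<^bsub>W\<^esub> w') - symb (x, w) - symb (x, w') \<in> ind_rels"
  "\<lbrakk>Poly_Mapping.keys x \<subseteq> carrier G; w \<in> carrier W\<rbrakk> \<Longrightarrow>
     symb (pscale c x, w) - Poly_Mapping.single (x, w) c \<in> ind_rels"
  "\<lbrakk>Poly_Mapping.keys x \<subseteq> carrier G; w \<in> carrier W\<rbrakk> \<Longrightarrow>
     symb (x, c \<odot>\<^bsub>W\<^esub> w) - Poly_Mapping.single (x, w) c \<in> ind_rels"
  "\<lbrakk>Poly_Mapping.keys x \<subseteq> carrier G; Poly_Mapping.keys b \<subseteq> H; w \<in> carrier W\<rbrakk> \<Longrightarrow>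
     symb (conv (mult G) x b, w) - symb (x, algebra_act W b w) \<in> ind_rels"
  unfolding ind_rels_def bilinear_rels_def group_algebra_sel mem_Collect_eq by blast+

lemma ind_relsE:
  assumes "\<rho> \<in> ind_rels"
  obtains
    (add1) x x' w where "\<rho> = symb (x + x', w) - symb (x, w) - symb (x', w)"
      "Poly_Mapping.keys x \<subseteq> carrier G" "Poly_Mapping.keys x' \<subseteq> carrier G" "w \<in> carrier W"
  | (add2) x w w' where "\<rho> = symb (x, w \<oplus>\<^bsub>W\<^esub> w') - symb (x, w) - symb (x, w')"
      "Poly_Mapping.keys x \<subseteq> carrier G" "w \<in> carrier W" "w' \<in> carrier W"
  | (smult1) c x w where "\<rho> = symb (pscale c x, w) - Poly_Mapping.single (x, w) c"
      "Poly_Mapping.keys x \<subseteq> carrier G" "w \<in> carrier W"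
  | (smult2) c x w where "\<rho> = symb (x, c \<odot>\<^bsub>W\<^esub> w) - Poly_Mapping.single (x, w) c"
      "Poly_Mapping.keys x \<subseteq> carrier G" "w \<in> carrier W"
  | (bal) x b w where "\<rho> = symb (conv (mult G) x b, w) - symb (x, algebra_act W b w)"
      "Poly_Mapping.keys x \<subseteq> carrier G" "Poly_Mapping.keys b \<subseteq> H" "w \<in> carrier W"
  using assms unfolding ind_rels_def bilinear_rels_def group_algebra_sel by blast

lemma algebra_act_ext: "algebra_act W b w = ext W (\<lambda>g. act W g w) b"
  by (simp add: algebra_act_def ext_def)

lemma algebra_act_closed:
  "Poly_Mapping.keys b \<subseteq> H \<Longrightarrow> w \<in> carrier W \<Longrightarrow> algebra_act W b w \<in> carrier W"
  unfolding algebra_act_ext by (rule W.V.ext_closed[where X = H]) (use W.act_closed in auto)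

lemma keys_shift:
  "g \<in> carrier G \<Longrightarrow> Poly_Mapping.keys x \<subseteq> carrier G \<Longrightarrow>
     Poly_Mapping.keys (linear_extension (mult G g) x) \<subseteq> carrier G"
  by (rule keys_linear_extension) auto

lemma shift_conv:
  assumes "g \<in> carrier G" "Poly_Mapping.keys x \<subseteq> carrier G" "Poly_Mapping.keys b \<subseteq> carrier G"
  shows "linear_extension (mult G g) (conv (mult G) x b) = conv (mult G) (linear_extension (mult G g) x) b"
  using assms(2)
proof (induction rule: poly_mapping_single_induct)
  case (add p k c)
  have "linear_extension (\<lambda>h. g \<otimes>\<^bsub>G\<^esub> (k \<otimes>\<^bsub>G\<^esub> h)) b = linear_extension (mult G (g \<otimes>\<^bsub>G\<^esub> k)) b"
    by (rule linear_extension_cong[OF assms(3)]) (use add assms G.m_assoc in auto)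
  then show ?case
    using add by (simp add: conv_add conv_single linear_extension_add linear_extension_scale
        linear_extension_comp)
qed (simp add: conv_zero)

lemma keys_symb: "z \<in> Z \<Longrightarrow> Poly_Mapping.keys (Poly_Mapping.single z c) \<subseteq> Z"
  by simp

sublocale P: presentation G symbols ind_rels shift
proof
  show "shift g x \<in> symbols" if "g \<in> carrier G" "x \<in> symbols" for g x
    using that keys_shift by (auto simp del: subset_iff)
  show "shift \<one>\<^bsub>G\<^esub> x = x" if "x \<in> symbols" for x
  proof (cases x)
    case (Pair y w)
    then have "linear_extension (mult G \<one>\<^bsub>G\<^esub>) y = linear_extension (\<lambda>h. h) y"
      using that by (intro linear_extension_cong[where X = "carrier G"]) auto
    then show ?thesis using Pair by (simp add: linear_extension_ident)
  qed
  show "shift (g \<otimes>\<^bsub>G\<^esub> h) x = shift g (shift h x)"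
    if "g \<in> carrier G" "h \<in> carrier G" "x \<in> symbols" for g h x
  proof (cases x)
    case (Pair y w)
    then have "linear_extension (mult G (g \<otimes>\<^bsub>G\<^esub> h)) y = linear_extension (\<lambda>k. g \<otimes>\<^bsub>G\<^esub> (h \<otimes>\<^bsub>G\<^esub> k)) y"
      using that by (intro linear_extension_cong[where X = "carrier G"]) (auto simp: G.m_assoc)
    then show ?thesis using Pair by (simp add: linear_extension_comp)
  qed
next
  fix \<rho> assume "\<rho> \<in> ind_rels"
  then show "Poly_Mapping.keys \<rho> \<subseteq> symbols"
  proof (cases rule: ind_relsE)
    case (bal x b w)
    then have "Poly_Mapping.keys (conv (mult G) x b) \<subseteq> carrier G"
      using H_G by (intro keys_conv) auto
    then show ?thesis
      unfolding bal(1) using bal algebra_act_closed by (intro keys_diff_subset keys_symb) auto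
  qed (use W.V.vsimps keys_subsets in \<open>simp only:, intro keys_diff_subset keys_symb,
      auto simp del: subset_iff del: subsetI intro!: keys_subsets\<close>)
next
  fix g \<rho> assume g: "g \<in> carrier G" and "\<rho> \<in> ind_rels"
  from this(2) show "linear_extension (shift g) \<rho> \<in> ind_rels"
  proof (cases rule: ind_relsE)
    case (bal x b w)
    have "Poly_Mapping.keys b \<subseteq> carrier G" using bal(3) H_G by auto
    then show ?thesis
      using bal ind_relsI(5)[of "linear_extension (mult G g) x" b w] keys_shift[OF g, of x] g
      by (simp add: linear_extension_diff shift_conv)
  qed (use keys_shift[OF g] in
      \<open>auto simp: linear_extension_diff linear_extension_add linear_extension_scale intro!: ind_relsI\<close>)
qed

definition "unit_map w = P.cls (symb (symb \<one>\<^bsub>G\<^esub>, w))"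

lemma act_unit_map:
  assumes "g \<in> carrier G"
  shows "act P.P g (unit_map w) = P.cls (symb (symb g, w))"
  unfolding unit_map_def P.act_symb[OF assms] using assms by simp

text \<open>The value of the projection p on the pure tensor of the group element k with w; p is
  obtained from it by linear extension in k.\<close>

definition "restr w k = (if k \<in> H then act W k w else \<zero>\<^bsub>W\<^esub>)"

lemma restr_closed: "w \<in> carrier W \<Longrightarrow> restr w k \<in> carrier W"
  using W.act_closed by (auto simp: restr_def)

lemma restr_lin:
  "w \<in> carrier W \<Longrightarrow> w' \<in> carrier W \<Longrightarrow> restr (w \<oplus>\<^bsub>W\<^esub> w') k = restr w k \<oplus>\<^bsub>W\<^esub> restr w' k"
  "w \<in> carrier W \<Longrightarrow> restr (c \<odot>\<^bsub>W\<^esub> w) k = c \<odot>\<^bsub>W\<^esub> restr w k" "restr \<zero>\<^bsub>W\<^esub> k = \<zero>\<^bsub>W\<^esub>"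
  using W.act_add W.act_smult W.act_zero by (auto simp: restr_def W.V.vsimps)

text \<open>The projection respects the balancing relations because, for h in H, gh lies in H
  exactly if g does, and then gh acts on w as g acts on hw.\<close>

lemma restr_bal:
  assumes "w \<in> carrier W" "Poly_Mapping.keys b \<subseteq> H" "g \<in> carrier G"
  shows "ext W (restr w) (linear_extension (mult G g) b) = restr (algebra_act W b w) g"
  using assms(2)
proof (induction rule: poly_mapping_single_induct)
  case zero
  then show ?case by (simp add: algebra_act_ext W.V.ext_zero restr_lin)
next
  case (add q h d)
  have m: "g \<otimes>\<^bsub>G\<^esub> h \<in> H \<longleftrightarrow> g \<in> H"
  proof
    assume "g \<otimes>\<^bsub>G\<^esub> h \<in> H"
    then have "(g \<otimes>\<^bsub>G\<^esub> h) \<otimes>\<^bsub>G\<^esub> inv\<^bsub>G\<^esub> h \<in> H"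
      using add(2) subgroup.m_closed[OF sub] subgroup.m_inv_closed[OF sub] by blast
    then show "g \<in> H" using add(2) H_G assms(3) by (simp add: G.m_assoc)
  qed (use add(2) subgroup.m_closed[OF sub] in auto)
  have r: "restr w (g \<otimes>\<^bsub>G\<^esub> h) = restr (act W h w) g"
    using m W.act_mult[of g h w] add(2) assms(1) by (auto simp: restr_def)
  have c: "act W h w \<in> carrier W" using W.act_closed[of h w] add(2) assms(1) by simp
  have e: "algebra_act W (q + Poly_Mapping.single h d) w = algebra_act W q w \<oplus>\<^bsub>W\<^esub> d \<odot>\<^bsub>W\<^esub> act W h w"
    unfolding algebra_act_ext
    by (subst W.V.ext_add[where X = H])
      (use add W.act_closed assms(1) c in \<open>auto simp: W.V.ext_single\<close>)
  have "ext W (restr w) (linear_extension (mult G g) (q + Poly_Mapping.single h d)) =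
      ext W (restr w) (linear_extension (mult G g) q) \<oplus>\<^bsub>W\<^esub> d \<odot>\<^bsub>W\<^esub> restr w (g \<otimes>\<^bsub>G\<^esub> h)"
    unfolding linear_extension_add linear_extension_single
    by (subst W.V.ext_add[where X = UNIV])
      (use restr_closed[OF assms(1)] in \<open>auto simp: W.V.ext_single\<close>)
  then show ?case
    using add(3) e r restr_lin c algebra_act_closed[OF add(1) assms(1)]
    by (simp add: W.V.vsimps)
qed

theorem ind_struct_presented: "\<exists>p. ind_struct G H W (induced G H W) unit_map p"
proof -
  note rcl = restr_closed
  have conv_bal: "ext W (restr w) (conv (mult G) x b) = ext W (restr (algebra_act W b w)) x"
    if "Poly_Mapping.keys x \<subseteq> carrier G" "Poly_Mapping.keys b \<subseteq> H" "w \<in> carrier W" for x b w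
    using that(1)
  proof (induction rule: poly_mapping_single_induct)
    case zero
    then show ?case by (simp add: conv_zero W.V.ext_zero)
  next
    case (add q g c)
    have a: "algebra_act W b w \<in> carrier W" using algebra_act_closed that by blast
    have "ext W (restr w) (conv (mult G) (q + Poly_Mapping.single g c) b) =
      ext W (restr w) (conv (mult G) q b) \<oplus>\<^bsub>W\<^esub> c \<odot>\<^bsub>W\<^esub> restr (algebra_act W b w) g"
      unfolding conv_add conv_single
      by (subst W.V.ext_add[where X = UNIV])
        (use rcl[OF that(3)] restr_bal[OF that(3,2) add(2)] W.V.ext_scale[where X = UNIV and \<tau> = "restr w"] in auto)
    also have "\<dots> = ext W (restr (algebra_act W b w)) (q + Poly_Mapping.single g c)"
      by (subst W.V.ext_add[where X = UNIV]) (use rcl[OF a] add(3) in \<open>auto simp: W.V.ext_single\<close>)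
    finally show ?case .
  qed
  have "ext W (\<lambda>(x, w). ext W (restr w) x) \<rho> = \<zero>\<^bsub>W\<^esub>" if "\<rho> \<in> ind_rels" for \<rho>
    using that
  proof (cases rule: ind_relsE)
    case (add1 x x' w)
    have "ext W (restr w) (x + x') = ext W (restr w) x \<oplus>\<^bsub>W\<^esub> ext W (restr w) x'"
      by (rule W.V.ext_add[where X = UNIV]) (use rcl[OF add1(4)] in auto)
    then show ?thesis unfolding add1(1)
      by (intro W.V.ext_rel_add) (auto intro!: W.V.ext_closed[where X = UNIV] rcl[OF add1(4)])
  next
    case (add2 x w w')
    have s: "restr (w \<oplus>\<^bsub>W\<^esub> w') = (\<lambda>k. restr w k \<oplus>\<^bsub>W\<^esub> restr w' k)"
      using restr_lin(1)[OF add2(3,4)] by auto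
    have "ext W (restr (w \<oplus>\<^bsub>W\<^esub> w')) x = ext W (restr w) x \<oplus>\<^bsub>W\<^esub> ext W (restr w') x"
      unfolding s by (rule W.V.ext_add_fun) (use rcl add2 in auto)
    then show ?thesis unfolding add2(1)
      by (intro W.V.ext_rel_add)
        (auto intro!: W.V.ext_closed[where X = UNIV] rcl simp: add2 W.V.vsimps)
  next
    case (smult1 c x w)
    have "ext W (restr w) (pscale c x) = c \<odot>\<^bsub>W\<^esub> ext W (restr w) x"
      by (rule W.V.ext_scale[where X = UNIV]) (use rcl[OF smult1(3)] in auto)
    then show ?thesis unfolding smult1(1)
      by (intro W.V.ext_rel_smult) (auto intro!: W.V.ext_closed[where X = UNIV] rcl[OF smult1(3)])
  next
    case (smult2 c x w)
    have s: "restr (c \<odot>\<^bsub>W\<^esub> w) = (\<lambda>k. c \<odot>\<^bsub>W\<^esub> restr w k)"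
      using restr_lin(2)[OF smult2(3)] by auto
    have "ext W (restr (c \<odot>\<^bsub>W\<^esub> w)) x = c \<odot>\<^bsub>W\<^esub> ext W (restr w) x"
      unfolding s by (rule W.V.ext_smult_fun) (use rcl smult2 in auto)
    then show ?thesis unfolding smult2(1)
      by (intro W.V.ext_rel_smult)
        (auto intro!: W.V.ext_closed[where X = UNIV] rcl simp: smult2 W.V.vsimps)
  next
    case (bal x b w)
    have c: "ext W (restr (algebra_act W b w)) x \<in> carrier W"
      by (rule W.V.ext_closed[where X = UNIV]) (use rcl algebra_act_closed bal in auto)
    show ?thesis unfolding bal(1)
      by (rule W.V.ext_rel_smult) (use c conv_bal[OF bal(2-4)] in \<open>auto simp: W.V.vsimps\<close>)
  qed
  then obtain p where p: "p \<in> lin_hom P.P W"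
    and p_cls: "\<And>z. z \<in> symbols \<Longrightarrow> p (P.cls (symb z)) = (\<lambda>(x, w). ext W (restr w) x) z"
    by (rule P.hom_P[OF W.V.fvs_axioms, rotated]) (auto intro!: W.V.ext_closed[where X = UNIV] rcl)
  interpret V: gmodule G P.P by (rule P.gmodule_P)
  have one: "Poly_Mapping.keys (symb g) \<subseteq> carrier G" if "g \<in> carrier G" for g using that by simp
  have "ind_struct G H W P.P unit_map p"
  proof (intro ind_struct.intro ind_struct_axioms.intro)
    show "subgroup H G" "gmodule G P.P" "gmodule (G\<lparr>carrier := H\<rparr>) W" "p \<in> lin_hom P.P W"
      by (rule sub V.gmodule_axioms W.gmodule_axioms p)+
    show "unit_map \<in> lin_hom W P.P"
    proof (rule lin_homI)
      show "unit_map v \<in> carrier P.P" if "v \<in> carrier W" for v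
        unfolding unit_map_def by (rule P.cls_symb_closed) (use that in simp)
      show "unit_map (v \<oplus>\<^bsub>W\<^esub> w) = unit_map v \<oplus>\<^bsub>P.P\<^esub> unit_map w"
        if "v \<in> carrier W" "w \<in> carrier W" for v w
        unfolding unit_map_def by (rule P.cls_rel_add[OF ind_relsI(2)]) (use that in auto)
      show "unit_map (c \<odot>\<^bsub>W\<^esub> v) = c \<odot>\<^bsub>P.P\<^esub> unit_map v" if "v \<in> carrier W" for c v
        unfolding unit_map_def by (rule P.cls_rel_smult[OF ind_relsI(4)]) (use that in auto)
    qed
    show "act P.P h (unit_map w) = unit_map (act W h w)" if "h \<in> H" "w \<in> carrier W" for h w
    proof -
      have a: "algebra_act W (symb h) w = act W h w"
        unfolding algebra_act_ext using W.act_closed[of h w] that by (simp add: W.V.ext_single W.V.vsimps)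
      have b: "conv (mult G) (symb \<one>\<^bsub>G\<^esub>) (symb h) = (symb h :: 'g \<Rightarrow>\<^sub>0 'f)"
        using H_G[OF that(1)] by (simp add: conv_single pscale_simps)
      \<comment> \<open>The balancing relation for x = 1 and b = h moves h across the tensor sign.
        It is read as a scaling relation with factor 1.\<close>
      have "P.cls (symb (symb h, w)) = 1 \<odot>\<^bsub>P.P\<^esub> unit_map (act W h w)"
        unfolding unit_map_def
        by (rule P.cls_rel_smult) (use ind_relsI(5)[of "symb \<one>\<^bsub>G\<^esub>" "symb h" w] that a b in simp)
      also have "\<dots> = unit_map (act W h w)"
        unfolding unit_map_def
        by (rule V.V.smult_one') (rule P.cls_symb_closed, use W.act_closed[of h w] that in simp)
      finally show ?thesis using act_unit_map H_G[OF that(1)] by simp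
    qed
    show "p (act P.P g (unit_map w)) = (if g \<in> H then act W g w else \<zero>\<^bsub>W\<^esub>)"
      if "g \<in> carrier G" "w \<in> carrier W" for g w
      using that p_cls[of "(symb g, w)"] rcl[of w g]
      by (simp add: act_unit_map W.V.ext_single W.V.vsimps) (simp add: restr_def)
    fix Q v assume Q: "lin_closed P.P Q" and v: "v \<in> carrier P.P"
      and gen: "\<And>g w. g \<in> carrier G \<Longrightarrow> w \<in> carrier W \<Longrightarrow> act P.P g (unit_map w) \<in> Q"
    have "P.cls (symb (x, w)) \<in> Q" if x: "Poly_Mapping.keys x \<subseteq> carrier G" and w: "w \<in> carrier W" for x w
      using x
    proof (induction rule: poly_mapping_single_induct)
      case zero
      \<comment> \<open>The symbol (0, w) is a basis vector of the free space, not its zero; the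
        scaling relation with factor 0 makes its class vanish.\<close>
      have "P.cls (symb (0, w)) = 0 \<odot>\<^bsub>P.P\<^esub> P.cls (symb (0, w))"
        by (rule P.cls_rel_smult) (use ind_relsI(3)[of 0 w 0] w in \<open>simp add: pscale_simps\<close>)
      also have "\<dots> = \<zero>\<^bsub>P.P\<^esub>"
        by (rule V.V.smult_zero', rule P.cls_symb_closed) (use w in simp)
      finally show ?case using lin_closedD(2)[OF Q] by simp
    next
      case (add q g c)
      have "P.cls (symb (q + Poly_Mapping.single g c, w)) =
          P.cls (symb (q, w)) \<oplus>\<^bsub>P.P\<^esub> P.cls (symb (Poly_Mapping.single g c, w))"
        by (rule P.cls_rel_add[OF ind_relsI(1)]) (use add w in auto)
      also have "P.cls (symb (Poly_Mapping.single g c, w)) = c \<odot>\<^bsub>P.P\<^esub> P.cls (symb (symb g, w))"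
        by (rule P.cls_rel_smult) (use ind_relsI(3)[of "symb g" w c] add w in \<open>simp add: pscale_simps\<close>)
      finally show ?case
        using add gen[OF add(2) w] act_unit_map[OF add(2), of w] lin_closedD(3,4)[OF Q] by simp
    qed
    then have "Q = carrier P.P" by (intro P.span_P[OF Q]) auto
    then show "v \<in> Q" using v by simp
  qed
  then show ?thesis unfolding induced_eq by blast
qed

end

lemma ind_struct_induced:
  assumes "group G" "subgroup H G" "gmodule (G\<lparr>carrier := H\<rparr>) W"
  obtains \<iota> p where "ind_struct G H W (induced G H W) \<iota> p"
proof -
  interpret induction_data G H W
    using assms by (simp add: induction_data_def induction_data_axioms_def)
  show thesis using ind_struct_presented that by blast
qed

section \<open>Twisting by a linear character\<close>

text \<open>A model, on the space V itself, of the tensor product of V with the one-dimensional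
  module of \<psi>.\<close>

definition twist :: "('g \<Rightarrow> 'f::field) \<Rightarrow> ('f, 'v, 'g) gmodule \<Rightarrow> ('f, 'v, 'g) gmodule" where
  "twist \<psi> V = V\<lparr>act := (\<lambda>g v. \<psi> g \<odot>\<^bsub>V\<^esub> act V g v)\<rparr>"

lemma twist_sel [simp]:
  "carrier (twist \<psi> V) = carrier V" "zero (twist \<psi> V) = zero V" "add (twist \<psi> V) = add V"
  "smult (twist \<psi> V) = smult V" "act (twist \<psi> V) g v = \<psi> g \<odot>\<^bsub>V\<^esub> act V g v"
  by (auto simp: twist_def)

lemma lin_hom_twist [simp]: "lin_hom (twist \<psi> V) W = lin_hom V W" "lin_hom W (twist \<psi> V) = lin_hom W V"
  "lin_closed (twist \<psi> V) = lin_closed V"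
  by (auto simp: LinearCombinations.module_hom_def lin_closed_def fun_eq_iff)

lemma gmodule_twist:
  assumes "gmodule G V" "\<psi> \<in> hom G F_star"
  shows "gmodule G (twist \<psi> V)"
proof -
  interpret V: gmodule G V by fact
  note \<psi> = F_star_homD[OF assms(2)]
  have "fvs (twist \<psi> V)"
    by (rule fvsI) (auto simp: V.V.vsimps V.V.add.m_comm V.V.add.m_lcomm V.V.add.m_assoc)
  then show ?thesis
    by (intro gmodI) (auto simp: V.V.vsimps V.act_closed V.act_add V.act_smult V.act_one V.act_mult
        \<psi> V.G.is_group mult.commute)
qed

text \<open>The isomorphism is v -> v \<otimes> 1. Its inverse comes from the universal property
  applied to (v, c) -> c v; the two are inverse on the spanning classes because v \<otimes> c = c (v
  \<otimes> 1).\<close>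

lemma tensor_char_iso:
  fixes V :: "('f::field, 'v, 'g) gmodule" and \<psi> :: "'g \<Rightarrow> 'f"
  assumes "gmodule G V" "\<psi> \<in> hom G F_star"
  obtains \<theta> where "gmodule G (tensor_gmod V (char_module \<psi>))"
    "\<theta> \<in> gmod_hom G (twist \<psi> V) (tensor_gmod V (char_module \<psi>))"
    "bij_betw \<theta> (carrier (twist \<psi> V)) (carrier (tensor_gmod V (char_module \<psi>)))"
proof -
  interpret V: gmodule G V by fact
  let ?W = "char_module \<psi> :: ('f, 'f, 'g) gmodule"
  let ?a = "\<lambda>g (v, w :: 'f). (act V g v, \<psi> g * w)"
  let ?X = "carrier V \<times> (UNIV :: 'f set)"
  let ?R = "bilinear_rels V ?W"
  note \<psi> = F_star_homD[OF assms(2)]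
  have relI:
    "\<And>v v' w. \<lbrakk>v \<in> carrier V; v' \<in> carrier V\<rbrakk> \<Longrightarrow> symb (v \<oplus>\<^bsub>V\<^esub> v', w) - symb (v, w) - symb (v', w) \<in> ?R"
    "\<And>v w w'. v \<in> carrier V \<Longrightarrow> symb (v, w + w') - symb (v, w) - symb (v, w') \<in> ?R"
    "\<And>c v w. v \<in> carrier V \<Longrightarrow> symb (c \<odot>\<^bsub>V\<^esub> v, w) - Poly_Mapping.single (v, w) c \<in> ?R"
    "\<And>c v w. v \<in> carrier V \<Longrightarrow> symb (v, c * w) - Poly_Mapping.single (v, w) c \<in> ?R"
    unfolding bilinear_rels_def char_module_sel by blast+
  have relE: thesis if "\<rho> \<in> ?R"
    and "\<And>v v' w. \<lbrakk>v \<in> carrier V; v' \<in> carrier V; \<rho> = symb (v \<oplus>\<^bsub>V\<^esub> v', w) - symb (v, w) - symb (v', w)\<rbrakk> \<Longrightarrow> thesis"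
    "\<And>v w w'. \<lbrakk>v \<in> carrier V; \<rho> = symb (v, w + w') - symb (v, w) - symb (v, w')\<rbrakk> \<Longrightarrow> thesis"
    "\<And>c v w. \<lbrakk>v \<in> carrier V; \<rho> = symb (c \<odot>\<^bsub>V\<^esub> v, w) - Poly_Mapping.single (v, w) c\<rbrakk> \<Longrightarrow> thesis"
    "\<And>c v w. \<lbrakk>v \<in> carrier V; \<rho> = symb (v, c * w) - Poly_Mapping.single (v, w) c\<rbrakk> \<Longrightarrow> thesis"
    for \<rho> thesis
    using that(1) unfolding bilinear_rels_def char_module_sel
    by (elim UnE CollectE exE conjE) (rule that(2-5); assumption)+
  have eq: "tensor_gmod V ?W = presented_gmod ?X ?R ?a"
    by (simp add: tensor_gmod_def)
  interpret P: presentation G ?X ?R ?a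
  proof
    fix \<rho> assume "\<rho> \<in> ?R"
    then show "Poly_Mapping.keys \<rho> \<subseteq> ?X"
      by (rule relE; hypsubst) (intro keys_diff_subset keys_single_subset; auto simp: V.V.vsimps)+
  next
    fix g \<rho> assume g: "g \<in> carrier G" and \<rho>: "\<rho> \<in> ?R"
    from \<rho> show "linear_extension (?a g) \<rho> \<in> ?R"
    proof (rule relE)
      fix c v w assume "v \<in> carrier V" "\<rho> = symb (v, c * w) - Poly_Mapping.single (v, w) c"
      then show ?thesis using relI(4)[of "act V g v" c "\<psi> g * w"] g V.act_closed
        by (simp add: linear_extension_diff mult.left_commute)
    qed (use g relI in \<open>simp_all add: linear_extension_diff V.act_closed V.act_add V.act_smult distrib_left\<close>)
  qed (auto simp: V.act_closed V.act_one V.act_mult \<psi> V.G.is_group)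
  interpret PV: gmodule G P.P by (rule P.gmodule_P)
  let ?\<theta> = "\<lambda>v. P.cls (symb (v, 1))"
  have \<theta>_cl: "?\<theta> v \<in> carrier P.P" if "v \<in> carrier V" for v
    by (rule P.cls_symb_closed) (use that in simp)
  have c1: "P.cls (symb (v, c)) = c \<odot>\<^bsub>P.P\<^esub> ?\<theta> v" if "v \<in> carrier V" for v c
    by (rule P.cls_rel_smult) (use relI(4)[OF that, of c 1] in simp)
  have \<theta>_lin: "?\<theta> \<in> lin_hom V P.P"
    by (rule lin_homI, erule \<theta>_cl, rule P.cls_rel_add[OF relI(1)], assumption, assumption,
        rule P.cls_rel_smult[OF relI(3)], assumption)
  have \<theta>: "?\<theta> \<in> gmod_hom G (twist \<psi> V) P.P"
  proof (rule gmod_homI)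
    show "?\<theta> \<in> lin_hom (twist \<psi> V) P.P" using \<theta>_lin by simp
    show "?\<theta> (act (twist \<psi> V) g v) = act P.P g (?\<theta> v)"
      if "g \<in> carrier G" "v \<in> carrier (twist \<psi> V)" for g v
      using that c1[of "act V g v" "\<psi> g"] V.act_closed lin_homD(3)[OF \<theta>_lin]
      by (simp add: P.act_symb)
  qed
  have "ext V (\<lambda>(v, c). c \<odot>\<^bsub>V\<^esub> v) \<rho> = \<zero>\<^bsub>V\<^esub>" if "\<rho> \<in> ?R" for \<rho>
    using that
    by (rule relE; hypsubst)
      (rule V.V.ext_rel_add V.V.ext_rel_smult; simp add: V.V.vsimps mult.commute)+
  then obtain T where T: "T \<in> lin_hom P.P V"
    and T_cls: "\<And>z. z \<in> ?X \<Longrightarrow> T (P.cls (symb z)) = (\<lambda>(v, c). c \<odot>\<^bsub>V\<^esub> v) z"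
    by (rule P.hom_P[OF V.V.fvs_axioms, rotated]) (auto simp: V.V.vsimps)
  have T\<theta>: "T (?\<theta> v) = v" if "v \<in> carrier V" for v
    using T_cls[of "(v, 1)"] that by (simp add: V.V.vsimps)
  have "{y \<in> carrier P.P. ?\<theta> (T y) = y} = carrier P.P"
  proof (rule P.span_P)
    show "lin_closed P.P {y \<in> carrier P.P. ?\<theta> (T y) = y}"
      using lin_hom_zero[OF lin_hom_comp[OF T \<theta>_lin] PV.V.fvs_axioms PV.V.fvs_axioms]
      by (intro lin_closedI) (auto simp: PV.V.vsimps lin_homD[OF T] lin_homD[OF \<theta>_lin])
    show "P.cls (symb x) \<in> {y \<in> carrier P.P. ?\<theta> (T y) = y}" if "x \<in> ?X" for x
    proof (cases x)
      case (Pair v c)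
      then have v: "v \<in> carrier V" using that by simp
      have "?\<theta> (T (P.cls (symb x))) = c \<odot>\<^bsub>P.P\<^esub> ?\<theta> v"
        using T_cls[OF that] lin_homD(3)[OF \<theta>_lin v] Pair by simp
      also have "\<dots> = P.cls (symb x)" using c1[OF v, of c] Pair by simp
      finally show ?thesis using P.cls_symb_closed[OF that] by simp
    qed
  qed
  then have "bij_betw ?\<theta> (carrier V) (carrier P.P)"
    using T\<theta> \<theta>_cl lin_homD(1)[OF T] by (intro bij_betw_byWitness[where f' = T]) auto
  then show thesis using that[of ?\<theta>] \<theta> P.gmodule_P unfolding eq by simp
qed

section \<open>Finite direct sums\<close>

lemma direct_sum_sel:
  assumes "finite J"
  shows "carrier (direct_sum_gmod J V) = (\<Pi>\<^sub>E i\<in>J. carrier (V i))"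
    "zero (direct_sum_gmod J V) = (\<lambda>i\<in>J. \<zero>\<^bsub>V i\<^esub>)"
    "add (direct_sum_gmod J V) \<phi> \<psi> = (\<lambda>i\<in>J. \<phi> i \<oplus>\<^bsub>V i\<^esub> \<psi> i)"
    "smult (direct_sum_gmod J V) c \<phi> = (\<lambda>i\<in>J. c \<odot>\<^bsub>V i\<^esub> \<phi> i)"
    "act (direct_sum_gmod J V) g \<phi> = (\<lambda>i\<in>J. act (V i) g (\<phi> i))"
  using assms by (auto simp: direct_sum_gmod_def)

definition single_comp ::
    "'i set \<Rightarrow> ('i \<Rightarrow> ('f, 'v, 'g) gmodule) \<Rightarrow> 'i \<Rightarrow> 'v \<Rightarrow> 'i \<Rightarrow> 'v" where
  "single_comp J V i v = (\<lambda>k\<in>J. if k = i then v else \<zero>\<^bsub>V k\<^esub>)"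

context
  fixes G :: "('g, 'm) monoid_scheme" and J :: "'i set" and V :: "'i \<Rightarrow> ('f::field, 'v, 'g) gmodule"
  assumes fin: "finite J" and gr: "group G" and gm: "\<And>i. i \<in> J \<Longrightarrow> gmodule G (V i)"
begin

abbreviation (input) "DS \<equiv> direct_sum_gmod J V"

lemmas ds = direct_sum_sel[OF fin, of V]

lemma ds_fvs_i: "i \<in> J \<Longrightarrow> fvs (V i)"
  using gm gmodule_fvs by blast

lemma ds_closed:
  "\<phi> \<in> carrier DS \<Longrightarrow> i \<in> J \<Longrightarrow> \<phi> i \<in> carrier (V i)"
  unfolding ds by auto

lemma gmodule_direct_sum: "gmodule G DS"
proof -
  note f = ds_fvs_i
  have vs: "fvs DS"
  proof (rule fvsI)
    have ab: "abelian_group (V i)" if "i \<in> J" for i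
    proof -
      interpret fvs "V i" by (rule f[OF that])
      show ?thesis by unfold_locales
    qed
    note a = abelian_group.axioms(1)[OF ab]
    note as = abelian_monoid.a_comm[OF a] abelian_monoid.a_assoc[OF a] abelian_monoid.r_zero[OF a]
      abelian_monoid.a_closed[OF a] abelian_monoid.zero_closed[OF a]
    note m = ds_closed
    show "\<zero>\<^bsub>DS\<^esub> \<in> carrier DS"
      using as unfolding ds by auto
    show "v \<oplus>\<^bsub>DS\<^esub> w \<in> carrier DS" if "v \<in> carrier DS" "w \<in> carrier DS" for v w
      using as m that unfolding ds by auto
    show "c \<odot>\<^bsub>DS\<^esub> v \<in> carrier DS" if "v \<in> carrier DS" for c v
      using m[OF that] fvs.vsimps(1)[OF f] unfolding ds by auto
    show "v \<oplus>\<^bsub>DS\<^esub> w = w \<oplus>\<^bsub>DS\<^esub> v" if "v \<in> carrier DS" "w \<in> carrier DS" for v w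
      unfolding ds by (rule restrict_ext) (use as(1) m that in auto)
    show "u \<oplus>\<^bsub>DS\<^esub> v \<oplus>\<^bsub>DS\<^esub> w = u \<oplus>\<^bsub>DS\<^esub> (v \<oplus>\<^bsub>DS\<^esub> w)"
      if "u \<in> carrier DS" "v \<in> carrier DS" "w \<in> carrier DS" for u v w
      unfolding ds by (rule restrict_ext) (use as(2) m that in auto)
    show "v \<oplus>\<^bsub>DS\<^esub> \<zero>\<^bsub>DS\<^esub> = v" if "v \<in> carrier DS" for v
      using that as(3) m[OF that] unfolding ds by (intro extensionalityI[where A = J]) (auto simp: PiE_def)
    show "(c * d) \<odot>\<^bsub>DS\<^esub> v = c \<odot>\<^bsub>DS\<^esub> (d \<odot>\<^bsub>DS\<^esub> v)" if "v \<in> carrier DS" for c d v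
      unfolding ds by (rule restrict_ext) (use fvs.smult_assoc'[OF f] m[OF that] in auto)
    show "1 \<odot>\<^bsub>DS\<^esub> v = v" if "v \<in> carrier DS" for v
      using that fvs.smult_one'[OF f] m[OF that] unfolding ds by (intro extensionalityI[where A = J]) (auto simp: PiE_def)
    show "0 \<odot>\<^bsub>DS\<^esub> v = \<zero>\<^bsub>DS\<^esub>" if "v \<in> carrier DS" for v
      unfolding ds by (rule restrict_ext) (use fvs.smult_zero'[OF f] m[OF that] in auto)
    show "(c + d) \<odot>\<^bsub>DS\<^esub> v = c \<odot>\<^bsub>DS\<^esub> v \<oplus>\<^bsub>DS\<^esub> d \<odot>\<^bsub>DS\<^esub> v" if "v \<in> carrier DS" for c d v
      unfolding ds by (rule restrict_ext) (use fvs.smult_l_distr'[OF f] m[OF that] in auto)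
    show "c \<odot>\<^bsub>DS\<^esub> (v \<oplus>\<^bsub>DS\<^esub> w) = c \<odot>\<^bsub>DS\<^esub> v \<oplus>\<^bsub>DS\<^esub> c \<odot>\<^bsub>DS\<^esub> w"
      if "v \<in> carrier DS" "w \<in> carrier DS" for c v w
      unfolding ds by (rule restrict_ext) (use fvs.smult_r_distr'[OF f] m that in auto)
  qed
  show ?thesis
  proof (rule gmodI[OF gr vs])
    note m = ds_closed
    show "act DS g v \<in> carrier DS" if "g \<in> carrier G" "v \<in> carrier DS" for g v
      using m[OF that(2)] that(1) gmodule.act_closed[OF gm] unfolding ds by auto
    show "act DS g (v \<oplus>\<^bsub>DS\<^esub> w) = act DS g v \<oplus>\<^bsub>DS\<^esub> act DS g w"
      if "g \<in> carrier G" "v \<in> carrier DS" "w \<in> carrier DS" for g v w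
      unfolding ds by (rule restrict_ext) (use gmodule.act_add[OF gm] m that in auto)
    show "act DS g (c \<odot>\<^bsub>DS\<^esub> v) = c \<odot>\<^bsub>DS\<^esub> act DS g v" if "g \<in> carrier G" "v \<in> carrier DS" for g c v
      unfolding ds by (rule restrict_ext) (use gmodule.act_smult[OF gm] m that in auto)
    show "act DS \<one>\<^bsub>G\<^esub> v = v" if "v \<in> carrier DS" for v
      using that gmodule.act_one[OF gm] m[OF that] unfolding ds by (intro extensionalityI[where A = J]) (auto simp: PiE_def)
    show "act DS (g \<otimes>\<^bsub>G\<^esub> h) v = act DS g (act DS h v)"
      if "g \<in> carrier G" "h \<in> carrier G" "v \<in> carrier DS" for g h v
      unfolding ds by (rule restrict_ext) (use gmodule.act_mult[OF gm] m that in auto)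
  qed
qed

lemma component_lin_hom: "i \<in> J \<Longrightarrow> (\<lambda>\<phi>. \<phi> i) \<in> lin_hom DS (V i)"
  by (rule lin_homI) (auto simp: ds)

lemma single_comp_lin_hom:
  assumes "i \<in> J"
  shows "single_comp J V i \<in> lin_hom (V i) DS"
proof (rule lin_homI)
  have z: "\<zero>\<^bsub>V k\<^esub> \<in> carrier (V k)" "\<zero>\<^bsub>V k\<^esub> \<oplus>\<^bsub>V k\<^esub> \<zero>\<^bsub>V k\<^esub> = \<zero>\<^bsub>V k\<^esub>" "c \<odot>\<^bsub>V k\<^esub> \<zero>\<^bsub>V k\<^esub> = \<zero>\<^bsub>V k\<^esub>"
    if "k \<in> J" for k c
  proof -
    interpret fvs "V k" by (rule ds_fvs_i[OF that])
    show "\<zero>\<^bsub>V k\<^esub> \<in> carrier (V k)" "\<zero>\<^bsub>V k\<^esub> \<oplus>\<^bsub>V k\<^esub> \<zero>\<^bsub>V k\<^esub> = \<zero>\<^bsub>V k\<^esub>" "c \<odot>\<^bsub>V k\<^esub> \<zero>\<^bsub>V k\<^esub> = \<zero>\<^bsub>V k\<^esub>"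
      by (simp_all add: vsimps)
  qed
  show "single_comp J V i v \<in> carrier DS" if "v \<in> carrier (V i)" for v
    using that z(1) unfolding ds single_comp_def by auto
  show "single_comp J V i (v \<oplus>\<^bsub>V i\<^esub> w) = single_comp J V i v \<oplus>\<^bsub>DS\<^esub> single_comp J V i w" for v w
    using z(2) unfolding ds single_comp_def by (auto intro!: restrict_ext)
  show "single_comp J V i (c \<odot>\<^bsub>V i\<^esub> v) = c \<odot>\<^bsub>DS\<^esub> single_comp J V i v" for c v
    using z(3) unfolding ds single_comp_def by (auto intro!: restrict_ext)
qed

lemma direct_sum_span:
  assumes Q: "lin_closed DS Q" and gen: "\<And>i v. i \<in> J \<Longrightarrow> v \<in> carrier (V i) \<Longrightarrow> single_comp J V i v \<in> Q"
    and \<phi>: "\<phi> \<in> carrier DS"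
  shows "\<phi> \<in> Q"
proof -
  \<comment> \<open>B is the set of coordinates of \<phi> already filled in; the others are
    zero.\<close>
  have "(\<lambda>k\<in>J. if k \<in> B then \<phi> k else \<zero>\<^bsub>V k\<^esub>) \<in> Q" if "B \<subseteq> J" for B
    using finite_subset[OF that fin] that
  proof (induction B rule: finite_induct)
    case empty
    then show ?case using lin_closedD(2)[OF Q] unfolding ds by (simp add: restrict_def)
  next
    case (insert i B)
    have z: "v \<oplus>\<^bsub>V k\<^esub> \<zero>\<^bsub>V k\<^esub> = v" "\<zero>\<^bsub>V k\<^esub> \<oplus>\<^bsub>V k\<^esub> v = v" if "k \<in> J" "v \<in> carrier (V k)" for k v
    proof -
      interpret fvs "V k" by (rule ds_fvs_i[OF that(1)])
      show "v \<oplus>\<^bsub>V k\<^esub> \<zero>\<^bsub>V k\<^esub> = v" "\<zero>\<^bsub>V k\<^esub> \<oplus>\<^bsub>V k\<^esub> v = v" using that by simp_all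
    qed
    have z0: "\<zero>\<^bsub>V k\<^esub> \<in> carrier (V k)" if "k \<in> J" for k
    proof -
      interpret fvs "V k" by (rule ds_fvs_i[OF that(1)])
      show ?thesis by simp
    qed
    have "(\<lambda>k\<in>J. if k \<in> insert i B then \<phi> k else \<zero>\<^bsub>V k\<^esub>) =
       (\<lambda>k\<in>J. if k \<in> B then \<phi> k else \<zero>\<^bsub>V k\<^esub>) \<oplus>\<^bsub>DS\<^esub> single_comp J V i (\<phi> i)"
      unfolding ds single_comp_def
      by (rule restrict_ext) (use insert z z0 ds_closed[OF \<phi>] in auto)
    moreover have "i \<in> J" "B \<subseteq> J" using insert by auto
    ultimately show ?case
      using lin_closedD(3)[OF Q insert.IH gen[of i "\<phi> i"]] ds_closed[OF \<phi>] by metis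
  qed
  from this[of J] have "(\<lambda>k\<in>J. \<phi> k) \<in> Q"
    by (simp cong: restrict_cong)
  moreover have "(\<lambda>k\<in>J. \<phi> k) = \<phi>" using \<phi> unfolding ds by (auto simp: PiE_restrict)
  ultimately show ?thesis by simp
qed

end

section \<open>Tensor products of finite families\<close>

locale tensor_data =
  fixes G :: "('g, 'm) monoid_scheme" and J :: "'i set" and V :: "'i \<Rightarrow> ('f::field, 'v, 'g) gmodule"
  assumes fin: "finite J" and gr: "group G" and gm: "i \<in> J \<Longrightarrow> gmodule G (V i)"
begin

abbreviation "symbols \<equiv> \<Pi>\<^sub>E i\<in>J. carrier (V i)"
definition "shift g \<phi> = (\<lambda>i\<in>J. act (V i) g (\<phi> i))"
abbreviation "rels \<equiv> multilinear_rels J V"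

lemma fvs_i: "i \<in> J \<Longrightarrow> fvs (V i)"
  using gm gmodule_fvs by blast

lemma symbols_mem: "\<phi> \<in> symbols \<Longrightarrow> i \<in> J \<Longrightarrow> \<phi> i \<in> carrier (V i)"
  by (auto simp: PiE_def)

lemma relsI:
  "\<lbrakk>\<phi> \<in> symbols; i \<in> J; v \<in> carrier (V i); v' \<in> carrier (V i)\<rbrakk> \<Longrightarrow>
     symb (\<phi>(i := v \<oplus>\<^bsub>V i\<^esub> v')) - symb (\<phi>(i := v)) - symb (\<phi>(i := v')) \<in> rels"
  "\<lbrakk>\<phi> \<in> symbols; i \<in> J; v \<in> carrier (V i)\<rbrakk> \<Longrightarrow>
     symb (\<phi>(i := c \<odot>\<^bsub>V i\<^esub> v)) - Poly_Mapping.single (\<phi>(i := v)) c \<in> rels"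
  unfolding multilinear_rels_def by blast+

lemma relsE:
  assumes "\<rho> \<in> rels"
  obtains
    (add) \<phi> i v v' where "\<phi> \<in> symbols" "i \<in> J" "v \<in> carrier (V i)" "v' \<in> carrier (V i)"
      "\<rho> = symb (\<phi>(i := v \<oplus>\<^bsub>V i\<^esub> v')) - symb (\<phi>(i := v)) - symb (\<phi>(i := v'))"
  | (smult) \<phi> i c v where "\<phi> \<in> symbols" "i \<in> J" "v \<in> carrier (V i)"
      "\<rho> = symb (\<phi>(i := c \<odot>\<^bsub>V i\<^esub> v)) - Poly_Mapping.single (\<phi>(i := v)) c"
  using assms unfolding multilinear_rels_def by blast

lemma upd_symbols: "\<phi> \<in> symbols \<Longrightarrow> i \<in> J \<Longrightarrow> v \<in> carrier (V i) \<Longrightarrow> \<phi>(i := v) \<in> symbols"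
  by (auto simp: PiE_def Pi_def extensional_def)

lemma add_closed: "i \<in> J \<Longrightarrow> v \<in> carrier (V i) \<Longrightarrow> w \<in> carrier (V i) \<Longrightarrow> v \<oplus>\<^bsub>V i\<^esub> w \<in> carrier (V i)"
proof -
  assume i: "i \<in> J" and vw: "v \<in> carrier (V i)" "w \<in> carrier (V i)"
  interpret fvs "V i" by (rule fvs_i[OF i])
  show ?thesis using vw by simp
qed

lemma shift_symbols: "g \<in> carrier G \<Longrightarrow> \<phi> \<in> symbols \<Longrightarrow> shift g \<phi> \<in> symbols"
  using gmodule.act_closed[OF gm] by (auto simp: shift_def)

lemma shift_upd: "i \<in> J \<Longrightarrow> shift g (\<phi>(i := v)) = (shift g \<phi>)(i := act (V i) g v)"
  by (auto simp: fun_eq_iff shift_def)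

sublocale P: presentation G symbols rels shift
proof (rule presentation.intro)
  show "group G" by (rule gr)
  show "shift g \<phi> \<in> symbols" if "g \<in> carrier G" "\<phi> \<in> symbols" for g \<phi>
    using that by (rule shift_symbols)
  show "shift \<one>\<^bsub>G\<^esub> \<phi> = \<phi>" if "\<phi> \<in> symbols" for \<phi>
    using that gmodule.act_one[OF gm] by (intro extensionalityI[where A = J]) (auto simp: PiE_def shift_def)
  show "shift (g \<otimes>\<^bsub>G\<^esub> h) \<phi> = shift g (shift h \<phi>)"
    if "g \<in> carrier G" "h \<in> carrier G" "\<phi> \<in> symbols" for g h \<phi>
    unfolding shift_def by (rule restrict_ext) (use that gmodule.act_mult[OF gm] symbols_mem in auto)
next
  fix \<rho> assume "\<rho> \<in> rels"
  then show "Poly_Mapping.keys \<rho> \<subseteq> symbols"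
  proof (cases rule: relsE)
    case (add \<phi> i v v')
    then show ?thesis unfolding add(5)
      by (intro keys_diff_subset keys_single_subset upd_symbols add_closed)
  next
    case (smult \<phi> i c v)
    then show ?thesis unfolding smult(4)
      by (intro keys_diff_subset keys_single_subset upd_symbols fvs.smult_closed'[OF fvs_i])
  qed
next
  fix g \<rho> assume g: "g \<in> carrier G" and "\<rho> \<in> rels"
  from this(2) show "linear_extension (shift g) \<rho> \<in> rels"
  proof (cases rule: relsE)
    case (add \<phi> i v v')
    have "linear_extension (shift g) \<rho> = symb ((shift g \<phi>)(i := act (V i) g v \<oplus>\<^bsub>V i\<^esub> act (V i) g v')) -
        symb ((shift g \<phi>)(i := act (V i) g v)) - symb ((shift g \<phi>)(i := act (V i) g v'))"
      unfolding add(5) linear_extension_diff linear_extension_single shift_upd[OF add(2)]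
        gmodule.act_add[OF gm[OF add(2)] g add(3,4)] ..
    then show ?thesis
      using relsI(1)[OF shift_symbols[OF g add(1)] add(2)] gmodule.act_closed[OF gm[OF add(2)] g] add by simp
  next
    case (smult \<phi> i c v)
    have "linear_extension (shift g) \<rho> = symb ((shift g \<phi>)(i := c \<odot>\<^bsub>V i\<^esub> act (V i) g v)) -
        Poly_Mapping.single ((shift g \<phi>)(i := act (V i) g v)) c"
      unfolding smult(4) linear_extension_diff linear_extension_single shift_upd[OF smult(2)]
        gmodule.act_smult[OF gm[OF smult(2)] g smult(3)] ..
    then show ?thesis
      using relsI(2)[OF shift_symbols[OF g smult(1)] smult(2)] gmodule.act_closed[OF gm[OF smult(2)] g] smult by simp
  qed
qed

lemma tensor_family_eq: "tensor_family J V = P.P"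
  unfolding tensor_family_def shift_def ..

lemma cls_upd_smult:
  assumes "\<phi> \<in> symbols" "i \<in> J"
  shows "P.cls (symb (\<phi>(i := c \<odot>\<^bsub>V i\<^esub> \<phi> i))) = c \<odot>\<^bsub>P.P\<^esub> P.cls (symb \<phi>)"
proof -
  have "\<phi> i \<in> carrier (V i)" by (rule symbols_mem[OF assms])
  from P.cls_rel_smult[OF relsI(2)[OF assms this]] show ?thesis by simp
qed

text \<open>Multilinearity pulls out one scalar at a time, which is why the statement ranges over
  subsets B. The case B = J computes the action of a group element on a tensor of
  eigenvectors.\<close>

lemma cls_smult_family:
  assumes "\<phi> \<in> symbols" "B \<subseteq> J"
  shows "P.cls (symb (\<lambda>i\<in>J. if i \<in> B then c i \<odot>\<^bsub>V i\<^esub> \<phi> i else \<phi> i)) =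
      (\<Prod>i\<in>B. c i) \<odot>\<^bsub>P.P\<^esub> P.cls (symb \<phi>)"
  using finite_subset[OF assms(2) fin] assms(2)
proof (induction B rule: finite_induct)
  case empty
  have "(\<lambda>i\<in>J. \<phi> i) = \<phi>" using assms(1) by (auto simp: PiE_restrict)
  then show ?case using P.cls_symb_closed[OF assms(1)] fvs.smult_one'[OF P.fvs_P] by simp
next
  case (insert i B)
  let ?\<psi> = "\<lambda>k\<in>J. if k \<in> B then c k \<odot>\<^bsub>V k\<^esub> \<phi> k else \<phi> k"
  have \<psi>: "?\<psi> \<in> symbols" using symbols_mem[OF assms(1)] fvs.smult_closed'[OF fvs_i] by auto
  have i: "i \<in> J" and \<psi>i: "?\<psi> i = \<phi> i" using insert by auto
  have "(\<lambda>k\<in>J. if k \<in> insert i B then c k \<odot>\<^bsub>V k\<^esub> \<phi> k else \<phi> k) = ?\<psi>(i := c i \<odot>\<^bsub>V i\<^esub> ?\<psi> i)"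
    unfolding \<psi>i using i by (auto simp: fun_eq_iff)
  then have "P.cls (symb (\<lambda>k\<in>J. if k \<in> insert i B then c k \<odot>\<^bsub>V k\<^esub> \<phi> k else \<phi> k)) =
      c i \<odot>\<^bsub>P.P\<^esub> P.cls (symb ?\<psi>)"
    using cls_upd_smult[OF \<psi> i, of "c i"] by simp
  also have "\<dots> = c i \<odot>\<^bsub>P.P\<^esub> ((\<Prod>i\<in>B. c i) \<odot>\<^bsub>P.P\<^esub> P.cls (symb \<phi>))"
    unfolding insert.IH[OF order_trans[OF subset_insertI insert.prems]] ..
  also have "\<dots> = (\<Prod>i\<in>insert i B. c i) \<odot>\<^bsub>P.P\<^esub> P.cls (symb \<phi>)"
    using insert P.cls_symb_closed[OF assms(1)] fvs.smult_assoc'[OF P.fvs_P] by simp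
  finally show ?case .
qed

text \<open>The generator is the tensor of the vectors \<iota> i 1. By \<open>transitive\<close>
  every tensor of translates k_i \<iota>_i(1) is a single translate by one g; the condition that
  \<psi> i takes the value 1 makes the two tensors equal and not just proportional.\<close>

theorem ind_struct_tensor:
  assumes ind: "\<And>i. i \<in> J \<Longrightarrow> ind_struct G (H i) (char_module (\<psi> i)) (V i) (\<iota> i) (p i)"
    and transitive: "\<And>k. (\<And>i. i \<in> J \<Longrightarrow> k i \<in> carrier G) \<Longrightarrow>
      \<exists>g\<in>carrier G. \<forall>i\<in>J. inv\<^bsub>G\<^esub> g \<otimes>\<^bsub>G\<^esub> k i \<in> H i \<and> \<psi> i (inv\<^bsub>G\<^esub> g \<otimes>\<^bsub>G\<^esub> k i) = 1"
    and sub: "subgroup K G" and K: "K = {g \<in> carrier G. \<forall>i\<in>J. g \<in> H i}"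
    and lam: "lam \<in> hom (G\<lparr>carrier := K\<rparr>) F_star" "\<And>g. g \<in> K \<Longrightarrow> lam g = (\<Prod>i\<in>J. \<psi> i g)"
  shows "\<exists>\<iota> p. ind_struct G K (char_module lam) (tensor_family J V) \<iota> p"
proof -
  note gen = ind_struct_char_gen[OF ind]
  interpret G: group G by (rule gr)
  interpret PV: gmodule G P.P by (rule P.gmodule_P)
  have v_cl: "act (V i) g (\<iota> i 1) \<in> carrier (V i)" if "i \<in> J" "g \<in> carrier G" for i g
    using gen(1) gmodule.act_closed[OF gm] that by blast
  define e where "e = (\<lambda>i\<in>J. \<iota> i 1)"
  have e: "e \<in> symbols" using gen(1) by (auto simp: e_def)
  \<comment> \<open>The projection is the product of the p i. It is linear in each coordinate, and
    on a translate by g it vanishes unless g lies in every H i.\<close>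
  have "ext (char_module lam) (\<lambda>\<phi>. \<Prod>i\<in>J. p i (\<phi> i)) \<rho> = \<zero>\<^bsub>char_module lam\<^esub>" if "\<rho> \<in> rels" for \<rho>
    using that
  proof (cases rule: relsE)
    case (add \<phi> i v v')
    have pr: "(\<Prod>k\<in>J. p k ((\<phi>(i := u)) k)) = p i u * (\<Prod>k\<in>J - {i}. p k (\<phi> k))" for u
      using prod.remove[OF fin add(2), of "\<lambda>k. p k ((\<phi>(i := u)) k)"]
      by (simp cong: prod.cong) (rule disjI2, rule prod.cong, auto)
    interpret ind_struct G "H i" "char_module (\<psi> i)" "V i" "\<iota> i" "p i" by (rule ind[OF add(2)])
    show ?thesis unfolding add(5)
      by (rule fvs.ext_rel_add[OF fvs_char_module])
        (use lin_homD(2)[OF p_hom add(3,4)] in \<open>simp_all add: pr distrib_right del: fun_upd_apply\<close>)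
  next
    case (smult \<phi> i c v)
    have pr: "(\<Prod>k\<in>J. p k ((\<phi>(i := u)) k)) = p i u * (\<Prod>k\<in>J - {i}. p k (\<phi> k))" for u
      using prod.remove[OF fin smult(2), of "\<lambda>k. p k ((\<phi>(i := u)) k)"]
      by (simp cong: prod.cong) (rule disjI2, rule prod.cong, auto)
    interpret ind_struct G "H i" "char_module (\<psi> i)" "V i" "\<iota> i" "p i" by (rule ind[OF smult(2)])
    show ?thesis unfolding smult(4)
      by (rule fvs.ext_rel_smult[OF fvs_char_module])
        (use lin_homD(3)[OF p_hom smult(3)] in \<open>simp_all add: pr del: fun_upd_apply\<close>)
  qed
  then obtain \<epsilon> where \<epsilon>: "\<epsilon> \<in> lin_hom P.P (char_module lam)"
    and \<epsilon>_cls: "\<And>\<phi>. \<phi> \<in> symbols \<Longrightarrow> \<epsilon> (P.cls (symb \<phi>)) = (\<Prod>i\<in>J. p i (\<phi> i))"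
    by (rule P.hom_P[OF fvs_char_module, rotated]) auto
  have act_e: "act P.P g (P.cls (symb e)) = P.cls (symb (\<lambda>i\<in>J. act (V i) g (\<iota> i 1)))"
    if "g \<in> carrier G" for g
  proof -
    have "shift g e = (\<lambda>i\<in>J. act (V i) g (\<iota> i 1))" unfolding shift_def by (rule restrict_ext) (simp add: e_def)
    then show ?thesis using P.act_symb[OF that] by simp
  qed
  have "ind_struct G K (char_module lam) P.P (\<lambda>c. c \<odot>\<^bsub>P.P\<^esub> P.cls (symb e)) \<epsilon>"
  proof (rule ind_struct_charI[OF P.gmodule_P sub lam(1)])
    show "P.cls (symb e) \<in> carrier P.P" by (rule P.cls_symb_closed[OF e])
    show "act P.P h (P.cls (symb e)) = lam h \<odot>\<^bsub>P.P\<^esub> P.cls (symb e)" if h: "h \<in> K" for h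
    proof -
      have hG: "h \<in> carrier G" and hi: "\<And>i. i \<in> J \<Longrightarrow> h \<in> H i" using h K by auto
      have "(\<lambda>i\<in>J. act (V i) h (\<iota> i 1)) = (\<lambda>i\<in>J. if i \<in> J then \<psi> i h \<odot>\<^bsub>V i\<^esub> e i else e i)"
        by (rule restrict_ext) (simp add: e_def gen(2)[OF _ hi])
      then show ?thesis
        unfolding act_e[OF hG] lam(2)[OF h] using cls_smult_family[OF e order_refl, of "\<lambda>i. \<psi> i h"] by simp
    qed
    show "\<epsilon> \<in> lin_hom P.P (char_module lam)" by (rule \<epsilon>)
    show "\<epsilon> (act P.P g (P.cls (symb e))) = (if g \<in> K then lam g else 0)" if g: "g \<in> carrier G" for g
    proof -
      have "(\<lambda>i\<in>J. act (V i) g (\<iota> i 1)) \<in> symbols" using v_cl g by auto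
      then have "\<epsilon> (act P.P g (P.cls (symb e))) = (\<Prod>i\<in>J. if g \<in> H i then \<psi> i g else 0)"
        unfolding act_e[OF g] using gen(4)[OF _ g] by (subst \<epsilon>_cls) (auto intro!: prod.cong)
      also have "\<dots> = (if g \<in> K then lam g else 0)"
      proof (cases "g \<in> K")
        case True
        then show ?thesis using lam(2)[OF True] K by (auto intro!: prod.cong)
      next
        case False
        then obtain i where "i \<in> J" "g \<notin> H i" using g K by auto
        then have "(\<Prod>i\<in>J. if g \<in> H i then \<psi> i g else 0) = 0"
          by (intro prod_zero[OF fin] bexI[of _ i]) auto
        then show ?thesis using False by simp
      qed
      finally show ?thesis .
    qed
    fix Q assume Q: "lin_closed P.P Q" and gQ: "\<And>g. g \<in> carrier G \<Longrightarrow> act P.P g (P.cls (symb e)) \<in> Q"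
    have base: "P.cls (symb (\<lambda>i\<in>J. act (V i) (k i) (\<iota> i 1))) \<in> Q"
      if k: "\<And>i. i \<in> J \<Longrightarrow> k i \<in> carrier G" for k
    proof -
      have "\<exists>g\<in>carrier G. \<forall>i\<in>J. inv\<^bsub>G\<^esub> g \<otimes>\<^bsub>G\<^esub> k i \<in> H i \<and> \<psi> i (inv\<^bsub>G\<^esub> g \<otimes>\<^bsub>G\<^esub> k i) = 1"
        by (rule transitive) (rule k)
      then obtain g where g: "g \<in> carrier G"
        and gk: "\<And>i. i \<in> J \<Longrightarrow> inv\<^bsub>G\<^esub> g \<otimes>\<^bsub>G\<^esub> k i \<in> H i \<and> \<psi> i (inv\<^bsub>G\<^esub> g \<otimes>\<^bsub>G\<^esub> k i) = 1"
        by blast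
      have "act (V i) (k i) (\<iota> i 1) = act (V i) g (\<iota> i 1)" if i: "i \<in> J" for i
      proof -
        interpret Vi: gmodule G "V i" by (rule gm[OF i])
        let ?h = "inv\<^bsub>G\<^esub> g \<otimes>\<^bsub>G\<^esub> k i"
        have "k i = g \<otimes>\<^bsub>G\<^esub> ?h" using g k[OF i] by (simp add: G.m_assoc[symmetric])
        then have "act (V i) (k i) (\<iota> i 1) = act (V i) g (act (V i) ?h (\<iota> i 1))"
          using Vi.act_mult[of g ?h "\<iota> i 1"] g k[OF i] gen(1)[OF i] by simp
        also have "act (V i) ?h (\<iota> i 1) = \<iota> i 1"
          using gen(2)[OF i, of ?h] gk[OF i] gen(1)[OF i] Vi.V.smult_one' by simp
        finally show ?thesis .
      qed
      then have "(\<lambda>i\<in>J. act (V i) (k i) (\<iota> i 1)) = (\<lambda>i\<in>J. act (V i) g (\<iota> i 1))"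
        by (intro restrict_ext)
      then show ?thesis using gQ[OF g] act_e[OF g] by simp
    qed
    \<comment> \<open>Coordinates in B are arbitrary, those outside B are translates of \<iota> i 1.
      Coordinate i is released by the spanning property of V i, with all other coordinates held
      fixed.\<close>
    have "P.cls (symb \<phi>) \<in> Q" if "B \<subseteq> J" "\<phi> \<in> symbols"
      "\<And>i. i \<in> J - B \<Longrightarrow> \<exists>k\<in>carrier G. \<phi> i = act (V i) k (\<iota> i 1)" for B \<phi>
      using finite_subset[OF that(1) fin] that
    proof (induction B arbitrary: \<phi> rule: finite_induct)
      case empty
      then obtain k where k: "\<And>i. i \<in> J \<Longrightarrow> k i \<in> carrier G \<and> \<phi> i = act (V i) (k i) (\<iota> i 1)"
        by (metis Diff_empty)
      have "\<phi> = (\<lambda>i\<in>J. act (V i) (k i) (\<iota> i 1))"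
        using empty(2) k by (intro extensionalityI[where A = J]) (auto simp: PiE_def)
      moreover have "P.cls (symb (\<lambda>i\<in>J. act (V i) (k i) (\<iota> i 1))) \<in> Q"
        by (rule base) (simp add: k)
      ultimately show ?case by (simp only:)
    next
      case (insert i B)
      then have i: "i \<in> J" by simp
      let ?Q = "{v \<in> carrier (V i). P.cls (symb (\<phi>(i := v))) \<in> Q}"
      interpret Vi: gmodule G "V i" by (rule gm[OF i])
      have "lin_closed (V i) ?Q"
      proof (rule lin_closedI)
        have "P.cls (symb (\<phi>(i := \<zero>\<^bsub>V i\<^esub>))) = 0 \<odot>\<^bsub>P.P\<^esub> P.cls (symb \<phi>)"
          using cls_upd_smult[OF insert(5) i, of 0] Vi.V.smult_zero'[OF symbols_mem[OF insert(5) i]] by simp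
        then show "\<zero>\<^bsub>V i\<^esub> \<in> ?Q"
          using PV.V.smult_zero'[OF P.cls_symb_closed[OF insert(5)]] lin_closedD(2)[OF Q] by simp
      next
        fix v w assume "v \<in> ?Q" "w \<in> ?Q"
        then show "v \<oplus>\<^bsub>V i\<^esub> w \<in> ?Q"
          using P.cls_rel_add[OF relsI(1)[OF insert(5) i, of v w]] lin_closedD(3)[OF Q] by auto
      next
        fix c v assume "v \<in> ?Q"
        then show "c \<odot>\<^bsub>V i\<^esub> v \<in> ?Q"
          using P.cls_rel_smult[OF relsI(2)[OF insert(5) i, of v c]] lin_closedD(4)[OF Q] Vi.V.smult_closed' by auto
      qed auto
      moreover have "act (V i) g (\<iota> i 1) \<in> ?Q" if "g \<in> carrier G" for g
      proof -
        have "P.cls (symb (\<phi>(i := act (V i) g (\<iota> i 1)))) \<in> Q"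
          by (rule insert.IH) (use insert that i upd_symbols v_cl in auto)
        then show ?thesis using v_cl i that by simp
      qed
      ultimately have "carrier (V i) \<subseteq> ?Q" by (rule gen(3)[OF i])
      then have "\<phi> i \<in> ?Q" using symbols_mem[OF insert(5) i] by auto
      then show ?case by simp
    qed
    from this[of J] have "Q = carrier P.P" by (intro P.span_P[OF Q]) auto
    then show "carrier P.P \<subseteq> Q" by simp
  qed
  then show ?thesis unfolding tensor_family_eq by blast
qed

end

section \<open>McLain groups\<close>

abbreviation "lkp \<equiv> Poly_Mapping.lookup"
abbreviation "kys \<equiv> Poly_Mapping.keys"

section \<open>Elements of J as finitely supported matrices\<close>

definition indices :: "('l \<times> 'l \<Rightarrow>\<^sub>0 'r::zero) \<Rightarrow> 'l set" where
  "indices x = fst ` kys x \<union> snd ` kys x"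

lemma finite_indices [simp]: "finite (indices x)"
  by (simp add: indices_def)

lemma keys_indices: "kys x \<subseteq> indices x \<times> indices x"
  by (force simp: indices_def)

text \<open>Matrix multiplication over any finite index set containing both supports. Leaving S free
  allows several products to be expanded over one common index set.\<close>

lemma lookup_J_mult:
  assumes S: "finite S" "kys x \<subseteq> S \<times> S" "kys y \<subseteq> S \<times> S"
  shows "lkp (J_mult x y) (a, d) = (\<Sum>b\<in>S. lkp x (a, b) * lkp y (b, d))"
proof -
  let ?t = "\<lambda>\<alpha> \<beta> \<gamma> \<delta>. if \<beta> = \<gamma>
     then Poly_Mapping.single (\<alpha>, \<delta>) (lkp x (\<alpha>, \<beta>) * lkp y (\<gamma>, \<delta>)) else 0"
  have cp: "(\<Sum>p\<in>S \<times> S. g (fst p) (snd p)) = (\<Sum>a\<in>S. \<Sum>b\<in>S. g a b)"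
    for g :: "'a \<Rightarrow> 'a \<Rightarrow> ('a, 'b) mclain_elt"
    by (simp add: sum.cartesian_product case_prod_unfold)
  have "J_mult x y = (\<Sum>p\<in>kys x. \<Sum>q\<in>S \<times> S. ?t (fst p) (snd p) (fst q) (snd q))"
    unfolding J_mult_def case_prod_unfold
    by (intro sum.cong refl sum.mono_neutral_left) (use S in \<open>auto simp: in_keys_iff\<close>)
  also have "\<dots> = (\<Sum>p\<in>S \<times> S. \<Sum>q\<in>S \<times> S. ?t (fst p) (snd p) (fst q) (snd q))"
    by (intro sum.mono_neutral_left) (use S in \<open>auto simp: in_keys_iff intro!: sum.neutral\<close>)
  also have "\<dots> = (\<Sum>\<alpha>\<in>S. \<Sum>\<beta>\<in>S. \<Sum>q\<in>S \<times> S. ?t \<alpha> \<beta> (fst q) (snd q))"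
    by (rule cp[of "\<lambda>\<alpha> \<beta>. \<Sum>q\<in>S \<times> S. ?t \<alpha> \<beta> (fst q) (snd q)"])
  also have "\<dots> = (\<Sum>\<alpha>\<in>S. \<Sum>\<beta>\<in>S. \<Sum>\<gamma>\<in>S. \<Sum>\<delta>\<in>S. ?t \<alpha> \<beta> \<gamma> \<delta>)"
    by (intro sum.cong refl) (rule cp)
  finally have "lkp (J_mult x y) (a, d) = (\<Sum>\<alpha>\<in>S. \<Sum>\<beta>\<in>S. \<Sum>\<gamma>\<in>S. \<Sum>\<delta>\<in>S. lkp (?t \<alpha> \<beta> \<gamma> \<delta>) (a, d))"
    by (simp add: lookup_sum)
  also have "\<dots> = (\<Sum>\<alpha>\<in>S. \<Sum>\<beta>\<in>S. \<Sum>\<gamma>\<in>S. \<Sum>\<delta>\<in>S.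
      if \<delta> = d then (if \<gamma> = \<beta> then (if \<alpha> = a then lkp x (\<alpha>, \<beta>) * lkp y (\<beta>, \<delta>) else 0) else 0) else 0)"
    by (intro sum.cong refl) (auto simp: lookup_single when_def)
  also have "\<dots> = (\<Sum>\<beta>\<in>S. \<Sum>\<alpha>\<in>S. if \<alpha> = a then (if d \<in> S then lkp x (\<alpha>, \<beta>) * lkp y (\<beta>, d) else 0) else 0)"
    using S(1) by (subst sum.swap) (auto intro!: sum.cong simp: sum.delta)
  also have "\<dots> = (\<Sum>b\<in>S. if a \<in> S \<and> d \<in> S then lkp x (a, b) * lkp y (b, d) else 0)"
    using S(1) by (intro sum.cong refl) (simp add: sum.delta)
  also have "\<dots> = (\<Sum>b\<in>S. lkp x (a, b) * lkp y (b, d))"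
  proof (intro sum.cong refl)
    fix b
    have "a \<in> S" if "lkp x (a, b) \<noteq> 0" using that S(2) by (auto simp: in_keys_iff)
    moreover have "d \<in> S" if "lkp y (b, d) \<noteq> 0" using that S(3) by (auto simp: in_keys_iff)
    ultimately show "(if a \<in> S \<and> d \<in> S then lkp x (a, b) * lkp y (b, d) else 0) = lkp x (a, b) * lkp y (b, d)"
      by (cases "lkp x (a, b) = 0"; cases "lkp y (b, d) = 0") auto
  qed
  finally show ?thesis .
qed

lemma keys_J_multD:
  assumes "(a, d) \<in> kys (J_mult x y)"
  shows "\<exists>b. (a, b) \<in> kys x \<and> (b, d) \<in> kys y"
proof (rule ccontr)
  assume no: "\<not> ?thesis"
  let ?S = "indices x \<union> indices y"
  have "lkp (J_mult x y) (a, d) = (\<Sum>b\<in>?S. lkp x (a, b) * lkp y (b, d))"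
    by (rule lookup_J_mult) (use keys_indices[of x] keys_indices[of y] in auto)
  also have "\<dots> = 0" using no by (intro sum.neutral ballI) (metis in_keys_iff mult_not_zero)
  finally show False using assms by (simp add: in_keys_iff)
qed

lemma keys_J_mult_subset:
  assumes "finite S" "kys x \<subseteq> S \<times> S" "kys y \<subseteq> S \<times> S"
  shows "kys (J_mult x y) \<subseteq> S \<times> S"
proof (rule subrelI)
  fix a d assume "(a, d) \<in> kys (J_mult x y)"
  then show "(a, d) \<in> S \<times> S" using keys_J_multD[of a d x y] assms(2,3) by blast
qed

lemma J_mult_add: "J_mult (x + x') y = J_mult x y + J_mult x' y"
    "J_mult x (y + y') = J_mult x y + J_mult x y'"
proof -
  let ?S = "indices x \<union> indices x' \<union> indices y \<union> indices y'"
  have k: "kys x \<subseteq> ?S \<times> ?S" "kys x' \<subseteq> ?S \<times> ?S" "kys y \<subseteq> ?S \<times> ?S" "kys y' \<subseteq> ?S \<times> ?S"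
    using keys_indices[of x] keys_indices[of x'] keys_indices[of y] keys_indices[of y'] by auto
  have fin: "finite ?S" by simp
  note l = lookup_J_mult[OF fin]
  show "J_mult (x + x') y = J_mult x y + J_mult x' y"
    by (rule poly_mapping_eqI)
      (auto simp: l k keys_add_subset lookup_add distrib_right sum.distrib)
  show "J_mult x (y + y') = J_mult x y + J_mult x y'"
    by (rule poly_mapping_eqI)
      (auto simp: l k keys_add_subset lookup_add distrib_left sum.distrib)
qed

lemma J_mult_assoc: "J_mult (J_mult x y) z = J_mult x (J_mult y z)"
proof (rule poly_mapping_eqI)
  fix p :: "'a \<times> 'a"
  let ?S = "indices x \<union> indices y \<union> indices z"
  have k: "kys x \<subseteq> ?S \<times> ?S" "kys y \<subseteq> ?S \<times> ?S" "kys z \<subseteq> ?S \<times> ?S"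
    using keys_indices[of x] keys_indices[of y] keys_indices[of z] by auto
  have fin: "finite ?S" by simp
  note l = lookup_J_mult[OF fin]
  obtain a d where p: "p = (a, d)" by force
  have "lkp (J_mult (J_mult x y) z) (a, d) = (\<Sum>c\<in>?S. \<Sum>b\<in>?S. lkp x (a, b) * lkp y (b, c) * lkp z (c, d))"
    by (simp add: l k keys_J_mult_subset[OF fin] sum_distrib_right)
  also have "\<dots> = (\<Sum>b\<in>?S. \<Sum>c\<in>?S. lkp x (a, b) * (lkp y (b, c) * lkp z (c, d)))"
    by (subst sum.swap) (simp add: mult.assoc)
  also have "\<dots> = lkp (J_mult x (J_mult y z)) (a, d)"
    by (simp add: l k keys_J_mult_subset[OF fin] sum_distrib_left)
  finally show "lkp (J_mult (J_mult x y) z) p = lkp (J_mult x (J_mult y z)) p" unfolding p .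
qed

lemma J_mult_zero [simp]: "J_mult 0 y = 0" "J_mult x 0 = 0"
  by (auto simp: J_mult_def)

lemma mclain_sel [simp]:
  "carrier mclain = {x. kys x \<subseteq> Phi}" "x \<otimes>\<^bsub>mclain\<^esub> y = x + y + J_mult x y" "\<one>\<^bsub>mclain\<^esub> = 0"
  by (auto simp: mclain_def)

section \<open>Closed sets of roots and their subgroups\<close>

definition closed_roots :: "('l::linorder \<times> 'l) set \<Rightarrow> bool" where
  "closed_roots \<Delta> \<longleftrightarrow> \<Delta> \<subseteq> Phi \<and> (\<forall>a b c. (a, b) \<in> \<Delta> \<longrightarrow> (b, c) \<in> \<Delta> \<longrightarrow> (a, c) \<in> \<Delta>)"

lemma closed_rootsI:
  assumes "\<And>a b. (a, b) \<in> \<Delta> \<Longrightarrow> a < b" "\<And>a b c. (a, b) \<in> \<Delta> \<Longrightarrow> (b, c) \<in> \<Delta> \<Longrightarrow> (a, c) \<in> \<Delta>"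
  shows "closed_roots \<Delta>"
  unfolding closed_roots_def Phi_def using assms by auto

lemma closed_roots_Phi: "closed_roots Phi"
  by (rule closed_rootsI) (auto simp: Phi_def)

lemma mclain_mult_keys:
  assumes "closed_roots \<Delta>" "kys x \<subseteq> \<Delta>" "kys y \<subseteq> \<Delta>"
  shows "kys (x + y + J_mult x y) \<subseteq> \<Delta>"
proof -
  have "kys (J_mult x y) \<subseteq> \<Delta>"
  proof
    fix p assume "p \<in> kys (J_mult x y)"
    then obtain a d b where "p = (a, d)" "(a, b) \<in> kys x" "(b, d) \<in> kys y"
      using keys_J_multD by (metis surj_pair)
    then show "p \<in> \<Delta>" using assms unfolding closed_roots_def by blast
  qed
  then show ?thesis by (intro keys_add_subset assms(2,3))
qed

lemma root_elt_mult:
  assumes "a \<noteq> b"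
  shows "J_mult (root_elt (a, b) r) (root_elt (a, b) s) = 0"
  using assms by (auto simp: J_mult_def root_elt_def)

lemma mclain_assoc:
  "(x + y + J_mult x y) + z + J_mult (x + y + J_mult x y) z =
   x + (y + z + J_mult y z) + J_mult x (y + z + J_mult y z)"
  by (simp add: J_mult_add J_mult_assoc algebra_simps)

text \<open>The keys are removed one by one, starting from those with maximal row index; a root element
  in such a row annihilates the remaining part from the left.\<close>

lemma mclain_induct [consumes 2, case_names one root]:
  assumes "kys x \<subseteq> \<Delta>" "\<Delta> \<subseteq> Phi" and one: "P 0"
    and root: "\<And>d r x. d \<in> \<Delta> \<Longrightarrow> kys x \<subseteq> \<Delta> \<Longrightarrow> P x \<Longrightarrow> P (root_elt d r + x + J_mult (root_elt d r) x)"
  shows "P (x :: ('l::linorder, 'r::ring_1) mclain_elt)"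
  using assms(1)
proof (induction "card (kys x)" arbitrary: x)
  case 0
  then show ?case using one by simp
next
  case (Suc n)
  have ne: "fst ` kys x \<noteq> {}" "finite (fst ` kys x)" using Suc(2) by auto
  then obtain \<beta> where ab: "(Max (fst ` kys x), \<beta>) \<in> kys x"
    using Max_in[OF ne(2,1)] by force
  define \<alpha> where "\<alpha> = Max (fst ` kys x)"
  have mx: "a \<le> \<alpha>" if "(a, b) \<in> kys x" for a b
    unfolding \<alpha>_def using that ne(2) by (intro Max_ge) force+
  have lt: "\<alpha> < \<beta>" using ab Suc(3) assms(2) by (auto simp: \<alpha>_def Phi_def)
  define r where "r = lkp x (\<alpha>, \<beta>)"
  define x' where "x' = x - root_elt (\<alpha>, \<beta>) r"
  have k': "kys x' = kys x - {(\<alpha>, \<beta>)}"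
    by (auto simp: x'_def root_elt_def r_def in_keys_iff lookup_minus lookup_single when_def split: if_splits)
  have "P x'"
  proof (rule Suc(1))
    show "n = card (kys x')" using k' ab Suc(2) by (simp add: \<alpha>_def)
    show "kys x' \<subseteq> \<Delta>" using k' Suc(3) by auto
  qed
  have "(\<beta>, c) \<notin> kys x'" for c
  proof
    assume "(\<beta>, c) \<in> kys x'"
    then have "(\<beta>, c) \<in> kys x" unfolding k' by blast
    then have "\<beta> \<le> \<alpha>" by (rule mx)
    then show False using lt by simp
  qed
  moreover have "\<exists>c. (\<beta>, c) \<in> kys x'" if "(a, d) \<in> kys (J_mult (root_elt (\<alpha>, \<beta>) r) x')" for a d
    using keys_J_multD[OF that] by (auto simp: root_elt_def split: if_splits)
  ultimately have "kys (J_mult (root_elt (\<alpha>, \<beta>) r) x') = {}"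
    by (metis ex_in_conv surj_pair)
  then have "x = root_elt (\<alpha>, \<beta>) r + x' + J_mult (root_elt (\<alpha>, \<beta>) r) x'"
    by (simp add: x'_def)
  moreover have "P (root_elt (\<alpha>, \<beta>) r + x' + J_mult (root_elt (\<alpha>, \<beta>) r) x')"
    using \<open>P x'\<close> Suc(3) ab k' by (intro root) (auto simp: \<alpha>_def)
  ultimately show ?case by simp
qed

text \<open>The inverse is built up along \<open>mclain_induct\<close>, multiplying by the inverse
  root element 1 - r e_d at each step. This keeps its support inside \<Delta>, whence the subgroup
  property of the elements supported on \<Delta>.\<close>

lemma mclain_l_inv:
  assumes "closed_roots \<Delta>" "kys x \<subseteq> \<Delta>"
  shows "\<exists>y. kys y \<subseteq> \<Delta> \<and> y + x + J_mult y x = 0"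
  using assms(2) assms(1)[unfolded closed_roots_def, THEN conjunct1]
proof (induction rule: mclain_induct)
  case one
  show ?case by (rule exI[of _ 0]) simp
next
  case (root d r x)
  then obtain y where y: "kys y \<subseteq> \<Delta>" "y + x + J_mult y x = 0" by blast
  obtain a b where d: "d = (a, b)" by force
  have "a \<noteq> b" using root(1) assms(1) d by (auto simp: closed_roots_def Phi_def)
  let ?s = "root_elt d (- r)" and ?t = "root_elt d r"
  have st: "?s + ?t + J_mult ?s ?t = 0"
  proof -
    have "?s + ?t = 0" by (simp add: root_elt_def flip: single_add)
    then show ?thesis using root_elt_mult[OF \<open>a \<noteq> b\<close>, of "- r" r] by (simp only: d add_0)
  qed
  let ?w = "?t + x + J_mult ?t x" and ?v = "y + ?s + J_mult y ?s"
  have "?v + ?w + J_mult ?v ?w = y + (?s + ?w + J_mult ?s ?w) + J_mult y (?s + ?w + J_mult ?s ?w)"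
    by (rule mclain_assoc)
  also have "?s + ?w + J_mult ?s ?w = (?s + ?t + J_mult ?s ?t) + x + J_mult (?s + ?t + J_mult ?s ?t) x"
    by (rule mclain_assoc[symmetric])
  also have "\<dots> = x" unfolding st by simp
  finally have "?v + ?w + J_mult ?v ?w = 0" using y(2) by simp
  moreover have "kys ?v \<subseteq> \<Delta>"
    by (rule mclain_mult_keys[OF assms(1) y(1)]) (use root(1) in \<open>simp add: root_elt_def\<close>)
  ultimately show ?case by blast
qed

lemma group_mclain: "group (mclain :: ('l::linorder, 'r::ring_1) mclain_elt monoid)"
proof (rule groupI)
  show "x \<otimes>\<^bsub>mclain\<^esub> y \<otimes>\<^bsub>mclain\<^esub> z = x \<otimes>\<^bsub>mclain\<^esub> (y \<otimes>\<^bsub>mclain\<^esub> z)"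
    for x y z :: "('l, 'r) mclain_elt"
    by (simp only: mclain_sel mclain_assoc)
  show "x \<otimes>\<^bsub>mclain\<^esub> y \<in> carrier mclain" if "x \<in> carrier mclain" "y \<in> carrier mclain"
    for x y :: "('l, 'r) mclain_elt"
    using mclain_mult_keys[OF closed_roots_Phi, of x y] that by simp
  show "\<one>\<^bsub>mclain\<^esub> \<otimes>\<^bsub>mclain\<^esub> x = x" for x :: "('l, 'r) mclain_elt" by simp
  show "\<exists>y\<in>carrier mclain. y \<otimes>\<^bsub>mclain\<^esub> x = \<one>\<^bsub>mclain\<^esub>" if "x \<in> carrier mclain" for x :: "('l, 'r) mclain_elt"
    using mclain_l_inv[OF closed_roots_Phi, of x] that by simp
qed simp

interpretation mclain: group mclain
  by (rule group_mclain)

lemma mclain_inv_keys: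
  assumes "closed_roots \<Delta>" "kys x \<subseteq> \<Delta>"
  shows "kys (inv\<^bsub>mclain\<^esub> x) \<subseteq> \<Delta>"
proof -
  obtain y where y: "kys y \<subseteq> \<Delta>" "y + x + J_mult y x = 0" using mclain_l_inv[OF assms] by blast
  then have "inv\<^bsub>mclain\<^esub> x = y"
    using assms by (intro mclain.inv_equality) (auto simp: closed_roots_def)
  then show ?thesis using y by simp
qed

lemma subgroup_roots:
  assumes "closed_roots \<Delta>"
  shows "subgroup {x. kys x \<subseteq> \<Delta>} mclain"
proof (rule subgroup.intro)
  show "{x. kys x \<subseteq> \<Delta>} \<subseteq> carrier mclain" using assms unfolding closed_roots_def mclain_sel by blast
qed (use mclain_mult_keys[OF assms] mclain_inv_keys[OF assms] in simp_all)

lemma root_in_sub: "d \<in> \<Delta> \<Longrightarrow> root_elt d r \<in> mclain_sub \<Delta>"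
  unfolding mclain_sub_def by (rule generate.incl) auto

lemma lookup_root_elt: "lkp (root_elt e r) d = (if e = d then r else 0)"
  by (simp add: root_elt_def lookup_single when_def)

text \<open>By \<open>mclain_induct\<close> an element supported on a closed \<Delta> is a product
  of root elements from \<Delta>. From here on, membership in M(\<Delta>) is a condition on
  supports.\<close>

lemma mclain_sub_eq:
  fixes \<Delta> :: "('l::linorder \<times> 'l) set"
  assumes "closed_roots \<Delta>"
  shows "mclain_sub \<Delta> = {x :: ('l, 'r::ring_1) mclain_elt. kys x \<subseteq> \<Delta>}"
proof
  show "mclain_sub \<Delta> \<subseteq> {x :: ('l, 'r) mclain_elt. kys x \<subseteq> \<Delta>}"
    unfolding mclain_sub_def
    by (rule mclain.generate_subgroup_incl[OF _ subgroup_roots[OF assms]]) (auto simp: root_elt_def split: if_splits)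
  show "{x :: ('l, 'r) mclain_elt. kys x \<subseteq> \<Delta>} \<subseteq> mclain_sub \<Delta>"
  proof
    fix x :: "('l, 'r) mclain_elt" assume "x \<in> {x. kys x \<subseteq> \<Delta>}"
    then have "kys x \<subseteq> \<Delta>" "\<Delta> \<subseteq> Phi" using assms by (auto simp: closed_roots_def)
    then show "x \<in> mclain_sub \<Delta>"
    proof (induction rule: mclain_induct)
      case one
      show ?case unfolding mclain_sub_def using generate.one[of mclain] by simp
    next
      case (root d r x)
      then show ?case
        using generate.eng[of "root_elt d r" mclain _ x] root_in_sub[OF root(1), of r]
        unfolding mclain_sub_def by simp
    qed
  qed
qed

lemma subgroup_mclain_sub: "closed_roots \<Delta> \<Longrightarrow> subgroup (mclain_sub \<Delta>) mclain"
  using mclain_sub_eq subgroup_roots by metis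

lemma group_mclain_sub: "closed_roots \<Delta> \<Longrightarrow> group (mclain\<lparr>carrier := mclain_sub \<Delta>\<rparr>)"
  by (rule subgroup.subgroup_is_group[OF subgroup_mclain_sub group_mclain])

section \<open>Linear characters that read off one matrix entry\<close>

definition linear_char :: "('r::ring_1 \<Rightarrow> 'f::field) \<Rightarrow> bool" where
  "linear_char \<mu> \<longleftrightarrow> (\<forall>r. \<mu> r \<noteq> 0) \<and> (\<forall>r s. \<mu> (r + s) = \<mu> r * \<mu> s)"

lemma linear_char_if_right_primitive: "right_primitive \<mu> \<Longrightarrow> linear_char \<mu>"
  by (auto simp: right_primitive_def linear_char_def hom_def)

lemma linear_char_zero: "linear_char \<mu> \<Longrightarrow> \<mu> 0 = 1"
  unfolding linear_char_def by (metis add_0 mult_cancel_right1)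

text \<open>If d is not composed of two roots of \<Delta>, the product term xy in (1 + x)(1 + y) has
  no entry at d, so this entry is additive in the factors.\<close>

lemma root_coeff_hom:
  assumes "closed_roots \<Delta>" "linear_char \<mu>"
    and irr: "\<And>b. \<not> ((fst d, b) \<in> \<Delta> \<and> (b, snd d) \<in> \<Delta>)"
  shows "(\<lambda>x. \<mu> (lkp x d)) \<in> hom (mclain\<lparr>carrier := mclain_sub \<Delta>\<rparr>) F_star"
proof -
  have "lkp (J_mult x y) d = 0" if "kys x \<subseteq> \<Delta>" "kys y \<subseteq> \<Delta>" for x y :: "('a, 'b) mclain_elt"
  proof (rule ccontr)
    assume "lkp (J_mult x y) d \<noteq> 0"
    then have "(fst d, snd d) \<in> kys (J_mult x y)" by (simp add: in_keys_iff)
    then show False using keys_J_multD that irr by blast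
  qed
  then show ?thesis
    using assms(2) by (auto simp: hom_def mclain_sub_eq[OF assms(1)] linear_char_def lookup_add)
qed

text \<open>Resolves the definite description in \<open>root_char\<close>: existence is
  \<open>root_coeff_hom\<close>, and uniqueness follows by \<open>mclain_induct\<close>, as the
  values on root elements are prescribed.\<close>

lemma root_char_eq:
  fixes \<mu> :: "'r::ring_1 \<Rightarrow> 'f::field" and \<Delta> :: "('l::linorder \<times> 'l) set"
  assumes \<Delta>: "closed_roots \<Delta>" "linear_char \<mu>" "d \<in> \<Delta>"
    and irr: "\<And>b. \<not> ((fst d, b) \<in> \<Delta> \<and> (b, snd d) \<in> \<Delta>)"
  shows "root_char \<Delta> d \<mu> = (\<lambda>x\<in>mclain_sub \<Delta>. \<mu> (lkp x d))"
  unfolding root_char_def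
proof (rule the_equality)
  let ?\<psi> = "\<lambda>x\<in>mclain_sub \<Delta>. \<mu> (lkp x d)"
  note sub = subgroup.m_closed[OF subgroup_mclain_sub[OF \<Delta>(1)]]
  note hom = F_star_homD[OF root_coeff_hom[OF \<Delta>(1,2) irr]]
  have "?\<psi> \<in> hom (mclain\<lparr>carrier := mclain_sub \<Delta>\<rparr>) F_star"
    using root_coeff_hom[OF \<Delta>(1,2) irr] sub unfolding hom_def by (auto simp: restrict_def)
  moreover have "?\<psi> (root_elt e r) = (if e = d then \<mu> r else 1)" if "e \<in> \<Delta>" for e r
    using root_in_sub[OF that, of r] linear_char_zero[OF \<Delta>(2)] by (simp add: lookup_root_elt)
  ultimately show "?\<psi> \<in> hom (mclain\<lparr>carrier := mclain_sub \<Delta>\<rparr>) F_star \<and> ?\<psi> \<in> extensional (mclain_sub \<Delta>) \<and>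
     (\<forall>r. ?\<psi> (root_elt d r) = \<mu> r) \<and> (\<forall>e\<in>\<Delta> - {d}. \<forall>r. ?\<psi> (root_elt e r) = 1)"
    using \<Delta>(3) by (intro conjI ballI allI restrict_extensional) auto
  fix \<psi> :: "('l, 'r) mclain_elt \<Rightarrow> 'f"
  assume "\<psi> \<in> hom (mclain\<lparr>carrier := mclain_sub \<Delta>\<rparr>) F_star \<and> \<psi> \<in> extensional (mclain_sub \<Delta>) \<and>
     (\<forall>r. \<psi> (root_elt d r) = \<mu> r) \<and> (\<forall>e\<in>\<Delta> - {d}. \<forall>r. \<psi> (root_elt e r) = 1)"
  then have h: "\<psi> \<in> hom (mclain\<lparr>carrier := mclain_sub \<Delta>\<rparr>) F_star" and e: "\<psi> \<in> extensional (mclain_sub \<Delta>)"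
    and v: "\<And>r. \<psi> (root_elt d r) = \<mu> r" "\<And>e r. e \<in> \<Delta> - {d} \<Longrightarrow> \<psi> (root_elt e r) = 1" by auto
  note hm = F_star_homD[OF h]
  have "\<psi> x = \<mu> (lkp x d)" if "kys x \<subseteq> \<Delta>" for x
    using that \<Delta>(1)[unfolded closed_roots_def, THEN conjunct1]
  proof (induction rule: mclain_induct)
    case one
    then show ?case using hm(3)[OF group_mclain_sub[OF \<Delta>(1)]] linear_char_zero[OF \<Delta>(2)] by simp
  next
    case (root c r x)
    have x: "x \<in> mclain_sub \<Delta>" using root(2) by (simp add: mclain_sub_eq[OF \<Delta>(1)])
    have c: "root_elt c r \<in> mclain_sub \<Delta>" using root(1) root_in_sub by blast
    have "\<psi> (root_elt c r) = \<mu> (lkp (root_elt c r) d)"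
      using v root(1) linear_char_zero[OF \<Delta>(2)] by (cases "c = d") (simp_all add: lookup_root_elt)
    then show ?case using hm(2)[of "root_elt c r" x] hom(2)[of "root_elt c r" x] x c root(3) by simp
  qed
  then show "\<psi> = ?\<psi>"
    using e by (intro extensionalityI[where A = "mclain_sub \<Delta>"]) (auto simp: mclain_sub_eq[OF \<Delta>(1)])
qed

section \<open>Elementary modules\<close>

definition restr_roots :: "('l \<times> 'l) set \<Rightarrow> ('l, 'r::ring_1) mclain_elt \<Rightarrow> ('l, 'r) mclain_elt" where
  "restr_roots \<Delta> x = (\<Sum>d\<in>kys x \<inter> \<Delta>. Poly_Mapping.single d (lkp x d))"

lemma lookup_restr_roots: "lkp (restr_roots \<Delta> x) d = (if d \<in> \<Delta> then lkp x d else 0)"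
proof -
  have "lkp (restr_roots \<Delta> x) d = (\<Sum>e\<in>kys x \<inter> \<Delta>. if e = d then lkp x e else 0)"
    by (auto simp: restr_roots_def lookup_sum lookup_single when_def intro!: sum.cong)
  also have "\<dots> = (if d \<in> \<Delta> then lkp x d else 0)"
    by (auto simp: sum.delta in_keys_iff)
  finally show ?thesis .
qed

lemma keys_restr_roots: "kys (restr_roots \<Delta> x) = kys x \<inter> \<Delta>"
  by (auto simp: in_keys_iff lookup_restr_roots split: if_splits)

lemma restr_roots_id: "kys x \<subseteq> \<Delta> \<Longrightarrow> restr_roots \<Delta> x = x"
  by (rule poly_mapping_eqI) (auto simp: lookup_restr_roots in_keys_iff)

text \<open>For a closed and convex set of roots, a path a < b < c has its composite (a, c) in
  \<Delta> exactly if both parts are in \<Delta>; truncation to \<Delta> therefore respects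
  products.\<close>

lemma restr_roots_J_mult:
  assumes "closed_roots \<Delta>" "kys x \<subseteq> Phi" "kys y \<subseteq> Phi"
    and conv: "\<And>a b c. (a, c) \<in> \<Delta> \<Longrightarrow> a < b \<Longrightarrow> b < c \<Longrightarrow> (a, b) \<in> \<Delta> \<and> (b, c) \<in> \<Delta>"
  shows "restr_roots \<Delta> (J_mult x y) = J_mult (restr_roots \<Delta> x) (restr_roots \<Delta> y)"
proof (rule poly_mapping_eqI)
  fix p :: "'a \<times> 'a"
  obtain a d where p: "p = (a, d)" by force
  let ?S = "indices x \<union> indices y"
  have k: "kys x \<subseteq> ?S \<times> ?S" "kys y \<subseteq> ?S \<times> ?S"
    "kys (restr_roots \<Delta> x) \<subseteq> ?S \<times> ?S" "kys (restr_roots \<Delta> y) \<subseteq> ?S \<times> ?S"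
    using keys_indices[of x] keys_indices[of y] by (auto simp: keys_restr_roots)
  note l = lookup_J_mult[of ?S]
  have r: "lkp (J_mult (restr_roots \<Delta> x) (restr_roots \<Delta> y)) (a, d) =
    (\<Sum>b\<in>?S. lkp (restr_roots \<Delta> x) (a, b) * lkp (restr_roots \<Delta> y) (b, d))"
    by (rule l) (use k in auto)
  have l: "lkp (J_mult x y) (a, d) = (\<Sum>b\<in>?S. lkp x (a, b) * lkp y (b, d))"
    by (rule l) (use k in auto)
  have lt: "a < b" if "lkp x (a, b) \<noteq> 0" for a b using that assms(2) by (auto simp: in_keys_iff Phi_def)
  have lt': "a < b" if "lkp y (a, b) \<noteq> 0" for a b using that assms(3) by (auto simp: in_keys_iff Phi_def)
  have t: "(if (a, d) \<in> \<Delta> then lkp x (a, b) * lkp y (b, d) else 0) =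
      lkp (restr_roots \<Delta> x) (a, b) * lkp (restr_roots \<Delta> y) (b, d)" for b
  proof (cases "lkp x (a, b) = 0 \<or> lkp y (b, d) = 0")
    case True
    then show ?thesis by (auto simp: lookup_restr_roots)
  next
    case False
    then have "a < b" "b < d" using lt[of a b] lt'[of b d] by simp_all
    then have "(a, d) \<in> \<Delta> \<longleftrightarrow> (a, b) \<in> \<Delta> \<and> (b, d) \<in> \<Delta>"
      using conv[of a d b] assms(1) unfolding closed_roots_def by blast
    then show ?thesis by (simp add: lookup_restr_roots)
  qed
  show "lkp (restr_roots \<Delta> (J_mult x y)) p = lkp (J_mult (restr_roots \<Delta> x) (restr_roots \<Delta> y)) p"
    unfolding p r t[symmetric] lookup_restr_roots[of \<Delta> "J_mult x y"] l by simp
qed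

lemma restr_roots_add: "restr_roots \<Delta> (x + y) = restr_roots \<Delta> x + restr_roots \<Delta> y"
  by (rule poly_mapping_eqI) (auto simp: lookup_restr_roots lookup_add)

definition elem_L_roots :: "'l::linorder \<times> 'l \<Rightarrow> ('l \<times> 'l) set" where
  "elem_L_roots d = {(\<gamma>, \<delta>). fst d \<le> \<gamma> \<and> \<gamma> < \<delta> \<and> \<delta> \<le> snd d}"

text \<open>The roots of H_i for d = (\<alpha>_i, \<beta>_i): only row \<alpha>_i is restricted.
  \<open>ind_struct_elementary\<close> meets this group as the preimage of P under the projection of
  M onto L.\<close>

definition H_roots :: "'l::linorder \<times> 'l \<Rightarrow> ('l \<times> 'l) set" where
  "H_roots d = Phi - {(\<alpha>, \<gamma>). \<alpha> = fst d \<and> \<gamma> < snd d}"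

lemma closed_elem_roots:
  "closed_roots (elem_L_roots d)" "closed_roots (elem_P_roots d)" "closed_roots (H_roots d)"
  "closed_roots (Phi - elem_L_roots d)"
  by (rule closed_rootsI; force simp: elem_L_roots_def elem_P_roots_def H_roots_def Phi_def)+

lemma elem_L_eq: "elem_L d = {x. kys x \<subseteq> elem_L_roots d}"
proof -
  have "elem_L d = mclain_sub (elem_L_roots d)"
    by (auto simp: elem_L_def elem_L_roots_def case_prod_unfold)
  then show ?thesis unfolding mclain_sub_eq[OF closed_elem_roots(1)] .
qed

abbreviation "proj d \<equiv> restr_roots (elem_L_roots d)"

lemma proj_mult:
  assumes "x \<in> carrier mclain" "y \<in> carrier mclain"
  shows "proj d (x \<otimes>\<^bsub>mclain\<^esub> y) = proj d x \<otimes>\<^bsub>mclain\<^esub> proj d y"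
proof -
  have "proj d (J_mult x y) = J_mult (proj d x) (proj d y)"
    by (rule restr_roots_J_mult[OF closed_elem_roots(1)]) (use assms in \<open>auto simp: elem_L_roots_def\<close>)
  then show ?thesis by (simp add: restr_roots_add)
qed

lemma proj_closed: "kys (proj d x) \<subseteq> elem_L_roots d"
  by (auto simp: keys_restr_roots)

lemma proj_carrier: "proj d x \<in> carrier mclain"
  using proj_closed[of d x] closed_elem_roots(1)[of d] by (auto simp: closed_roots_def)

lemma proj_hom: "proj d \<in> hom mclain mclain"
  by (rule homI) (simp_all only: proj_carrier proj_mult)

lemma elem_N_eq:
  \<comment> \<open>N is the kernel of truncation to L. The kernel consists of the elements
    supported off the roots of L, a closed set whose root elements all occur among the generators of
    N, as conjugates by 1.\<close>
  fixes d :: "'l::linorder \<times> 'l"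
  shows "elem_N d = {x \<in> carrier (mclain :: ('l, 'r::ring_1) mclain_elt monoid). proj d x = 0}"
proof
  let ?M = "mclain :: ('l, 'r) mclain_elt monoid"
  interpret p: group_hom ?M ?M "proj d"
    by unfold_locales (rule proj_hom)
  have k: "kernel ?M ?M (proj d) = {x \<in> carrier mclain. proj d x = 0}"
    by (simp add: kernel_def)
  let ?gen = "{g \<otimes>\<^bsub>mclain\<^esub> x \<otimes>\<^bsub>mclain\<^esub> inv\<^bsub>mclain\<^esub> g | g x. g \<in> carrier ?M \<and>
        (\<exists>(\<gamma>, \<delta>)\<in>Phi. (\<gamma> < fst d \<or> \<delta> > snd d) \<and> x \<in> range (root_elt (\<gamma>, \<delta>)))}"
  have N: "elem_N d = generate mclain ?gen" by (simp add: elem_N_def case_prod_unfold)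
  show "elem_N d \<subseteq> {x \<in> carrier ?M. proj d x = 0}"
    unfolding N
  proof (rule mclain.generate_subgroup_incl)
    show "subgroup {x \<in> carrier ?M. proj d x = 0} mclain" using p.subgroup_kernel k by simp
    show "?gen \<subseteq> {x \<in> carrier ?M. proj d x = 0}"
    proof
      fix y assume "y \<in> ?gen"
      then obtain g x \<gamma> \<delta> r where g: "g \<in> carrier mclain" and y: "y = g \<otimes>\<^bsub>mclain\<^esub> x \<otimes>\<^bsub>mclain\<^esub> inv\<^bsub>mclain\<^esub> g"
        and x: "x = root_elt (\<gamma>, \<delta>) r" "(\<gamma>, \<delta>) \<in> Phi" "\<gamma> < fst d \<or> \<delta> > snd d" by auto
      have xc: "x \<in> carrier mclain" using x by (auto simp: root_elt_def split: if_splits)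
      have "proj d x = 0"
        by (rule poly_mapping_eqI)
          (use x in \<open>auto simp: lookup_restr_roots root_elt_def lookup_single when_def elem_L_roots_def\<close>)
      then have x1: "proj d x = \<one>\<^bsub>mclain\<^esub>" by simp
      have ig: "inv\<^bsub>mclain\<^esub> g \<in> carrier mclain" by (rule mclain.inv_closed[OF g])
      have "proj d y = proj d g \<otimes>\<^bsub>mclain\<^esub> proj d x \<otimes>\<^bsub>mclain\<^esub> inv\<^bsub>mclain\<^esub> proj d g"
        unfolding y p.hom_mult[OF mclain.m_closed[OF g xc] ig] p.hom_mult[OF g xc] p.hom_inv[OF g] ..
      also have "\<dots> = \<one>\<^bsub>mclain\<^esub>"
        unfolding x1 mclain.r_one[OF p.hom_closed[OF g]] by (rule mclain.r_inv[OF p.hom_closed[OF g]])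
      finally have "proj d y = \<one>\<^bsub>mclain\<^esub>" .
      moreover have "y \<in> carrier mclain" unfolding y by (intro mclain.m_closed g xc ig)
      ultimately show "y \<in> {x \<in> carrier mclain. proj d x = 0}" by simp
    qed
  qed
  show "{x \<in> carrier ?M. proj d x = 0} \<subseteq> elem_N d"
  proof
    fix x assume "x \<in> {x \<in> carrier ?M. proj d x = 0}"
    then have "kys x \<subseteq> Phi - elem_L_roots d"
      using keys_restr_roots[of "elem_L_roots d" x] by auto
    then have "x \<in> mclain_sub (Phi - elem_L_roots d)"
      unfolding mclain_sub_eq[OF closed_elem_roots(4)] by simp
    moreover have "mclain_sub (Phi - elem_L_roots d) \<subseteq> (elem_N d :: ('l, 'r) mclain_elt set)"
      unfolding mclain_sub_def N
    proof (rule mclain.mono_generate, rule subsetI)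
      fix y :: "('l, 'r) mclain_elt" assume "y \<in> (\<Union>e\<in>Phi - elem_L_roots d. range (root_elt e))"
      then obtain \<gamma> \<delta> where gd: "(\<gamma>, \<delta>) \<in> Phi - elem_L_roots d" and y: "y \<in> range (root_elt (\<gamma>, \<delta>))"
        by auto
      have "\<gamma> < fst d \<or> \<delta> > snd d" using gd by (auto simp: elem_L_roots_def Phi_def not_le)
      then have ex: "\<exists>(\<gamma>, \<delta>)\<in>Phi. (\<gamma> < fst d \<or> \<delta> > snd d) \<and> y \<in> range (root_elt (\<gamma>, \<delta>))"
        using gd y by blast
      have "y \<in> carrier mclain" using gd y by (auto simp: root_elt_def split: if_splits)
      then have "y = \<one>\<^bsub>mclain\<^esub> \<otimes>\<^bsub>mclain\<^esub> y \<otimes>\<^bsub>mclain\<^esub> inv\<^bsub>mclain\<^esub> \<one>\<^bsub>mclain\<^esub>"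
        using mclain.inv_one mclain.l_one mclain.r_one by metis
      then show "y \<in> ?gen" using ex mclain.one_closed by blast
    qed
    ultimately show "x \<in> elem_N d" by blast
  qed
qed

text \<open>Truncation is a homomorphism with kernel N that fixes L; so g = n l forces l to be the
  truncation of g, and g times the inverse of its truncation lies in N.\<close>

lemma elem_proj_eq:
  assumes g: "g \<in> carrier mclain"
  shows "elem_proj d g = proj d g"
  unfolding elem_proj_def
proof (rule the_equality)
  let ?l = "proj d g" and ?n = "g \<otimes>\<^bsub>mclain\<^esub> inv\<^bsub>mclain\<^esub> (proj d g)"
  have n: "?n \<in> carrier mclain" using g proj_carrier by blast
  have gn: "g = ?n \<otimes>\<^bsub>mclain\<^esub> ?l"
    using g proj_carrier by (metis mclain.inv_closed mclain.l_inv mclain.m_assoc mclain.r_one)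
  have "proj d ?l = ?l" using restr_roots_id[OF proj_closed] .
  then have "?l = proj d ?n \<otimes>\<^bsub>mclain\<^esub> ?l" using proj_mult[OF n proj_carrier] gn by metis
  then have "proj d ?n = \<one>\<^bsub>mclain\<^esub>" using proj_carrier by (metis mclain.r_cancel_one')
  then have "?n \<in> elem_N d" using n by (simp add: elem_N_eq)
  then show "?l \<in> elem_L d \<and> (\<exists>n\<in>elem_N d. g = n \<otimes>\<^bsub>mclain\<^esub> ?l)"
  proof (intro conjI bexI[of _ ?n])
    show "?l \<in> elem_L d" unfolding elem_L_eq using proj_closed by simp
  qed (rule gn)
  fix l assume "l \<in> elem_L d \<and> (\<exists>n\<in>elem_N d. g = n \<otimes>\<^bsub>mclain\<^esub> l)"
  then obtain n where l: "kys l \<subseteq> elem_L_roots d" and n: "n \<in> carrier mclain" "proj d n = 0"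
    and gl: "g = n \<otimes>\<^bsub>mclain\<^esub> l" unfolding elem_L_eq elem_N_eq by blast
  have "l \<in> carrier mclain" using l closed_elem_roots(1)[of d] by (auto simp: closed_roots_def)
  then have "proj d g = proj d n \<otimes>\<^bsub>mclain\<^esub> proj d l" unfolding gl by (rule proj_mult[OF n(1)])
  then show "l = proj d g" using n(2) restr_roots_id[OF l] by simp
qed

lemma elem_P_roots_irr: "\<not> ((fst d, b) \<in> elem_P_roots d \<and> (b, snd d) \<in> elem_P_roots d)"
  by (cases d) (auto simp: elem_P_roots_def)

lemma H_roots_irr: "\<not> ((fst d, b) \<in> H_roots d \<and> (b, snd d) \<in> H_roots d)"
  by (cases d) (auto simp: H_roots_def Phi_def)

text \<open>The module is induced from P to L and then inflated to M, hence induced to M from the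
  preimage of P, which is H_i.\<close>

theorem ind_struct_elementary:
  fixes d :: "'l::linorder \<times> 'l" and \<mu> :: "'r::ring_1 \<Rightarrow> 'f::field"
  assumes d: "d \<in> Phi" and \<mu>: "linear_char \<mu>"
  shows "\<exists>\<iota> p. ind_struct mclain (mclain_sub (H_roots d)) (char_module (\<lambda>x. \<mu> (lkp x d)))
           (elementary_module d \<mu>) \<iota> p"
proof -
  let ?M = "mclain :: ('l, 'r) mclain_elt monoid"
  let ?L = "?M\<lparr>carrier := elem_L d\<rparr>"
  let ?P = "mclain_sub (elem_P_roots d) :: ('l, 'r) mclain_elt set"
  let ?\<psi> = "root_char (elem_P_roots d) d \<mu>"
  let ?lam = "\<lambda>x. \<mu> (lkp x d)"
  have PL: "elem_P_roots d \<subseteq> elem_L_roots d"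
    by (cases d) (auto simp: elem_P_roots_def elem_L_roots_def)
  have dP: "d \<in> elem_P_roots d" using d by (cases d) (auto simp: elem_P_roots_def Phi_def)
  have subL: "subgroup (elem_L d) ?M"
    unfolding elem_L_eq by (rule subgroup_roots[OF closed_elem_roots(1)])
  have grL: "group ?L" by (rule subgroup.subgroup_is_group[OF subL group_mclain])
  have P_eq: "?P = {x. kys x \<subseteq> elem_P_roots d}"
    by (rule mclain_sub_eq[OF closed_elem_roots(2)])
  have "?P \<subseteq> elem_L d" unfolding P_eq elem_L_eq using PL by blast
  then have subP: "subgroup ?P ?L"
    by (intro mclain.subgroup_incl subgroup_mclain_sub closed_elem_roots(2) subL)
  have \<psi>_eq: "?\<psi> = (\<lambda>x\<in>?P. ?lam x)"
    by (rule root_char_eq[OF closed_elem_roots(2) \<mu> dP elem_P_roots_irr])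
  have homP: "?lam \<in> hom (?M\<lparr>carrier := ?P\<rparr>) F_star"
    by (rule root_coeff_hom[OF closed_elem_roots(2) \<mu> elem_P_roots_irr])
  have \<psi>_hom: "?\<psi> \<in> hom (?L\<lparr>carrier := ?P\<rparr>) F_star"
  proof (rule homI)
    fix x y assume xy: "x \<in> carrier (?L\<lparr>carrier := ?P\<rparr>)" "y \<in> carrier (?L\<lparr>carrier := ?P\<rparr>)"
    have "x \<otimes>\<^bsub>mclain\<^esub> y \<in> ?P"
      using xy subgroup.m_closed[OF subgroup_mclain_sub[OF closed_elem_roots(2)]] by (simp del: mclain_sel)
    then show "?\<psi> (x \<otimes>\<^bsub>?L\<lparr>carrier := ?P\<rparr>\<^esub> y) = ?\<psi> x \<otimes>\<^bsub>F_star\<^esub> ?\<psi> y"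
      using xy F_star_homD(2)[OF homP, of x y] by (simp add: \<psi>_eq del: mclain_sel)
  next
    fix x assume "x \<in> carrier (?L\<lparr>carrier := ?P\<rparr>)"
    then show "?\<psi> x \<in> carrier F_star" using F_star_homD(1)[OF homP, of x] by (simp add: \<psi>_eq)
  qed
  have "group (?L\<lparr>carrier := ?P\<rparr>)" by (rule subgroup.subgroup_is_group[OF subP grL])
  then have "gmodule (?L\<lparr>carrier := ?P\<rparr>) (char_module ?\<psi>)"
    using \<psi>_hom by (rule gmodule_char_module)
  then obtain \<iota> p where 1: "ind_struct ?L ?P (char_module ?\<psi>) (induced ?L ?P (char_module ?\<psi>)) \<iota> p"
    using ind_struct_induced[OF grL subP] by blast
  have \<pi>_eq: "elem_proj d g = proj d g" if "g \<in> carrier ?M" for g :: "('l, 'r) mclain_elt"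
    using that by (rule elem_proj_eq)
  have pL: "proj d g \<in> elem_L d" for g :: "('l, 'r) mclain_elt"
    unfolding elem_L_eq using proj_closed by simp
  have \<pi>_hom: "elem_proj d \<in> hom ?M ?L"
  proof (rule homI)
    fix x y assume xy: "x \<in> carrier ?M" "y \<in> carrier ?M"
    show "elem_proj d x \<in> carrier ?L" using xy pL \<pi>_eq by simp
    have "x \<otimes>\<^bsub>?M\<^esub> y \<in> carrier ?M" using xy by (rule mclain.m_closed)
    then show "elem_proj d (x \<otimes>\<^bsub>?M\<^esub> y) = elem_proj d x \<otimes>\<^bsub>?L\<^esub> elem_proj d y"
      using proj_mult[OF xy, of d] by (simp only: \<pi>_eq xy) simp
  qed
  have \<pi>_surj: "elem_proj d ` carrier ?M = carrier ?L"
  proof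
    show "elem_proj d ` carrier ?M \<subseteq> carrier ?L" using pL \<pi>_eq by auto
    show "carrier ?L \<subseteq> elem_proj d ` carrier ?M"
    proof
      fix l assume "l \<in> carrier ?L"
      then have l: "kys l \<subseteq> elem_L_roots d" by (simp add: elem_L_eq)
      then have lM: "l \<in> carrier ?M"
        using closed_elem_roots(1)[of d] unfolding closed_roots_def mclain_sel by blast
      have "elem_proj d l = l" using \<pi>_eq[OF lM] restr_roots_id[OF l] by simp
      then show "l \<in> elem_proj d ` carrier ?M" using lM by (metis imageI)
    qed
  qed
  \<comment> \<open>Among the roots of L those of P and those of H_i are the same, and H_i contains
    all roots outside L.\<close>
  have proj_P: "proj d g \<in> ?P \<longleftrightarrow> kys g \<subseteq> H_roots d" if "kys g \<subseteq> Phi" for g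
  proof -
    have "e \<in> elem_P_roots d \<longleftrightarrow> e \<in> H_roots d" if "e \<in> elem_L_roots d" for e
      using that by (cases d; cases e) (auto simp: elem_P_roots_def H_roots_def elem_L_roots_def Phi_def)
    moreover have "e \<in> H_roots d" if "e \<in> Phi" "e \<notin> elem_L_roots d" for e
      using that by (cases d; cases e) (auto simp: H_roots_def elem_L_roots_def Phi_def)
    ultimately show ?thesis unfolding P_eq mem_Collect_eq keys_restr_roots using that by blast
  qed
  have H_eq: "mclain_sub (H_roots d) = {x :: ('l, 'r) mclain_elt. kys x \<subseteq> H_roots d}"
    by (rule mclain_sub_eq[OF closed_elem_roots(3)])
  have H': "mclain_sub (H_roots d) = {g \<in> carrier ?M. elem_proj d g \<in> ?P}"
  proof (intro equalityI subsetI)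
    fix g :: "('l, 'r) mclain_elt" assume "g \<in> mclain_sub (H_roots d)"
    then have g: "kys g \<subseteq> H_roots d" by (simp add: H_eq)
    then have "kys g \<subseteq> Phi" by (auto simp: H_roots_def)
    then show "g \<in> {g \<in> carrier ?M. elem_proj d g \<in> ?P}" using g proj_P[of g] \<pi>_eq[of g] by simp
  next
    fix g assume "g \<in> {g \<in> carrier ?M. elem_proj d g \<in> ?P}"
    then show "g \<in> mclain_sub (H_roots d)" using proj_P[of g] \<pi>_eq[of g] by (simp add: H_eq)
  qed
  have 2: "ind_struct ?M (mclain_sub (H_roots d)) (pullback (elem_proj d) (char_module ?\<psi>))
      (elementary_module d \<mu>) \<iota> p"
    unfolding elementary_module_def
    by (rule ind_struct_pullback[OF 1 group_mclain \<pi>_hom \<pi>_surj H'])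
  interpret I2: ind_struct ?M "mclain_sub (H_roots d)" "pullback (elem_proj d) (char_module ?\<psi>)"
    "elementary_module d \<mu>" \<iota> p by (rule 2)
  \<comment> \<open>d is a root of L, so truncation leaves the entry at d unchanged.\<close>
  have v: "?\<psi> (elem_proj d x) = ?lam x" if "x \<in> mclain_sub (H_roots d)" for x
  proof -
    have x: "x \<in> carrier ?M" "elem_proj d x \<in> ?P" using that unfolding H' by auto
    have "d \<in> elem_L_roots d" using dP PL by blast
    then show ?thesis using x by (simp add: \<psi>_eq \<pi>_eq lookup_restr_roots)
  qed
  have homH: "?lam \<in> hom (?M\<lparr>carrier := mclain_sub (H_roots d)\<rparr>) F_star"
    by (rule root_coeff_hom[OF closed_elem_roots(3) \<mu> H_roots_irr])
  \<comment> \<open>On H_i the pulled back character agrees with the explicit formula, so the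
    identity map exchanges the two coefficient modules.\<close>
  have "(\<lambda>c. c) \<in> gmod_hom (?M\<lparr>carrier := mclain_sub (H_roots d)\<rparr>) (char_module ?lam)
      (pullback (elem_proj d) (char_module ?\<psi>))"
    by (intro gmod_homI lin_homI) (auto simp: v)
  then have "ind_struct ?M (mclain_sub (H_roots d)) (char_module ?lam) (elementary_module d \<mu>)
     (\<lambda>w. \<iota> ((\<lambda>c. c) w)) (\<lambda>v. inv_into (carrier (char_module ?lam)) (\<lambda>c. c) (p v))"
    by (intro ind_struct_iso[OF 2] gmodule_char_module group_mclain_sub closed_elem_roots(3) homH)
      (auto simp: bij_betw_def)
  then show ?thesis by blast
qed

section \<open>Basic modules\<close>

lemma closed_Gamma: "closed_roots (Gamma D)"
proof (rule closed_rootsI)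
  fix a b c assume "(a, b) \<in> Gamma D" "(b, c) \<in> Gamma D"
  then show "(a, c) \<in> Gamma D" by (fastforce simp: Gamma_def Phi_def)
qed (auto simp: Gamma_def Phi_def)

lemma Gamma_iff: "(a, c) \<in> Gamma D \<longleftrightarrow> a < c \<and> (\<forall>b. (a, b) \<in> D \<longrightarrow> b \<le> c)"
  by (auto simp: Gamma_def Phi_def not_less)

lemma H_sub_eq: "H_sub D = {x. kys x \<subseteq> Gamma D}"
  unfolding H_sub_def by (rule mclain_sub_eq[OF closed_Gamma])

lemma Gamma_H_roots:
  assumes "D \<subseteq> Phi"
  shows "kys x \<subseteq> Gamma D \<longleftrightarrow> kys x \<subseteq> Phi \<and> (\<forall>d\<in>D. kys x \<subseteq> H_roots d)"
  using assms by (fastforce simp: Gamma_def H_roots_def Phi_def)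

text \<open>On H the character \<lambda> depends only on the entries at the positions of D, each
  factor being a \<open>root_char\<close> that reads one entry.\<close>

lemma lambda_char_eq:
  assumes "D \<subseteq> Phi" "\<And>d. d \<in> D \<Longrightarrow> linear_char (f d)" "x \<in> H_sub D"
  shows "lambda_char D f x = (\<Prod>d\<in>D. f d (lkp x d))"
proof -
  have "lambda_hat d (f d) x = f d (lkp x d)" if "d \<in> D" for d
  proof -
    have r: "Phi - {(\<alpha>, \<gamma>). \<alpha> = fst d \<and> \<gamma> < snd d} = H_roots d" by (simp add: H_roots_def)
    have "d \<in> H_roots d" using that assms(1) by (cases d) (auto simp: H_roots_def)
    then have "lambda_hat d (f d) = (\<lambda>x\<in>mclain_sub (H_roots d). f d (lkp x d))"
      unfolding lambda_hat_def r
      by (rule root_char_eq[OF closed_elem_roots(3) assms(2)[OF that] _ H_roots_irr])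
    moreover have "x \<in> mclain_sub (H_roots d)"
      using assms(3) that Gamma_H_roots[OF assms(1), of x]
      by (simp add: mclain_sub_eq[OF closed_elem_roots(3)] H_sub_eq)
    ultimately show ?thesis by simp
  qed
  then show ?thesis unfolding lambda_char_def using assms(3) by simp
qed

text \<open>Row \<alpha>_i of a product depends only on row \<alpha>_i of the left factor. As the
  \<alpha>_i are distinct, one element y can have the same row \<alpha>_i as the inverse of k_i for
  every i; then y k_i has the row \<alpha>_i of the identity. The required g is the inverse of
  y.\<close>

lemma mclain_transitive:
  fixes k :: "'l::linorder \<times> 'l \<Rightarrow> ('l, 'r::ring_1) mclain_elt"
  assumes D: "basic_set D" and k: "\<And>d. d \<in> D \<Longrightarrow> k d \<in> carrier mclain"
  shows "\<exists>g\<in>carrier mclain. \<forall>d\<in>D. \<forall>c. lkp (inv\<^bsub>mclain\<^esub> g \<otimes>\<^bsub>mclain\<^esub> k d) (fst d, c) = 0"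
proof -
  let ?M = "mclain :: ('l, 'r) mclain_elt monoid"
  define y where "y = (\<Sum>d\<in>D. restr_roots {p. fst p = fst d} (inv\<^bsub>?M\<^esub> (k d)))"
  have fin: "finite D" and inj: "inj_on fst D" using D by (auto simp: basic_set_def)
  have ly: "lkp y (fst d, c) = lkp (inv\<^bsub>?M\<^esub> (k d)) (fst d, c)" if "d \<in> D" for d c
  proof -
    have "lkp y (fst d, c) = (\<Sum>e\<in>D. if e = d then lkp (inv\<^bsub>?M\<^esub> (k e)) (fst d, c) else 0)"
      unfolding y_def lookup_sum lookup_restr_roots
      by (intro sum.cong refl) (use inj that in \<open>auto dest: inj_onD\<close>)
    then show ?thesis using fin that by (simp add: sum.delta)
  qed
  have "kys (inv\<^bsub>?M\<^esub> (k d)) \<subseteq> Phi" if "d \<in> D" for d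
    using mclain.inv_closed[OF k[OF that]] by simp
  then have "lkp (inv\<^bsub>?M\<^esub> (k d)) p = 0" if "d \<in> D" "p \<notin> Phi" for d p
    using that by (meson in_keys_iff subsetD)
  then have "lkp y p = 0" if "p \<notin> Phi" for p
    using that unfolding y_def lookup_sum lookup_restr_roots by (intro sum.neutral) simp
  then have yM: "y \<in> carrier ?M" by (auto simp: in_keys_iff)
  have "lkp (y \<otimes>\<^bsub>?M\<^esub> k d) (fst d, c) = 0" if d: "d \<in> D" for d c
  proof -
    let ?i = "inv\<^bsub>?M\<^esub> (k d)"
    let ?S = "indices y \<union> indices ?i \<union> indices (k d)"
    have S: "kys y \<subseteq> ?S \<times> ?S" "kys ?i \<subseteq> ?S \<times> ?S" "kys (k d) \<subseteq> ?S \<times> ?S"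
      using keys_indices[of y] keys_indices[of ?i] keys_indices[of "k d"] by auto
    have "lkp (J_mult y (k d)) (fst d, c) = (\<Sum>b\<in>?S. lkp y (fst d, b) * lkp (k d) (b, c))"
      by (rule lookup_J_mult) (use S in auto)
    also have "\<dots> = (\<Sum>b\<in>?S. lkp ?i (fst d, b) * lkp (k d) (b, c))" by (simp add: ly[OF d])
    also have "\<dots> = lkp (J_mult ?i (k d)) (fst d, c)"
      by (rule lookup_J_mult[symmetric]) (use S in auto)
    finally have "lkp (y \<otimes>\<^bsub>?M\<^esub> k d) (fst d, c) = lkp (?i \<otimes>\<^bsub>?M\<^esub> k d) (fst d, c)"
      by (simp add: lookup_add ly[OF d])
    also have "?i \<otimes>\<^bsub>?M\<^esub> k d = \<one>\<^bsub>?M\<^esub>" by (rule mclain.l_inv[OF k[OF d]])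
    finally show ?thesis by simp
  qed
  then show ?thesis
    by (intro bexI[of _ "inv\<^bsub>?M\<^esub> y"]) (simp_all only: mclain.inv_inv[OF yM] mclain.inv_closed[OF yM], blast)
qed

theorem ind_struct_basic:
  fixes D :: "('l::linorder \<times> 'l) set" and f :: "'l \<times> 'l \<Rightarrow> 'r::ring_1 \<Rightarrow> 'f::field"
  assumes D: "basic_set D" and f: "\<And>d. d \<in> D \<Longrightarrow> linear_char (f d)"
    and hom: "lambda_char D f \<in> hom (mclain\<lparr>carrier := H_sub D\<rparr>) F_star"
  shows "\<exists>\<iota> p. ind_struct mclain (H_sub D) (char_module (lambda_char D f)) (basic_module D f) \<iota> p"
proof -
  have fin: "finite D" and DPhi: "D \<subseteq> Phi" using D by (auto simp: basic_set_def)
  have "\<forall>d\<in>D. \<exists>\<iota> p. ind_struct mclain (mclain_sub (H_roots d))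
      (char_module (\<lambda>x. f d (lkp x d))) (elementary_module d (f d)) \<iota> p"
  proof
    fix d assume d: "d \<in> D"
    show "\<exists>\<iota> p. ind_struct mclain (mclain_sub (H_roots d))
        (char_module (\<lambda>x. f d (lkp x d))) (elementary_module d (f d)) \<iota> p"
      by (rule ind_struct_elementary[OF subsetD[OF DPhi d] f[OF d]])
  qed
  from bchoice[OF this] obtain \<iota> where "\<forall>d\<in>D. \<exists>p. ind_struct mclain (mclain_sub (H_roots d))
      (char_module (\<lambda>x. f d (lkp x d))) (elementary_module d (f d)) (\<iota> d) p" by (elim exE)
  from bchoice[OF this] obtain p where ind: "\<forall>d\<in>D. ind_struct mclain (mclain_sub (H_roots d))
      (char_module (\<lambda>x. f d (lkp x d))) (elementary_module d (f d)) (\<iota> d) (p d)"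
    by (elim exE)
  note ind = bspec[OF ind]
  have H_eq: "mclain_sub (H_roots d) = {x :: ('l, 'r) mclain_elt. kys x \<subseteq> H_roots d}" for d :: "'l \<times> 'l"
    by (rule mclain_sub_eq[OF closed_elem_roots(3)])
  interpret T: tensor_data mclain D "\<lambda>d. elementary_module d (f d)"
  proof (rule tensor_data.intro[OF fin group_mclain])
    fix d assume "d \<in> D"
    then interpret ind_struct mclain "mclain_sub (H_roots d)" "char_module (\<lambda>x. f d (lkp x d))"
      "elementary_module d (f d)" "\<iota> d" "p d" by (rule ind)
    show "gmodule mclain (elementary_module d (f d))" by (rule V.gmodule_axioms)
  qed
  show ?thesis
    unfolding basic_module_def
  proof (rule T.ind_struct_tensor[OF ind])
    fix k :: "'l \<times> 'l \<Rightarrow> ('l, 'r) mclain_elt"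
    assume k: "\<And>i. i \<in> D \<Longrightarrow> k i \<in> carrier mclain"
    have "\<exists>g\<in>carrier mclain. \<forall>d\<in>D. \<forall>c. lkp (inv\<^bsub>mclain\<^esub> g \<otimes>\<^bsub>mclain\<^esub> k d) (fst d, c) = 0"
      by (rule mclain_transitive[OF D k])
    then obtain g where g: "g \<in> carrier mclain"
      and z: "\<forall>d\<in>D. \<forall>c. lkp (inv\<^bsub>mclain\<^esub> g \<otimes>\<^bsub>mclain\<^esub> k d) (fst d, c) = 0"
      by (elim bexE)
    note z = bspec[OF z, THEN spec]
    have "inv\<^bsub>mclain\<^esub> g \<otimes>\<^bsub>mclain\<^esub> k d \<in> mclain_sub (H_roots d) \<and>
        f d (lkp (inv\<^bsub>mclain\<^esub> g \<otimes>\<^bsub>mclain\<^esub> k d) d) = 1" if d: "d \<in> D" for d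
    proof
      let ?h = "inv\<^bsub>mclain\<^esub> g \<otimes>\<^bsub>mclain\<^esub> k d"
      have "?h \<in> carrier mclain" by (intro mclain.m_closed mclain.inv_closed g k d)
      then have "kys ?h \<subseteq> Phi" by (simp only: mclain_sel(1) mem_Collect_eq)
      moreover have "p \<in> H_roots d" if "p \<in> kys ?h" "p \<in> Phi" for p
        using that z[OF d, where x = "snd p"] by (auto simp: H_roots_def in_keys_iff simp del: mclain_sel)
      ultimately show "?h \<in> mclain_sub (H_roots d)" unfolding H_eq by blast
      show "f d (lkp ?h d) = 1" using z[OF d, where x = "snd d"] linear_char_zero[OF f[OF d]] by (simp del: mclain_sel)
    qed
    then show "\<exists>g\<in>carrier mclain. \<forall>i\<in>D. inv\<^bsub>mclain\<^esub> g \<otimes>\<^bsub>mclain\<^esub> k i \<in> mclain_sub (H_roots i) \<and>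
        f i (lkp (inv\<^bsub>mclain\<^esub> g \<otimes>\<^bsub>mclain\<^esub> k i) i) = 1"
      using g by blast
  next
    show "subgroup (H_sub D) (mclain :: ('l, 'r) mclain_elt monoid)" unfolding H_sub_def by (rule subgroup_mclain_sub[OF closed_Gamma])
    show "H_sub D = {g \<in> carrier (mclain :: ('l, 'r) mclain_elt monoid). \<forall>i\<in>D. g \<in> mclain_sub (H_roots i)}"
      by (simp add: H_sub_eq H_eq Gamma_H_roots[OF DPhi])
    show "lambda_char D f g = (\<Prod>i\<in>D. f i (lkp g i))" if "g \<in> H_sub D" for g :: "('l, 'r) mclain_elt"
      by (rule lambda_char_eq[OF DPhi f that])
  qed (use hom in auto)
qed

section \<open>The subgroup \<open>I\<close>\<close>

lemma basic_set_inj: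
  assumes "basic_set D"
  shows "(a, b) \<in> D \<Longrightarrow> (a, b') \<in> D \<Longrightarrow> b = b'" "(a, b) \<in> D \<Longrightarrow> (a', b) \<in> D \<Longrightarrow> a = a'"
  using assms inj_onD[of fst D "(a, b)" "(a, b')"] inj_onD[of snd D "(a, b)" "(a', b)"]
  by (auto simp: basic_set_def)

lemma OmegaI: "(a, \<beta>) \<in> D \<Longrightarrow> (c, \<delta>) \<in> D \<Longrightarrow> a < c \<Longrightarrow> c < \<beta> \<Longrightarrow> \<beta> < \<delta> \<Longrightarrow> (a, c) \<in> Omega D"
  by (auto simp: Omega_def Phi_def)

text \<open>Call \<beta> the partner of a if (a, \<beta>) is in D. If (a, c) is not in \<Gamma>,
  then c lies left of the partner of a, which forces first (a, b) and then (b, c) into \<Omega>.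
  Partners increase along \<Omega>, so (a, c) lies in \<Omega> too.\<close>

lemma closed_Gamma_Omega:
  assumes D: "basic_set D"
  shows "closed_roots (Gamma D \<union> Omega D)"
proof (rule closed_rootsI)
  fix a b assume "(a, b) \<in> Gamma D \<union> Omega D"
  then show "a < b" by (auto simp: Gamma_def Omega_def Phi_def)
next
  have inj: "\<beta> = \<beta>'" if "(a, \<beta>) \<in> D" "(a, \<beta>') \<in> D" for a \<beta> \<beta>'
    by (rule basic_set_inj(1)[OF D that])
  fix a b c assume ab: "(a, b) \<in> Gamma D \<union> Omega D" and bc: "(b, c) \<in> Gamma D \<union> Omega D"
  have lt: "a < b" "b < c" using ab bc by (auto simp: Gamma_def Omega_def Phi_def)
  show "(a, c) \<in> Gamma D \<union> Omega D"
  proof (cases "(a, c) \<in> Gamma D")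
    case False
    then obtain \<beta> where \<beta>: "(a, \<beta>) \<in> D" "c < \<beta>" using lt unfolding Gamma_iff by (auto simp: not_le)
    then have "(a, b) \<notin> Gamma D" using lt unfolding Gamma_iff by auto
    then have "(a, b) \<in> Omega D" using ab by simp
    then obtain \<delta> where \<delta>: "(b, \<delta>) \<in> D" "\<beta> < \<delta>"
      unfolding Omega_def using inj \<beta>(1) by blast
    then have "(b, c) \<notin> Gamma D" using \<beta>(2) unfolding Gamma_iff by auto
    then have "(b, c) \<in> Omega D" using bc by simp
    then obtain \<epsilon> where "(c, \<epsilon>) \<in> D" "\<delta> < \<epsilon>"
      unfolding Omega_def using inj \<delta>(1) by blast
    then show ?thesis using OmegaI[OF \<beta>(1), of c \<epsilon>] \<beta> \<delta> lt by auto
  qed simp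
qed

lemma Gamma_Omega_disjoint: "Gamma D \<inter> Omega D = {}"
  unfolding Omega_def using Gamma_iff[of _ _ D] by fastforce

lemma finite_Omega: "basic_set D \<Longrightarrow> finite (Omega D)"
  by (rule finite_subset[of _ "fst ` D \<times> fst ` D"]) (force simp: Omega_def basic_set_def)+

lemma I_sub_eq: "basic_set D \<Longrightarrow> I_sub D = {x. kys x \<subseteq> Gamma D \<union> Omega D}"
  unfolding I_sub_def by (rule mclain_sub_eq[OF closed_Gamma_Omega])

lemma subgroup_H: "subgroup (H_sub D) mclain"
  unfolding H_sub_def by (rule subgroup_mclain_sub[OF closed_Gamma])

lemma subgroup_I: "basic_set D \<Longrightarrow> subgroup (I_sub D) mclain"
  unfolding I_sub_def by (rule subgroup_mclain_sub[OF closed_Gamma_Omega])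

lemma H_sub_I: "basic_set D \<Longrightarrow> H_sub D \<subseteq> I_sub D"
  by (auto simp: H_sub_eq I_sub_eq)

text \<open>In each row \<Gamma> bounds the column from below, and right multiplication only moves
  entries to larger columns.\<close>

lemma Gamma_right_ideal:
  assumes "kys u \<subseteq> Gamma D" "kys x \<subseteq> Phi"
  shows "kys (J_mult u x) \<subseteq> Gamma D"
proof (rule subrelI)
  fix a c assume "(a, c) \<in> kys (J_mult u x)"
  then obtain b where "(a, b) \<in> kys u" "(b, c) \<in> kys x" using keys_J_multD by blast
  then have "(a, b) \<in> Gamma D" "b < c" using assms by (auto simp: Phi_def)
  then show "(a, c) \<in> Gamma D" unfolding Gamma_iff by force
qed

text \<open>A root (a, b) of \<Omega> leads to a row b whose partner in D lies further right than
  that of a, so the column bound for row b implies the one for row a.\<close>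

lemma Gamma_left_mult:
  assumes D: "basic_set D" and x: "kys x \<subseteq> Gamma D \<union> Omega D" and u: "kys u \<subseteq> Gamma D"
  shows "kys (J_mult x u) \<subseteq> Gamma D"
proof (rule subrelI)
  have inj: "\<beta> = \<beta>'" if "(a, \<beta>) \<in> D" "(a, \<beta>') \<in> D" for a \<beta> \<beta>'
    by (rule basic_set_inj(1)[OF D that])
  fix a c assume "(a, c) \<in> kys (J_mult x u)"
  then obtain b where "(a, b) \<in> kys x" "(b, c) \<in> kys u" using keys_J_multD by blast
  then have ab: "(a, b) \<in> Gamma D \<union> Omega D" and bc: "(b, c) \<in> Gamma D" using x u by auto
  have lt: "a < b" "b < c" using ab bc by (auto simp: Gamma_def Omega_def Phi_def)
  show "(a, c) \<in> Gamma D"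
  proof (rule ccontr)
    assume "(a, c) \<notin> Gamma D"
    then obtain \<beta> where \<beta>: "(a, \<beta>) \<in> D" "c < \<beta>" using lt unfolding Gamma_iff by (auto simp: not_le)
    then have "(a, b) \<notin> Gamma D" using lt unfolding Gamma_iff by auto
    then have "(a, b) \<in> Omega D" using ab by simp
    then obtain \<delta> where "(b, \<delta>) \<in> D" "\<beta> < \<delta>"
      unfolding Omega_def using inj \<beta>(1) by blast
    then show False using bc \<beta>(2) unfolding Gamma_iff by auto
  qed
qed

lemma H_normal_I:
  fixes D :: "('l::linorder \<times> 'l) set"
  assumes D: "basic_set D"
  shows "H_sub D \<lhd> (mclain :: ('l, 'r::ring_1) mclain_elt monoid)\<lparr>carrier := I_sub D\<rparr>"
proof -
  let ?M = "mclain :: ('l, 'r) mclain_elt monoid"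
  let ?I = "?M\<lparr>carrier := I_sub D\<rparr>"
  interpret I: group ?I by (rule subgroup.subgroup_is_group[OF subgroup_I[OF D] group_mclain])
  show ?thesis
  proof (rule I.normal_invI)
    show "subgroup (H_sub D) ?I"
      by (intro mclain.subgroup_incl subgroup_H subgroup_I[OF D] H_sub_I[OF D])
    fix x h :: "('l, 'r) mclain_elt" assume x: "x \<in> carrier ?I" and h: "h \<in> H_sub D"
    \<comment> \<open>With w = (1 + x)h and 1 + y inverse to 1 + x, the conjugate (1 + x)(1 + h)(1 +
      y) equals 1 + w(1 + y); w is supported on \<Gamma> by \<open>Gamma_left_mult\<close> and w(1 +
      y) by \<open>Gamma_right_ideal\<close>.\<close>
    let ?y = "inv\<^bsub>?M\<^esub> x" and ?w = "h + J_mult x h"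
    have xI: "x \<in> I_sub D" using x by simp
    have xM: "x \<in> carrier ?M" using subgroup.subset[OF subgroup_I[OF D]] xI by blast
    have inv: "inv\<^bsub>?I\<^esub> x = ?y" using mclain.m_inv_consistent[OF subgroup_I[OF D] xI] by simp
    have w: "kys ?w \<subseteq> Gamma D"
      using h xI Gamma_left_mult[OF D, of x h] by (intro keys_add_subset) (simp_all add: H_sub_eq I_sub_eq[OF D])
    have y: "kys ?y \<subseteq> Phi" using mclain.inv_closed[OF xM] by simp
    have "x \<otimes>\<^bsub>?M\<^esub> h \<otimes>\<^bsub>?M\<^esub> ?y = (x \<otimes>\<^bsub>?M\<^esub> ?y) + (?w + J_mult ?w ?y)"
      by (simp add: J_mult_add algebra_simps)
    also have "x \<otimes>\<^bsub>?M\<^esub> ?y = 0" using mclain.r_inv[OF xM] by (simp del: mclain_sel(2))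
    finally have "x \<otimes>\<^bsub>?M\<^esub> h \<otimes>\<^bsub>?M\<^esub> ?y = ?w + J_mult ?w ?y" by simp
    moreover have "kys (?w + J_mult ?w ?y) \<subseteq> Gamma D"
      by (intro keys_add_subset w Gamma_right_ideal y)
    ultimately have "x \<otimes>\<^bsub>?M\<^esub> h \<otimes>\<^bsub>?M\<^esub> ?y \<in> H_sub D" by (simp only: H_sub_eq mem_Collect_eq)
    then show "x \<otimes>\<^bsub>?I\<^esub> h \<otimes>\<^bsub>?I\<^esub> inv\<^bsub>?I\<^esub> x \<in> H_sub D" unfolding inv by (simp del: mclain_sel(2))
  qed
qed

section \<open>The orders of S and of finite subgroups of H\<close>

lemma finite_keys_subset:
  assumes "finite B" "finite (UNIV :: 'r::ring_1 set)"
  shows "finite {x :: 'x \<Rightarrow>\<^sub>0 'r. kys x \<subseteq> B}" "card {x :: 'x \<Rightarrow>\<^sub>0 'r. kys x \<subseteq> B} = card (UNIV :: 'r set) ^ card B"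
proof -
  have bij: "bij_betw (\<lambda>x. restrict (lkp x) B) {x :: 'x \<Rightarrow>\<^sub>0 'r. kys x \<subseteq> B} (PiE B (\<lambda>_. UNIV))"
    unfolding bij_betw_def
  proof
    show "inj_on (\<lambda>x. restrict (lkp x) B) {x :: 'x \<Rightarrow>\<^sub>0 'r. kys x \<subseteq> B}"
    proof (rule inj_onI)
      fix x y :: "'x \<Rightarrow>\<^sub>0 'r"
      assume xy: "x \<in> {x. kys x \<subseteq> B}" "y \<in> {x. kys x \<subseteq> B}" "restrict (lkp x) B = restrict (lkp y) B"
      show "x = y"
      proof (rule poly_mapping_eqI)
        fix k
        show "lkp x k = lkp y k"
        proof (cases "k \<in> B")
          case True
          then show ?thesis using fun_cong[OF xy(3), of k] by simp
        next
          case False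
          then have "k \<notin> kys x" "k \<notin> kys y" using xy(1,2) by auto
          then show ?thesis by (simp add: in_keys_iff)
        qed
      qed
    qed
    show "(\<lambda>x. restrict (lkp x) B) ` {x :: 'x \<Rightarrow>\<^sub>0 'r. kys x \<subseteq> B} = PiE B (\<lambda>_. UNIV)"
    proof
      show "PiE B (\<lambda>_. UNIV) \<subseteq> (\<lambda>x. restrict (lkp x) B) ` {x :: 'x \<Rightarrow>\<^sub>0 'r. kys x \<subseteq> B}"
      proof
        fix g :: "'x \<Rightarrow> 'r" assume g: "g \<in> PiE B (\<lambda>_. UNIV)"
        define x where "x = (\<Sum>b\<in>B. Poly_Mapping.single b (g b))"
        have l: "lkp x k = (if k \<in> B then g k else 0)" for k
          using assms(1) by (simp add: x_def lookup_sum lookup_single when_def sum.delta)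
        then have "kys x \<subseteq> B" by (auto simp: in_keys_iff split: if_splits)
        moreover have "restrict (lkp x) B = g" using g l by (intro extensionalityI[where A = B]) (auto simp: PiE_def)
        ultimately show "g \<in> (\<lambda>x. restrict (lkp x) B) ` {x. kys x \<subseteq> B}" by (intro image_eqI[of _ _ x]) auto
      qed
    qed auto
  qed
  have "finite (PiE B (\<lambda>_. UNIV :: 'r set))" by (rule finite_PiE) (use assms in auto)
  then show "finite {x :: 'x \<Rightarrow>\<^sub>0 'r. kys x \<subseteq> B}" using bij_betw_finite[OF bij] by simp
  show "card {x :: 'x \<Rightarrow>\<^sub>0 'r. kys x \<subseteq> B} = card (UNIV :: 'r set) ^ card B"
    using bij_betw_same_card[OF bij] assms by (simp add: card_PiE)
qed

text \<open>Left multiplication by 1 + h alters 1 + y by h(1 + y), which is supported on \<Gamma>;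
  so a coset of H in I is determined by the entries on \<Omega>. Conversely, if z = x - y is
  supported on \<Gamma>, then (1 + x)(1 + y)^-1 = 1 + z(1 + y)^-1 lies in H.\<close>

lemma H_coset_eq_iff:
  fixes D :: "('l::linorder \<times> 'l) set" and x y :: "('l, 'r::ring_1) mclain_elt"
  assumes D: "basic_set D" and x: "x \<in> I_sub D" and y: "y \<in> I_sub D"
  shows "H_sub D #>\<^bsub>mclain\<^esub> x = H_sub D #>\<^bsub>mclain\<^esub> y \<longleftrightarrow>
    restr_roots (Omega D) x = restr_roots (Omega D) y"
proof
  let ?M = "mclain :: ('l, 'r) mclain_elt monoid"
  have M: "x \<in> carrier ?M" "y \<in> carrier ?M" using subgroup.subset[OF subgroup_I[OF D]] x y by auto
  have k: "kys x \<subseteq> Gamma D \<union> Omega D" "kys y \<subseteq> Gamma D \<union> Omega D" using x y by (simp_all add: I_sub_eq[OF D])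
  {
    assume "H_sub D #>\<^bsub>?M\<^esub> x = H_sub D #>\<^bsub>?M\<^esub> y"
    then have "x \<in> H_sub D #>\<^bsub>?M\<^esub> y" using mclain.rcos_self[OF M(1) subgroup_H[of D]] by simp
    then obtain h where h: "h \<in> H_sub D" "x = h \<otimes>\<^bsub>?M\<^esub> y" unfolding r_coset_def by blast
    have "kys (h + J_mult h y) \<subseteq> Gamma D"
      using h(1) M(2) by (intro keys_add_subset Gamma_right_ideal) (simp_all add: H_sub_eq)
    then have "kys (restr_roots (Omega D) (h + J_mult h y)) = {}"
      unfolding keys_restr_roots using Gamma_Omega_disjoint[of D] by blast
    then have z: "restr_roots (Omega D) (h + J_mult h y) = 0" by (simp only: keys_eq_empty)
    have "x = (h + J_mult h y) + y" using h(2) by (simp add: algebra_simps)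
    then show "restr_roots (Omega D) x = restr_roots (Omega D) y"
      using z by (simp only: restr_roots_add add_0)
  }
  assume r: "restr_roots (Omega D) x = restr_roots (Omega D) y"
  let ?i = "inv\<^bsub>?M\<^esub> y" and ?z = "x - y"
  have "lkp ?z e = 0" if "e \<notin> Gamma D" for e
  proof (cases "e \<in> Omega D")
    case True
    then show ?thesis using lookup_restr_roots[of "Omega D" x e] lookup_restr_roots[of "Omega D" y e] r
      by (simp add: lookup_minus)
  next
    case False
    then have "e \<notin> kys x" "e \<notin> kys y" using that k by auto
    then show ?thesis by (simp add: lookup_minus in_keys_iff)
  qed
  then have z: "kys ?z \<subseteq> Gamma D" by (auto simp: in_keys_iff)
  have i: "kys ?i \<subseteq> Phi" using mclain.inv_closed[OF M(2)] by simp
  have "x \<otimes>\<^bsub>?M\<^esub> ?i = (y + ?z) + ?i + J_mult (y + ?z) ?i" by simp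
  also have "\<dots> = y \<otimes>\<^bsub>?M\<^esub> ?i + (?z + J_mult ?z ?i)" unfolding J_mult_add by (simp add: algebra_simps)
  also have "y \<otimes>\<^bsub>?M\<^esub> ?i = 0" using mclain.r_inv[OF M(2)] by (simp del: mclain_sel(2))
  finally have "x \<otimes>\<^bsub>?M\<^esub> ?i = ?z + J_mult ?z ?i" by simp
  moreover have "kys (?z + J_mult ?z ?i) \<subseteq> Gamma D" by (intro keys_add_subset z Gamma_right_ideal i)
  ultimately have h: "x \<otimes>\<^bsub>?M\<^esub> ?i \<in> H_sub D" by (simp only: H_sub_eq mem_Collect_eq)
  have "x = (x \<otimes>\<^bsub>?M\<^esub> ?i) \<otimes>\<^bsub>?M\<^esub> y"
    using M mclain.inv_closed[OF M(2)] mclain.m_assoc[OF M(1) mclain.inv_closed[OF M(2)] M(2)]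
    by (simp del: mclain_sel(2) add: mclain.l_inv mclain.r_one)
  then have "x \<in> H_sub D #>\<^bsub>?M\<^esub> y" using h unfolding r_coset_def by blast
  then show "H_sub D #>\<^bsub>?M\<^esub> x = H_sub D #>\<^bsub>?M\<^esub> y"
    using mclain.repr_independence[OF _ M(2) subgroup_H, of x D] by simp
qed

lemma S_quot_sel:
  "carrier (S_quot D) = (\<lambda>x. H_sub D #>\<^bsub>mclain\<^esub> x) ` I_sub D"
  by (auto simp: S_quot_def FactGroup_def RCOSETS_def r_coset_def)

lemma S_quot_mult:
  assumes D: "basic_set D" and "x \<in> I_sub D" "y \<in> I_sub D"
  shows "(H_sub D #>\<^bsub>mclain\<^esub> x) \<otimes>\<^bsub>S_quot D\<^esub> (H_sub D #>\<^bsub>mclain\<^esub> y) = H_sub D #>\<^bsub>mclain\<^esub> (x \<otimes>\<^bsub>mclain\<^esub> y)"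
  using normal.rcos_sum[OF H_normal_I[OF D], of x y] assms(2,3)
  by (simp add: S_quot_def FactGroup_def r_coset_def set_mult_def)

lemma group_S_quot:
  fixes D :: "('l::linorder \<times> 'l) set"
  shows "basic_set D \<Longrightarrow> group (S_quot D :: ('l, 'r::ring_1) mclain_elt set monoid)"
  unfolding S_quot_def by (rule normal.factorgroup_is_group[OF H_normal_I])

text \<open>The elements supported on the finite set \<Omega> form a transversal of H in I.\<close>

lemma S_quot_finite:
  fixes D :: "('l::linorder \<times> 'l) set"
  assumes D: "basic_set D" and fin: "finite (UNIV :: 'r::ring_1 set)"
  shows "finite (carrier (S_quot D :: ('l, 'r) mclain_elt set monoid))"
    "card (carrier (S_quot D :: ('l, 'r) mclain_elt set monoid)) = card (UNIV :: 'r set) ^ card (Omega D)"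
proof -
  let ?S = "S_quot D :: ('l, 'r) mclain_elt set monoid"
  let ?B = "{w :: ('l, 'r) mclain_elt. kys w \<subseteq> Omega D}"
  have I: "x \<in> I_sub D" "restr_roots (Omega D) x = x" if "x \<in> ?B" for x :: "('l, 'r) mclain_elt"
    using that restr_roots_id by (auto simp: I_sub_eq[OF D])
  have "bij_betw (\<lambda>x. H_sub D #>\<^bsub>mclain\<^esub> x) ?B (carrier ?S)"
    unfolding bij_betw_def S_quot_sel
  proof
    show "inj_on (\<lambda>x. H_sub D #>\<^bsub>mclain\<^esub> x) ?B"
    proof (rule inj_onI)
      fix x y :: "('l, 'r) mclain_elt"
      assume "x \<in> ?B" "y \<in> ?B" "H_sub D #>\<^bsub>mclain\<^esub> x = H_sub D #>\<^bsub>mclain\<^esub> y"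
      then show "x = y" using H_coset_eq_iff[OF D I(1) I(1), of x y] I(2) by simp
    qed
    show "(\<lambda>x. H_sub D #>\<^bsub>mclain\<^esub> x) ` ?B = (\<lambda>x. H_sub D #>\<^bsub>mclain\<^esub> x) ` I_sub D"
    proof
      show "(\<lambda>x. H_sub D #>\<^bsub>mclain\<^esub> x) ` I_sub D \<subseteq> (\<lambda>x. H_sub D #>\<^bsub>mclain\<^esub> x) ` ?B"
      proof (rule image_subsetI)
        fix x :: "('l, 'r) mclain_elt" assume x: "x \<in> I_sub D"
        let ?w = "restr_roots (Omega D) x"
        have w: "?w \<in> ?B" by (simp add: keys_restr_roots)
        have "H_sub D #>\<^bsub>mclain\<^esub> x = H_sub D #>\<^bsub>mclain\<^esub> ?w"
          using H_coset_eq_iff[OF D x I(1)[OF w]] I(2)[OF w] by simp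
        then show "H_sub D #>\<^bsub>mclain\<^esub> x \<in> (\<lambda>x. H_sub D #>\<^bsub>mclain\<^esub> x) ` ?B" using w by (rule image_eqI)
      qed
    qed (use I(1) in auto)
  qed
  note bij = this
  show "finite (carrier ?S)"
    using bij_betw_finite[OF bij] finite_keys_subset(1)[OF finite_Omega[OF D] fin] by simp
  show "card (carrier ?S) = card (UNIV :: 'r set) ^ card (Omega D)"
    using bij_betw_same_card[OF bij] finite_keys_subset(2)[OF finite_Omega[OF D] fin] by simp
qed

text \<open>The indices occurring in A form a finite set. The roots of \<Gamma> between these
  indices are again closed and finite in number, so the elements supported on them form the required
  finite subgroup.\<close>

lemma H_locally_finite:
  fixes A :: "('l::linorder, 'r::ring_1) mclain_elt set"
  assumes fin: "finite (UNIV :: 'r set)" and A: "finite A" "A \<subseteq> H_sub D"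
  shows "\<exists>K n. subgroup K mclain \<and> A \<subseteq> K \<and> K \<subseteq> H_sub D \<and> finite K \<and> card K = card (UNIV :: 'r set) ^ n"
proof -
  let ?S = "\<Union>x\<in>A. indices x"
  let ?\<Delta> = "Gamma D \<inter> ?S \<times> ?S"
  let ?K = "{x :: ('l, 'r) mclain_elt. kys x \<subseteq> ?\<Delta>}"
  have "closed_roots ?\<Delta>" using closed_Gamma[of D] unfolding closed_roots_def by blast
  then have "subgroup ?K mclain" by (rule subgroup_roots)
  moreover have "A \<subseteq> ?K"
  proof
    fix x assume x: "x \<in> A"
    then have "kys x \<subseteq> Gamma D" using A(2) by (auto simp: H_sub_eq)
    moreover have "kys x \<subseteq> ?S \<times> ?S" using keys_indices[of x] x by blast
    ultimately show "x \<in> ?K" by simp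
  qed
  moreover have "?K \<subseteq> H_sub D" by (auto simp: H_sub_eq)
  moreover have "finite ?\<Delta>" using A(1) by simp
  ultimately show ?thesis using finite_keys_subset[OF _ fin, of ?\<Delta>] by blast
qed

section \<open>The characteristic does not divide the order of the ring\<close>

text \<open>In characteristic p the binomial formula gives (x - 1)^p = x^p - 1, so 1 is the only
  p-th root of unity.\<close>

lemma power_prime_eq_one:
  assumes p: "prime p" "of_nat p = (0 :: 'f::field)" and x: "x ^ p = (1 :: 'f)"
  shows "x = 1"
proof -
  let ?y = "x - 1"
  have p0: "p > 0" using p(1) prime_gt_0_nat by blast
  have "(1 :: 'f) = (?y + 1) ^ p" using x by simp
  also have "\<dots> = (\<Sum>k\<le>p. of_nat (p choose k) * ?y ^ k * 1 ^ (p - k))" by (rule binomial_ring)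
  also have "\<dots> = (\<Sum>k\<in>{0, p}. of_nat (p choose k) * ?y ^ k)"
  proof (subst sum.mono_neutral_right[where S = "{0, p}"])
    show "\<forall>k\<in>{..p} - {0, p}. of_nat (p choose k) * ?y ^ k * 1 ^ (p - k) = 0"
    proof
      fix k assume "k \<in> {..p} - {0, p}"
      then have "p dvd (p choose k)" using p(1) by (intro dvd_choose_prime) auto
      then obtain m where "p choose k = p * m" by blast
      then show "of_nat (p choose k) * ?y ^ k * 1 ^ (p - k) = 0" using p(2) by simp
    qed
  qed auto
  also have "\<dots> = 1 + ?y ^ p" using p0 by simp
  finally have "?y ^ p = 0" by simp
  then show ?thesis by simp
qed

lemma right_idealI:
  assumes "0 \<in> A" "\<And>x y. x \<in> A \<Longrightarrow> y \<in> A \<Longrightarrow> x + y \<in> A" "\<And>x r. x \<in> A \<Longrightarrow> x * r \<in> A"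
  shows "right_ideal (A :: 'r::ring_1 set)"
proof -
  have n: "- x \<in> A" if "x \<in> A" for x using assms(3)[OF that, of "- 1"] by simp
  have inv: "inv\<^bsub>add_monoid (class_ring :: 'r ring)\<^esub> x = - x" for x
    unfolding a_inv_def[symmetric] by (simp add: class_ring_simps)
  have "subgroup A (add_monoid (class_ring :: 'r ring))"
    by (rule subgroup.intro) (use assms n inv in auto)
  then show ?thesis using assms(3) by (auto simp: right_ideal_def)
qed

text \<open>If p = char F divides |R|, the elements killed by p form a right ideal on which \<mu>
  takes p-th roots of unity, hence the value 1. Right primitivity makes this ideal zero, yet a
  subgroup of R of order p lies in it.\<close>

lemma card_ring_nonzero:
  fixes \<mu> :: "'r::ring_1 \<Rightarrow> 'f::field"
  assumes fin: "finite (UNIV :: 'r set)" and \<mu>: "right_primitive \<mu>"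
  shows "of_nat (card (UNIV :: 'r set)) \<noteq> (0 :: 'f)"
proof
  assume z: "of_nat (card (UNIV :: 'r set)) = (0 :: 'f)"
  let ?G = "add_monoid (class_ring :: 'r ring)"
  have "card (UNIV :: 'r set) > 0" using fin by (simp add: card_gt_0_iff)
  then have pr: "prime CHAR('f)"
    using z CHAR_eq0_iff prime_CHAR_semidom by blast
  define p where "p = CHAR('f)"
  have p: "prime p" "of_nat p = (0 :: 'f)" using pr by (simp_all add: p_def)
  obtain m where m: "card (UNIV :: 'r set) = p * m" using z of_nat_eq_0_iff_char_dvd p_def by blast
  have G: "group ?G" using class_ring.add.is_group by simp
  interpret G: group ?G by (rule G)
  have "\<exists>H. subgroup H ?G \<and> card H = p ^ 1"
    by (rule sylow_thm[OF p(1) G, where m = m]) (use m fin in \<open>simp_all add: Coset.order_def\<close>)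
  then obtain H where H: "subgroup H ?G" "card H = p" by auto
  have Hadd: "r + h \<in> H" if "r \<in> H" "h \<in> H" for r h
    using subgroup.m_closed[OF H(1) that] by simp
  have finH: "finite H" using H(2) prime_gt_0_nat[OF p(1)] card_ge_0_finite by metis
  \<comment> \<open>Translation by r permutes H, so the sum of all elements of H equals itself plus
    p r.\<close>
  have pH: "of_nat p * r = 0" if r: "r \<in> H" for r
  proof -
    have "(+) r ` H = H"
      by (rule card_seteq[OF finH]) (use Hadd[OF r] in \<open>auto simp: card_image\<close>)
    then have "(\<Sum>h\<in>H. h) = (\<Sum>h\<in>(+) r ` H. h)" by simp
    also have "\<dots> = (\<Sum>h\<in>H. r + h)" by (simp add: sum.reindex)
    also have "\<dots> = of_nat p * r + (\<Sum>h\<in>H. h)" by (simp add: sum.distrib H(2))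
    finally show ?thesis by simp
  qed
  let ?A = "{r :: 'r. of_nat p * r = 0}"
  note lin = linear_char_if_right_primitive[OF \<mu>]
  have "right_ideal ?A"
    by (rule right_idealI) (auto simp: distrib_left mult.assoc[symmetric])
  moreover have "?A \<subseteq> {r. \<mu> r = 1}"
  proof
    fix r assume "r \<in> ?A"
    then have r: "of_nat p * r = 0" by simp
    have "\<mu> (of_nat n * r) = \<mu> r ^ n" for n
      using lin linear_char_zero[OF lin] by (induction n) (auto simp: linear_char_def algebra_simps)
    from this[of p] have "\<mu> r ^ p = 1" using r linear_char_zero[OF lin] by simp
    then show "r \<in> {r. \<mu> r = 1}" using power_prime_eq_one[OF p] by simp
  qed
  ultimately have "?A = {0}" using \<mu> by (auto simp: right_primitive_def)
  then have "H \<subseteq> {0}" using pH by blast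
  then have "card H \<le> 1" using card_mono[of "{0}" H] by simp
  then show False using H(2) prime_gt_1_nat[OF p(1)] by simp
qed

section \<open>Separation of the conjugates of \<open>\<lambda>\<close>\<close>

lemma lookup_J_mult_single:
  "lkp (J_mult x (Poly_Mapping.single (c, \<beta>) s)) (a, d) = (if d = \<beta> then lkp x (a, c) * s else 0)"
  "lkp (J_mult (Poly_Mapping.single (c, \<beta>) s) x) (a, d) = (if a = c then s * lkp x (\<beta>, d) else 0)"
proof -
  let ?u = "Poly_Mapping.single (c, \<beta>) s"
  let ?S = "indices x \<union> {c, \<beta>}"
  have S: "finite ?S" "kys x \<subseteq> ?S \<times> ?S" "kys ?u \<subseteq> ?S \<times> ?S"
    using keys_indices[of x] by auto
  have "lkp (J_mult x ?u) (a, d) = (\<Sum>b\<in>?S. lkp x (a, b) * lkp ?u (b, d))"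
    by (rule lookup_J_mult[OF S])
  also have "\<dots> = (\<Sum>b\<in>?S. if b = c then (if d = \<beta> then lkp x (a, c) * s else 0) else 0)"
    by (intro sum.cong refl) (auto simp: lookup_single when_def)
  finally show "lkp (J_mult x ?u) (a, d) = (if d = \<beta> then lkp x (a, c) * s else 0)"
    by (simp add: sum.delta)
  have "lkp (J_mult ?u x) (a, d) = (\<Sum>b\<in>?S. lkp ?u (a, b) * lkp x (b, d))"
    by (rule lookup_J_mult[OF S(1,3,2)])
  also have "\<dots> = (\<Sum>b\<in>?S. if b = \<beta> then (if a = c then s * lkp x (\<beta>, d) else 0) else 0)"
    by (intro sum.cong refl) (auto simp: lookup_single when_def)
  finally show "lkp (J_mult ?u x) (a, d) = (if a = c then s * lkp x (\<beta>, d) else 0)"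
    by (simp add: sum.delta)
qed

text \<open>For \<open>u \<in> J\<close> supported on \<open>\<Gamma>\<close> with \<open>xu\<close> supported on \<open>\<Gamma>\<close> as well,
  \<open>k = 1 + (1 + x)u\<close> and \<open>k' = 1 + u(1 + x)\<close> are conjugate under \<open>1 + x\<close>, and
  \<open>\<lambda>(k) = \<lambda>(k') \<lambda>(1 + xu)\<close>.\<close>

lemma lambda_separates:
  fixes D :: "('l::linorder \<times> 'l) set" and f :: "'l \<times> 'l \<Rightarrow> 'r::ring_1 \<Rightarrow> 'f::field"
  assumes D: "basic_set D" and f: "\<And>d. d \<in> D \<Longrightarrow> right_primitive (f d)"
    and x: "x \<in> carrier mclain" "x \<notin> I_sub D"
  shows "\<exists>k\<in>H_sub D. \<exists>k'\<in>H_sub D. k \<otimes>\<^bsub>mclain\<^esub> x = x \<otimes>\<^bsub>mclain\<^esub> k' \<and> lambda_char D f k \<noteq> lambda_char D f k'"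
proof -
  have inj1: "\<beta> = \<beta>'" if "(a, \<beta>) \<in> D" "(a, \<beta>') \<in> D" for a \<beta> \<beta>'
    by (rule basic_set_inj(1)[OF D that])
  have inj2: "a = a'" if "(a, \<beta>) \<in> D" "(a', \<beta>) \<in> D" for a a' \<beta>
    by (rule basic_set_inj(2)[OF D that])
  have fin: "finite D" and DPhi: "D \<subseteq> Phi" using D by (auto simp: basic_set_def)
  note lin = linear_char_if_right_primitive[OF f]
  have lam: "lambda_char D f y = (\<Prod>d\<in>D. f d (lkp y d))" if "y \<in> H_sub D" for y
    by (rule lambda_char_eq[OF DPhi _ that]) (rule lin)
  have xPhi: "kys x \<subseteq> Phi" using x(1) by simp
  have "\<not> kys x \<subseteq> Gamma D \<union> Omega D" using x(2) by (simp add: I_sub_eq[OF D])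
  then obtain a0 c where ac: "(a0, c) \<in> kys x" "(a0, c) \<notin> Gamma D \<union> Omega D"
    by auto
  \<comment> \<open>The candidates are rows with an entry of x in column c outside \<Gamma> \<union>
    \<Omega>, listed with their partner \<beta> in D. Choosing \<beta> maximal ensures that every
    row with an entry in column c has its partner, if any, at or left of \<beta>; hence xu is
    supported on \<Gamma> for u = s e_(c,\<beta>).\<close>
  let ?Bad = "\<lambda>a \<beta>. (a, \<beta>) \<in> D \<and> (a, c) \<in> kys x \<and> c < \<beta> \<and> (a, c) \<notin> Omega D"
  let ?B = "{\<beta>. \<exists>a. ?Bad a \<beta>}"
  have "a0 < c" using ac(1) xPhi by (auto simp: Phi_def)
  moreover have "(a0, c) \<notin> Gamma D" "(a0, c) \<notin> Omega D" using ac(2) by simp_all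
  ultimately obtain \<beta>0 where "?Bad a0 \<beta>0" using ac(1) unfolding Gamma_iff by (auto simp: not_le)
  then have "?B \<noteq> {}" by blast
  moreover have finB: "finite ?B" by (rule finite_subset[of _ "snd ` D"]) (use fin in force)+
  ultimately have "Max ?B \<in> ?B" by (intro Max_in)
  then obtain a where bad: "?Bad a (Max ?B)" by blast
  define \<beta> where "\<beta> = Max ?B"
  have a\<beta>: "(a, \<beta>) \<in> D" and acx: "(a, c) \<in> kys x" and c\<beta>: "c < \<beta>" and acO: "(a, c) \<notin> Omega D"
    using bad by (auto simp: \<beta>_def)
  have max: "b \<le> \<beta>" if "?Bad a' b" for a' b
    unfolding \<beta>_def using that by (intro Max_ge finB) blast
  have "a < c" using acx xPhi by (auto simp: Phi_def)
  \<comment> \<open>A partner of c to the right of \<beta> would put (a, c) into \<Omega>.\<close>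
  have cG: "(c, \<beta>) \<in> Gamma D"
    unfolding Gamma_iff using c\<beta> acO OmegaI[OF a\<beta> _ \<open>a < c\<close>] by (meson not_le)
  let ?r = "lkp x (a, c)"
  have r0: "?r \<noteq> 0" using acx by (simp add: in_keys_iff)
  \<comment> \<open>The multiples r s form a nonzero right ideal, on which a right primitive
    character is not trivial; r s will be the entry of xu at (a, \<beta>).\<close>
  have "\<exists>s. f (a, \<beta>) (?r * s) \<noteq> 1"
  proof (rule ccontr)
    assume "\<nexists>s. f (a, \<beta>) (?r * s) \<noteq> 1"
    then have sub: "range (\<lambda>s. ?r * s) \<subseteq> {r. f (a, \<beta>) r = 1}" by auto
    have "right_ideal (range (\<lambda>s. ?r * s))"
    proof (rule right_idealI)
      show "0 \<in> range (\<lambda>s. ?r * s)" by (rule range_eqI[of _ _ 0]) simp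
      fix y z assume "y \<in> range (\<lambda>s. ?r * s)" "z \<in> range (\<lambda>s. ?r * s)"
      then show "y + z \<in> range (\<lambda>s. ?r * s)" by (auto simp: distrib_left[symmetric])
    next
      fix y t assume "y \<in> range (\<lambda>s. ?r * s)"
      then show "y * t \<in> range (\<lambda>s. ?r * s)" by (auto simp: mult.assoc)
    qed
    then have "range (\<lambda>s. ?r * s) = {0}" using f[OF a\<beta>] sub by (auto simp: right_primitive_def)
    then have "?r * 1 = 0" by blast
    then show False using r0 by simp
  qed
  then obtain s where s: "f (a, \<beta>) (?r * s) \<noteq> 1" by blast
  define u where "u = Poly_Mapping.single (c, \<beta>) s"
  have u: "kys u \<subseteq> Gamma D" using cG by (auto simp: u_def split: if_splits)
  have xu: "kys (J_mult x u) \<subseteq> Gamma D"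
  proof (rule subrelI)
    fix a' b' assume k: "(a', b') \<in> kys (J_mult x u)"
    then have b': "b' = \<beta>" and a'c: "(a', c) \<in> kys x"
      by (auto simp: in_keys_iff u_def lookup_J_mult_single split: if_splits)
    then have lt: "a' < c" using xPhi by (auto simp: Phi_def)
    have "e \<le> \<beta>" if e: "(a', e) \<in> D" for e
    proof (rule ccontr)
      assume "\<not> e \<le> \<beta>"
      then have be: "\<beta> < e" by simp
      \<comment> \<open>Otherwise c has a partner beyond e and so beyond \<beta>, which again puts
        (a, c) into \<Omega>.\<close>
      have "(a', c) \<notin> Omega D"
      proof
        assume "(a', c) \<in> Omega D"
        then obtain \<delta> where "(c, \<delta>) \<in> D" "e < \<delta>" unfolding Omega_def using inj1 e by blast
        then show False
          using OmegaI[OF a\<beta> _ \<open>a < c\<close> c\<beta>, of \<delta>] acO less_trans[OF be, of \<delta>] by blast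
      qed
      then have "?Bad a' e" using e a'c c\<beta> be by auto
      then show False using max be by (meson not_le)
    qed
    then show "(a', b') \<in> Gamma D" unfolding Gamma_iff using lt c\<beta> b' by auto
  qed
  have ux: "kys (J_mult u x) \<subseteq> Gamma D" by (rule Gamma_right_ideal[OF u xPhi])
  let ?k = "u + J_mult x u" and ?k' = "u + J_mult u x"
  have k: "?k \<in> H_sub D" and k': "?k' \<in> H_sub D"
    using u xu ux by (simp_all add: H_sub_eq keys_add_subset)
  have eq: "?k \<otimes>\<^bsub>mclain\<^esub> x = x \<otimes>\<^bsub>mclain\<^esub> ?k'"
    by (simp add: J_mult_add J_mult_assoc algebra_simps)
  \<comment> \<open>The entries of ux lie in row c strictly to the right of column \<beta>; since
    (c, \<beta>) is in \<Gamma>, no element of D is found there.\<close>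
  have "lkp (J_mult u x) d = 0" if d: "d \<in> D" for d
  proof (rule ccontr)
    assume nz: "lkp (J_mult u x) d \<noteq> 0"
    obtain d1 d2 where dd: "d = (d1, d2)" by force
    have "d1 = c" "(\<beta>, d2) \<in> kys x"
      using nz by (auto simp: dd u_def lookup_J_mult_single in_keys_iff split: if_splits)
    then have "\<beta> < d2" "(c, d2) \<in> D" using xPhi d dd by (auto simp: Phi_def)
    then show False using cG unfolding Gamma_iff by auto
  qed
  then have "lambda_char D f ?k' = (\<Prod>d\<in>D. f d (lkp u d))"
    unfolding lam[OF k'] by (intro prod.cong refl) (simp add: lookup_add)
  moreover have "lambda_char D f ?k = (\<Prod>d\<in>D. f d (lkp u d)) * f (a, \<beta>) (?r * s)"
  proof -
    have "lambda_char D f ?k = (\<Prod>d\<in>D. f d (lkp u d) * f d (lkp (J_mult x u) d))"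
      unfolding lam[OF k]
      by (intro prod.cong refl) (use lin in \<open>simp add: lookup_add linear_char_def\<close>)
    also have "\<dots> = (\<Prod>d\<in>D. f d (lkp u d)) * (\<Prod>d\<in>D. f d (lkp (J_mult x u) d))"
      by (rule prod.distrib)
    also have "(\<Prod>d\<in>D. f d (lkp (J_mult x u) d)) = (\<Prod>d\<in>D. if d = (a, \<beta>) then f (a, \<beta>) (?r * s) else 1)"
    proof (intro prod.cong refl)
      fix d assume d: "d \<in> D"
      obtain d1 d2 where dd: "d = (d1, d2)" by force
      show "f d (lkp (J_mult x u) d) = (if d = (a, \<beta>) then f (a, \<beta>) (?r * s) else 1)"
      proof (cases "d2 = \<beta>")
        case True
        have "d1 = a" by (rule inj2[OF _ a\<beta>]) (use d in \<open>simp add: dd True\<close>)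
        then show ?thesis by (simp add: dd True u_def lookup_J_mult_single)
      next
        case False
        then show ?thesis
          using linear_char_zero[OF lin[OF d]] by (simp add: dd u_def lookup_J_mult_single)
      qed
    qed
    also have "\<dots> = f (a, \<beta>) (?r * s)" using fin a\<beta> by (simp add: prod.delta)
    finally show ?thesis .
  qed
  moreover have "(\<Prod>d\<in>D. f d (lkp u d)) \<noteq> 0"
    using fin lin by (auto simp: linear_char_def)
  ultimately have "lambda_char D f ?k \<noteq> lambda_char D f ?k'" using s by simp
  then show ?thesis using k k' eq by blast
qed

section \<open>Dual bases and traces\<close>

definition lfun :: "('f::field, 'v, 'a) module_scheme \<Rightarrow> ('v \<Rightarrow> 'f) set" where
  "lfun V = {l. (\<forall>v\<in>carrier V. \<forall>w\<in>carrier V. l (v \<oplus>\<^bsub>V\<^esub> w) = l v + l w) \<and>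
     (\<forall>c. \<forall>v\<in>carrier V. l (c \<odot>\<^bsub>V\<^esub> v) = c * l v)}"

lemma lfunD:
  assumes "l \<in> lfun V"
  shows "v \<in> carrier V \<Longrightarrow> w \<in> carrier V \<Longrightarrow> l (v \<oplus>\<^bsub>V\<^esub> w) = l v + l w"
    "v \<in> carrier V \<Longrightarrow> l (c \<odot>\<^bsub>V\<^esub> v) = c * l v"
  using assms by (auto simp: lfun_def)

lemma lfunI:
  assumes "\<And>v w. v \<in> carrier V \<Longrightarrow> w \<in> carrier V \<Longrightarrow> l (v \<oplus>\<^bsub>V\<^esub> w) = l v + l w"
    "\<And>c v. v \<in> carrier V \<Longrightarrow> l (c \<odot>\<^bsub>V\<^esub> v) = c * l v"
  shows "l \<in> lfun V"
  using assms by (auto simp: lfun_def)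

lemma lfun_comp:
  assumes "T \<in> lin_hom V W" "l \<in> lfun W"
  shows "(\<lambda>v. l (T v)) \<in> lfun V"
  by (rule lfunI) (simp_all add: lin_homD[OF assms(1)] lfunD[OF assms(2)])

context fvs
begin

lemma lfun_zero: "l \<in> lfun V \<Longrightarrow> l \<zero>\<^bsub>V\<^esub> = 0"
  using lfunD(2)[of l V "\<zero>\<^bsub>V\<^esub>" 0] by (simp add: vsimps)

lemma lfun_finsum:
  assumes "l \<in> lfun V" "finite A" "\<And>x. x \<in> A \<Longrightarrow> f x \<in> carrier V"
  shows "l (\<Oplus>\<^bsub>V\<^esub>x\<in>A. f x) = (\<Sum>x\<in>A. l (f x))"
  using assms(2,3)
  by (induction A) (auto simp: lfun_zero[OF assms(1)] lfunD[OF assms(1)] Pi_def)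

lemma lfun_ext:
  assumes "l \<in> lfun V" "finite A" "kys p \<subseteq> A" "\<And>x. x \<in> A \<Longrightarrow> \<tau> x \<in> carrier V"
  shows "l (ext V \<tau> p) = (\<Sum>x\<in>A. lkp p x * l (\<tau> x))"
  using ext_superset[OF assms(2-4)] lfun_finsum[OF assms(1,2), of "\<lambda>x. lkp p x \<odot>\<^bsub>V\<^esub> \<tau> x"] assms(4)
  by (simp add: vsimps lfunD[OF assms(1)])

end

text \<open>A finite basis together with its dual basis. Both are indexed families, so that the
  bases of all U_\<chi> can be numbered by initial segments of the natural numbers, like the
  summands of \<open>copies\<close>.\<close>

definition frame ::
    "('f::field, 'v, 'a) module_scheme \<Rightarrow> 'j set \<Rightarrow> ('j \<Rightarrow> 'v) \<Rightarrow> ('j \<Rightarrow> 'v \<Rightarrow> 'f) \<Rightarrow> bool" where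
  "frame V J b l \<longleftrightarrow> finite J \<and> (\<forall>j\<in>J. b j \<in> carrier V \<and> l j \<in> lfun V) \<and>
     (\<forall>i\<in>J. \<forall>j\<in>J. l i (b j) = (if i = j then 1 else 0)) \<and>
     (\<forall>v\<in>carrier V. v = (\<Oplus>\<^bsub>V\<^esub>j\<in>J. l j v \<odot>\<^bsub>V\<^esub> b j))"

lemma frameD:
  assumes "frame V J b l"
  shows "finite J" "j \<in> J \<Longrightarrow> b j \<in> carrier V" "j \<in> J \<Longrightarrow> l j \<in> lfun V"
    "i \<in> J \<Longrightarrow> j \<in> J \<Longrightarrow> l i (b j) = (if i = j then 1 else 0)"
    "v \<in> carrier V \<Longrightarrow> (\<Oplus>\<^bsub>V\<^esub>j\<in>J. l j v \<odot>\<^bsub>V\<^esub> b j) = v"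
  using assms unfolding frame_def by simp_all

lemma frame_reindex:
  assumes "frame V J b l" "bij_betw h I J" "fvs V"
  shows "frame V I (\<lambda>i. b (h i)) (\<lambda>i. l (h i))"
proof -
  interpret fvs V by fact
  have h: "h i \<in> J" if "i \<in> I" for i using assms(2) that by (auto simp: bij_betw_def)
  have inj: "inj_on h I" and im: "h ` I = J" using assms(2) by (auto simp: bij_betw_def)
  have "finite I" using bij_betw_finite[OF assms(2)] frameD(1)[OF assms(1)] by simp
  moreover have "(\<Oplus>\<^bsub>V\<^esub>i\<in>I. l (h i) v \<odot>\<^bsub>V\<^esub> b (h i)) = v" if "v \<in> carrier V" for v
  proof -
    have "(\<Oplus>\<^bsub>V\<^esub>j\<in>h ` I. l j v \<odot>\<^bsub>V\<^esub> b j) = (\<Oplus>\<^bsub>V\<^esub>i\<in>I. l (h i) v \<odot>\<^bsub>V\<^esub> b (h i))"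
      by (rule add.finprod_reindex[OF _ inj]) (use h frameD(2)[OF assms(1)] in \<open>auto simp: vsimps\<close>)
    then show ?thesis using frameD(5)[OF assms(1) that] im by simp
  qed
  ultimately show ?thesis
    using h inj frameD[OF assms(1)] by (auto simp: frame_def inj_on_def)
qed

lemma frame_transfer:
  assumes "frame V J b l" "T \<in> lin_hom V W" "bij_betw T (carrier V) (carrier W)" "fvs V" "fvs W"
  shows "frame W J (\<lambda>j. T (b j)) (\<lambda>j w. l j (inv_into (carrier V) T w))"
proof -
  interpret V: fvs V by fact
  interpret W: fvs W by fact
  let ?S = "inv_into (carrier V) T"
  have S: "?S \<in> lin_hom W V" by (rule lin_hom_inv_into[OF assms(2-4)])
  have ST: "?S (T v) = v" if "v \<in> carrier V" for v using assms(3) that by (auto simp: bij_betw_def)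
  have TS: "T (?S w) = w" if "w \<in> carrier W" for w
    using assms(3) that by (auto simp: bij_betw_def intro: f_inv_into_f)
  note f = frameD[OF assms(1)]
  have "(\<Oplus>\<^bsub>W\<^esub>j\<in>J. l j (?S w) \<odot>\<^bsub>W\<^esub> T (b j)) = w" if w: "w \<in> carrier W" for w
  proof -
    have "w = T (\<Oplus>\<^bsub>V\<^esub>j\<in>J. l j (?S w) \<odot>\<^bsub>V\<^esub> b j)"
      using f(5)[OF lin_homD(1)[OF S w]] TS[OF w] by simp
    also have "\<dots> = (\<Oplus>\<^bsub>W\<^esub>j\<in>J. T (l j (?S w) \<odot>\<^bsub>V\<^esub> b j))"
      by (rule lin_hom_finsum[OF assms(2,4,5) f(1)]) (use f(2) in \<open>simp add: V.vsimps\<close>)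
    also have "\<dots> = (\<Oplus>\<^bsub>W\<^esub>j\<in>J. l j (?S w) \<odot>\<^bsub>W\<^esub> T (b j))"
      by (rule W.finsum_cong') (use f(2) lin_homD[OF assms(2)] in \<open>auto simp: W.vsimps\<close>)
    finally show ?thesis by simp
  qed
  then show ?thesis
    using f(1-4) lin_homD(1)[OF assms(2)] ST lfun_comp[OF S] by (auto simp: frame_def)
qed

lemma frame_eqI:
  assumes "frame V J b l" "v \<in> carrier V" "w \<in> carrier V" "\<And>j. j \<in> J \<Longrightarrow> l j v = l j w" "fvs V"
  shows "v = w"
proof -
  interpret fvs V by fact
  have "(\<Oplus>\<^bsub>V\<^esub>j\<in>J. l j v \<odot>\<^bsub>V\<^esub> b j) = (\<Oplus>\<^bsub>V\<^esub>j\<in>J. l j w \<odot>\<^bsub>V\<^esub> b j)"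
    by (rule finsum_cong') (use assms(4) frameD(2)[OF assms(1)] in \<open>auto simp: vsimps\<close>)
  then show ?thesis using frameD(5)[OF assms(1)] assms(2,3) by simp
qed

lemma lfun_expand:
  assumes "frame V J b l" "m \<in> lfun V" "v \<in> carrier V" "fvs V"
  shows "m v = (\<Sum>j\<in>J. l j v * m (b j))"
proof -
  interpret fvs V by fact
  note f = frameD[OF assms(1)]
  have "m v = m (\<Oplus>\<^bsub>V\<^esub>j\<in>J. l j v \<odot>\<^bsub>V\<^esub> b j)" using f(5)[OF assms(3)] by simp
  also have "\<dots> = (\<Sum>j\<in>J. m (l j v \<odot>\<^bsub>V\<^esub> b j))"
    by (rule lfun_finsum[OF assms(2) f(1)]) (use f(2) in \<open>simp add: vsimps\<close>)
  also have "\<dots> = (\<Sum>j\<in>J. l j v * m (b j))"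
    by (intro sum.cong refl lfunD(2)[OF assms(2)] f(2))
  finally show ?thesis .
qed

text \<open>Both traces equal the double sum of the products l'_k(b_j) l_j(T b'_k), by expanding in
  one frame or in the other.\<close>

lemma frame_trace:
  assumes "frame V J b l" "frame V J' b' l'" "T \<in> lin_hom V V" "fvs V"
  shows "(\<Sum>j\<in>J. l j (T (b j))) = (\<Sum>k\<in>J'. l' k (T (b' k)))"
proof -
  interpret fvs V by fact
  note f = frameD[OF assms(1)] and f' = frameD[OF assms(2)]
  have "(\<Sum>j\<in>J. l j (T (b j))) = (\<Sum>j\<in>J. \<Sum>k\<in>J'. l' k (b j) * l j (T (b' k)))"
    by (intro sum.cong refl lfun_expand[OF assms(2) lfun_comp[OF assms(3) f(3)] f(2) assms(4)])
  also have "\<dots> = (\<Sum>k\<in>J'. \<Sum>j\<in>J. l j (T (b' k)) * l' k (b j))"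
    by (subst sum.swap) (simp add: mult.commute)
  also have "\<dots> = (\<Sum>k\<in>J'. l' k (T (b' k)))"
    by (intro sum.cong refl lfun_expand[OF assms(1) f'(3) _ assms(4), symmetric] lin_homD(1)[OF assms(3)] f'(2))
  finally show ?thesis .
qed

context fvs
begin

lemma lincomb_eq: "lincomb a B = (\<Oplus>\<^bsub>V\<^esub>b\<in>B. a b \<odot>\<^bsub>V\<^esub> b)"
  by (simp add: lincomb_def)

lemma basis_coords:
  assumes B: "finite B" "basis B"
  obtains l where "frame V B (\<lambda>b. b) l"
    "\<forall>a. \<forall>b\<in>B. l b (lincomb a B) = a b"
proof -
  have Bc: "B \<subseteq> carrier V" and ind: "lin_indpt B" and gen: "gen_set B"
    using B(2) by (auto simp: basis_def)
  have cl: "(\<Oplus>\<^bsub>V\<^esub>b\<in>B. a b \<odot>\<^bsub>V\<^esub> b) \<in> carrier V" for a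
    by (rule finsum_closed) (use Bc in \<open>auto simp: vsimps\<close>)
  have plus: "(\<Oplus>\<^bsub>V\<^esub>b\<in>B. (a b + c b) \<odot>\<^bsub>V\<^esub> b) = (\<Oplus>\<^bsub>V\<^esub>b\<in>B. a b \<odot>\<^bsub>V\<^esub> b) \<oplus>\<^bsub>V\<^esub> (\<Oplus>\<^bsub>V\<^esub>b\<in>B. c b \<odot>\<^bsub>V\<^esub> b)" for a c
  proof -
    have "(\<Oplus>\<^bsub>V\<^esub>b\<in>B. (a b + c b) \<odot>\<^bsub>V\<^esub> b) = (\<Oplus>\<^bsub>V\<^esub>b\<in>B. a b \<odot>\<^bsub>V\<^esub> b \<oplus>\<^bsub>V\<^esub> c b \<odot>\<^bsub>V\<^esub> b)"
      by (rule finsum_cong') (use Bc in \<open>auto simp: vsimps\<close>)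
    also have "\<dots> = (\<Oplus>\<^bsub>V\<^esub>b\<in>B. a b \<odot>\<^bsub>V\<^esub> b) \<oplus>\<^bsub>V\<^esub> (\<Oplus>\<^bsub>V\<^esub>b\<in>B. c b \<odot>\<^bsub>V\<^esub> b)"
      by (rule finsum_addf) (use Bc in \<open>auto simp: vsimps\<close>)
    finally show ?thesis .
  qed
  have unique: "a b = c b"
    if eq: "(\<Oplus>\<^bsub>V\<^esub>b\<in>B. a b \<odot>\<^bsub>V\<^esub> b) = (\<Oplus>\<^bsub>V\<^esub>b\<in>B. c b \<odot>\<^bsub>V\<^esub> b)" and b: "b \<in> B" for a c b
  proof (rule ccontr)
    assume ne: "a b \<noteq> c b"
    let ?z = "\<Oplus>\<^bsub>V\<^esub>b\<in>B. (a b - c b) \<odot>\<^bsub>V\<^esub> b"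
    have "?z \<oplus>\<^bsub>V\<^esub> (\<Oplus>\<^bsub>V\<^esub>b\<in>B. c b \<odot>\<^bsub>V\<^esub> b) = (\<Oplus>\<^bsub>V\<^esub>b\<in>B. c b \<odot>\<^bsub>V\<^esub> b)"
      using plus[of "\<lambda>b. a b - c b" c] eq by simp
    then have "?z = \<zero>\<^bsub>V\<^esub>" using cl by simp
    then have "lincomb (\<lambda>b. a b - c b) B = \<zero>\<^bsub>V\<^esub>" by (simp add: lincomb_eq)
    then have "lin_dep B" using lin_dep_crit[OF B(1) order_refl, of "\<lambda>b. a b - c b" b] b ne by simp
    then show False using ind by simp
  qed
  have "\<exists>a. v = (\<Oplus>\<^bsub>V\<^esub>b\<in>B. a b \<odot>\<^bsub>V\<^esub> b)" if "v \<in> carrier V" for v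
    using finite_in_span[OF B(1) Bc, of v] gen that by (auto simp: lincomb_eq)
  then obtain a where a: "\<And>v. v \<in> carrier V \<Longrightarrow> v = (\<Oplus>\<^bsub>V\<^esub>b\<in>B. a v b \<odot>\<^bsub>V\<^esub> b)" by metis
  have au: "a (\<Oplus>\<^bsub>V\<^esub>b\<in>B. c b \<odot>\<^bsub>V\<^esub> b) b = c b" if "b \<in> B" for c b
    by (rule unique[OF a[OF cl, symmetric] that])
  have lf: "(\<lambda>v. a v b) \<in> lfun V" if b: "b \<in> B" for b
  proof (rule lfunI)
    fix v w assume "v \<in> carrier V" "w \<in> carrier V"
    then have "v \<oplus>\<^bsub>V\<^esub> w = (\<Oplus>\<^bsub>V\<^esub>b\<in>B. (a v b + a w b) \<odot>\<^bsub>V\<^esub> b)"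
      using plus[of "a v" "a w"] a by simp
    then show "a (v \<oplus>\<^bsub>V\<^esub> w) b = a v b + a w b" using au[OF b, of "\<lambda>b. a v b + a w b"] by simp
  next
    fix c v assume v: "v \<in> carrier V"
    have "c \<odot>\<^bsub>V\<^esub> v = c \<odot>\<^bsub>V\<^esub> (\<Oplus>\<^bsub>V\<^esub>b\<in>B. a v b \<odot>\<^bsub>V\<^esub> b)" using a[OF v] by simp
    also have "\<dots> = (\<Oplus>\<^bsub>V\<^esub>b\<in>B. c \<odot>\<^bsub>V\<^esub> (a v b \<odot>\<^bsub>V\<^esub> b))"
      by (rule smult_finsum[OF B(1)]) (use Bc in \<open>auto simp: vsimps\<close>)
    also have "\<dots> = (\<Oplus>\<^bsub>V\<^esub>b\<in>B. (c * a v b) \<odot>\<^bsub>V\<^esub> b)"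
      by (rule finsum_cong') (use Bc in \<open>auto simp: vsimps\<close>)
    finally show "a (c \<odot>\<^bsub>V\<^esub> v) b = c * a v b" using au[OF b, of "\<lambda>b. c * a v b"] by simp
  qed
  have dual: "a b' b = (if b = b' then 1 else 0)" if "b \<in> B" "b' \<in> B" for b b'
  proof -
    have "(\<Oplus>\<^bsub>V\<^esub>b\<in>B. (if b = b' then 1 else 0) \<odot>\<^bsub>V\<^esub> b) = (\<Oplus>\<^bsub>V\<^esub>b\<in>{b'}. (if b = b' then 1 else 0) \<odot>\<^bsub>V\<^esub> b)"
      by (rule add.finprod_mono_neutral_cong_right) (use that B(1) Bc in \<open>auto simp: vsimps\<close>)
    also have "\<dots> = b'" using that Bc by (auto simp: vsimps)
    finally have "(\<Oplus>\<^bsub>V\<^esub>b\<in>B. (if b = b' then 1 else 0) \<odot>\<^bsub>V\<^esub> b) = b'" .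
    then show ?thesis using au[OF that(1), of "\<lambda>b. if b = b' then 1 else 0"] by simp
  qed
  have "frame V B (\<lambda>b. b) (\<lambda>b v. a v b)"
    using B(1) Bc lf dual a unfolding frame_def by blast
  then show thesis using that[of "\<lambda>b v. a v b"] au by (simp add: lincomb_eq)
qed

text \<open>The description in \<open>trace_on\<close> ranges over all finite bases; each of them
  gives a frame, and \<open>frame_trace\<close> shows that they agree. The assumed basis B supplies
  existence.\<close>

lemma trace_on_frame:
  assumes fr: "frame V J b l" and T: "T \<in> lin_hom V V" and B: "finite B" "basis B"
  shows "trace_on V T = (\<Sum>j\<in>J. l j (T (b j)))"
  unfolding trace_on_def
proof (rule the_equality)
  obtain m where m: "frame V B (\<lambda>b. b) m" "\<forall>a. \<forall>b\<in>B. m b (lincomb a B) = a b"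
    by (rule basis_coords[OF B])
  have "T b = lincomb (\<lambda>c. m c (T b)) B" if "b \<in> B" for b
    using frameD(5)[OF m(1), of "T b"] lin_homD(1)[OF T] frameD(2)[OF m(1) that] by (simp add: lincomb_eq)
  moreover have "(\<Sum>j\<in>J. l j (T (b j))) = (\<Sum>b\<in>B. m b (T b))"
    by (rule frame_trace[OF fr m(1) T fvs_axioms])
  ultimately show "\<exists>B a. finite B \<and> basis B \<and> (\<forall>b\<in>B. T b = lincomb (a b) B) \<and>
      (\<Sum>j\<in>J. l j (T (b j))) = (\<Sum>b\<in>B. a b b)"
    using B by (intro exI[of _ B] exI[of _ "\<lambda>b c. m c (T b)"]) simp
next
  fix t assume "\<exists>B a. finite B \<and> basis B \<and> (\<forall>b\<in>B. T b = lincomb (a b) B) \<and> t = (\<Sum>b\<in>B. a b b)"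
  then obtain B a where B: "finite B" "basis B" "\<And>b. b \<in> B \<Longrightarrow> T b = lincomb (a b) B" "t = (\<Sum>b\<in>B. a b b)"
    by blast
  obtain m where m: "frame V B (\<lambda>b. b) m" "\<forall>a. \<forall>b\<in>B. m b (lincomb a B) = a b"
    by (rule basis_coords[OF B(1,2)])
  have "t = (\<Sum>b\<in>B. m b (T b))" unfolding B(4) by (intro sum.cong refl) (simp add: B(3) m(2))
  also have "\<dots> = (\<Sum>j\<in>J. l j (T (b j)))" by (rule frame_trace[OF m(1) fr T fvs_axioms])
  finally show "t = (\<Sum>j\<in>J. l j (T (b j)))" .
qed

end

section \<open>Irreducible modules of finite groups\<close>

lemma irreducible_gmoduleD:
  assumes "irreducible_gmodule G V"
  shows "gmodule G V" "carrier V \<noteq> {\<zero>\<^bsub>V\<^esub>}"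
    "lin_closed V N \<Longrightarrow> (\<And>g v. g \<in> carrier G \<Longrightarrow> v \<in> N \<Longrightarrow> act V g v \<in> N) \<Longrightarrow>
      N = {\<zero>\<^bsub>V\<^esub>} \<or> N = carrier V"
proof -
  show g: "gmodule G V" and "carrier V \<noteq> {\<zero>\<^bsub>V\<^esub>}" using assms by (auto simp: irreducible_gmodule_def)
  interpret gmodule G V by (rule g)
  show "N = {\<zero>\<^bsub>V\<^esub>} \<or> N = carrier V" if "lin_closed V N"
    "\<And>g v. g \<in> carrier G \<Longrightarrow> v \<in> N \<Longrightarrow> act V g v \<in> N"
    using assms V.subspace_if_lin_closed[OF that(1)] that(2) unfolding irreducible_gmodule_def by blast
qed

lemma irreducible_gmoduleI:
  assumes "gmodule G V" "carrier V \<noteq> {\<zero>\<^bsub>V\<^esub>}"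
    "\<And>N. lin_closed V N \<Longrightarrow> (\<And>g v. g \<in> carrier G \<Longrightarrow> v \<in> N \<Longrightarrow> act V g v \<in> N) \<Longrightarrow>
      N \<noteq> {\<zero>\<^bsub>V\<^esub>} \<Longrightarrow> carrier V \<subseteq> N"
  shows "irreducible_gmodule G V"
  unfolding irreducible_gmodule_def
proof (intro conjI allI impI assms(1,2))
  fix N assume N: "VectorSpace.subspace class_ring N V \<and> (\<forall>g\<in>carrier G. \<forall>v\<in>N. act V g v \<in> N)"
  then have lc: "lin_closed V N" by (blast intro: lin_closed_if_subspace)
  have "carrier V \<subseteq> N" if "N \<noteq> {\<zero>\<^bsub>V\<^esub>}" by (rule assms(3)[OF lc _ that]) (use N in blast)
  then show "N = {\<zero>\<^bsub>V\<^esub>} \<or> N = carrier V" using lin_closedD(1)[OF lc] by blast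
qed

lemma irreducible_iso:
  assumes "irreducible_gmodule G U" "gmodule G V" "T \<in> gmod_hom G U V" "bij_betw T (carrier U) (carrier V)"
  shows "irreducible_gmodule G V"
proof (rule irreducible_gmoduleI[OF assms(2)])
  note U = irreducible_gmoduleD[OF assms(1)] and T = gmod_homD[OF assms(3)]
  interpret U: gmodule G U by (rule U(1))
  interpret V: gmodule G V by fact
  have inj: "inj_on T (carrier U)" and im: "T ` carrier U = carrier V" using assms(4) by (auto simp: bij_betw_def)
  have T0: "T \<zero>\<^bsub>U\<^esub> = \<zero>\<^bsub>V\<^esub>" by (rule lin_hom_zero[OF T(1) U.V.fvs_axioms V.V.fvs_axioms])
  show "carrier V \<noteq> {\<zero>\<^bsub>V\<^esub>}"
  proof
    assume V0: "carrier V = {\<zero>\<^bsub>V\<^esub>}"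
    have "u = \<zero>\<^bsub>U\<^esub>" if "u \<in> carrier U" for u
      using inj_onD[OF inj, of u "\<zero>\<^bsub>U\<^esub>"] T0 V0 im that by auto
    then show False using U(2) U.V.zero_closed by blast
  qed
  fix N assume N: "lin_closed V N" "\<And>g v. g \<in> carrier G \<Longrightarrow> v \<in> N \<Longrightarrow> act V g v \<in> N" "N \<noteq> {\<zero>\<^bsub>V\<^esub>}"
  let ?M = "{u \<in> carrier U. T u \<in> N}"
  have lc: "lin_closed U ?M" by (rule lin_closed_vimage[OF T(1) U.V.fvs_axioms V.V.fvs_axioms N(1)])
  have "?M = {\<zero>\<^bsub>U\<^esub>} \<or> ?M = carrier U"
    by (rule U(3)[OF lc]) (auto simp: T(2) N(2) U.act_closed)
  moreover have "?M \<noteq> {\<zero>\<^bsub>U\<^esub>}"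
  proof
    assume M0: "?M = {\<zero>\<^bsub>U\<^esub>}"
    have "N \<subseteq> {\<zero>\<^bsub>V\<^esub>}"
    proof
      fix v assume "v \<in> N"
      have "v \<in> T ` carrier U" using subsetD[OF lin_closedD(1)[OF N(1)] \<open>v \<in> N\<close>] im by simp
      then obtain u where "u \<in> carrier U" "T u = v" by blast
      then have "u \<in> ?M" using \<open>v \<in> N\<close> by simp
      then have "u = \<zero>\<^bsub>U\<^esub>" using M0 by blast
      then show "v \<in> {\<zero>\<^bsub>V\<^esub>}" using T0 \<open>T u = v\<close> by simp
    qed
    moreover have "\<zero>\<^bsub>V\<^esub> \<in> N" by (rule lin_closedD(2)[OF N(1)])
    ultimately show False using N(3) by blast
  qed
  ultimately have "?M = carrier U" by blast
  moreover have "T ` ?M \<subseteq> N" by (auto simp only:)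
  ultimately show "carrier V \<subseteq> N" using im by (simp only:)
qed

lemma Schur_bij:
  assumes "irreducible_gmodule G U" "irreducible_gmodule G V" "T \<in> gmod_hom G U V"
    and nz: "u \<in> carrier U" "T u \<noteq> \<zero>\<^bsub>V\<^esub>"
  shows "bij_betw T (carrier U) (carrier V)"
proof -
  note U = irreducible_gmoduleD[OF assms(1)] and V = irreducible_gmoduleD[OF assms(2)]
    and T = gmod_homD[OF assms(3)]
  interpret U: gmodule G U by (rule U(1))
  interpret V: gmodule G V by (rule V(1))
  have T0: "T \<zero>\<^bsub>U\<^esub> = \<zero>\<^bsub>V\<^esub>" by (rule lin_hom_zero[OF T(1) U.V.fvs_axioms V.V.fvs_axioms])
  let ?K = "{u \<in> carrier U. T u \<in> {\<zero>\<^bsub>V\<^esub>}}"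
  have z: "lin_closed V {\<zero>\<^bsub>V\<^esub>}" by (rule lin_closedI) (auto simp: V.V.vsimps)
  have "?K = {\<zero>\<^bsub>U\<^esub>} \<or> ?K = carrier U"
    by (rule U(3)[OF lin_closed_vimage[OF T(1) U.V.fvs_axioms V.V.fvs_axioms z]])
      (auto simp: T(2) U.act_closed V.act_zero)
  moreover have "?K \<noteq> carrier U" using nz by blast
  ultimately have K: "?K = {\<zero>\<^bsub>U\<^esub>}" by blast
  have inj: "inj_on T (carrier U)"
  proof (rule inj_onI)
    fix x y assume xy: "x \<in> carrier U" "y \<in> carrier U" "T x = T y"
    let ?d = "x \<oplus>\<^bsub>U\<^esub> (- 1) \<odot>\<^bsub>U\<^esub> y"
    have neg: "v \<oplus>\<^bsub>V\<^esub> (- 1) \<odot>\<^bsub>V\<^esub> v = \<zero>\<^bsub>V\<^esub>" if "v \<in> carrier V" for v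
      using V.V.smult_l_distr'[OF that, of 1 "- 1"] that by (simp add: V.V.vsimps)
    have d: "?d \<in> carrier U" using xy by (simp add: U.V.vsimps)
    have "T ?d = T y \<oplus>\<^bsub>V\<^esub> (- 1) \<odot>\<^bsub>V\<^esub> T y" using xy by (simp add: lin_homD[OF T(1)] U.V.vsimps)
    then have "T ?d = \<zero>\<^bsub>V\<^esub>" using neg lin_homD(1)[OF T(1) xy(2)] by simp
    then have "?d \<in> ?K" using d by simp
    then have d0: "?d = \<zero>\<^bsub>U\<^esub>" using K by blast
    have "x = x \<oplus>\<^bsub>U\<^esub> ((- 1) \<odot>\<^bsub>U\<^esub> y \<oplus>\<^bsub>U\<^esub> y)"
      using U.V.smult_l_distr'[OF xy(2), of "- 1" 1] xy by (simp add: U.V.vsimps)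
    also have "\<dots> = ?d \<oplus>\<^bsub>U\<^esub> y" using xy by (simp add: U.V.vsimps U.V.add.m_assoc)
    finally show "x = y" using d0 xy by simp
  qed
  have "lin_closed V (T ` carrier U)"
  proof (rule lin_closedI)
    show "\<zero>\<^bsub>V\<^esub> \<in> T ` carrier U" using T0 U.V.zero_closed by (metis imageI)
    fix v w assume "v \<in> T ` carrier U" "w \<in> T ` carrier U"
    then obtain x y where "x \<in> carrier U" "y \<in> carrier U" "v = T x" "w = T y" by blast
    then show "v \<oplus>\<^bsub>V\<^esub> w \<in> T ` carrier U"
      by (intro image_eqI[of _ _ "x \<oplus>\<^bsub>U\<^esub> y"]) (simp_all add: lin_homD[OF T(1)])
  next
    fix c v assume "v \<in> T ` carrier U"
    then obtain x where "x \<in> carrier U" "v = T x" by blast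
    then show "c \<odot>\<^bsub>V\<^esub> v \<in> T ` carrier U"
      by (intro image_eqI[of _ _ "c \<odot>\<^bsub>U\<^esub> x"]) (simp_all add: lin_homD[OF T(1)] U.V.vsimps)
  qed (use lin_homD(1)[OF T(1)] in blast)
  then have "T ` carrier U = {\<zero>\<^bsub>V\<^esub>} \<or> T ` carrier U = carrier V"
  proof (rule V(3))
    fix g v assume "g \<in> carrier G" "v \<in> T ` carrier U"
    then obtain x where "x \<in> carrier U" "v = T x" by blast
    then show "act V g v \<in> T ` carrier U"
      using T(2)[OF \<open>g \<in> carrier G\<close>, of x] U.act_closed[OF \<open>g \<in> carrier G\<close>, of x] by (metis imageI)
  qed
  then have "T ` carrier U = carrier V" using nz by blast
  then show ?thesis using inj by (simp add: bij_betw_def)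
qed

text \<open>\<open>card_nz\<close> is the condition of Maschke's theorem, and \<open>split\<close>
  makes the scalars in Schur's lemma lie in F.\<close>

locale finite_rep =
  S: group S for S :: "('s, 'm) monoid_scheme" and ty :: "'f::field itself" +
  assumes fin: "finite (carrier S)" and card_nz: "of_nat (card (carrier S)) \<noteq> (0 :: 'f)"
    and split: "splitting_field ty S"
begin

lemma orbit_span:
  fixes U :: "('f, 'u, 's, 'a) gmodule_scheme"
  assumes U: "irreducible_gmodule S U" and u: "u \<in> carrier U" "u \<noteq> \<zero>\<^bsub>U\<^esub>" and Q: "lin_closed U Q"
    and orb: "\<And>s. s \<in> carrier S \<Longrightarrow> act U s u \<in> Q"
  shows "carrier U \<subseteq> Q"
proof -
  note U = irreducible_gmoduleD[OF U]
  interpret U: gmodule S U by (rule U(1))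
  \<comment> \<open>The largest invariant subspace contained in Q; irreducibility applies to
    it.\<close>
  let ?N = "{v \<in> carrier U. \<forall>s\<in>carrier S. act U s v \<in> Q}"
  have "lin_closed U ?N"
    using lin_closedD[OF Q]
    by (intro lin_closedI) (auto simp: U.V.vsimps U.act_add U.act_smult U.act_zero)
  moreover have "act U g v \<in> ?N" if "g \<in> carrier S" "v \<in> ?N" for g v
    using that U.act_mult[symmetric] by (auto simp: U.act_closed)
  ultimately have "?N = {\<zero>\<^bsub>U\<^esub>} \<or> ?N = carrier U" by (rule U(3))
  moreover have "u \<in> ?N" using u orb by simp
  ultimately have N: "?N = carrier U" using u(2) by blast
  show ?thesis
  proof
    fix v assume "v \<in> carrier U"
    then have "act U \<one>\<^bsub>S\<^esub> v \<in> Q" using N by blast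
    then show "v \<in> Q" using U.act_one \<open>v \<in> carrier U\<close> by simp
  qed
qed

text \<open>The finite orbit of any nonzero vector spans, so a finite basis exists.\<close>

lemma irreducible_finite_basis:
  fixes U :: "('f, 'u, 's, 'a) gmodule_scheme"
  assumes U: "irreducible_gmodule S U"
  obtains B where "finite B" "vectorspace.basis class_ring U B" "vectorspace.dim class_ring U = card B"
proof -
  interpret U: gmodule S U by (rule irreducible_gmoduleD(1)[OF U])
  obtain u where u: "u \<in> carrier U" "u \<noteq> \<zero>\<^bsub>U\<^esub>"
    using irreducible_gmoduleD(2)[OF U] U.V.zero_closed by blast
  let ?A = "(\<lambda>s. act U s u) ` carrier S"
  have A: "finite ?A" "?A \<subseteq> carrier U" using fin u U.act_closed by auto
  have "submodule class_ring (U.V.span ?A) U" by (rule U.V.span_is_submodule[OF A(2)])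
  then have "lin_closed U (U.V.span ?A)" by (auto simp: submodule_def lin_closed_def)
  moreover have "act U s u \<in> U.V.span ?A" if "s \<in> carrier S" for s
    using U.V.in_own_span[OF A(2)] that by blast
  ultimately have "carrier U \<subseteq> U.V.span ?A" by (rule orbit_span[OF U u])
  then have "U.V.gen_set ?A" using U.V.span_is_subset2[OF A(2)] by blast
  then have fd: "U.V.fin_dim" unfolding U.V.fin_dim_def using A by blast
  obtain B where B: "finite B" "U.V.basis B" using U.V.finite_basis_exists[OF fd] by blast
  then show thesis using that[OF B] U.V.dim_basis[OF B] by blast
qed

lemma irreducible_frame:
  fixes U :: "('f, 'u, 's, 'a) gmodule_scheme"
  assumes U: "irreducible_gmodule S U"
  obtains b l where "frame U {..<vectorspace.dim class_ring U} b l"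
proof -
  interpret U: gmodule S U by (rule irreducible_gmoduleD(1)[OF U])
  obtain B where B: "finite B" "vectorspace.basis class_ring U B" "vectorspace.dim class_ring U = card B"
    by (rule irreducible_finite_basis[OF U])
  obtain l where l: "frame U B (\<lambda>b. b) l" by (rule U.V.basis_coords[OF B(1,2)])
  obtain h where "bij_betw h {0..<card B} B" using ex_bij_betw_nat_finite[OF B(1)] by blast
  then have h: "bij_betw h {..<vectorspace.dim class_ring U} B" using B(3) by (simp add: atLeast0LessThan)
  show thesis using frame_reindex[OF l h U.V.fvs_axioms] that by blast
qed

lemma character_frame:
  fixes U :: "('f, 'u, 's, 'a) gmodule_scheme"
  assumes U: "irreducible_gmodule S U" and fr: "frame U J b l" and s: "s \<in> carrier S"
  shows "character_of S U s = (\<Sum>j\<in>J. l j (act U s (b j)))"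
proof -
  interpret U: gmodule S U by (rule irreducible_gmoduleD(1)[OF U])
  obtain B where B: "finite B" "vectorspace.basis class_ring U B"
    by (rule irreducible_finite_basis[OF U])
  show ?thesis unfolding character_of_def using s
    by (simp add: U.V.trace_on_frame[OF fr U.act_lin_hom[OF s] B])
qed

lemma character_iso:
  fixes U :: "('f, 'u, 's, 'a) gmodule_scheme" and V :: "('f, 'v, 's, 'c) gmodule_scheme"
  assumes U: "irreducible_gmodule S U" and V: "irreducible_gmodule S V"
    and T: "T \<in> gmod_hom S U V" "bij_betw T (carrier U) (carrier V)"
  shows "character_of S U = character_of S V"
proof
  interpret U: gmodule S U by (rule irreducible_gmoduleD(1)[OF U])
  interpret V: gmodule S V by (rule irreducible_gmoduleD(1)[OF V])
  fix s
  obtain b l where fr: "frame U {..<vectorspace.dim class_ring U} b l" by (rule irreducible_frame[OF U])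
  note fr' = frame_transfer[OF fr gmod_homD(1)[OF T(1)] T(2) U.V.fvs_axioms V.V.fvs_axioms]
  show "character_of S U s = character_of S V s"
  proof (cases "s \<in> carrier S")
    case True
    have "inv_into (carrier U) T (act V s (T (b j))) = act U s (b j)" if "j < vectorspace.dim class_ring U" for j
    proof -
      have bj: "b j \<in> carrier U" using frameD(2)[OF fr] that by simp
      have "act V s (T (b j)) = T (act U s (b j))" using gmod_homD(2)[OF T(1) True bj] by simp
      then show ?thesis using T(2) U.act_closed[OF True bj] by (simp add: bij_betw_def)
    qed
    then show ?thesis
      unfolding character_frame[OF U fr True] character_frame[OF V fr' True] by simp
  qed (simp add: character_of_def)
qed

definition transport :: "('u \<Rightarrow> 'v) \<Rightarrow> ('f, 'u, 's, 'a) gmodule_scheme \<Rightarrow> ('f, 'v, 's) gmodule" where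
  "transport k U = (let k' = inv_into (carrier U) k in
    \<lparr>carrier = k ` carrier U, mult = undefined, one = undefined, zero = k \<zero>\<^bsub>U\<^esub>,
     add = (\<lambda>x y. k (k' x \<oplus>\<^bsub>U\<^esub> k' y)), smult = (\<lambda>c x. k (c \<odot>\<^bsub>U\<^esub> k' x)),
     act = (\<lambda>g x. k (act U g (k' x)))\<rparr>)"

lemma transport:
  assumes "gmodule S U" "inj_on k (carrier U)"
  shows "gmodule S (transport k U)" "k \<in> gmod_hom S U (transport k U)"
    "bij_betw k (carrier U) (carrier (transport k U))"
proof -
  interpret U: gmodule S U by fact
  have [simp]: "inv_into (carrier U) k (k u) = u" if "u \<in> carrier U" for u
    using assms(2) that by simp
  note [simp] = U.V.vsimps U.act_closed U.act_add U.act_smult U.act_one U.act_mult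
  have "fvs (transport k U)"
    by (rule fvsI) (auto simp: transport_def Let_def U.V.add.m_comm U.V.add.m_lcomm U.V.add.m_assoc)
  then show "gmodule S (transport k U)"
    by (intro gmodI) (auto simp: transport_def Let_def)
  show "k \<in> gmod_hom S U (transport k U)"
    by (intro gmod_homI lin_homI) (auto simp: transport_def Let_def)
  show "bij_betw k (carrier U) (carrier (transport k U))"
    using assms(2) by (auto simp: transport_def Let_def bij_betw_def)
qed

text \<open>\<open>Irr\<close> and \<open>splitting_field\<close> quantify over modules whose
  elements are vectors over F. Coordinates in a frame embed any irreducible module injectively into
  that type, and its structure is carried along.\<close>

lemma irreducible_vec_model:
  fixes U :: "('f, 'u, 's, 'a) gmodule_scheme"
  assumes U: "irreducible_gmodule S U"
  obtains k :: "'u \<Rightarrow> 'f vec" and U' :: "('f, 'f vec, 's) gmodule"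
  where "irreducible_gmodule S U'" "k \<in> gmod_hom S U U'" "bij_betw k (carrier U) (carrier U')"
    "character_of S U' = character_of S U"
proof -
  interpret U: gmodule S U by (rule irreducible_gmoduleD(1)[OF U])
  obtain b l where fr: "frame U {..<vectorspace.dim class_ring U} b l" by (rule irreducible_frame[OF U])
  let ?n = "vectorspace.dim class_ring U"
  let ?k = "\<lambda>u. vec ?n (\<lambda>j. l j u)"
  have inj: "inj_on ?k (carrier U)"
  proof (rule inj_onI)
    fix u v assume uv: "u \<in> carrier U" "v \<in> carrier U" "?k u = ?k v"
    have "l j u = l j v" if "j < ?n" for j using arg_cong[OF uv(3), of "\<lambda>x. x $ j"] that by simp
    then show "u = v" by (intro frame_eqI[OF fr uv(1,2) _ U.V.fvs_axioms]) simp
  qed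
  note t = transport[OF U.gmodule_axioms inj]
  have irr: "irreducible_gmodule S (transport ?k U)" by (rule irreducible_iso[OF U t])
  show thesis using that[OF irr t(2,3)] character_iso[OF U irr t(2,3)] by simp
qed

lemma character_in_Irr:
  fixes U :: "('f, 'u, 's, 'a) gmodule_scheme"
  assumes "irreducible_gmodule S U"
  shows "character_of S U \<in> Irr S"
proof -
  obtain k :: "'u \<Rightarrow> 'f vec" and U' :: "('f, 'f vec, 's) gmodule"
    where "irreducible_gmodule S U'" "character_of S U' = character_of S U"
    by (rule irreducible_vec_model[OF assms])
  then show ?thesis unfolding Irr_def by (metis (mono_tags, lifting) mem_Collect_eq)
qed

text \<open>The splitting hypothesis is applied to the copy of U from
  \<open>irreducible_vec_model\<close>, with T conjugated by the isomorphism.\<close>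

lemma Schur_scalar:
  fixes U :: "('f, 'u, 's, 'a) gmodule_scheme"
  assumes U: "irreducible_gmodule S U" and T: "T \<in> gmod_hom S U U"
  obtains c where "\<And>v. v \<in> carrier U \<Longrightarrow> T v = c \<odot>\<^bsub>U\<^esub> v"
proof -
  interpret U: gmodule S U by (rule irreducible_gmoduleD(1)[OF U])
  obtain k :: "'u \<Rightarrow> 'f vec" and U' :: "('f, 'f vec, 's) gmodule"
    where U': "irreducible_gmodule S U'" and k: "k \<in> gmod_hom S U U'" "bij_betw k (carrier U) (carrier U')"
    by (rule irreducible_vec_model[OF U])
  interpret U': gmodule S U' by (rule irreducible_gmoduleD(1)[OF U'])
  let ?k' = "inv_into (carrier U) k"
  note kh = gmod_homD[OF k(1)]
  have k'l: "?k' \<in> lin_hom U' U" by (rule lin_hom_inv_into[OF kh(1) k(2) U.V.fvs_axioms])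
  have k'k: "?k' (k u) = u" if "u \<in> carrier U" for u using k(2) that by (auto simp: bij_betw_def)
  have kk': "k (?k' u) = u" if "u \<in> carrier U'" for u
    using k(2) that by (auto simp: bij_betw_def intro: f_inv_into_f)
  have "?k' \<in> gmod_hom S U' U"
  proof (rule gmod_homI[OF k'l])
    fix g v assume gv: "g \<in> carrier S" "v \<in> carrier U'"
    have v: "?k' v \<in> carrier U" by (rule lin_homD(1)[OF k'l gv(2)])
    have "act U' g v = k (act U g (?k' v))" using kh(2)[OF gv(1) v] kk'[OF gv(2)] by simp
    then show "?k' (act U' g v) = act U g (?k' v)" using k'k U.act_closed[OF gv(1) v] by simp
  qed
  from gmod_hom_comp[OF gmod_hom_comp[OF this T] k(1)]
  have "(\<lambda>x. k (T (?k' x))) \<in> gmod_hom S U' U'" .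
  moreover have "\<forall>T\<in>gmod_hom S U' U'. \<exists>c. \<forall>v\<in>carrier U'. T v = c \<odot>\<^bsub>U'\<^esub> v"
    using split[unfolded splitting_field_def, rule_format] U' by blast
  ultimately have "\<exists>c. \<forall>v\<in>carrier U'. k (T (?k' v)) = c \<odot>\<^bsub>U'\<^esub> v" by (rule bspec[rotated])
  then obtain c where c: "\<And>v. v \<in> carrier U' \<Longrightarrow> k (T (?k' v)) = c \<odot>\<^bsub>U'\<^esub> v"
    by blast
  show thesis
  proof (rule that)
    fix v assume v: "v \<in> carrier U"
    have kv: "k v \<in> carrier U'" by (rule lin_homD(1)[OF kh(1) v])
    have Tv: "T v \<in> carrier U" by (rule lin_homD(1)[OF gmod_homD(1)[OF T] v])
    have "k (T v) = k (c \<odot>\<^bsub>U\<^esub> v)" using c[OF kv] k'k[OF v] lin_homD(3)[OF kh(1) v] by simp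
    then show "T v = c \<odot>\<^bsub>U\<^esub> v" using k(2) Tv U.V.smult_closed'[OF v] by (metis k'k)
  qed
qed

end

section \<open>Orthogonality relations\<close>

text \<open>The sum over s of the maps s E s^-1, where E is the rank one map u -> l(u) w. Every such
  sum intertwines U and V, so Schur's lemma computes it.\<close>

definition average ::
    "('s, 'm) monoid_scheme \<Rightarrow> ('f::field, 'u, 's, 'a) gmodule_scheme \<Rightarrow> ('f, 'v, 's, 'c) gmodule_scheme \<Rightarrow>
     ('u \<Rightarrow> 'f) \<Rightarrow> 'v \<Rightarrow> 'u \<Rightarrow> 'v" where
  "average S U V l w u = (\<Oplus>\<^bsub>V\<^esub>s\<in>carrier S. l (act U (inv\<^bsub>S\<^esub> s) u) \<odot>\<^bsub>V\<^esub> act V s w)"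

context finite_rep
begin

lemma average_hom:
  fixes U :: "('f, 'u, 's, 'a) gmodule_scheme" and V :: "('f, 'v, 's, 'c) gmodule_scheme"
  assumes "gmodule S U" "gmodule S V" and l: "l \<in> lfun U" and w: "w \<in> carrier V"
  shows "average S U V l w \<in> gmod_hom S U V"
proof -
  interpret U: gmodule S U by fact
  interpret V: gmodule S V by fact
  have cl: "c \<odot>\<^bsub>V\<^esub> act V s w \<in> carrier V" if "s \<in> carrier S" for c s
    using that w by (simp add: V.V.vsimps V.act_closed)
  show ?thesis
  proof (intro gmod_homI lin_homI)
    fix u assume u: "u \<in> carrier U"
    show "average S U V l w u \<in> carrier V"
      unfolding average_def by (rule V.V.finsum_closed) (simp add: cl Pi_def)
    show "average S U V l w (c \<odot>\<^bsub>U\<^esub> u) = c \<odot>\<^bsub>V\<^esub> average S U V l w u" for c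
      unfolding average_def
      by (subst V.V.smult_finsum[OF fin], erule cl, rule V.V.finsum_cong')
        (use u w in \<open>auto simp: U.act_smult U.act_closed lfunD[OF l] V.V.vsimps V.act_closed\<close>)
    fix u' assume u': "u' \<in> carrier U"
    have "average S U V l w (u \<oplus>\<^bsub>U\<^esub> u') = (\<Oplus>\<^bsub>V\<^esub>s\<in>carrier S. l (act U (inv\<^bsub>S\<^esub> s) u) \<odot>\<^bsub>V\<^esub> act V s w
        \<oplus>\<^bsub>V\<^esub> l (act U (inv\<^bsub>S\<^esub> s) u') \<odot>\<^bsub>V\<^esub> act V s w)"
      unfolding average_def
      by (rule V.V.finsum_cong')
        (use u u' w in \<open>auto simp: U.act_add U.act_closed lfunD[OF l] V.V.vsimps V.act_closed\<close>)
    also have "\<dots> = average S U V l w u \<oplus>\<^bsub>V\<^esub> average S U V l w u'"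
      unfolding average_def by (rule V.V.finsum_addf) (simp_all add: cl Pi_def)
    finally show "average S U V l w (u \<oplus>\<^bsub>U\<^esub> u') = average S U V l w u \<oplus>\<^bsub>V\<^esub> average S U V l w u'" .
  next
    fix g u assume g: "g \<in> carrier S" and u: "u \<in> carrier U"
    have inj: "inj_on (\<lambda>s. g \<otimes>\<^bsub>S\<^esub> s) (carrier S)" using g by (auto intro!: inj_onI)
    have im: "(\<lambda>s. g \<otimes>\<^bsub>S\<^esub> s) ` carrier S = carrier S" using S.surj_const_mult[OF g] .
    have "average S U V l w (act U g u) = (\<Oplus>\<^bsub>V\<^esub>s\<in>(\<lambda>s. g \<otimes>\<^bsub>S\<^esub> s) ` carrier S.
        l (act U (inv\<^bsub>S\<^esub> s) (act U g u)) \<odot>\<^bsub>V\<^esub> act V s w)"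
      unfolding average_def im ..
    also have "\<dots> = (\<Oplus>\<^bsub>V\<^esub>s\<in>carrier S.
        l (act U (inv\<^bsub>S\<^esub> (g \<otimes>\<^bsub>S\<^esub> s)) (act U g u)) \<odot>\<^bsub>V\<^esub> act V (g \<otimes>\<^bsub>S\<^esub> s) w)"
      by (rule V.V.add.finprod_reindex[OF _ inj]) (use g cl in auto)
    also have "\<dots> = (\<Oplus>\<^bsub>V\<^esub>s\<in>carrier S. act V g (l (act U (inv\<^bsub>S\<^esub> s) u) \<odot>\<^bsub>V\<^esub> act V s w))"
      by (rule V.V.finsum_cong')
        (use g u w in \<open>auto simp: S.inv_mult_group U.act_mult U.act_closed V.act_mult V.act_smult V.act_closed V.V.vsimps\<close>)
    also have "\<dots> = act V g (average S U V l w u)"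
      unfolding average_def by (rule V.act_finsum[OF g fin cl, symmetric])
    finally show "average S U V l w (act U g u) = act V g (average S U V l w u)" .
  qed
qed

lemma average_lfun:
  fixes U :: "('f, 'u, 's, 'a) gmodule_scheme" and V :: "('f, 'v, 's, 'c) gmodule_scheme"
  assumes "gmodule S V" "m \<in> lfun V" "w \<in> carrier V"
  shows "m (average S U V l w u) = (\<Sum>s\<in>carrier S. l (act U (inv\<^bsub>S\<^esub> s) u) * m (act V s w))"
proof -
  interpret V: gmodule S V by fact
  show ?thesis unfolding average_def
    by (subst V.V.lfun_finsum[OF assms(2) fin])
      (use assms(3) in \<open>auto simp: V.V.vsimps V.act_closed lfunD[OF assms(2)]\<close>)
qed

lemma average_not_isomorphic:
  fixes U :: "('f, 'u, 's, 'a) gmodule_scheme" and V :: "('f, 'v, 's, 'c) gmodule_scheme"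
  assumes U: "irreducible_gmodule S U" and V: "irreducible_gmodule S V"
    and "\<not> gmod_isomorphic S U V" and l: "l \<in> lfun U" and w: "w \<in> carrier V" and u: "u \<in> carrier U"
  shows "average S U V l w u = \<zero>\<^bsub>V\<^esub>"
proof (rule ccontr)
  note h = average_hom[OF irreducible_gmoduleD(1)[OF U] irreducible_gmoduleD(1)[OF V] l w]
  assume "average S U V l w u \<noteq> \<zero>\<^bsub>V\<^esub>"
  from Schur_bij[OF U V h u this] h show False using assms(3) by (auto simp: gmod_isomorphic_def)
qed

lemma sum_inverse: "(\<Sum>s\<in>carrier S. h (inv\<^bsub>S\<^esub> s)) = (\<Sum>s\<in>carrier S. h s)"
  for h :: "'s \<Rightarrow> 'f"
  by (rule sum.reindex_bij_witness[of _ "\<lambda>s. inv\<^bsub>S\<^esub> s" "\<lambda>s. inv\<^bsub>S\<^esub> s"]) auto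

text \<open>By Schur's lemma the average is a scalar depending on m and w. A symmetry under s ->
  s^-1 shows this scalar to be \<kappa> m(w) with one constant \<kappa>, and summing over dual bases
  gives \<kappa> dim U = |S|; so \<kappa> is nonzero.\<close>

lemma average_irreducible:
  fixes U :: "('f, 'u, 's, 'a) gmodule_scheme"
  assumes U: "irreducible_gmodule S U" and fr: "frame U J b l"
  obtains \<kappa> where "\<kappa> \<noteq> 0" "\<kappa> * of_nat (card J) = of_nat (card (carrier S))"
    "\<forall>m\<in>lfun U. \<forall>w\<in>carrier U. \<forall>u\<in>carrier U. average S U U m w u = (\<kappa> * m w) \<odot>\<^bsub>U\<^esub> u"
proof -
  interpret U: gmodule S U by (rule irreducible_gmoduleD(1)[OF U])
  note f = frameD[OF fr]
  have "\<exists>c. \<forall>u\<in>carrier U. average S U U m w u = c \<odot>\<^bsub>U\<^esub> u"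
    if "m \<in> lfun U" "w \<in> carrier U" for m w
    by (rule Schur_scalar[OF U average_hom[OF U.gmodule_axioms U.gmodule_axioms that]]) auto
  then obtain c where c: "\<And>m w u. m \<in> lfun U \<Longrightarrow> w \<in> carrier U \<Longrightarrow> u \<in> carrier U \<Longrightarrow>
      average S U U m w u = c m w \<odot>\<^bsub>U\<^esub> u"
    by metis
  \<comment> \<open>Applying n to the average for (m, w) and substituting s^-1 for s exchanges (m,
    w) with (n, u).\<close>
  have sym: "c m w * n u = c n u * m w"
    if "m \<in> lfun U" "n \<in> lfun U" "w \<in> carrier U" "u \<in> carrier U" for m n w u
  proof -
    have "c m w * n u = n (average S U U m w u)" using c that lfunD(2)[OF that(2)] by simp
    also have "\<dots> = (\<Sum>s\<in>carrier S. m (act U (inv\<^bsub>S\<^esub> s) u) * n (act U s w))"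
      by (rule average_lfun[OF U.gmodule_axioms that(2,3)])
    also have "\<dots> = (\<Sum>s\<in>carrier S. n (act U (inv\<^bsub>S\<^esub> s) w) * m (act U s u))"
      by (subst sum_inverse[symmetric]) (simp add: mult.commute)
    also have "\<dots> = m (average S U U n u w)"
      by (rule average_lfun[OF U.gmodule_axioms that(1,4), symmetric])
    also have "\<dots> = c n u * m w" using c that lfunD(2)[OF that(1)] by simp
    finally show ?thesis .
  qed
  obtain u0 where u0: "u0 \<in> carrier U" "u0 \<noteq> \<zero>\<^bsub>U\<^esub>"
    using irreducible_gmoduleD(2)[OF U] U.V.zero_closed by blast
  have "\<exists>i\<in>J. l i u0 \<noteq> 0"
  proof (rule ccontr)
    assume "\<not> (\<exists>i\<in>J. l i u0 \<noteq> 0)"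
    then have "u0 = \<zero>\<^bsub>U\<^esub>"
      by (intro frame_eqI[OF fr u0(1) _ _ U.V.fvs_axioms]) (use U.V.lfun_zero[OF f(3)] in auto)
    then show False using u0 by simp
  qed
  then obtain i where i: "i \<in> J" "l i u0 \<noteq> 0" by blast
  \<comment> \<open>The choice n = l_i, u = b_i with l_i(b_i) = 1 in \<open>sym\<close> isolates the
    constant.\<close>
  define \<kappa> where "\<kappa> = c (l i) (b i)"
  have c\<kappa>: "c m w = \<kappa> * m w" if "m \<in> lfun U" "w \<in> carrier U" for m w
    using sym[OF that(1) f(3)[OF i(1)] that(2) f(2)[OF i(1)]] f(4)[OF i(1) i(1)] by (simp add: \<kappa>_def)
  \<comment> \<open>The maps u -> l_j(u) b_j add up to the identity, so their averages add up to |S|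
    times the identity. Evaluating with l_i at u0, where l_i(u0) is nonzero, allows
    cancellation.\<close>
  have "of_nat (card (carrier S)) * l i u0 = (\<Sum>s\<in>carrier S. l i (act U s (act U (inv\<^bsub>S\<^esub> s) u0)))"
    using u0 by simp
  also have "\<dots> = (\<Sum>s\<in>carrier S. \<Sum>j\<in>J. l j (act U (inv\<^bsub>S\<^esub> s) u0) * l i (act U s (b j)))"
    by (intro sum.cong refl lfun_expand[OF fr lfun_comp[OF U.act_lin_hom f(3)[OF i(1)]] _ U.V.fvs_axioms])
      (use u0 U.act_closed in auto)
  also have "\<dots> = (\<Sum>j\<in>J. l i (average S U U (l j) (b j) u0))"
    by (subst sum.swap) (intro sum.cong refl average_lfun[OF U.gmodule_axioms f(3)[OF i(1)] f(2), symmetric])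
  also have "\<dots> = (\<Sum>j\<in>J. \<kappa> * l i u0)"
    by (rule sum.cong) (use c c\<kappa> f u0 lfunD(2)[OF f(3)[OF i(1)]] in auto)
  finally have \<kappa>: "\<kappa> * of_nat (card J) = of_nat (card (carrier S))"
    using i(2) by (simp add: mult.commute)
  then have "\<kappa> \<noteq> 0" using card_nz by auto
  then show thesis using that[OF _ \<kappa>] c c\<kappa> by simp
qed

text \<open>Writing both characters as traces over frames reduces the orthogonality of characters to
  averages of rank one maps.\<close>

lemma character_product:
  fixes U :: "('f, 'u, 's, 'a) gmodule_scheme" and V :: "('f, 'v, 's, 'c) gmodule_scheme"
  assumes U: "irreducible_gmodule S U" and V: "irreducible_gmodule S V"
    and fr: "frame U J b l" and fr': "frame V K d m"
  shows "(\<Sum>s\<in>carrier S. character_of S U (inv\<^bsub>S\<^esub> s) * character_of S V s) =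
    (\<Sum>i\<in>J. \<Sum>k\<in>K. m k (average S U V (l i) (d k) (b i)))"
proof -
  note f = frameD[OF fr] and f' = frameD[OF fr']
  have "(\<Sum>s\<in>carrier S. character_of S U (inv\<^bsub>S\<^esub> s) * character_of S V s) =
      (\<Sum>s\<in>carrier S. \<Sum>i\<in>J. \<Sum>k\<in>K. l i (act U (inv\<^bsub>S\<^esub> s) (b i)) * m k (act V s (d k)))"
    by (intro sum.cong refl) (simp add: character_frame[OF U fr] character_frame[OF V fr'] sum_product)
  also have "\<dots> = (\<Sum>i\<in>J. \<Sum>k\<in>K. \<Sum>s\<in>carrier S. l i (act U (inv\<^bsub>S\<^esub> s) (b i)) * m k (act V s (d k)))"
    by (subst sum.swap, intro sum.cong refl, rule sum.swap)
  also have "\<dots> = (\<Sum>i\<in>J. \<Sum>k\<in>K. m k (average S U V (l i) (d k) (b i)))"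
    by (intro sum.cong refl average_lfun[OF irreducible_gmoduleD(1)[OF V] f'(3) f'(2), symmetric])
  finally show ?thesis .
qed

lemma character_orthogonal:
  fixes U :: "('f, 'u, 's, 'a) gmodule_scheme" and V :: "('f, 'v, 's, 'c) gmodule_scheme"
  assumes U: "irreducible_gmodule S U" and V: "irreducible_gmodule S V" and "\<not> gmod_isomorphic S U V"
  shows "(\<Sum>s\<in>carrier S. character_of S U (inv\<^bsub>S\<^esub> s) * character_of S V s) = 0"
proof -
  obtain b l where fr: "frame U {..<vectorspace.dim class_ring U} b l" by (rule irreducible_frame[OF U])
  obtain d m where fr': "frame V {..<vectorspace.dim class_ring V} d m" by (rule irreducible_frame[OF V])
  interpret V: gmodule S V by (rule irreducible_gmoduleD(1)[OF V])
  note f = frameD[OF fr] and f' = frameD[OF fr']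
  show ?thesis unfolding character_product[OF U V fr fr']
    by (intro sum.neutral ballI)
      (simp add: average_not_isomorphic[OF U V assms(3) f(3) f'(2) f(2)] V.V.lfun_zero[OF f'(3)])
qed

lemma character_norm:
  fixes U :: "('f, 'u, 's, 'a) gmodule_scheme"
  assumes U: "irreducible_gmodule S U"
  shows "(\<Sum>s\<in>carrier S. character_of S U (inv\<^bsub>S\<^esub> s) * character_of S U s) = of_nat (card (carrier S))"
proof -
  obtain b l where fr: "frame U {..<vectorspace.dim class_ring U} b l" by (rule irreducible_frame[OF U])
  let ?J = "{..<vectorspace.dim class_ring U}"
  note f = frameD[OF fr]
  obtain \<kappa> where "\<kappa> \<noteq> 0" and \<kappa>: "\<kappa> * of_nat (card ?J) = of_nat (card (carrier S))"
    "\<forall>m\<in>lfun U. \<forall>w\<in>carrier U. \<forall>u\<in>carrier U. average S U U m w u = (\<kappa> * m w) \<odot>\<^bsub>U\<^esub> u"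
    by (rule average_irreducible[OF U fr])
  have "(\<Sum>k\<in>?J. l k (average S U U (l i) (b k) (b i))) = \<kappa>" if i: "i \<in> ?J" for i
  proof -
    have "(\<Sum>k\<in>?J. l k (average S U U (l i) (b k) (b i))) = (\<Sum>k\<in>?J. if k = i then \<kappa> else 0)"
      by (rule sum.cong) (use i \<kappa>(2) f lfunD(2)[OF f(3)] in auto)
    then show ?thesis using i by simp
  qed
  then have "(\<Sum>i\<in>?J. \<Sum>k\<in>?J. l k (average S U U (l i) (b k) (b i))) = of_nat (card ?J) * \<kappa>"
    by simp
  then show ?thesis unfolding character_product[OF U U fr fr] using \<kappa>(1) by (simp add: mult.commute)
qed

lemma isomorphic_if_character_eq:
  fixes U :: "('f, 'u, 's, 'a) gmodule_scheme" and V :: "('f, 'v, 's, 'c) gmodule_scheme"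
  assumes "irreducible_gmodule S U" "irreducible_gmodule S V" "character_of S U = character_of S V"
  shows "gmod_isomorphic S U V"
proof (rule ccontr)
  assume "\<not> gmod_isomorphic S U V"
  from character_orthogonal[OF assms(1,2) this] show False
    using character_norm[OF assms(2)] card_nz assms(3) by simp
qed

end

section \<open>Faithfulness of the irreducible modules on the group algebra\<close>

interpretation pm: vector_space "pscale :: 'f::field \<Rightarrow> ('x \<Rightarrow>\<^sub>0 'f) \<Rightarrow> _"
  by unfold_locales (simp_all add: pscale_simps)

interpretation pmp: vector_space_pair "pscale :: 'f::field \<Rightarrow> ('x \<Rightarrow>\<^sub>0 'f) \<Rightarrow> _"
    "pscale :: 'f::field \<Rightarrow> ('x \<Rightarrow>\<^sub>0 'f) \<Rightarrow> _" ..

text \<open>A member of least dimension is minimal under inclusion; everything takes place in the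
  span of a finite set. It provides the minimal left ideal of
  \<open>group_algebra_faithful\<close>.\<close>

lemma (in vector_space) minimal_subspace:
  assumes "finite T" "Z \<subseteq> span T" "P Z" and sub: "\<And>Y. P Y \<Longrightarrow> subspace Y"
  obtains Z0 where "P Z0" "\<And>Y. P Y \<Longrightarrow> Y \<subseteq> Z0 \<Longrightarrow> Y = Z0"
proof -
  obtain Z0 where Z0: "P Z0 \<and> Z0 \<subseteq> Z" and min: "\<And>Y. P Y \<and> Y \<subseteq> Z \<Longrightarrow> dim Z0 \<le> dim Y"
    using ex_has_least_nat[of "\<lambda>Y. P Y \<and> Y \<subseteq> Z" Z dim] assms(3) by blast
  have fin: "finite B" if "independent B" "B \<subseteq> Z" for B
    using independent_span_bound[OF assms(1) that(1)] that(2) assms(2) by blast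
  show thesis
  proof (rule that)
    show "P Z0" using Z0 by simp
    fix Y assume Y: "P Y" "Y \<subseteq> Z0"
    show "Y = Z0"
    proof (rule ccontr)
      assume "Y \<noteq> Z0"
      then obtain z where z: "z \<in> Z0" "z \<notin> Y" using Y(2) by blast
      obtain B where B: "B \<subseteq> Y" "independent B" "Y \<subseteq> span B" "card B = dim Y" by (rule basis_exists)
      obtain C where C: "C \<subseteq> Z0" "independent C" "Z0 \<subseteq> span C" "card C = dim Z0" by (rule basis_exists)
      have "z \<notin> span B" using span_minimal[OF B(1) sub[OF Y(1)]] z(2) by blast
      then have "independent (insert z B)" using B(2) by (rule independent_insertI)
      moreover have "insert z B \<subseteq> span C" using z(1) B(1) Y(2) C(3) by blast
      moreover have "finite C" "finite B" using fin[OF C(2)] fin[OF B(2)] C(1) B(1) Y(2) Z0 by blast+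
      ultimately have "card (insert z B) \<le> card C" using independent_span_bound[of C "insert z B"] by blast
      moreover have "z \<notin> B" using z(2) B(1) by blast
      ultimately have "dim Y < dim Z0" using \<open>finite B\<close> B(4) C(4) by simp
      then show False using min[of Y] Y Z0 by auto
    qed
  qed
qed

lemma (in gmodule) ext_translate:
  assumes "kys q \<subseteq> carrier G" "g \<in> carrier G" "v \<in> carrier V"
  shows "ext V (\<lambda>s. act V s v) (linear_extension (\<lambda>t. g \<otimes>\<^bsub>G\<^esub> t) q) = act V g (ext V (\<lambda>s. act V s v) q)"
  using assms(1)
proof (induction rule: poly_mapping_single_induct)
  case zero
  then show ?case using assms(2) by (simp add: V.ext_zero act_zero)
next
  case (add q x c)
  have cl: "act V s v \<in> carrier V" if "s \<in> carrier G" for s using act_closed[OF that assms(3)] .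
  have gx: "g \<otimes>\<^bsub>G\<^esub> x \<in> carrier G" using assms(2) add(2) by simp
  have k: "kys (linear_extension (\<lambda>t. g \<otimes>\<^bsub>G\<^esub> t) q) \<subseteq> carrier G"
    by (rule keys_linear_extension[OF add(1)]) (use assms(2) in simp)
  have qc: "ext V (\<lambda>s. act V s v) q \<in> carrier V"
    by (rule V.ext_closed[OF _ add(1)]) (rule cl)
  have "ext V (\<lambda>s. act V s v) (linear_extension (\<lambda>t. g \<otimes>\<^bsub>G\<^esub> t) (q + Poly_Mapping.single x c)) =
      ext V (\<lambda>s. act V s v) (linear_extension (\<lambda>t. g \<otimes>\<^bsub>G\<^esub> t) q) \<oplus>\<^bsub>V\<^esub> c \<odot>\<^bsub>V\<^esub> act V (g \<otimes>\<^bsub>G\<^esub> x) v"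
    using V.ext_add[where \<tau> = "\<lambda>s. act V s v", OF cl k keys_single_subset[OF gx]]
      V.ext_single[where \<tau> = "\<lambda>s. act V s v" and x = "g \<otimes>\<^bsub>G\<^esub> x", OF cl[OF gx]]
    by (simp add: linear_extension_add)
  also have "\<dots> = act V g (ext V (\<lambda>s. act V s v) q \<oplus>\<^bsub>V\<^esub> c \<odot>\<^bsub>V\<^esub> act V x v)"
    using add.IH add(2) qc cl assms by (simp add: act_add act_smult act_mult V.vsimps)
  also have "ext V (\<lambda>s. act V s v) q \<oplus>\<^bsub>V\<^esub> c \<odot>\<^bsub>V\<^esub> act V x v = ext V (\<lambda>s. act V s v) (q + Poly_Mapping.single x c)"
    using V.ext_add[where \<tau> = "\<lambda>s. act V s v", OF cl add(1) keys_single_subset[OF add(2)]]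
      V.ext_single[where \<tau> = "\<lambda>s. act V s v" and x = x, OF cl[OF add(2)]] by simp
  finally show ?case .
qed

lemma gmod_hom_ext:
  assumes "T \<in> gmod_hom G U V" "gmodule G U" "gmodule G V" "kys q \<subseteq> carrier G" "u \<in> carrier U"
  shows "T (ext U (\<lambda>s. act U s u) q) = ext V (\<lambda>s. act V s (T u)) q"
proof -
  interpret U: gmodule G U by fact
  interpret V: gmodule G V by fact
  note T = gmod_homD[OF assms(1)]
  have s: "s \<in> carrier G" if "s \<in> kys q" for s using that assms(4) by blast
  have "T (ext U (\<lambda>s. act U s u) q) = (\<Oplus>\<^bsub>V\<^esub>s\<in>kys q. T (lkp q s \<odot>\<^bsub>U\<^esub> act U s u))"
    unfolding ext_def
    by (rule lin_hom_finsum[OF T(1) U.V.fvs_axioms V.V.fvs_axioms])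
      (use s assms(5) in \<open>simp_all add: U.V.vsimps U.act_closed\<close>)
  also have "\<dots> = ext V (\<lambda>s. act V s (T u)) q"
    unfolding ext_def
    by (rule V.V.finsum_cong')
      (use s assms(5) lin_homD[OF T(1)] in \<open>auto simp: V.V.vsimps V.act_closed U.act_closed T(2)\<close>)
  finally show ?thesis .
qed

text \<open>A left ideal Z of the group algebra, regarded as a submodule of the regular
  module.\<close>

definition sub_regular :: "('s, 'm) monoid_scheme \<Rightarrow> ('s \<Rightarrow>\<^sub>0 'f) set \<Rightarrow> ('f::field, 's \<Rightarrow>\<^sub>0 'f, 's) gmodule" where
  "sub_regular S Z = \<lparr>carrier = Z, mult = undefined, one = undefined, zero = 0, add = (+), smult = pscale,
     act = (\<lambda>g. linear_extension (\<lambda>t. g \<otimes>\<^bsub>S\<^esub> t))\<rparr>"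

lemma sub_regular_sel [simp]:
  "carrier (sub_regular S Z) = Z" "zero (sub_regular S Z) = 0" "add (sub_regular S Z) = (+)"
  "smult (sub_regular S Z) = pscale" "act (sub_regular S Z) g = linear_extension (\<lambda>t. g \<otimes>\<^bsub>S\<^esub> t)"
  by (auto simp: sub_regular_def)

context finite_rep
begin

abbreviation translate where "translate g \<equiv> linear_extension (\<lambda>t. g \<otimes>\<^bsub>S\<^esub> t)"

lemma translate_mult:
  assumes "kys q \<subseteq> carrier S" "g \<in> carrier S" "h \<in> carrier S"
  shows "translate g (translate h q) = translate (g \<otimes>\<^bsub>S\<^esub> h) q"
  unfolding linear_extension_comp
  by (rule linear_extension_cong[OF assms(1)]) (use assms(2,3) in \<open>simp add: S.m_assoc\<close>)

lemma translate_one: "kys q \<subseteq> carrier S \<Longrightarrow> translate \<one>\<^bsub>S\<^esub> q = q"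
  by (subst (2) linear_extension_ident[symmetric], rule linear_extension_cong) auto

lemma keys_translate: "kys q \<subseteq> carrier S \<Longrightarrow> g \<in> carrier S \<Longrightarrow> kys (translate g q) \<subseteq> carrier S"
  by (rule keys_linear_extension) auto

lemma gmodule_sub_regular:
  assumes "pm.subspace Z" and "Z \<subseteq> {q. kys q \<subseteq> carrier S}" "\<And>g z. g \<in> carrier S \<Longrightarrow> z \<in> Z \<Longrightarrow> translate g z \<in> Z"
  shows "gmodule S (sub_regular S (Z :: ('s \<Rightarrow>\<^sub>0 'f) set))"
proof -
  have k: "kys z \<subseteq> carrier S" if "z \<in> Z" for z using assms(2) that by blast
  have "fvs (sub_regular S Z)"
    by (rule fvsI) (use pm.subspace_0[OF assms(1)] pm.subspace_add[OF assms(1)] pm.subspace_scale[OF assms(1)]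
      in \<open>simp_all add: pscale_simps algebra_simps\<close>)
  then show ?thesis
    by (intro gmodI S.is_group)
      (simp_all add: assms(3) linear_extension_add linear_extension_scale translate_one[OF k] translate_mult[OF k, symmetric])
qed

text \<open>
  A nonzero minimal left ideal \<open>Z\<close> of the ideal of elements acting as zero on all irreducible modules
  is itself irreducible, hence killed by \<open>Z\<close>; but the averaged projection onto \<open>Z\<close> shows that every
  \<open>z \<in> Z\<close> is, up to the factor \<open>card S\<close>, the product of \<open>z\<close> with an element of \<open>Z\<close>.
\<close>

lemma group_algebra_faithful:
  fixes U :: "('s \<Rightarrow> 'f) \<Rightarrow> ('f, 'u, 's, 'a) gmodule_scheme"
  assumes U: "\<And>\<chi>. \<chi> \<in> Irr S \<Longrightarrow> irreducible_gmodule S (U \<chi>)" "\<And>\<chi>. \<chi> \<in> Irr S \<Longrightarrow> character_of S (U \<chi>) = \<chi>"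
    and p: "kys p \<subseteq> carrier S"
    "\<And>\<chi> v. \<chi> \<in> Irr S \<Longrightarrow> v \<in> carrier (U \<chi>) \<Longrightarrow> ext (U \<chi>) (\<lambda>s. act (U \<chi>) s v) p = \<zero>\<^bsub>U \<chi>\<^esub>"
  shows "p = 0"
proof (rule ccontr)
  assume p0: "p \<noteq> 0"
  define N where "N = {q :: 's \<Rightarrow>\<^sub>0 'f. kys q \<subseteq> carrier S \<and>
    (\<forall>\<chi>\<in>Irr S. \<forall>v\<in>carrier (U \<chi>). ext (U \<chi>) (\<lambda>s. act (U \<chi>) s v) q = \<zero>\<^bsub>U \<chi>\<^esub>)}"
  have gU: "gmodule S (U \<chi>)" if "\<chi> \<in> Irr S" for \<chi> using irreducible_gmoduleD(1)[OF U(1)[OF that]] .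
  have Nk: "kys q \<subseteq> carrier S" if "q \<in> N" for q using that by (simp add: N_def)
  have Ne: "ext (U \<chi>) (\<lambda>s. act (U \<chi>) s v) q = \<zero>\<^bsub>U \<chi>\<^esub>" if "q \<in> N" "\<chi> \<in> Irr S" "v \<in> carrier (U \<chi>)" for q \<chi> v
    using that by (simp add: N_def)
  have NI: "q \<in> N" if "kys q \<subseteq> carrier S"
    "\<And>\<chi> v. \<lbrakk>\<chi> \<in> Irr S; v \<in> carrier (U \<chi>); gmodule S (U \<chi>)\<rbrakk> \<Longrightarrow> ext (U \<chi>) (\<lambda>s. act (U \<chi>) s v) q = \<zero>\<^bsub>U \<chi>\<^esub>" for q
    using that gU by (simp add: N_def)
  have N_sub: "pm.subspace N"
  proof (rule pm.subspaceI)
    show "0 \<in> N"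
      by (rule NI) (simp_all add: fvs.ext_zero[OF gmodule_fvs])
    show "x + y \<in> N" if xy: "x \<in> N" "y \<in> N" for x y
    proof (rule NI)
      show "kys (x + y) \<subseteq> carrier S" by (rule keys_add_subset[OF Nk[OF xy(1)] Nk[OF xy(2)]])
      fix \<chi> v assume \<chi>: "\<chi> \<in> Irr S" "v \<in> carrier (U \<chi>)" "gmodule S (U \<chi>)"
      interpret gmodule S "U \<chi>" by (rule \<chi>(3))
      show "ext (U \<chi>) (\<lambda>s. act (U \<chi>) s v) (x + y) = \<zero>\<^bsub>U \<chi>\<^esub>"
        by (subst V.ext_add[OF _ Nk[OF xy(1)] Nk[OF xy(2)]]) (simp_all add: act_closed \<chi>(2) Ne[OF xy(1) \<chi>(1,2)] Ne[OF xy(2) \<chi>(1,2)])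
    qed
    show "pscale c x \<in> N" if x: "x \<in> N" for c x
    proof (rule NI)
      show "kys (pscale c x) \<subseteq> carrier S" by (rule keys_pscale_subset[OF Nk[OF x]])
      fix \<chi> v assume \<chi>: "\<chi> \<in> Irr S" "v \<in> carrier (U \<chi>)" "gmodule S (U \<chi>)"
      interpret gmodule S "U \<chi>" by (rule \<chi>(3))
      show "ext (U \<chi>) (\<lambda>s. act (U \<chi>) s v) (pscale c x) = \<zero>\<^bsub>U \<chi>\<^esub>"
        by (subst V.ext_scale[OF _ Nk[OF x]]) (simp_all add: act_closed \<chi>(2) Ne[OF x \<chi>(1,2)] V.vsimps)
    qed
  qed
  have N_inv: "translate g x \<in> N" if g: "g \<in> carrier S" and x: "x \<in> N" for g x
  proof (rule NI)
    show "kys (translate g x) \<subseteq> carrier S" by (rule keys_translate[OF Nk[OF x] g])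
    fix \<chi> v assume \<chi>: "\<chi> \<in> Irr S" "v \<in> carrier (U \<chi>)" "gmodule S (U \<chi>)"
    interpret gmodule S "U \<chi>" by (rule \<chi>(3))
    show "ext (U \<chi>) (\<lambda>s. act (U \<chi>) s v) (translate g x) = \<zero>\<^bsub>U \<chi>\<^esub>"
      by (subst ext_translate[OF Nk[OF x] g \<chi>(2)]) (simp add: Ne[OF x \<chi>(1,2)] act_zero[OF g])
  qed
  define P where "P Z \<longleftrightarrow> pm.subspace Z \<and> Z \<noteq> {0} \<and> Z \<subseteq> N \<and> (\<forall>g\<in>carrier S. \<forall>z\<in>Z. translate g z \<in> Z)"
    for Z :: "('s \<Rightarrow>\<^sub>0 'f) set"
  have "q \<in> pm.span (symb ` carrier S)" if "kys q \<subseteq> carrier S" for q :: "'s \<Rightarrow>\<^sub>0 'f"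
    using that
  proof (induction rule: poly_mapping_single_induct)
    case (add q x c)
    have "pscale c (symb x) \<in> pm.span (symb ` carrier S)"
      by (intro pm.span_scale pm.span_base imageI add(2))
    then show ?case using pm.span_add[OF add(3)] by (simp add: pscale_simps)
  qed (rule pm.span_zero)
  then have N_span: "N \<subseteq> pm.span (symb ` carrier S)" using Nk by blast
  have "p \<in> N" using p by (intro NI) auto
  then have "P N" unfolding P_def using p0 N_sub N_inv by blast
  then obtain Z where PZ: "P Z" and Zmin: "\<And>Y. P Y \<Longrightarrow> Y \<subseteq> Z \<Longrightarrow> Y = Z"
    using pm.minimal_subspace[OF finite_imageI[OF fin] N_span, of P] by (metis P_def)
  have Z: "pm.subspace Z" "Z \<noteq> {0}" "Z \<subseteq> N" "\<And>g z. g \<in> carrier S \<Longrightarrow> z \<in> Z \<Longrightarrow> translate g z \<in> Z"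
    using PZ by (auto simp: P_def)
  have Zk: "kys z \<subseteq> carrier S" if "z \<in> Z" for z using Nk Z(3) that by blast
  have gZ: "gmodule S (sub_regular S Z)"
    by (rule gmodule_sub_regular[OF Z(1) _ Z(4)]) (use Zk in auto)
  have irr: "irreducible_gmodule S (sub_regular S Z)"
  proof (rule irreducible_gmoduleI[OF gZ])
    show "carrier (sub_regular S Z) \<noteq> {\<zero>\<^bsub>sub_regular S Z\<^esub>}" using Z(2) by simp
    fix Y assume Y: "lin_closed (sub_regular S Z) Y"
      "\<And>g v. g \<in> carrier S \<Longrightarrow> v \<in> Y \<Longrightarrow> act (sub_regular S Z) g v \<in> Y" "Y \<noteq> {\<zero>\<^bsub>sub_regular S Z\<^esub>}"
    note Yl = lin_closedD[OF Y(1)]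
    have YZ: "Y \<subseteq> Z" using Yl(1) by simp
    have "pm.subspace Y" by (rule pm.subspaceI) (use Yl(2,3,4) in simp_all)
    then have "P Y" unfolding P_def using Y(2,3) YZ Z(3) by simp
    then show "carrier (sub_regular S Z) \<subseteq> Y" using Zmin[OF _ YZ] by simp
  qed
  interpret Z: gmodule S "sub_regular S Z" by (rule gZ)
  define \<chi> where "\<chi> = character_of S (sub_regular S Z)"
  have \<chi>: "\<chi> \<in> Irr S" unfolding \<chi>_def by (rule character_in_Irr[OF irr])
  obtain T where T: "T \<in> gmod_hom S (U \<chi>) (sub_regular S Z)"
    "bij_betw T (carrier (U \<chi>)) (carrier (sub_regular S Z))"
    using isomorphic_if_character_eq[OF U(1)[OF \<chi>] irr] U(2)[OF \<chi>] unfolding \<chi>_def gmod_isomorphic_def by blast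
  \<comment> \<open>Equality of characters makes Z isomorphic to one of the U \<chi>, and N acts as
    zero on all of these.\<close>
  have kill: "ext (sub_regular S Z) (\<lambda>s. translate s y) q = 0" if y: "y \<in> Z" and q: "q \<in> N" for y q
  proof -
    have "y \<in> T ` carrier (U \<chi>)" using T(2) y by (simp add: bij_betw_def)
    then obtain u where u: "u \<in> carrier (U \<chi>)" "y = T u" by blast
    have "ext (sub_regular S Z) (\<lambda>s. translate s y) q = T (ext (U \<chi>) (\<lambda>s. act (U \<chi>) s u) q)"
      using gmod_hom_ext[OF T(1) gU[OF \<chi>] gZ Nk[OF q] u(1)] u(2) by simp
    also have "\<dots> = 0"
      using lin_hom_zero[OF gmod_homD(1)[OF T(1)] gmodule_fvs[OF gU[OF \<chi>]] Z.V.fvs_axioms] Ne[OF q \<chi> u(1)] by simp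
    finally show ?thesis .
  qed
  have idl: "Vector_Spaces.linear pscale pscale (\<lambda>x :: 's \<Rightarrow>\<^sub>0 'f. x)"
    by (rule pm.linear_ident)
  obtain \<pi> :: "('s \<Rightarrow>\<^sub>0 'f) \<Rightarrow> ('s \<Rightarrow>\<^sub>0 'f)" where \<pi>: "range \<pi> \<subseteq> Z" "Vector_Spaces.linear pscale pscale \<pi>" "\<forall>z\<in>Z. \<pi> z = z"
    using pmp.linear_exists_left_inverse_on[OF idl Z(1)] by auto
  interpret \<pi>: Vector_Spaces.linear pscale pscale \<pi> by (rule \<pi>(2))
  \<comment> \<open>The sum of the conjugates of \<pi>, not divided by |S|. It commutes with left
    translation and is therefore right multiplication by \<rho>(1), an element of Z.\<close>
  define \<rho> where "\<rho> x = (\<Sum>s\<in>carrier S. translate s (\<pi> (translate (inv\<^bsub>S\<^esub> s) x)))" for x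
  have \<pi>Z: "\<pi> x \<in> Z" for x using \<pi>(1) by blast
  have \<rho>Z: "\<rho> x \<in> Z" for x unfolding \<rho>_def by (intro pm.subspace_sum[OF Z(1)] Z(4) \<pi>Z)
  have \<rho>_add: "\<rho> (x + y) = \<rho> x + \<rho> y" for x y
    by (simp add: \<rho>_def linear_extension_add \<pi>.add sum.distrib)
  have \<rho>_scale: "\<rho> (pscale c x) = pscale c (\<rho> x)" for c x
    by (simp add: \<rho>_def linear_extension_scale \<pi>.scale pm.scale_sum_right)
  have le_sum: "translate g (\<Sum>s\<in>A. F s) = (\<Sum>s\<in>A. translate g (F s))" for g A and F :: "'s \<Rightarrow> 's \<Rightarrow>\<^sub>0 'f"
    by (induction A rule: infinite_finite_induct) (simp_all add: linear_extension_add)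
  have \<rho>_translate: "\<rho> (translate g x) = translate g (\<rho> x)" if g: "g \<in> carrier S" and x: "kys x \<subseteq> carrier S" for g x
  proof -
    have "\<rho> (translate g x) = (\<Sum>s\<in>carrier S. translate (g \<otimes>\<^bsub>S\<^esub> s) (\<pi> (translate (inv\<^bsub>S\<^esub> (g \<otimes>\<^bsub>S\<^esub> s)) (translate g x))))"
      unfolding \<rho>_def
      by (rule sum.reindex_bij_witness[of _ "\<lambda>s. g \<otimes>\<^bsub>S\<^esub> s" "\<lambda>s. inv\<^bsub>S\<^esub> g \<otimes>\<^bsub>S\<^esub> s"])
        (use g in \<open>auto simp: S.m_assoc[symmetric]\<close>)
    also have "\<dots> = (\<Sum>s\<in>carrier S. translate g (translate s (\<pi> (translate (inv\<^bsub>S\<^esub> s) x))))"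
      by (intro sum.cong refl)
        (use g in \<open>simp add: translate_mult[OF x] translate_mult[OF Zk[OF \<pi>Z]] S.inv_mult_group S.m_assoc\<close>)
    finally show ?thesis by (simp add: \<rho>_def le_sum)
  qed
  have \<rho>_id: "\<rho> z = pscale (of_nat (card (carrier S))) z" if z: "z \<in> Z" for z
  proof -
    have "\<rho> z = (\<Sum>s\<in>carrier S. z)"
      unfolding \<rho>_def
      by (intro sum.cong refl) (use z \<pi>(3) Z(4) in \<open>simp add: translate_mult[OF Zk[OF z]] translate_one[OF Zk[OF z]]\<close>)
    also have "\<dots> = pscale (of_nat (card (carrier S))) z"
      by (rule poly_mapping_eqI) (simp add: lookup_pscale Poly_Mapping.lookup_sum)
    finally show ?thesis .
  qed
  have \<rho>_ext: "\<rho> x = ext (sub_regular S Z) (\<lambda>s. translate s (\<rho> (symb \<one>\<^bsub>S\<^esub>))) x" if "kys x \<subseteq> carrier S" for x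
    using that
  proof (induction rule: poly_mapping_single_induct)
    case zero
    then show ?case using \<rho>_scale[of 0 0] by (simp add: Z.V.ext_zero pscale_simps)
  next
    case (add x t c)
    have cl: "translate s (\<rho> (symb \<one>\<^bsub>S\<^esub>)) \<in> carrier (sub_regular S Z)" if "s \<in> carrier S" for s using Z(4)[OF that \<rho>Z] by simp
    have "\<rho> (symb t) = translate t (\<rho> (symb \<one>\<^bsub>S\<^esub>))" using \<rho>_translate[OF add(2), of "symb \<one>\<^bsub>S\<^esub>"] add(2) by simp
    then have "\<rho> (Poly_Mapping.single t c) = pscale c (translate t (\<rho> (symb \<one>\<^bsub>S\<^esub>)))"
      using \<rho>_scale[of c "symb t"] by (simp add: pscale_simps)
    then show ?case
      using Z.V.ext_add[where \<tau> = "\<lambda>s. translate s (\<rho> (symb \<one>\<^bsub>S\<^esub>))", OF cl add(1) keys_single_subset[OF add(2)]]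
        Z.V.ext_single[where \<tau> = "\<lambda>s. translate s (\<rho> (symb \<one>\<^bsub>S\<^esub>))" and x = t, OF cl[OF add(2)]] add.IH
      by (simp add: \<rho>_add)
  qed
  have "z = 0" if z: "z \<in> Z" for z
  proof -
    have "z \<in> N" using z Z(3) by blast
    have "pscale (of_nat (card (carrier S))) z = 0"
      using \<rho>_id[OF z] \<rho>_ext[OF Zk[OF z]] kill[OF \<rho>Z \<open>z \<in> N\<close>] by simp
    then show ?thesis using card_nz by simp
  qed
  then show False using Z(2) pm.subspace_0[OF Z(1)] by blast
qed

end

section \<open>Orthogonality over all irreducible characters\<close>

context finite_rep
begin

lemma Irr_orthogonal:
  assumes "\<chi> \<in> Irr S" "\<psi> \<in> Irr S"
  shows "(\<Sum>s\<in>carrier S. \<psi> (inv\<^bsub>S\<^esub> s) * \<chi> s) = (if \<chi> = \<psi> then of_nat (card (carrier S)) else (0::'f))"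
proof -
  obtain U V :: "('f, 'f vec, 's) gmodule" where U: "irreducible_gmodule S U" "\<psi> = character_of S U"
    and V: "irreducible_gmodule S V" "\<chi> = character_of S V"
    using assms unfolding Irr_def by blast
  show ?thesis
  proof (cases "gmod_isomorphic S U V")
    case True
    then have "\<chi> = \<psi>" using character_iso[OF U(1) V(1)] U(2) V(2) by (auto simp: gmod_isomorphic_def)
    then show ?thesis using character_norm[OF U(1)] U(2) by simp
  next
    case False
    have 0: "(\<Sum>s\<in>carrier S. \<psi> (inv\<^bsub>S\<^esub> s) * \<chi> s) = 0"
      using character_orthogonal[OF U(1) V(1) False] U(2) V(2) by simp
    moreover have "\<chi> \<noteq> \<psi>"
    proof
      assume "\<chi> = \<psi>"
      then show False using 0 character_norm[OF U(1)] U(2) card_nz by simp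
    qed
    ultimately show ?thesis by simp
  qed
qed

text \<open>Orthogonality makes the irreducible characters linearly independent; written as finitely
  supported functions on S they lie in a finite dimensional space.\<close>

lemma finite_Irr: "finite (Irr S :: ('s \<Rightarrow> 'f) set)"
proof -
  define P where "P \<chi> = (\<Sum>s\<in>carrier S. Poly_Mapping.single s (\<chi> s))" for \<chi> :: "'s \<Rightarrow> 'f"
  have lk: "lkp (P \<chi>) s = \<chi> s" if "s \<in> carrier S" for \<chi> s
    using that fin by (simp add: P_def lookup_sum lookup_single when_def)
  have inj: "inj_on P (Irr S)"
  proof (rule inj_onI)
    fix \<chi> \<psi> assume "\<chi> \<in> Irr S" "\<psi> \<in> Irr S" and eq: "P \<chi> = P \<psi>"
    then have "\<chi> \<in> extensional (carrier S)" "\<psi> \<in> extensional (carrier S)"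
      by (auto simp: Irr_def character_of_def)
    then show "\<chi> = \<psi>" by (rule extensionalityI) (metis lk eq)
  qed
  have "pm.independent (P ` Irr S)"
  proof
    assume "pm.dependent (P ` Irr S)"
    then obtain t u where t: "finite t" "t \<subseteq> P ` Irr S" "(\<Sum>v\<in>t. pscale (u v) v) = 0" "\<exists>v\<in>t. u v \<noteq> 0"
      unfolding pm.dependent_explicit by blast
    then obtain \<psi> where \<psi>: "\<psi> \<in> Irr S" "P \<psi> \<in> t" "u (P \<psi>) \<noteq> 0" by blast
    have "0 = (\<Sum>s\<in>carrier S. \<psi> (inv\<^bsub>S\<^esub> s) * lkp (\<Sum>v\<in>t. pscale (u v) v) s)"
      by (simp add: t(3))
    also have "\<dots> = (\<Sum>s\<in>carrier S. \<Sum>v\<in>t. u v * (\<psi> (inv\<^bsub>S\<^esub> s) * lkp v s))"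
      by (simp add: lookup_sum lookup_pscale sum_distrib_left mult.left_commute)
    also have "\<dots> = (\<Sum>v\<in>t. u v * (\<Sum>s\<in>carrier S. \<psi> (inv\<^bsub>S\<^esub> s) * lkp v s))"
      by (subst sum.swap) (simp add: sum_distrib_left)
    also have "\<dots> = (\<Sum>v\<in>t. if v = P \<psi> then u v * of_nat (card (carrier S)) else 0)"
    proof (rule sum.cong[OF refl])
      fix v assume "v \<in> t"
      then obtain \<chi> where \<chi>: "\<chi> \<in> Irr S" "v = P \<chi>" using t(2) by blast
      have "(\<Sum>s\<in>carrier S. \<psi> (inv\<^bsub>S\<^esub> s) * lkp v s) = (\<Sum>s\<in>carrier S. \<psi> (inv\<^bsub>S\<^esub> s) * \<chi> s)"
        by (rule sum.cong) (simp_all add: \<chi>(2) lk)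
      also have "\<dots> = (if v = P \<psi> then of_nat (card (carrier S)) else 0)"
        unfolding Irr_orthogonal[OF \<chi>(1) \<psi>(1)] \<chi>(2) using inj_on_eq_iff[OF inj \<chi>(1) \<psi>(1)] by simp
      finally show "u v * (\<Sum>s\<in>carrier S. \<psi> (inv\<^bsub>S\<^esub> s) * lkp v s) =
          (if v = P \<psi> then u v * of_nat (card (carrier S)) else 0)"
        by simp
    qed
    also have "\<dots> = u (P \<psi>) * of_nat (card (carrier S))" using t(1) \<psi>(2) by simp
    finally show False using \<psi>(3) card_nz by simp
  qed
  moreover have "P ` Irr S \<subseteq> pm.span (symb ` carrier S)"
  proof
    fix q assume "q \<in> P ` Irr S"
    then obtain \<chi> where "q = P \<chi>" by blast
    moreover have "Poly_Mapping.single s (\<chi> s) \<in> pm.span (symb ` carrier S)" if "s \<in> carrier S" for s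
    proof -
      have "pscale (\<chi> s) (symb s) \<in> pm.span (symb ` carrier S)"
        by (intro pm.span_scale pm.span_base imageI that)
      then show ?thesis by (simp add: pscale_simps)
    qed
    ultimately show "q \<in> pm.span (symb ` carrier S)" by (simp add: P_def pm.span_sum)
  qed
  ultimately have "finite (P ` Irr S)" using pm.independent_span_bound[OF finite_imageI[OF fin]] by blast
  then show ?thesis using inj by (rule finite_imageD)
qed

end

locale irreducible_family = finite_rep S ty
  for S :: "('s, 'm) monoid_scheme" and ty :: "'f::field itself" +
  fixes U :: "('s \<Rightarrow> 'f) \<Rightarrow> ('f, 'u, 's) gmodule"
  assumes irr: "\<chi> \<in> Irr S \<Longrightarrow> irreducible_gmodule S (U \<chi>)"
    and char: "\<chi> \<in> Irr S \<Longrightarrow> character_of S (U \<chi>) = \<chi>"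
begin

abbreviation deg where "deg \<chi> \<equiv> vectorspace.dim class_ring (U \<chi>)"

lemma not_isomorphic:
  assumes "\<chi> \<in> Irr S" "\<psi> \<in> Irr S" "\<chi> \<noteq> \<psi>"
  shows "\<not> gmod_isomorphic S (U \<chi>) (U \<psi>)"
proof
  assume "gmod_isomorphic S (U \<chi>) (U \<psi>)"
  then have "character_of S (U \<chi>) = character_of S (U \<psi>)"
    using character_iso[OF irr[OF assms(1)] irr[OF assms(2)]] by (auto simp: gmod_isomorphic_def)
  then show False using char assms by simp
qed

text \<open>The last fact is the expansion of the identity of FS by central idempotents: its inner
  sum is \<chi>(g), and 1/\<kappa>_\<chi> equals \<chi>(1)/|S| in F.\<close>

lemma orthogonality:
  obtains b :: "('s \<Rightarrow> 'f) \<Rightarrow> nat \<Rightarrow> 'u" and l :: "('s \<Rightarrow> 'f) \<Rightarrow> nat \<Rightarrow> 'u \<Rightarrow> 'f" and \<kappa> :: "('s \<Rightarrow> 'f) \<Rightarrow> 'f"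
  where "\<forall>\<chi>\<in>Irr S. frame (U \<chi>) {..<deg \<chi>} (b \<chi>) (l \<chi>)" "\<forall>\<chi>\<in>Irr S. \<kappa> \<chi> \<noteq> 0"
    "\<forall>\<chi>\<in>Irr S. \<forall>\<psi>\<in>Irr S. \<forall>m\<in>lfun (U \<chi>). \<forall>w\<in>carrier (U \<psi>). \<forall>v\<in>carrier (U \<chi>).
      average S (U \<chi>) (U \<psi>) m w v = (if \<chi> = \<psi> then (\<kappa> \<chi> * m w) \<odot>\<^bsub>U \<psi>\<^esub> v else \<zero>\<^bsub>U \<psi>\<^esub>)"
    "\<forall>g\<in>carrier S. (\<Sum>\<chi>\<in>Irr S. inverse (\<kappa> \<chi>) * (\<Sum>j<deg \<chi>. l \<chi> j (act (U \<chi>) g (b \<chi> j)))) =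
      (if g = \<one>\<^bsub>S\<^esub> then 1 else 0)"
proof -
  have gU: "gmodule S (U \<chi>)" if "\<chi> \<in> Irr S" for \<chi> using irreducible_gmoduleD(1)[OF irr[OF that]] .
  have "\<exists>bl. frame (U \<chi>) {..<deg \<chi>} (fst bl) (snd bl)" if \<chi>: "\<chi> \<in> Irr S" for \<chi>
  proof -
    obtain b l where "frame (U \<chi>) {..<deg \<chi>} b l" by (rule irreducible_frame[OF irr[OF \<chi>]])
    then show ?thesis by (intro exI[of _ "(b, l)"]) simp
  qed
  then obtain bl where bl: "\<And>\<chi>. \<chi> \<in> Irr S \<Longrightarrow> frame (U \<chi>) {..<deg \<chi>} (fst (bl \<chi>)) (snd (bl \<chi>))" by metis
  define b where "b \<chi> = fst (bl \<chi>)" for \<chi>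
  define l where "l \<chi> = snd (bl \<chi>)" for \<chi>
  have fr: "frame (U \<chi>) {..<deg \<chi>} (b \<chi>) (l \<chi>)" if "\<chi> \<in> Irr S" for \<chi> using bl[OF that] by (simp add: b_def l_def)
  have "\<exists>k. k \<noteq> 0 \<and> (\<forall>m\<in>lfun (U \<chi>). \<forall>w\<in>carrier (U \<chi>). \<forall>v\<in>carrier (U \<chi>).
      average S (U \<chi>) (U \<chi>) m w v = (k * m w) \<odot>\<^bsub>U \<chi>\<^esub> v)" if \<chi>: "\<chi> \<in> Irr S" for \<chi>
  proof -
    obtain k where "k \<noteq> 0" "k * of_nat (card {..<deg \<chi>}) = of_nat (card (carrier S))"
      "\<forall>m\<in>lfun (U \<chi>). \<forall>w\<in>carrier (U \<chi>). \<forall>v\<in>carrier (U \<chi>).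
        average S (U \<chi>) (U \<chi>) m w v = (k * m w) \<odot>\<^bsub>U \<chi>\<^esub> v"
      by (rule average_irreducible[OF irr[OF \<chi>] fr[OF \<chi>]])
    then show ?thesis by (intro exI[of _ k]) simp
  qed
  then obtain \<kappa> where \<kappa>0: "\<And>\<chi>. \<chi> \<in> Irr S \<Longrightarrow> \<kappa> \<chi> \<noteq> 0"
    and \<kappa>: "\<And>\<chi>. \<chi> \<in> Irr S \<Longrightarrow> \<forall>m\<in>lfun (U \<chi>). \<forall>w\<in>carrier (U \<chi>). \<forall>v\<in>carrier (U \<chi>).
      average S (U \<chi>) (U \<chi>) m w v = (\<kappa> \<chi> * m w) \<odot>\<^bsub>U \<chi>\<^esub> v"
    by metis
  have O: "average S (U \<chi>) (U \<psi>) m w v = (if \<chi> = \<psi> then (\<kappa> \<chi> * m w) \<odot>\<^bsub>U \<psi>\<^esub> v else \<zero>\<^bsub>U \<psi>\<^esub>)"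
    if "\<chi> \<in> Irr S" "\<psi> \<in> Irr S" "m \<in> lfun (U \<chi>)" "w \<in> carrier (U \<psi>)" "v \<in> carrier (U \<chi>)" for \<chi> \<psi> m w v
    using that \<kappa> average_not_isomorphic[OF irr[OF that(1)] irr[OF that(2)] not_isomorphic[OF that(1,2)] that(3-5)]
    by auto
  have chi: "\<chi> s = (\<Sum>j<deg \<chi>. l \<chi> j (act (U \<chi>) s (b \<chi> j)))" if "\<chi> \<in> Irr S" "s \<in> carrier S" for \<chi> s
    using character_frame[OF irr[OF that(1)] fr[OF that(1)] that(2)] char[OF that(1)] by simp
  \<comment> \<open>The coefficients of the sum of the central idempotents minus 1. This element
    will act as zero on every U \<chi>, so \<open>group_algebra_faithful\<close> makes it vanish.
    The argument g^-1 is undone when Q is evaluated at the inverse of g.\<close>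
  define Q where "Q g = (\<Sum>\<chi>\<in>Irr S. inverse (\<kappa> \<chi>) * \<chi> (inv\<^bsub>S\<^esub> g)) - (if g = \<one>\<^bsub>S\<^esub> then 1 else 0)" for g
  define q where "q = (\<Sum>s\<in>carrier S. Poly_Mapping.single s (Q s))"
  have lk: "lkp q s = (if s \<in> carrier S then Q s else 0)" for s
    using fin by (auto simp: q_def lookup_sum lookup_single when_def)
  have "q = 0"
  proof (rule group_algebra_faithful[of U, OF irr char])
    show kq: "kys q \<subseteq> carrier S" by (auto simp: in_keys_iff lk split: if_splits)
    fix \<chi> w assume \<chi>: "\<chi> \<in> Irr S" and w: "w \<in> carrier (U \<chi>)"
    interpret U: gmodule S "U \<chi>" by (rule gU[OF \<chi>])
    note f = frameD[OF fr[OF \<chi>]]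
    have cl: "act (U \<chi>) s w \<in> carrier (U \<chi>)" if "s \<in> carrier S" for s using U.act_closed[OF that w] .
    show "ext (U \<chi>) (\<lambda>s. act (U \<chi>) s w) q = \<zero>\<^bsub>U \<chi>\<^esub>"
    proof (rule frame_eqI[OF fr[OF \<chi>] _ _ _ U.V.fvs_axioms])
      show "ext (U \<chi>) (\<lambda>s. act (U \<chi>) s w) q \<in> carrier (U \<chi>)" by (rule U.V.ext_closed[OF _ kq]) (rule cl)
      fix i assume i: "i \<in> {..<deg \<chi>}"
      \<comment> \<open>The sum over s is an average of a rank one map; it survives for \<psi> =
        \<chi> only, and there the dual basis leaves the single term j = i.\<close>
      have other: "(\<Sum>j<deg \<psi>. \<Sum>s\<in>carrier S. l \<psi> j (act (U \<psi>) (inv\<^bsub>S\<^esub> s) (b \<psi> j)) * l \<chi> i (act (U \<chi>) s w)) =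
          (if \<psi> = \<chi> then \<kappa> \<chi> * l \<chi> i w else 0)" if \<psi>: "\<psi> \<in> Irr S" for \<psi>
      proof -
        note f' = frameD[OF fr[OF \<psi>]]
        have "(\<Sum>j<deg \<psi>. \<Sum>s\<in>carrier S. l \<psi> j (act (U \<psi>) (inv\<^bsub>S\<^esub> s) (b \<psi> j)) * l \<chi> i (act (U \<chi>) s w)) =
            (\<Sum>j<deg \<psi>. l \<chi> i (average S (U \<psi>) (U \<chi>) (l \<psi> j) w (b \<psi> j)))"
          by (rule sum.cong[OF refl]) (rule average_lfun[OF gU[OF \<chi>] f(3)[OF i] w, symmetric])
        also have "\<dots> = (\<Sum>j<deg \<psi>. if \<psi> = \<chi> then \<kappa> \<chi> * l \<chi> j w * l \<chi> i (b \<chi> j) else 0)"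
        proof (rule sum.cong[OF refl])
          fix j assume j: "j \<in> {..<deg \<psi>}"
          show "l \<chi> i (average S (U \<psi>) (U \<chi>) (l \<psi> j) w (b \<psi> j)) =
              (if \<psi> = \<chi> then \<kappa> \<chi> * l \<chi> j w * l \<chi> i (b \<chi> j) else 0)"
            using f'(2)[OF j] U.V.lfun_zero[OF f(3)[OF i]]
            by (subst O[OF \<psi> \<chi> f'(3)[OF j] w f'(2)[OF j]]) (auto simp: lfunD(2)[OF f(3)[OF i]])
        qed
        also have "\<dots> = (if \<psi> = \<chi> then \<kappa> \<chi> * l \<chi> i w else 0)"
        proof (cases "\<psi> = \<chi>")
          case True
          have "(\<Sum>j<deg \<chi>. \<kappa> \<chi> * l \<chi> j w * l \<chi> i (b \<chi> j)) = (\<Sum>j<deg \<chi>. if j = i then \<kappa> \<chi> * l \<chi> j w else 0)"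
            by (rule sum.cong[OF refl]) (use f(4)[OF i] in auto)
          then show ?thesis using True i by simp
        qed simp
        finally show ?thesis .
      qed
      have "l \<chi> i (ext (U \<chi>) (\<lambda>s. act (U \<chi>) s w) q) = (\<Sum>s\<in>carrier S. lkp q s * l \<chi> i (act (U \<chi>) s w))"
        by (rule U.V.lfun_ext[OF f(3)[OF i] fin kq cl])
      also have "\<dots> = (\<Sum>s\<in>carrier S. (\<Sum>\<psi>\<in>Irr S. inverse (\<kappa> \<psi>) * (\<Sum>j<deg \<psi>.
          l \<psi> j (act (U \<psi>) (inv\<^bsub>S\<^esub> s) (b \<psi> j)) * l \<chi> i (act (U \<chi>) s w))) -
          (if s = \<one>\<^bsub>S\<^esub> then l \<chi> i (act (U \<chi>) s w) else 0))"
        by (rule sum.cong[OF refl])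
          (simp add: lk Q_def chi left_diff_distrib sum_distrib_right mult.assoc cong: sum.cong)
      also have "\<dots> = (\<Sum>s\<in>carrier S. \<Sum>\<psi>\<in>Irr S. inverse (\<kappa> \<psi>) * (\<Sum>j<deg \<psi>.
          l \<psi> j (act (U \<psi>) (inv\<^bsub>S\<^esub> s) (b \<psi> j)) * l \<chi> i (act (U \<chi>) s w))) - l \<chi> i w"
        using fin w by (simp add: sum_subtractf U.act_one)
      also have "(\<Sum>s\<in>carrier S. \<Sum>\<psi>\<in>Irr S. inverse (\<kappa> \<psi>) * (\<Sum>j<deg \<psi>.
          l \<psi> j (act (U \<psi>) (inv\<^bsub>S\<^esub> s) (b \<psi> j)) * l \<chi> i (act (U \<chi>) s w))) =
          (\<Sum>\<psi>\<in>Irr S. inverse (\<kappa> \<psi>) * (\<Sum>j<deg \<psi>. \<Sum>s\<in>carrier S.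
          l \<psi> j (act (U \<psi>) (inv\<^bsub>S\<^esub> s) (b \<psi> j)) * l \<chi> i (act (U \<chi>) s w)))"
        by (subst sum.swap, rule sum.cong[OF refl], subst sum_distrib_left[symmetric], subst sum.swap, rule refl)
      also have "\<dots> = (\<Sum>\<psi>\<in>Irr S. if \<psi> = \<chi> then l \<chi> i w else 0)"
        by (rule sum.cong[OF refl]) (simp add: other \<kappa>0[OF \<chi>])
      also have "\<dots> = l \<chi> i w" using finite_Irr \<chi> by simp
      finally show "l \<chi> i (ext (U \<chi>) (\<lambda>s. act (U \<chi>) s w) q) = l \<chi> i \<zero>\<^bsub>U \<chi>\<^esub>"
        using U.V.lfun_zero[OF f(3)[OF i]] by simp
    qed simp
  qed
  have "(\<Sum>\<chi>\<in>Irr S. inverse (\<kappa> \<chi>) * (\<Sum>j<deg \<chi>. l \<chi> j (act (U \<chi>) g (b \<chi> j)))) =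
      (if g = \<one>\<^bsub>S\<^esub> then 1 else 0)" if g: "g \<in> carrier S" for g
  proof -
    have "Q (inv\<^bsub>S\<^esub> g) = 0" using lk[of "inv\<^bsub>S\<^esub> g"] \<open>q = 0\<close> g by simp
    then have "(\<Sum>\<chi>\<in>Irr S. inverse (\<kappa> \<chi>) * \<chi> g) = (if g = \<one>\<^bsub>S\<^esub> then 1 else 0)"
      using g by (simp add: Q_def)
    then show ?thesis using g by (simp add: chi cong: sum.cong)
  qed
  then show thesis using that[of b l \<kappa>] fr \<kappa>0 O by simp
qed

end

section \<open>Induced modules with a separated linear character\<close>

text \<open>\<open>separated\<close> is Mackey's irreducibility condition: for g outside I the
  character \<psi> and its conjugate by g differ on H \<inter> gHg^-1. \<open>locally_finite\<close>
  makes averaging over H possible although H may be infinite.\<close>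

locale separated_ind = ind_struct G I X V \<iota> p
  for G :: "('g, 'm) monoid_scheme" and I :: "'g set"
    and X :: "('f::field, 'x, 'g, 'c) gmodule_scheme" and V :: "('f, 'v, 'g, 'b) gmodule_scheme"
    and \<iota> :: "'x \<Rightarrow> 'v" and p :: "'v \<Rightarrow> 'x" +
  fixes H :: "'g set" and \<psi> :: "'g \<Rightarrow> 'f"
  assumes H_sub: "subgroup H G" "H \<subseteq> I"
    and \<psi>_hom: "\<psi> \<in> hom (G\<lparr>carrier := H\<rparr>) F_star"
    and X_act: "h \<in> H \<Longrightarrow> x \<in> carrier X \<Longrightarrow> act X h x = \<psi> h \<odot>\<^bsub>X\<^esub> x"
    and X_irr: "irreducible_gmodule (G\<lparr>carrier := I\<rparr>) X"
    and separated: "g \<in> carrier G \<Longrightarrow> g \<notin> I \<Longrightarrow>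
      \<exists>k\<in>H. \<exists>k'\<in>H. k \<otimes>\<^bsub>G\<^esub> g = g \<otimes>\<^bsub>G\<^esub> k' \<and> \<psi> k \<noteq> \<psi> k'"
    and locally_finite: "finite A \<Longrightarrow> A \<subseteq> H \<Longrightarrow>
      \<exists>K. subgroup K G \<and> A \<subseteq> K \<and> K \<subseteq> H \<and> finite K \<and> of_nat (card K) \<noteq> (0 :: 'f)"
begin

lemma H_closed: "h \<in> H \<Longrightarrow> h \<in> carrier G"
  using subgroup.subset[OF H_sub(1)] by blast

lemma \<psi>_mult: "h \<in> H \<Longrightarrow> k \<in> H \<Longrightarrow> \<psi> (h \<otimes>\<^bsub>G\<^esub> k) = \<psi> h * \<psi> k"
  using F_star_homD(2)[OF \<psi>_hom] by simp

lemma \<psi>_inv: "h \<in> H \<Longrightarrow> \<psi> (inv\<^bsub>G\<^esub> h) * \<psi> h = 1"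
  using \<psi>_mult[of "inv\<^bsub>G\<^esub> h" h] subgroup.m_inv_closed[OF H_sub(1)] H_closed
    F_star_homD(3)[OF \<psi>_hom subgroup.subgroup_is_group[OF H_sub(1) V.G.is_group]]
  by simp

text \<open>Up to the factor |K|, the projection onto the vectors on which the finite group K acts
  through \<psi>. The factor is divided out only where it is known to be nonzero in F.\<close>

definition isotypic :: "'g set \<Rightarrow> 'v \<Rightarrow> 'v" where
  "isotypic K v = (\<Oplus>\<^bsub>V\<^esub>k\<in>K. \<psi> (inv\<^bsub>G\<^esub> k) \<odot>\<^bsub>V\<^esub> act V k v)"

lemma isotypic_lin_hom:
  assumes "K \<subseteq> H" "finite K"
  shows "isotypic K \<in> lin_hom V V"
proof (rule lin_homI)
  have K: "k \<in> carrier G" if "k \<in> K" for k using that assms(1) H_closed by blast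
  have cl: "\<psi> (inv\<^bsub>G\<^esub> k) \<odot>\<^bsub>V\<^esub> act V k v \<in> carrier V" if "k \<in> K" "v \<in> carrier V" for k v
    using K that by (simp add: V.V.vsimps V.act_closed)
  fix v assume v: "v \<in> carrier V"
  show "isotypic K v \<in> carrier V"
    unfolding isotypic_def by (rule V.V.finsum_closed) (use cl v in \<open>simp add: Pi_def\<close>)
  show "isotypic K (c \<odot>\<^bsub>V\<^esub> v) = c \<odot>\<^bsub>V\<^esub> isotypic K v" for c
    unfolding isotypic_def
    by (subst V.V.smult_finsum[OF assms(2)], erule cl[OF _ v], rule V.V.finsum_cong')
      (use K v in \<open>auto simp: V.act_smult V.V.vsimps V.act_closed mult.commute\<close>)
  fix w assume w: "w \<in> carrier V"
  have "isotypic K (v \<oplus>\<^bsub>V\<^esub> w) = (\<Oplus>\<^bsub>V\<^esub>k\<in>K. \<psi> (inv\<^bsub>G\<^esub> k) \<odot>\<^bsub>V\<^esub> act V k v \<oplus>\<^bsub>V\<^esub> \<psi> (inv\<^bsub>G\<^esub> k) \<odot>\<^bsub>V\<^esub> act V k w)"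
    unfolding isotypic_def
    by (rule V.V.finsum_cong') (use K v w in \<open>auto simp: V.act_add V.V.vsimps V.act_closed\<close>)
  also have "\<dots> = isotypic K v \<oplus>\<^bsub>V\<^esub> isotypic K w"
    unfolding isotypic_def by (rule V.V.finsum_addf) (use cl v w in \<open>simp_all add: Pi_def\<close>)
  finally show "isotypic K (v \<oplus>\<^bsub>V\<^esub> w) = isotypic K v \<oplus>\<^bsub>V\<^esub> isotypic K w" .
qed

lemma isotypic_in:
  assumes "lin_closed V N" "\<And>g v. g \<in> carrier G \<Longrightarrow> v \<in> N \<Longrightarrow> act V g v \<in> N" "K \<subseteq> H" "finite K" "v \<in> N"
  shows "isotypic K v \<in> N"
  unfolding isotypic_def
  by (rule V.V.finsum_in_lin_closed[OF assms(1,4)])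
    (use assms(2,3,5) H_closed lin_closedD(4)[OF assms(1)] in blast)

lemma isotypic_\<iota>:
  assumes "K \<subseteq> H" "finite K" "x \<in> carrier X"
  shows "isotypic K (\<iota> x) = of_nat (card K) \<odot>\<^bsub>V\<^esub> \<iota> x"
proof -
  have "isotypic K (\<iota> x) = (\<Oplus>\<^bsub>V\<^esub>k\<in>K. 1 \<odot>\<^bsub>V\<^esub> \<iota> x)"
    unfolding isotypic_def
  proof (rule V.V.finsum_cong'[OF refl])
    fix k assume "k \<in> K"
    then have k: "k \<in> H" using assms(1) by blast
    have "act V k (\<iota> x) = \<iota> (\<psi> k \<odot>\<^bsub>X\<^esub> x)"
      using \<iota>_act[of k x] X_act[OF k assms(3)] k H_sub(2) assms(3) by auto
    also have "\<dots> = \<psi> k \<odot>\<^bsub>V\<^esub> \<iota> x" by (rule lin_homD(3)[OF \<iota>_hom assms(3)])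
    finally show "\<psi> (inv\<^bsub>G\<^esub> k) \<odot>\<^bsub>V\<^esub> act V k (\<iota> x) = 1 \<odot>\<^bsub>V\<^esub> \<iota> x"
      using \<iota>_closed[OF assms(3)] \<psi>_inv[OF k] by (simp add: V.V.vsimps)
  qed (use \<iota>_closed[OF assms(3)] in \<open>simp add: V.V.vsimps\<close>)
  also have "\<dots> = of_nat (card K) \<odot>\<^bsub>V\<^esub> \<iota> x"
    by (subst V.V.finsum_smult_left[OF assms(2) \<iota>_closed[OF assms(3)]]) simp
  finally show ?thesis .
qed

lemma isotypic_act:
  assumes K: "subgroup K G" "K \<subseteq> H" "finite K" and k: "k \<in> K" and v: "v \<in> carrier V"
  shows "isotypic K (act V k v) = \<psi> k \<odot>\<^bsub>V\<^esub> isotypic K v"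
proof -
  have Kc: "j \<in> carrier G" if "j \<in> K" for j using that subgroup.subset[OF K(1)] by blast
  have KH: "j \<in> H" if "j \<in> K" for j using that K(2) by blast
  have cl: "\<psi> (inv\<^bsub>G\<^esub> j) \<odot>\<^bsub>V\<^esub> act V j v \<in> carrier V" if "j \<in> K" for j
    using Kc[OF that] v by (simp add: V.V.vsimps V.act_closed)
  let ?r = "\<lambda>j. j \<otimes>\<^bsub>G\<^esub> k"
  have inj: "inj_on ?r K" using Kc k by (auto intro!: inj_onI)
  have im: "?r ` K = K"
    by (rule card_seteq[OF K(3)]) (use subgroup.m_closed[OF K(1)] k in \<open>auto simp: card_image[OF inj]\<close>)
  have "isotypic K (act V k v) = (\<Oplus>\<^bsub>V\<^esub>j\<in>K. \<psi> k \<odot>\<^bsub>V\<^esub> (\<psi> (inv\<^bsub>G\<^esub> (?r j)) \<odot>\<^bsub>V\<^esub> act V (?r j) v))"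
    unfolding isotypic_def
  proof (rule V.V.finsum_cong'[OF refl])
    fix j assume j: "j \<in> K"
    have ij: "inv\<^bsub>G\<^esub> j \<in> H" "inv\<^bsub>G\<^esub> k \<in> H" using KH[OF j] KH[OF k] subgroup.m_inv_closed[OF H_sub(1)] by auto
    have "\<psi> k * \<psi> (inv\<^bsub>G\<^esub> (?r j)) = (\<psi> (inv\<^bsub>G\<^esub> k) * \<psi> k) * \<psi> (inv\<^bsub>G\<^esub> j)"
      using Kc[OF j] Kc[OF k] ij by (simp add: V.G.inv_mult_group \<psi>_mult)
    then show "\<psi> (inv\<^bsub>G\<^esub> j) \<odot>\<^bsub>V\<^esub> act V j (act V k v) = \<psi> k \<odot>\<^bsub>V\<^esub> (\<psi> (inv\<^bsub>G\<^esub> (?r j)) \<odot>\<^bsub>V\<^esub> act V (?r j) v)"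
      using Kc[OF j] Kc[OF k] v \<psi>_inv[OF KH[OF k]] by (simp add: V.act_mult V.act_closed V.V.vsimps)
  qed (use Kc k v in \<open>auto simp: V.V.vsimps V.act_closed\<close>)
  also have "\<dots> = \<psi> k \<odot>\<^bsub>V\<^esub> (\<Oplus>\<^bsub>V\<^esub>j\<in>K. \<psi> (inv\<^bsub>G\<^esub> (?r j)) \<odot>\<^bsub>V\<^esub> act V (?r j) v)"
    by (rule V.V.smult_finsum[OF K(3), symmetric]) (use Kc k v in \<open>simp add: V.V.vsimps V.act_closed\<close>)
  also have "(\<Oplus>\<^bsub>V\<^esub>j\<in>K. \<psi> (inv\<^bsub>G\<^esub> (?r j)) \<odot>\<^bsub>V\<^esub> act V (?r j) v) =
      (\<Oplus>\<^bsub>V\<^esub>j\<in>?r ` K. \<psi> (inv\<^bsub>G\<^esub> j) \<odot>\<^bsub>V\<^esub> act V j v)"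
    by (rule V.V.add.finprod_reindex[OF _ inj, symmetric]) (use cl im in \<open>simp add: Pi_def\<close>)
  finally show ?thesis unfolding im isotypic_def .
qed

text \<open>A generator g \<iota>(x) with g outside I is annihilated as soon as K contains a
  separating element for g. A vector is a finite combination of generators, so finitely many such
  elements, collected in A, suffice.\<close>

lemma isotypic_eq:
  assumes "v \<in> carrier V"
  shows "\<exists>A. finite A \<and> A \<subseteq> H \<and> (\<forall>K. subgroup K G \<and> A \<subseteq> K \<and> K \<subseteq> H \<and> finite K \<longrightarrow>
    isotypic K v = of_nat (card K) \<odot>\<^bsub>V\<^esub> \<iota> (p v))"
proof -
  define good where "good A v \<longleftrightarrow> finite A \<and> A \<subseteq> H \<and> (\<forall>K. subgroup K G \<and> A \<subseteq> K \<and> K \<subseteq> H \<and> finite K \<longrightarrow>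
    isotypic K v = of_nat (card K) \<odot>\<^bsub>V\<^esub> \<iota> (p v))" for A v
  have \<iota>0: "\<iota> \<zero>\<^bsub>X\<^esub> = \<zero>\<^bsub>V\<^esub>" by (rule lin_hom_zero[OF \<iota>_hom W.V.fvs_axioms V.V.fvs_axioms])
  have p0: "p \<zero>\<^bsub>V\<^esub> = \<zero>\<^bsub>X\<^esub>" by (rule lin_hom_zero[OF p_hom V.V.fvs_axioms W.V.fvs_axioms])
  have goodI: "good A v" if "finite A" "A \<subseteq> H"
    "\<And>K. \<lbrakk>subgroup K G; A \<subseteq> K; K \<subseteq> H; finite K; isotypic K \<in> lin_hom V V\<rbrakk> \<Longrightarrow>
      isotypic K v = of_nat (card K) \<odot>\<^bsub>V\<^esub> \<iota> (p v)" for A v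
    using that isotypic_lin_hom by (auto simp: good_def)
  have goodD: "isotypic K v = of_nat (card K) \<odot>\<^bsub>V\<^esub> \<iota> (p v)"
    if "good A v" "subgroup K G" "A \<subseteq> K" "K \<subseteq> H" "finite K" for A K v
    using that by (simp add: good_def)
  have lc: "lin_closed V {v \<in> carrier V. \<exists>A. good A v}"
  proof (rule lin_closedI)
    have "good {} \<zero>\<^bsub>V\<^esub>"
      by (rule goodI) (simp_all add: \<iota>0 p0 V.V.vsimps lin_hom_zero[OF _ V.V.fvs_axioms V.V.fvs_axioms])
    then show "\<zero>\<^bsub>V\<^esub> \<in> {v \<in> carrier V. \<exists>A. good A v}" by blast
  next
    fix v w assume "v \<in> {v \<in> carrier V. \<exists>A. good A v}" "w \<in> {v \<in> carrier V. \<exists>A. good A v}"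
    then obtain A B where v: "v \<in> carrier V" "good A v" and w: "w \<in> carrier V" "good B w" by blast
    have "good (A \<union> B) (v \<oplus>\<^bsub>V\<^esub> w)"
    proof (rule goodI)
      show "finite (A \<union> B)" "A \<union> B \<subseteq> H" using v(2) w(2) by (auto simp: good_def)
      fix K assume K: "subgroup K G" "A \<union> B \<subseteq> K" "K \<subseteq> H" "finite K" "isotypic K \<in> lin_hom V V"
      show "isotypic K (v \<oplus>\<^bsub>V\<^esub> w) = of_nat (card K) \<odot>\<^bsub>V\<^esub> \<iota> (p (v \<oplus>\<^bsub>V\<^esub> w))"
        using K(2) v(1) w(1) p_closed \<iota>_closed goodD[OF v(2) K(1) _ K(3,4)] goodD[OF w(2) K(1) _ K(3,4)]
        by (simp add: lin_homD[OF K(5)] lin_homD(2)[OF p_hom] lin_homD(2)[OF \<iota>_hom] V.V.vsimps)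
    qed
    then show "v \<oplus>\<^bsub>V\<^esub> w \<in> {v \<in> carrier V. \<exists>A. good A v}" using v(1) w(1) by blast
  next
    fix c v assume "v \<in> {v \<in> carrier V. \<exists>A. good A v}"
    then obtain A where v: "v \<in> carrier V" "good A v" by blast
    have "good A (c \<odot>\<^bsub>V\<^esub> v)"
    proof (rule goodI)
      show "finite A" "A \<subseteq> H" using v(2) by (auto simp: good_def)
      fix K assume K: "subgroup K G" "A \<subseteq> K" "K \<subseteq> H" "finite K" "isotypic K \<in> lin_hom V V"
      show "isotypic K (c \<odot>\<^bsub>V\<^esub> v) = of_nat (card K) \<odot>\<^bsub>V\<^esub> \<iota> (p (c \<odot>\<^bsub>V\<^esub> v))"
        using v(1) p_closed \<iota>_closed goodD[OF v(2) K(1-4)]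
        by (simp add: lin_homD[OF K(5)] lin_homD(3)[OF p_hom] lin_homD(3)[OF \<iota>_hom] V.V.vsimps mult.commute)
    qed
    then show "c \<odot>\<^bsub>V\<^esub> v \<in> {v \<in> carrier V. \<exists>A. good A v}" using v(1) V.V.smult_closed' by blast
  qed blast
  have "v \<in> {v \<in> carrier V. \<exists>A. good A v}"
  proof (rule span[OF lc _ assms])
    fix g x assume g: "g \<in> carrier G" and x: "x \<in> carrier X"
    have gx: "act V g (\<iota> x) \<in> carrier V" using V.act_closed[OF g \<iota>_closed[OF x]] .
    have "\<exists>A. good A (act V g (\<iota> x))"
    proof (cases "g \<in> I")
      case True
      have y: "act X g x \<in> carrier X" using W.act_closed[of g x] True x by simp
      have eq: "act V g (\<iota> x) = \<iota> (act X g x)" by (rule \<iota>_act[OF True x])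
      have "good {} (\<iota> (act X g x))" by (rule goodI) (simp_all add: isotypic_\<iota> p_\<iota> y)
      then show ?thesis unfolding eq by blast
    next
      case False
      obtain k k' where k: "k \<in> H" "k' \<in> H" "k \<otimes>\<^bsub>G\<^esub> g = g \<otimes>\<^bsub>G\<^esub> k'" "\<psi> k \<noteq> \<psi> k'" using separated[OF g False] by blast
      have k'x: "act V k' (\<iota> x) = \<psi> k' \<odot>\<^bsub>V\<^esub> \<iota> x"
        using \<iota>_act[of k' x] X_act[OF k(2) x] k(2) H_sub(2) x lin_homD(3)[OF \<iota>_hom x] by auto
      have "act V k (act V g (\<iota> x)) = act V g (act V k' (\<iota> x))"
        using V.act_mult[OF H_closed[OF k(1)] g \<iota>_closed[OF x]] V.act_mult[OF g H_closed[OF k(2)] \<iota>_closed[OF x]] k(3)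
        by simp
      then have kg: "act V k (act V g (\<iota> x)) = \<psi> k' \<odot>\<^bsub>V\<^esub> act V g (\<iota> x)"
        using k'x V.act_smult[OF g \<iota>_closed[OF x]] by simp
      \<comment> \<open>k multiplies g \<iota>(x) by \<psi>(k'), whereas averaging turns k into
        \<psi>(k). The two scalars differ, so the average is zero.\<close>
      have "good {k} (act V g (\<iota> x))"
      proof (rule goodI)
        fix K assume K: "subgroup K G" "{k} \<subseteq> K" "K \<subseteq> H" "finite K" "isotypic K \<in> lin_hom V V"
        let ?e = "isotypic K (act V g (\<iota> x))"
        have e: "?e \<in> carrier V" by (rule lin_homD(1)[OF K(5) gx])
        have "\<psi> k \<odot>\<^bsub>V\<^esub> ?e = isotypic K (\<psi> k' \<odot>\<^bsub>V\<^esub> act V g (\<iota> x))"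
          using isotypic_act[OF K(1,3,4) _ gx, of k] K(2) kg by simp
        also have "\<dots> = \<psi> k' \<odot>\<^bsub>V\<^esub> ?e" by (rule lin_homD(3)[OF K(5) gx])
        finally have "(\<psi> k - \<psi> k') \<odot>\<^bsub>V\<^esub> ?e = \<psi> k' \<odot>\<^bsub>V\<^esub> ?e \<oplus>\<^bsub>V\<^esub> (- \<psi> k') \<odot>\<^bsub>V\<^esub> ?e"
          using V.V.smult_l_distr'[OF e, of "\<psi> k" "- \<psi> k'"] by simp
        also have "\<dots> = \<zero>\<^bsub>V\<^esub>"
          using V.V.smult_l_distr'[OF e, of "\<psi> k'" "- \<psi> k'"] e by (simp add: V.V.vsimps)
        finally have "?e = \<zero>\<^bsub>V\<^esub>" by (rule V.V.smult_eq_zero'[OF e]) (use k(4) in simp)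
        then show "?e = of_nat (card K) \<odot>\<^bsub>V\<^esub> \<iota> (p (act V g (\<iota> x)))"
          using p_act[OF g x] False by (simp add: \<iota>0 V.V.vsimps)
      qed (use k(1) in auto)
      then show ?thesis by blast
    qed
    then show "act V g (\<iota> x) \<in> {v \<in> carrier V. \<exists>A. good A v}" using gx by blast
  qed
  then show ?thesis unfolding good_def by blast
qed

lemma irreducible: "irreducible_gmodule G V"
proof (rule irreducible_gmoduleI[OF V.gmodule_axioms])
  note Xi = irreducible_gmoduleD[OF X_irr]
  have p0: "p \<zero>\<^bsub>V\<^esub> = \<zero>\<^bsub>X\<^esub>" by (rule lin_hom_zero[OF p_hom V.V.fvs_axioms W.V.fvs_axioms])
  show "carrier V \<noteq> {\<zero>\<^bsub>V\<^esub>}"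
  proof
    assume V0: "carrier V = {\<zero>\<^bsub>V\<^esub>}"
    have "x = \<zero>\<^bsub>X\<^esub>" if "x \<in> carrier X" for x
      using p_\<iota>[OF that] \<iota>_closed[OF that] V0 p0 by simp
    then show False using Xi(2) W.V.zero_closed by blast
  qed
  fix N assume N: "lin_closed V N" "\<And>g v. g \<in> carrier G \<Longrightarrow> v \<in> N \<Longrightarrow> act V g v \<in> N" "N \<noteq> {\<zero>\<^bsub>V\<^esub>}"
  have NV: "v \<in> carrier V" if "v \<in> N" for v using lin_closedD(1)[OF N(1)] that by blast
  \<comment> \<open>If every vector of the submodule had zero component at the coset I, translation
    would kill all components, and N would be zero.\<close>
  have "\<exists>v\<in>N. p v \<noteq> \<zero>\<^bsub>X\<^esub>"
  proof (rule ccontr)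
    assume "\<not> (\<exists>v\<in>N. p v \<noteq> \<zero>\<^bsub>X\<^esub>)"
    then have z: "p v = \<zero>\<^bsub>X\<^esub>" if "v \<in> N" for v using that by blast
    have "v = \<zero>\<^bsub>V\<^esub>" if "v \<in> N" for v
      by (rule eq_zeroI[OF NV[OF that]]) (rule z[OF N(2)[OF _ that]])
    then show False using N(3) lin_closedD(2)[OF N(1)] by blast
  qed
  then obtain v where v: "v \<in> N" "p v \<noteq> \<zero>\<^bsub>X\<^esub>" by blast
  obtain A where A: "finite A" "A \<subseteq> H" "\<And>K. subgroup K G \<Longrightarrow> A \<subseteq> K \<Longrightarrow> K \<subseteq> H \<Longrightarrow> finite K \<Longrightarrow>
    isotypic K v = of_nat (card K) \<odot>\<^bsub>V\<^esub> \<iota> (p v)" using isotypic_eq[OF NV[OF v(1)]] by blast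
  obtain K where K: "subgroup K G" "A \<subseteq> K" "K \<subseteq> H" "finite K" "of_nat (card K) \<noteq> (0 :: 'f)"
    using locally_finite[OF A(1,2)] by blast
  have pv: "p v \<in> carrier X" by (rule p_closed[OF NV[OF v(1)]])
  have "of_nat (card K) \<odot>\<^bsub>V\<^esub> \<iota> (p v) \<in> N"
    using isotypic_in[OF N(1,2) K(3,4) v(1)] A(3)[OF K(1-4)] by simp
  then have "inverse (of_nat (card K)) \<odot>\<^bsub>V\<^esub> (of_nat (card K) \<odot>\<^bsub>V\<^esub> \<iota> (p v)) \<in> N"
    by (rule lin_closedD(4)[OF N(1)])
  then have ipv: "\<iota> (p v) \<in> N" using \<iota>_closed[OF pv] K(5) by (simp add: V.V.vsimps)
  \<comment> \<open>The part of X that \<iota> maps into N is an I-submodule containing p v, hence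
    all of X.\<close>
  let ?M = "{x \<in> carrier X. \<iota> x \<in> N}"
  have "?M = {\<zero>\<^bsub>X\<^esub>} \<or> ?M = carrier X"
  proof (rule Xi(3)[OF lin_closed_vimage[OF \<iota>_hom W.V.fvs_axioms V.V.fvs_axioms N(1)]])
    fix g x assume g: "g \<in> carrier (G\<lparr>carrier := I\<rparr>)" and x: "x \<in> ?M"
    have "\<iota> (act X g x) = act V g (\<iota> x)" using \<iota>_act[of g x] g x by simp
    also have "\<dots> \<in> N" using N(2)[of g "\<iota> x"] g x sub_closed by simp
    finally show "act X g x \<in> ?M" using W.act_closed[OF g] x by simp
  qed
  moreover have "p v \<in> ?M" using ipv pv by simp
  ultimately have M: "?M = carrier X" using v(2) by blast
  show "carrier V \<subseteq> N"
  proof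
    fix v assume "v \<in> carrier V"
    show "v \<in> N"
    proof (rule span[OF N(1) _ \<open>v \<in> carrier V\<close>])
      fix g x assume "g \<in> carrier G" "x \<in> carrier X"
      then have "x \<in> ?M" using M by simp
      then show "act V g (\<iota> x) \<in> N" using N(2)[OF \<open>g \<in> carrier G\<close>] by simp
    qed
  qed
qed

end

text \<open>A homomorphism T commutes with averaging over K. As \<iota>(x) is |K|-fold fixed by it,
  T(\<iota> x) coincides with its own component in \<iota>'(X'). So T restricts to a nonzero
  I-homomorphism from X to X', and Schur's lemma makes it bijective.\<close>

lemma separated_ind_isomorphic:
  fixes \<psi> :: "'g \<Rightarrow> 'f::field"
  assumes "separated_ind G I X V \<iota> p H \<psi>" "separated_ind G I X' V' \<iota>' p' H \<psi>" "gmod_isomorphic G V V'"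
  shows "gmod_isomorphic (G\<lparr>carrier := I\<rparr>) X X'"
proof -
  interpret A: separated_ind G I X V \<iota> p H \<psi> by fact
  interpret B: separated_ind G I X' V' \<iota>' p' H \<psi> by fact
  obtain T where T: "T \<in> gmod_hom G V V'" and bij: "bij_betw T (carrier V) (carrier V')"
    using assms(3) by (auto simp: gmod_isomorphic_def)
  note t = gmod_homD[OF T]
  let ?\<phi> = "\<lambda>x. p' (T (\<iota> x))"
  have eq: "T (\<iota> x) = \<iota>' (?\<phi> x)" if x: "x \<in> carrier X" for x
  proof -
    have ix: "\<iota> x \<in> carrier V" by (rule A.\<iota>_closed[OF x])
    have Tx: "T (\<iota> x) \<in> carrier V'" by (rule lin_homD(1)[OF t(1) ix])
    have px: "\<iota>' (?\<phi> x) \<in> carrier V'" using B.\<iota>_closed[OF B.p_closed[OF Tx]] .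
    obtain A where A: "finite A" "A \<subseteq> H" "\<And>K. subgroup K G \<Longrightarrow> A \<subseteq> K \<Longrightarrow> K \<subseteq> H \<Longrightarrow> finite K \<Longrightarrow>
      B.isotypic K (T (\<iota> x)) = of_nat (card K) \<odot>\<^bsub>V'\<^esub> \<iota>' (?\<phi> x)" using B.isotypic_eq[OF Tx] by blast
    obtain K where K: "subgroup K G" "A \<subseteq> K" "K \<subseteq> H" "finite K" "of_nat (card K) \<noteq> (0 :: 'f)"
      using A.locally_finite[OF A(1,2)] by blast
    have Kc: "k \<in> carrier G" if "k \<in> K" for k using K(3) A.H_closed that by blast
    have "of_nat (card K) \<odot>\<^bsub>V'\<^esub> T (\<iota> x) = T (A.isotypic K (\<iota> x))"
      using A.isotypic_\<iota>[OF K(3,4) x] lin_homD(3)[OF t(1) ix] by simp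
    also have "\<dots> = (\<Oplus>\<^bsub>V'\<^esub>k\<in>K. T (\<psi> (inv\<^bsub>G\<^esub> k) \<odot>\<^bsub>V\<^esub> act V k (\<iota> x)))"
      unfolding A.isotypic_def
      by (rule lin_hom_finsum[OF t(1) A.V.V.fvs_axioms B.V.V.fvs_axioms K(4)])
        (use Kc ix in \<open>simp add: A.V.V.vsimps A.V.act_closed\<close>)
    also have "\<dots> = B.isotypic K (T (\<iota> x))"
      unfolding B.isotypic_def
      by (rule B.V.V.finsum_cong')
        (use Kc ix Tx in \<open>auto simp: B.V.V.vsimps B.V.act_closed A.V.act_closed lin_homD[OF t(1)] t(2)\<close>)
    finally have e: "of_nat (card K) \<odot>\<^bsub>V'\<^esub> T (\<iota> x) = of_nat (card K) \<odot>\<^bsub>V'\<^esub> \<iota>' (?\<phi> x)"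
      using A(3)[OF K(1-4)] by simp
    have "inverse (of_nat (card K)) \<odot>\<^bsub>V'\<^esub> (of_nat (card K) \<odot>\<^bsub>V'\<^esub> T (\<iota> x)) = T (\<iota> x)"
      using K(5) Tx by (simp add: B.V.V.vsimps)
    then show ?thesis unfolding e using K(5) px by (simp add: B.V.V.vsimps)
  qed
  have \<phi>: "?\<phi> \<in> gmod_hom (G\<lparr>carrier := I\<rparr>) X X'"
  proof (rule gmod_homI[OF lin_hom_comp[OF A.\<iota>_hom lin_hom_comp[OF t(1) B.p_hom]]])
    fix g x assume g: "g \<in> carrier (G\<lparr>carrier := I\<rparr>)" and x: "x \<in> carrier X"
    have gI: "g \<in> I" and gG: "g \<in> carrier G" using g A.sub_closed by auto
    have px: "?\<phi> x \<in> carrier X'"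
      by (rule B.p_closed[OF lin_homD(1)[OF t(1) A.\<iota>_closed[OF x]]])
    have "?\<phi> (act X g x) = p' (act V' g (T (\<iota> x)))"
      using A.\<iota>_act[OF gI x] t(2)[OF gG A.\<iota>_closed[OF x]] by simp
    also have "\<dots> = act X' g (?\<phi> x)" using B.p_act[OF gG px] gI eq[OF x] by simp
    finally show "?\<phi> (act X g x) = act X' g (?\<phi> x)" .
  qed
  obtain x where x: "x \<in> carrier X" "x \<noteq> \<zero>\<^bsub>X\<^esub>"
    using irreducible_gmoduleD(2)[OF A.X_irr] A.W.V.zero_closed by blast
  have "?\<phi> x \<noteq> \<zero>\<^bsub>X'\<^esub>"
  proof
    assume "?\<phi> x = \<zero>\<^bsub>X'\<^esub>"
    then have "T (\<iota> x) = T \<zero>\<^bsub>V\<^esub>"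
      using eq[OF x(1)] lin_hom_zero[OF B.\<iota>_hom B.W.V.fvs_axioms B.V.V.fvs_axioms]
        lin_hom_zero[OF t(1) A.V.V.fvs_axioms B.V.V.fvs_axioms] by simp
    then have "\<iota> x = \<zero>\<^bsub>V\<^esub>"
      using bij A.\<iota>_closed[OF x(1)] by (auto simp: bij_betw_def dest: inj_onD)
    then have "x = p \<zero>\<^bsub>V\<^esub>" using A.p_\<iota>[OF x(1)] by simp
    then show False using x(2) lin_hom_zero[OF A.p_hom A.V.V.fvs_axioms A.W.V.fvs_axioms] by simp
  qed
  then show ?thesis
    using Schur_bij[OF A.X_irr B.X_irr \<phi> x(1)] \<phi> unfolding gmod_isomorphic_def by blast
qed

section \<open>The induced regular module\<close>

text \<open>The modules C \<chi> enter through their induction data alone; \<theta> is the extension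
  of the character from H to I, and \<pi> identifies I/H with S.\<close>

locale regular_decomposition = irreducible_family S ty U
  for S :: "('s, 'm) monoid_scheme" and ty :: "'f::field itself"
    and U :: "('s \<Rightarrow> 'f) \<Rightarrow> ('f, 'u, 's) gmodule" +
  fixes G :: "('g, 'n) monoid_scheme" and H I :: "'g set" and \<pi> :: "'g \<Rightarrow> 's"
    and \<theta> :: "'g \<Rightarrow> 'f" and C :: "('s \<Rightarrow> 'f) \<Rightarrow> ('f, 'v, 'g) gmodule"
    and \<iota> :: "('s \<Rightarrow> 'f) \<Rightarrow> 'u \<Rightarrow> 'v" and p :: "('s \<Rightarrow> 'f) \<Rightarrow> 'v \<Rightarrow> 'u"
  assumes G: "group G" and H: "subgroup H G" "H \<subseteq> I" and I: "subgroup I G"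
    and \<pi>: "\<pi> \<in> hom (G\<lparr>carrier := I\<rparr>) S" "\<pi> ` I = carrier S"
    and kernel: "x \<in> I \<Longrightarrow> \<pi> x = \<one>\<^bsub>S\<^esub> \<longleftrightarrow> x \<in> H"
    and \<theta>: "\<theta> \<in> hom (G\<lparr>carrier := I\<rparr>) F_star"
    and ind: "\<chi> \<in> Irr S \<Longrightarrow> ind_struct G I (twist \<theta> (pullback \<pi> (U \<chi>))) (C \<chi>) (\<iota> \<chi>) (p \<chi>)"
begin

definition total where
  "total = direct_sum_gmod (Irr S) (\<lambda>\<chi>. copies (deg \<chi>) (C \<chi>))"

lemma gmodule_C: "\<chi> \<in> Irr S \<Longrightarrow> gmodule G (C \<chi>)"
  using ind ind_struct.axioms(1) by blast

lemma gmodule_copies: "\<chi> \<in> Irr S \<Longrightarrow> gmodule G (copies (deg \<chi>) (C \<chi>))"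
  unfolding copies_def using gmodule_C by (intro gmodule_direct_sum G) simp_all

lemma gmodule_total: "gmodule G total"
  unfolding total_def by (rule gmodule_direct_sum[OF finite_Irr G gmodule_copies])

lemma copies_sel:
  "carrier (copies n V) = (\<Pi>\<^sub>E i\<in>{..<n}. carrier V)" "act (copies n V) g \<phi> = (\<lambda>i\<in>{..<n}. act V g (\<phi> i))"
  "zero (copies n V) = (\<lambda>i\<in>{..<n}. \<zero>\<^bsub>V\<^esub>)"
  unfolding copies_def by (simp_all add: direct_sum_sel)

lemma total_act: "\<chi> \<in> Irr S \<Longrightarrow> j < deg \<chi> \<Longrightarrow> act total g t \<chi> j = act (C \<chi>) g (t \<chi> j)"
  unfolding total_def by (simp add: direct_sum_sel[OF finite_Irr] copies_sel)

lemma total_comp: "\<chi> \<in> Irr S \<Longrightarrow> j < deg \<chi> \<Longrightarrow> (\<lambda>t. t \<chi> j) \<in> lin_hom total (C \<chi>)"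
proof -
  assume \<chi>: "\<chi> \<in> Irr S" and j: "j < deg \<chi>"
  have 1: "(\<lambda>t. t \<chi>) \<in> lin_hom total (copies (deg \<chi>) (C \<chi>))"
    unfolding total_def by (rule component_lin_hom[OF finite_Irr G gmodule_copies \<chi>])
  have 2: "(\<lambda>t. t j) \<in> lin_hom (copies (deg \<chi>) (C \<chi>)) (C \<chi>)"
    unfolding copies_def by (rule component_lin_hom[OF _ G]) (use gmodule_C[OF \<chi>] j in simp_all)
  show ?thesis by (rule lin_hom_comp[OF 1 2])
qed

lemma total_eqI:
  assumes "s \<in> carrier total" "t \<in> carrier total" "\<And>\<chi> j. \<chi> \<in> Irr S \<Longrightarrow> j < deg \<chi> \<Longrightarrow> s \<chi> j = t \<chi> j"
  shows "s = t"
proof -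
  have st: "s \<in> (\<Pi>\<^sub>E \<chi>\<in>Irr S. \<Pi>\<^sub>E i\<in>{..<deg \<chi>}. carrier (C \<chi>))" "t \<in> (\<Pi>\<^sub>E \<chi>\<in>Irr S. \<Pi>\<^sub>E i\<in>{..<deg \<chi>}. carrier (C \<chi>))"
    using assms(1,2) unfolding total_def by (simp_all add: direct_sum_sel[OF finite_Irr] copies_sel)
  show ?thesis
  proof (rule PiE_ext[OF st])
    fix \<chi> :: "'s \<Rightarrow> 'f" assume \<chi>: "\<chi> \<in> Irr S"
    show "s \<chi> = t \<chi>"
      by (rule PiE_ext[OF PiE_mem[OF st(1) \<chi>] PiE_mem[OF st(2) \<chi>]]) (simp add: assms(3)[OF \<chi>])
  qed
qed

text \<open>The embedding of C \<chi> as the k-th of its copies in the total direct sum.\<close>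

definition cell where
  "cell \<chi> k v = single_comp (Irr S) (\<lambda>\<chi>. copies (deg \<chi>) (C \<chi>)) \<chi> (single_comp {..<deg \<chi>} (\<lambda>_. C \<chi>) k v)"

lemma cell_comp:
  assumes "\<psi> \<in> Irr S" "j < deg \<psi>"
  shows "cell \<chi> k v \<psi> j = (if \<psi> = \<chi> \<and> j = k then v else \<zero>\<^bsub>C \<psi>\<^esub>)"
  using assms by (auto simp: cell_def single_comp_def copies_sel)

lemma cell_lin_hom:
  assumes "\<chi> \<in> Irr S" "k < deg \<chi>"
  shows "cell \<chi> k \<in> lin_hom (C \<chi>) total"
proof -
  have 1: "single_comp {..<deg \<chi>} (\<lambda>_. C \<chi>) k \<in> lin_hom (C \<chi>) (copies (deg \<chi>) (C \<chi>))"
    unfolding copies_def by (rule single_comp_lin_hom[OF _ G]) (use gmodule_C[OF assms(1)] assms(2) in simp_all)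
  have 2: "single_comp (Irr S) (\<lambda>\<chi>. copies (deg \<chi>) (C \<chi>)) \<chi> \<in> lin_hom (copies (deg \<chi>) (C \<chi>)) total"
    unfolding total_def by (rule single_comp_lin_hom[OF finite_Irr G gmodule_copies assms(1)])
  show ?thesis unfolding cell_def by (rule lin_hom_comp[OF 1 2])
qed

lemma total_span:
  assumes Q: "lin_closed total Q" and cells: "\<And>\<chi> k v. \<chi> \<in> Irr S \<Longrightarrow> k < deg \<chi> \<Longrightarrow> v \<in> carrier (C \<chi>) \<Longrightarrow> cell \<chi> k v \<in> Q"
  shows "carrier total \<subseteq> Q"
proof
  interpret T: gmodule G total by (rule gmodule_total)
  fix t assume t: "t \<in> carrier total"
  show "t \<in> Q"
  proof (rule direct_sum_span[OF finite_Irr G gmodule_copies Q[unfolded total_def] _ t[unfolded total_def]])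
    fix \<chi> w assume \<chi>: "\<chi> \<in> Irr S" and w: "w \<in> carrier (copies (deg \<chi>) (C \<chi>))"
    interpret W: gmodule G "copies (deg \<chi>) (C \<chi>)" by (rule gmodule_copies[OF \<chi>])
    let ?s = "single_comp (Irr S) (\<lambda>\<chi>. copies (deg \<chi>) (C \<chi>)) \<chi>"
    define R where "R = {w \<in> carrier (copies (deg \<chi>) (C \<chi>)). ?s w \<in> Q}"
    have "?s \<in> lin_hom (copies (deg \<chi>) (C \<chi>)) total"
      unfolding total_def by (rule single_comp_lin_hom[OF finite_Irr G gmodule_copies \<chi>])
    then have lc: "lin_closed (copies (deg \<chi>) (C \<chi>)) R"
      unfolding R_def by (rule lin_closed_vimage[OF _ W.V.fvs_axioms T.V.fvs_axioms Q])
    have "w \<in> R"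
    proof (rule direct_sum_span[OF _ G _ lc[unfolded copies_def] _ w[unfolded copies_def]])
      fix k v assume k: "k \<in> {..<deg \<chi>}" and v: "v \<in> carrier (C \<chi>)"
      have "single_comp {..<deg \<chi>} (\<lambda>_. C \<chi>) k \<in> lin_hom (C \<chi>) (copies (deg \<chi>) (C \<chi>))"
        unfolding copies_def by (rule single_comp_lin_hom[OF _ G]) (use gmodule_C[OF \<chi>] k in simp_all)
      then have "single_comp {..<deg \<chi>} (\<lambda>_. C \<chi>) k v \<in> carrier (copies (deg \<chi>) (C \<chi>))"
        using v by (rule lin_homD(1))
      then show "single_comp {..<deg \<chi>} (\<lambda>_. C \<chi>) k v \<in> R"
        using cells[OF \<chi> _ v, of k] k unfolding cell_def R_def by simp
    qed (use gmodule_C[OF \<chi>] in simp_all)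
    then show "?s w \<in> Q" by (simp add: R_def)
  qed
qed

text \<open>For g in I the functional \<epsilon> sends g t0 to \<theta>(g) times the weighted sum of
  characters at \<pi>(g) from \<open>orthogonality\<close>, which is 1 on H and 0 elsewhere. For g
  outside I every p \<chi> already gives zero.\<close>

theorem ind_struct_total:
  assumes \<psi>: "\<psi> \<in> hom (G\<lparr>carrier := H\<rparr>) F_star" "\<And>h. h \<in> H \<Longrightarrow> \<psi> h = \<theta> h"
  shows "\<exists>\<iota> p. ind_struct G H (char_module \<psi>) total \<iota> p"
proof -
  obtain b :: "('s \<Rightarrow> 'f) \<Rightarrow> nat \<Rightarrow> 'u" and l :: "('s \<Rightarrow> 'f) \<Rightarrow> nat \<Rightarrow> 'u \<Rightarrow> 'f" and \<kappa> :: "('s \<Rightarrow> 'f) \<Rightarrow> 'f"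
    where fr0: "\<forall>\<chi>\<in>Irr S. frame (U \<chi>) {..<deg \<chi>} (b \<chi>) (l \<chi>)" and \<kappa>0: "\<forall>\<chi>\<in>Irr S. \<kappa> \<chi> \<noteq> 0"
      and orth: "\<forall>\<chi>\<in>Irr S. \<forall>\<psi>\<in>Irr S. \<forall>m\<in>lfun (U \<chi>). \<forall>w\<in>carrier (U \<psi>). \<forall>v\<in>carrier (U \<chi>).
        average S (U \<chi>) (U \<psi>) m w v = (if \<chi> = \<psi> then (\<kappa> \<chi> * m w) \<odot>\<^bsub>U \<psi>\<^esub> v else \<zero>\<^bsub>U \<psi>\<^esub>)"
      and unit: "\<forall>g\<in>carrier S. (\<Sum>\<chi>\<in>Irr S. inverse (\<kappa> \<chi>) * (\<Sum>j<deg \<chi>. l \<chi> j (act (U \<chi>) g (b \<chi> j)))) =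
        (if g = \<one>\<^bsub>S\<^esub> then 1 else 0)"
    by (rule orthogonality)
  have fr: "frame (U \<chi>) {..<deg \<chi>} (b \<chi>) (l \<chi>)" if "\<chi> \<in> Irr S" for \<chi> using fr0 that by blast
  have bc: "b \<chi> j \<in> carrier (U \<chi>)" if "\<chi> \<in> Irr S" "j < deg \<chi>" for \<chi> j
    by (rule frameD(2)[OF fr[OF that(1)]]) (use that(2) in simp)
  have lc: "l \<chi> j \<in> lfun (U \<chi>)" if "\<chi> \<in> Irr S" "j < deg \<chi>" for \<chi> j
    by (rule frameD(3)[OF fr[OF that(1)]]) (use that(2) in simp)
  interpret T: gmodule G total by (rule gmodule_total)
  have IG: "x \<in> carrier G" if "x \<in> I" for x using subgroup.subset[OF I] that by blast
  have \<pi>c: "\<pi> x \<in> carrier S" if "x \<in> I" for x using \<pi>(2) that by blast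
  have gU: "gmodule S (U \<chi>)" if "\<chi> \<in> Irr S" for \<chi> using irreducible_gmoduleD(1)[OF irr[OF that]] .
  have hom: "\<iota> \<chi> \<in> lin_hom (U \<chi>) (C \<chi>)" "p \<chi> \<in> lin_hom (C \<chi>) (U \<chi>)" if "\<chi> \<in> Irr S" for \<chi>
    using ind_struct.\<iota>_hom[OF ind[OF that]] ind_struct.p_hom[OF ind[OF that]]
    by (simp_all add: LinearCombinations.module_hom_def)
  have \<iota>c: "\<iota> \<chi> u \<in> carrier (C \<chi>)" if "\<chi> \<in> Irr S" "u \<in> carrier (U \<chi>)" for \<chi> u
    by (rule lin_homD(1)[OF hom(1)[OF that(1)] that(2)])
  have \<iota>_act: "act (C \<chi>) x (\<iota> \<chi> u) = \<theta> x \<odot>\<^bsub>C \<chi>\<^esub> \<iota> \<chi> (act (U \<chi>) (\<pi> x) u)"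
    if "\<chi> \<in> Irr S" "x \<in> I" "u \<in> carrier (U \<chi>)" for \<chi> x u
    using ind_struct.\<iota>_act[OF ind[OF that(1)] that(2), of u] that(3)
      lin_homD(3)[OF hom(1)[OF that(1)] gmodule.act_closed[OF gU[OF that(1)] \<pi>c[OF that(2)] that(3)]]
    by simp
  have p_act: "p \<chi> (act (C \<chi>) g (\<iota> \<chi> u)) =
      (if g \<in> I then \<theta> g \<odot>\<^bsub>U \<chi>\<^esub> act (U \<chi>) (\<pi> g) u else \<zero>\<^bsub>U \<chi>\<^esub>)"
    if "\<chi> \<in> Irr S" "g \<in> carrier G" "u \<in> carrier (U \<chi>)" for \<chi> g u
    using ind_struct.p_act[OF ind[OF that(1)] that(2), of u] that(3) by simp
  have \<theta>0: "\<theta> x \<noteq> 0" if "x \<in> I" for x using F_star_homD(1)[OF \<theta>] that by simp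
  define t0 where "t0 = (\<lambda>\<chi>\<in>Irr S. \<lambda>j\<in>{..<deg \<chi>}. \<iota> \<chi> (b \<chi> j))"
  have t0: "t0 \<in> carrier total"
    unfolding total_def direct_sum_sel(1)[OF finite_Irr] copies_sel t0_def
    by (intro PiE_I) (auto simp: \<iota>c bc)
  have t0_comp: "t0 \<chi> j = \<iota> \<chi> (b \<chi> j)" if "\<chi> \<in> Irr S" "j < deg \<chi>" for \<chi> j
    using that by (simp add: t0_def)
  have h_act: "act total h t0 = \<psi> h \<odot>\<^bsub>total\<^esub> t0" if h: "h \<in> H" for h
  proof (rule total_eqI)
    have hI: "h \<in> I" using h H(2) by blast
    show "act total h t0 \<in> carrier total" "\<psi> h \<odot>\<^bsub>total\<^esub> t0 \<in> carrier total"
      using T.act_closed[OF IG[OF hI] t0] T.V.smult_closed'[OF t0] by auto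
    fix \<chi> j assume \<chi>: "\<chi> \<in> Irr S" and j: "j < deg \<chi>"
    have "act total h t0 \<chi> j = \<theta> h \<odot>\<^bsub>C \<chi>\<^esub> \<iota> \<chi> (b \<chi> j)"
      using total_act[OF \<chi> j] t0_comp[OF \<chi> j] \<iota>_act[OF \<chi> hI bc[OF \<chi> j]] kernel[OF hI] h
        gmodule.act_one[OF gU[OF \<chi>] bc[OF \<chi> j]] by simp
    also have "\<dots> = (\<psi> h \<odot>\<^bsub>total\<^esub> t0) \<chi> j"
      using lin_homD(3)[OF total_comp[OF \<chi> j] t0, of "\<psi> h"] \<psi>(2)[OF h] t0_comp[OF \<chi> j] by simp
    finally show "act total h t0 \<chi> j = (\<psi> h \<odot>\<^bsub>total\<^esub> t0) \<chi> j" .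
  qed
  \<comment> \<open>\<sigma> chooses preimages in I. In \<open>cell_in\<close> the factor
    \<open>inverse (\<theta> (\<sigma> s))\<close> cancels the twist, so that \<sigma>(s) acts as s
    does.\<close>
  have "\<forall>s\<in>carrier S. \<exists>x\<in>I. \<pi> x = s" unfolding \<pi>(2)[symmetric] by blast
  then obtain \<sigma> where \<sigma>: "\<And>s. s \<in> carrier S \<Longrightarrow> \<sigma> s \<in> I" "\<And>s. s \<in> carrier S \<Longrightarrow> \<pi> (\<sigma> s) = s" by metis
  \<comment> \<open>The sum over s of l_k(s^-1 u) s t0 has as its component at (\<psi>', j) the
    image under \<iota> of an averaged rank one map at u. By orthogonality only (\<chi>, k)
    survives, with value \<kappa>_\<chi> \<iota>(u); thus t0 alone generates each copy
    separately.\<close>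
  have cell_in: "cell \<chi> k (\<iota> \<chi> u) \<in> Q"
    if Q: "lin_closed total Q" "\<And>g. g \<in> carrier G \<Longrightarrow> act total g t0 \<in> Q"
      and \<chi>: "\<chi> \<in> Irr S" and k: "k < deg \<chi>" and u: "u \<in> carrier (U \<chi>)" for Q \<chi> k u
  proof -
    let ?c = "\<lambda>s. l \<chi> k (act (U \<chi>) (inv\<^bsub>S\<^esub> s) u)"
    let ?F = "\<lambda>s. (?c s * inverse (\<theta> (\<sigma> s))) \<odot>\<^bsub>total\<^esub> act total (\<sigma> s) t0"
    have at: "act total (\<sigma> s) t0 \<in> carrier total" if "s \<in> carrier S" for s
      by (rule T.act_closed[OF IG[OF \<sigma>(1)[OF that]] t0])
    have Fc: "?F s \<in> carrier total" if "s \<in> carrier S" for s using at[OF that] by (simp add: T.V.vsimps)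
    have cc: "cell \<chi> k (\<iota> \<chi> u) \<in> carrier total" by (rule lin_homD(1)[OF cell_lin_hom[OF \<chi> k] \<iota>c[OF \<chi> u]])
    have eq: "(\<Oplus>\<^bsub>total\<^esub>s\<in>carrier S. ?F s) = \<kappa> \<chi> \<odot>\<^bsub>total\<^esub> cell \<chi> k (\<iota> \<chi> u)"
    proof (rule total_eqI)
      show "(\<Oplus>\<^bsub>total\<^esub>s\<in>carrier S. ?F s) \<in> carrier total" by (rule T.V.finsum_closed) (use Fc in \<open>simp add: Pi_def\<close>)
      show "\<kappa> \<chi> \<odot>\<^bsub>total\<^esub> cell \<chi> k (\<iota> \<chi> u) \<in> carrier total" using cc by (simp add: T.V.vsimps)
      fix \<psi>' j assume \<psi>': "\<psi>' \<in> Irr S" and j: "j < deg \<psi>'"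
      interpret C: gmodule G "C \<psi>'" by (rule gmodule_C[OF \<psi>'])
      interpret U: gmodule S "U \<psi>'" by (rule gU[OF \<psi>'])
      note tc = total_comp[OF \<psi>' j] and bj = bc[OF \<psi>' j] and ih = hom(1)[OF \<psi>']
      have ub: "act (U \<psi>') s (b \<psi>' j) \<in> carrier (U \<psi>')" if "s \<in> carrier S" for s by (rule U.act_closed[OF that bj])
      have tm: "?F s \<psi>' j = \<iota> \<psi>' (?c s \<odot>\<^bsub>U \<psi>'\<^esub> act (U \<psi>') s (b \<psi>' j))" if s: "s \<in> carrier S" for s
      proof -
        have "?F s \<psi>' j = (?c s * inverse (\<theta> (\<sigma> s))) \<odot>\<^bsub>C \<psi>'\<^esub> (\<theta> (\<sigma> s) \<odot>\<^bsub>C \<psi>'\<^esub> \<iota> \<psi>' (act (U \<psi>') s (b \<psi>' j)))"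
          using lin_homD(3)[OF tc at[OF s]] total_act[OF \<psi>' j] t0_comp[OF \<psi>' j] \<iota>_act[OF \<psi>' \<sigma>(1)[OF s] bj] \<sigma>(2)[OF s]
          by simp
        also have "\<dots> = ?c s \<odot>\<^bsub>C \<psi>'\<^esub> \<iota> \<psi>' (act (U \<psi>') s (b \<psi>' j))"
          using \<theta>0[OF \<sigma>(1)[OF s]] \<iota>c[OF \<psi>' ub[OF s]] by (simp add: C.V.vsimps mult.assoc)
        also have "\<dots> = \<iota> \<psi>' (?c s \<odot>\<^bsub>U \<psi>'\<^esub> act (U \<psi>') s (b \<psi>' j))"
          by (rule lin_homD(3)[OF ih ub[OF s], symmetric])
        finally show ?thesis .
      qed
      have "(\<Oplus>\<^bsub>total\<^esub>s\<in>carrier S. ?F s) \<psi>' j = (\<Oplus>\<^bsub>C \<psi>'\<^esub>s\<in>carrier S. ?F s \<psi>' j)"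
        by (rule lin_hom_finsum[OF tc T.V.fvs_axioms C.V.fvs_axioms fin Fc])
      also have "\<dots> = (\<Oplus>\<^bsub>C \<psi>'\<^esub>s\<in>carrier S. \<iota> \<psi>' (?c s \<odot>\<^bsub>U \<psi>'\<^esub> act (U \<psi>') s (b \<psi>' j)))"
        by (rule C.V.finsum_cong') (use tm \<iota>c[OF \<psi>'] ub in \<open>simp_all add: U.V.vsimps Pi_def\<close>)
      also have "\<dots> = \<iota> \<psi>' (average S (U \<chi>) (U \<psi>') (l \<chi> k) (b \<psi>' j) u)"
        unfolding average_def
        by (rule lin_hom_finsum[OF ih U.V.fvs_axioms C.V.fvs_axioms fin, symmetric]) (use ub in \<open>simp add: U.V.vsimps\<close>)
      also have "average S (U \<chi>) (U \<psi>') (l \<chi> k) (b \<psi>' j) u =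
          (if \<chi> = \<psi>' then (\<kappa> \<chi> * l \<chi> k (b \<psi>' j)) \<odot>\<^bsub>U \<psi>'\<^esub> u else \<zero>\<^bsub>U \<psi>'\<^esub>)"
        using orth \<chi> \<psi>' lc[OF \<chi> k] bj u by blast
      also have "\<iota> \<psi>' \<dots> = \<kappa> \<chi> \<odot>\<^bsub>C \<psi>'\<^esub> (if \<psi>' = \<chi> \<and> j = k then \<iota> \<chi> u else \<zero>\<^bsub>C \<psi>'\<^esub>)"
      proof (cases "\<psi>' = \<chi>")
        case True
        have "l \<chi> k (b \<chi> j) = (if k = j then 1 else 0)"
          by (rule frameD(4)[OF fr[OF \<chi>]]) (use j k True in auto)
        then show ?thesis
          using True u lin_homD(3)[OF ih, of u] C.V.smult_zero'[OF \<iota>c[OF \<psi>', of u]] C.V.smult_rzero'[of "\<kappa> \<chi>"]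
          by auto
      next
        case False
        then show ?thesis using lin_hom_zero[OF ih U.V.fvs_axioms C.V.fvs_axioms] by (auto simp: C.V.vsimps)
      qed
      also have "\<dots> = (\<kappa> \<chi> \<odot>\<^bsub>total\<^esub> cell \<chi> k (\<iota> \<chi> u)) \<psi>' j"
        using lin_homD(3)[OF tc cc, of "\<kappa> \<chi>"] cell_comp[OF \<psi>' j, of \<chi> k "\<iota> \<chi> u"] by simp
      finally show "(\<Oplus>\<^bsub>total\<^esub>s\<in>carrier S. ?F s) \<psi>' j = (\<kappa> \<chi> \<odot>\<^bsub>total\<^esub> cell \<chi> k (\<iota> \<chi> u)) \<psi>' j" .
    qed
    have "(\<Oplus>\<^bsub>total\<^esub>s\<in>carrier S. ?F s) \<in> Q"
      by (rule T.V.finsum_in_lin_closed[OF Q(1) fin]) (rule lin_closedD(4)[OF Q(1) Q(2)[OF IG[OF \<sigma>(1)]]])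
    then have "inverse (\<kappa> \<chi>) \<odot>\<^bsub>total\<^esub> (\<kappa> \<chi> \<odot>\<^bsub>total\<^esub> cell \<chi> k (\<iota> \<chi> u)) \<in> Q"
      unfolding eq by (rule lin_closedD(4)[OF Q(1)])
    then show ?thesis using cc \<kappa>0 \<chi> by (simp add: T.V.vsimps)
  qed
  have span: "carrier total \<subseteq> Q"
    if Q: "lin_closed total Q" "\<And>g. g \<in> carrier G \<Longrightarrow> act total g t0 \<in> Q" for Q
  proof (rule total_span[OF Q(1)])
    fix \<chi> k v assume \<chi>: "\<chi> \<in> Irr S" and k: "k < deg \<chi>" and v: "v \<in> carrier (C \<chi>)"
    interpret C: ind_struct G I "twist \<theta> (pullback \<pi> (U \<chi>))" "C \<chi>" "\<iota> \<chi>" "p \<chi>" by (rule ind[OF \<chi>])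
    note ch = cell_lin_hom[OF \<chi> k]
    have "v \<in> {v \<in> carrier (C \<chi>). cell \<chi> k v \<in> Q}"
    proof (rule C.span[OF lin_closed_vimage[OF ch C.V.V.fvs_axioms T.V.fvs_axioms Q(1)] _ v])
      fix g u assume g: "g \<in> carrier G" and "u \<in> carrier (twist \<theta> (pullback \<pi> (U \<chi>)))"
      then have u: "u \<in> carrier (U \<chi>)" by simp
      have iu: "\<iota> \<chi> u \<in> carrier (C \<chi>)" by (rule \<iota>c[OF \<chi> u])
      have cu: "cell \<chi> k (\<iota> \<chi> u) \<in> carrier total" by (rule lin_homD(1)[OF ch iu])
      have giu: "act (C \<chi>) g (\<iota> \<chi> u) \<in> carrier (C \<chi>)" by (rule C.V.act_closed[OF g iu])
      \<comment> \<open>\<open>cell_in\<close> is applied to the preimage of Q under g in place of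
        Q, which brings the translates g \<iota>(u) into reach.\<close>
      let ?R = "{t \<in> carrier total. act total g t \<in> Q}"
      have R: "lin_closed total ?R"
        by (rule lin_closed_vimage[OF T.act_lin_hom[OF g] T.V.fvs_axioms T.V.fvs_axioms Q(1)])
      have "cell \<chi> k (\<iota> \<chi> u) \<in> ?R"
      proof (rule cell_in[OF R _ \<chi> k u])
        fix h assume h: "h \<in> carrier G"
        have "act total (g \<otimes>\<^bsub>G\<^esub> h) t0 \<in> Q" by (rule Q(2)) (use g h in simp)
        then show "act total h t0 \<in> ?R" using T.act_closed[OF h t0] T.act_mult[OF g h t0] by simp
      qed
      moreover have "act total g (cell \<chi> k (\<iota> \<chi> u)) = cell \<chi> k (act (C \<chi>) g (\<iota> \<chi> u))"
      proof (rule total_eqI[OF T.act_closed[OF g cu] lin_homD(1)[OF ch giu]])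
        fix \<psi>' j assume *: "\<psi>' \<in> Irr S" "j < deg \<psi>'"
        then show "act total g (cell \<chi> k (\<iota> \<chi> u)) \<psi>' j = cell \<chi> k (act (C \<chi>) g (\<iota> \<chi> u)) \<psi>' j"
          using gmodule.act_zero[OF gmodule_C[OF *(1)] g] by (simp add: total_act cell_comp)
      qed
      ultimately show "act (C \<chi>) g (\<iota> \<chi> u) \<in> {v \<in> carrier (C \<chi>). cell \<chi> k v \<in> Q}" using giu by simp
    qed
    then show "cell \<chi> k v \<in> Q" by simp
  qed
  \<comment> \<open>Traces over the frames of the U \<chi>, weighted as in the expansion of the
    identity of FS.\<close>
  define \<epsilon> where "\<epsilon> t = (\<Sum>\<chi>\<in>Irr S. inverse (\<kappa> \<chi>) * (\<Sum>j<deg \<chi>. l \<chi> j (p \<chi> (t \<chi> j))))" for t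
  have lt: "(\<lambda>t. l \<chi> j (p \<chi> (t \<chi> j))) \<in> lfun total" if "\<chi> \<in> Irr S" "j < deg \<chi>" for \<chi> j
    by (rule lfun_comp[OF lin_hom_comp[OF total_comp[OF that] hom(2)[OF that(1)]] lc[OF that]])
  have \<epsilon>_hom: "\<epsilon> \<in> lin_hom total (char_module \<psi>)"
  proof (rule lin_homI)
    fix v assume v: "v \<in> carrier total"
    show "\<epsilon> (c \<odot>\<^bsub>total\<^esub> v) = c \<odot>\<^bsub>char_module \<psi>\<^esub> \<epsilon> v" for c
      using v unfolding \<epsilon>_def
      by (simp add: lfunD(2)[OF lt] sum_distrib_left mult.left_commute)
    show "\<epsilon> (v \<oplus>\<^bsub>total\<^esub> w) = \<epsilon> v \<oplus>\<^bsub>char_module \<psi>\<^esub> \<epsilon> w" if "w \<in> carrier total" for w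
      using v that unfolding \<epsilon>_def
      by (simp add: lfunD(1)[OF lt] sum.distrib distrib_left)
  qed simp
  have \<epsilon>_act: "\<epsilon> (act total g t0) = (if g \<in> H then \<psi> g else 0)" if g: "g \<in> carrier G" for g
  proof (cases "g \<in> I")
    case True
    have "l \<chi> j (p \<chi> (act total g t0 \<chi> j)) = \<theta> g * l \<chi> j (act (U \<chi>) (\<pi> g) (b \<chi> j))"
      if "\<chi> \<in> Irr S" "j < deg \<chi>" for \<chi> j
      using total_act[OF that] t0_comp[OF that] p_act[OF that(1) g bc[OF that]] True
        lfunD(2)[OF lc[OF that] gmodule.act_closed[OF gU[OF that(1)] \<pi>c[OF True] bc[OF that]]] by simp
    then have "\<epsilon> (act total g t0) =
        \<theta> g * (\<Sum>\<chi>\<in>Irr S. inverse (\<kappa> \<chi>) * (\<Sum>j<deg \<chi>. l \<chi> j (act (U \<chi>) (\<pi> g) (b \<chi> j))))"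
      unfolding \<epsilon>_def by (simp add: sum_distrib_left mult.left_commute)
    also have "\<dots> = (if g \<in> H then \<psi> g else 0)"
      using unit \<pi>c[OF True] kernel[OF True] \<psi>(2) by simp
    finally show ?thesis .
  next
    case False
    have "l \<chi> j (p \<chi> (act total g t0 \<chi> j)) = 0" if "\<chi> \<in> Irr S" "j < deg \<chi>" for \<chi> j
      using total_act[OF that] t0_comp[OF that] p_act[OF that(1) g bc[OF that]] False
        fvs.lfun_zero[OF gmodule_fvs[OF gU[OF that(1)]] lc[OF that]] by simp
    moreover have "g \<notin> H" using False H(2) by blast
    ultimately show ?thesis unfolding \<epsilon>_def by simp
  qed
  have "ind_struct G H (char_module \<psi>) total (\<lambda>c. c \<odot>\<^bsub>total\<^esub> t0) \<epsilon>"
  proof (rule ind_struct_charI[OF T.gmodule_axioms H(1) \<psi>(1) t0])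
    show "act total h t0 = \<psi> h \<odot>\<^bsub>total\<^esub> t0" if "h \<in> H" for h by (rule h_act[OF that])
    show "\<epsilon> \<in> lin_hom total (char_module \<psi>)" by (rule \<epsilon>_hom)
    show "\<epsilon> (act total g t0) = (if g \<in> H then \<psi> g else 0)" if "g \<in> carrier G" for g by (rule \<epsilon>_act[OF that])
    fix Q assume "lin_closed total Q" "\<And>g. g \<in> carrier G \<Longrightarrow> act total g t0 \<in> Q"
    then show "carrier total \<subseteq> Q" by (rule span)
  qed
  then show ?thesis by blast
qed

end

section \<open>The decomposition of basic modules\<close>

text \<open>\<theta> has nonzero values and \<pi> is onto, so every invariant subspace of the
  twisted pullback is invariant in U.\<close>

lemma irreducible_twist_pullback:
  assumes U: "irreducible_gmodule S U" and G: "group G" and \<pi>: "\<pi> \<in> hom G S" "\<pi> ` carrier G = carrier S"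
    and \<theta>: "\<theta> \<in> hom G F_star"
  shows "irreducible_gmodule G (twist \<theta> (pullback \<pi> U))"
proof (rule irreducible_gmoduleI)
  note U = irreducible_gmoduleD[OF U]
  interpret U: gmodule S U by (rule U(1))
  show "gmodule G (twist \<theta> (pullback \<pi> U))" by (rule gmodule_twist[OF gmodule_pullback[OF U(1) G \<pi>(1)] \<theta>])
  show "carrier (twist \<theta> (pullback \<pi> U)) \<noteq> {\<zero>\<^bsub>twist \<theta> (pullback \<pi> U)\<^esub>}" using U(2) by simp
  fix N assume N: "lin_closed (twist \<theta> (pullback \<pi> U)) N"
    "\<And>g v. g \<in> carrier G \<Longrightarrow> v \<in> N \<Longrightarrow> act (twist \<theta> (pullback \<pi> U)) g v \<in> N"
    "N \<noteq> {\<zero>\<^bsub>twist \<theta> (pullback \<pi> U)\<^esub>}"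
  have lc: "lin_closed U N" using N(1) by simp
  have "act U s v \<in> N" if "s \<in> carrier S" "v \<in> N" for s v
  proof -
    have "s \<in> \<pi> ` carrier G" using \<pi>(2) that(1) by simp
    then obtain g where g: "g \<in> carrier G" "s = \<pi> g" by blast
    have v: "v \<in> carrier U" by (rule subsetD[OF lin_closedD(1)[OF lc] that(2)])
    have "inverse (\<theta> g) \<odot>\<^bsub>U\<^esub> (\<theta> g \<odot>\<^bsub>U\<^esub> act U s v) \<in> N"
      using lin_closedD(4)[OF lc N(2)[OF g(1) that(2)]] g(2) by simp
    then show ?thesis
      using F_star_homD(1)[OF \<theta> g(1)] U.act_closed[OF that(1) v] by (simp add: U.V.vsimps)
  qed
  then have "N = {\<zero>\<^bsub>U\<^esub>} \<or> N = carrier U" by (rule U(3)[OF lc])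
  then show "carrier (twist \<theta> (pullback \<pi> U)) \<subseteq> N" using N(3) by simp
qed

lemma isomorphic_twist_pullback:
  assumes "gmod_isomorphic G (twist \<theta> (pullback \<pi> U)) (twist \<theta> (pullback \<pi> U'))" "gmodule S U" "gmodule S U'"
    and \<pi>: "\<pi> ` carrier G = carrier S" and \<theta>: "\<theta> \<in> hom G F_star"
  shows "gmod_isomorphic S U U'"
proof -
  interpret U: gmodule S U by fact
  interpret U': gmodule S U' by fact
  obtain T where T: "T \<in> gmod_hom G (twist \<theta> (pullback \<pi> U)) (twist \<theta> (pullback \<pi> U'))"
    and bij: "bij_betw T (carrier U) (carrier U')"
    using assms(1) by (auto simp: gmod_isomorphic_def)
  have lh: "T \<in> lin_hom U U'" using gmod_homD(1)[OF T] by simp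
  have "T \<in> gmod_hom S U U'"
  proof (rule gmod_homI[OF lh])
    fix s v assume s: "s \<in> carrier S" and v: "v \<in> carrier U"
    have "s \<in> \<pi> ` carrier G" using \<pi> s by simp
    then obtain g where g: "g \<in> carrier G" "s = \<pi> g" by blast
    have Tv: "T v \<in> carrier U'" "T (act U s v) \<in> carrier U'"
      using lin_homD(1)[OF lh] v U.act_closed[OF s v] by auto
    have "\<theta> g \<odot>\<^bsub>U'\<^esub> T (act U s v) = \<theta> g \<odot>\<^bsub>U'\<^esub> act U' s (T v)"
      using gmod_homD(2)[OF T g(1), of v] v g(2) lin_homD(3)[OF lh U.act_closed[OF s v]] by simp
    then have "inverse (\<theta> g) \<odot>\<^bsub>U'\<^esub> (\<theta> g \<odot>\<^bsub>U'\<^esub> T (act U s v)) =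
        inverse (\<theta> g) \<odot>\<^bsub>U'\<^esub> (\<theta> g \<odot>\<^bsub>U'\<^esub> act U' s (T v))"
      by simp
    then show "T (act U s v) = act U' s (T v)"
      using F_star_homD(1)[OF \<theta> g(1)] Tv U'.act_closed[OF s Tv(1)] by (simp add: U'.V.vsimps)
  qed
  then show ?thesis using bij by (auto simp: gmod_isomorphic_def)
qed

lemma quotient_map:
  fixes D :: "('l::linorder \<times> 'l) set"
  assumes D: "basic_set D"
  defines "\<pi> \<equiv> \<lambda>x :: ('l, 'r::ring_1) mclain_elt. H_sub D #>\<^bsub>mclain\<^esub> x"
  shows "\<pi> \<in> hom (mclain\<lparr>carrier := I_sub D\<rparr>) (S_quot D)" "\<pi> ` I_sub D = carrier (S_quot D)"
    "x \<in> I_sub D \<Longrightarrow> \<pi> x = \<one>\<^bsub>S_quot D\<^esub> \<longleftrightarrow> x \<in> H_sub D"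
proof -
  show "\<pi> ` I_sub D = carrier (S_quot D)" by (simp add: S_quot_sel \<pi>_def)
  show "\<pi> \<in> hom (mclain\<lparr>carrier := I_sub D\<rparr>) (S_quot D)"
    by (rule homI) (simp_all add: S_quot_sel \<pi>_def S_quot_mult[OF D] del: mclain_sel(2))
  assume x: "x \<in> I_sub D"
  have xM: "x \<in> carrier mclain" using subgroup.subset[OF subgroup_I[OF D]] x by blast
  have "\<one>\<^bsub>S_quot D\<^esub> = H_sub D" by (simp add: S_quot_def FactGroup_def)
  moreover have "H_sub D #>\<^bsub>mclain\<^esub> x = H_sub D" if "x \<in> H_sub D"
    by (rule mclain.coset_join2[OF xM subgroup_H that])
  moreover have "x \<in> H_sub D" if "H_sub D #>\<^bsub>mclain\<^esub> x = H_sub D"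
    using mclain.rcos_self[OF xM subgroup_H[of D]] that by simp
  ultimately show "\<pi> x = \<one>\<^bsub>S_quot D\<^esub> \<longleftrightarrow> x \<in> H_sub D" unfolding \<pi>_def by auto
qed

lemma ind_struct_constituent:
  \<comment> \<open>\<open>tensor_char_iso\<close> puts the twisted pullback in place of the tensor
    product from which \<open>constituent\<close> is induced.\<close>
  fixes D :: "('l::linorder \<times> 'l) set" and U :: "('f::field, 'u, ('l, 'r::ring_1) mclain_elt set) gmodule"
  assumes D: "basic_set D" and U: "gmodule (S_quot D) U"
    and lam1: "lam1 \<in> hom (mclain\<lparr>carrier := I_sub D\<rparr>) F_star"
  shows "\<exists>\<iota> p. ind_struct mclain (I_sub D) (twist lam1 (pullback (\<lambda>x. H_sub D #>\<^bsub>mclain\<^esub> x) U))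
    (constituent D U lam1) \<iota> p"
proof -
  let ?I = "(mclain :: ('l, 'r) mclain_elt monoid)\<lparr>carrier := I_sub D\<rparr>"
  let ?X = "pullback (\<lambda>x. H_sub D #>\<^bsub>mclain\<^esub> x) U"
  have I: "group ?I" by (rule subgroup.subgroup_is_group[OF subgroup_I[OF D] group_mclain])
  have X: "gmodule ?I ?X" by (rule gmodule_pullback[OF U I quotient_map(1)[OF D]])
  obtain \<theta> where \<theta>: "gmodule ?I (tensor_gmod ?X (char_module lam1))"
    "\<theta> \<in> gmod_hom ?I (twist lam1 ?X) (tensor_gmod ?X (char_module lam1))"
    "bij_betw \<theta> (carrier (twist lam1 ?X)) (carrier (tensor_gmod ?X (char_module lam1)))"
    by (rule tensor_char_iso[OF X lam1])
  obtain \<iota> p where "ind_struct mclain (I_sub D) (tensor_gmod ?X (char_module lam1)) (constituent D U lam1) \<iota> p"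
    unfolding constituent_def by (rule ind_struct_induced[OF group_mclain subgroup_I[OF D] \<theta>(1)])
  from ind_struct_iso[OF this gmodule_twist[OF X lam1] \<theta>(2,3)] show ?thesis by blast
qed

theorem theorem8p15:
  fixes D :: "('l::linorder \<times> 'l) set"
    and f :: "'l \<times> 'l \<Rightarrow> 'r::ring_1 \<Rightarrow> 'f::field"
    and U :: "(('l, 'r) mclain_elt set \<Rightarrow> 'f) \<Rightarrow> ('f, 'u, ('l, 'r) mclain_elt set) gmodule"
    and lam1 :: "('l, 'r) mclain_elt \<Rightarrow> 'f"
  assumes "finite (UNIV :: 'r set)"
    and "basic_set D"
    and "\<forall>d\<in>D. right_primitive (f d)"
    and "\<not> special_triple D"
    and "splitting_field TYPE('f) (S_quot D :: ('l, 'r) mclain_elt set monoid)"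
    and "strongly_ascendant TYPE('x) CHAR('f)
           (mclain :: ('l, 'r) mclain_elt monoid) (I_sub D)"
    and U: "\<forall>\<chi>\<in>Irr (S_quot D).
           irreducible_gmodule (S_quot D) (U \<chi>) \<and> character_of (S_quot D) (U \<chi>) = \<chi>"
    and lam1_hom: "lam1 \<in> hom (mclain\<lparr>carrier := I_sub D\<rparr>) F_star"
    and lam1_ext: "\<forall>x\<in>H_sub D. lam1 x = lambda_char D f x"
  shows "gmod_isomorphic mclain (basic_module D f)
           (direct_sum_gmod (Irr (S_quot D))
              (\<lambda>\<chi>. copies (vectorspace.dim class_ring (U \<chi>)) (constituent D (U \<chi>) lam1)))
       \<and> (\<forall>\<chi>\<in>Irr (S_quot D). irreducible_gmodule mclain (constituent D (U \<chi>) lam1))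
       \<and> (\<forall>\<chi>\<in>Irr (S_quot D). \<forall>\<chi>'\<in>Irr (S_quot D). \<chi> \<noteq> \<chi>' \<longrightarrow>
            \<not> gmod_isomorphic mclain (constituent D (U \<chi>) lam1) (constituent D (U \<chi>') lam1))"
proof -
  let ?M = "mclain :: ('l, 'r) mclain_elt monoid"
  let ?S = "S_quot D :: ('l, 'r) mclain_elt set monoid"
  let ?I = "I_sub D :: ('l, 'r) mclain_elt set"
  let ?H = "H_sub D :: ('l, 'r) mclain_elt set"
  let ?\<pi> = "\<lambda>x :: ('l, 'r) mclain_elt. H_sub D #>\<^bsub>mclain\<^esub> x"
  let ?X = "\<lambda>\<chi>. twist lam1 (pullback ?\<pi> (U \<chi>))"
  let ?C = "\<lambda>\<chi>. constituent D (U \<chi>) lam1"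
  note fin = assms(1) and D = assms(2)
  have rp: "right_primitive (f d)" if "d \<in> D" for d using assms(3) that by blast
  \<comment> \<open>A basic set is not empty, so a right primitive character is at hand to show that
    |R| is nonzero in F.\<close>
  obtain d where "d \<in> D" using D by (auto simp: basic_set_def)
  then have q: "of_nat (card (UNIV :: 'r set)) \<noteq> (0 :: 'f)" by (rule card_ring_nonzero[OF fin rp])
  have "finite_rep ?S TYPE('f)"
    by (intro finite_rep.intro finite_rep_axioms.intro group_S_quot[OF D] S_quot_finite(1)[OF D fin] assms(5))
      (simp add: S_quot_finite(2)[OF D fin] q)
  then interpret F: irreducible_family ?S "TYPE('f)" U
    using U by (intro irreducible_family.intro irreducible_family_axioms.intro) auto
  have gI: "group (?M\<lparr>carrier := ?I\<rparr>)" by (rule subgroup.subgroup_is_group[OF subgroup_I[OF D] group_mclain])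
  note \<pi> = quotient_map[OF D, where 'r = 'r]
  have HI: "h \<in> ?I" if "h \<in> ?H" for h using H_sub_I[OF D] that by blast
  \<comment> \<open>Multiplicativity of \<lambda> on H is inherited from its extension to I.\<close>
  have lam_hom: "lambda_char D f \<in> hom (?M\<lparr>carrier := ?H\<rparr>) F_star"
  proof (rule homI)
    fix x y assume "x \<in> carrier (?M\<lparr>carrier := ?H\<rparr>)" "y \<in> carrier (?M\<lparr>carrier := ?H\<rparr>)"
    then have xy: "x \<in> ?H" "y \<in> ?H" by auto
    have "lam1 (x \<otimes>\<^bsub>?M\<^esub> y) = lam1 x * lam1 y" using F_star_homD(2)[OF lam1_hom] HI xy by simp
    moreover have "x \<otimes>\<^bsub>?M\<^esub> y \<in> ?H" by (rule subgroup.m_closed[OF subgroup_H xy])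
    ultimately show "lambda_char D f (x \<otimes>\<^bsub>?M\<lparr>carrier := ?H\<rparr>\<^esub> y) = lambda_char D f x \<otimes>\<^bsub>F_star\<^esub> lambda_char D f y"
      using lam1_ext xy by (simp del: mclain_sel(2))
    show "lambda_char D f x \<in> carrier F_star"
      using F_star_homD(1)[OF lam1_hom, of x] HI[OF xy(1)] lam1_ext xy(1) by simp
  qed
  have "\<forall>\<chi>\<in>Irr ?S. \<exists>\<iota> p. ind_struct ?M ?I (?X \<chi>) (?C \<chi>) \<iota> p"
    using ind_struct_constituent[OF D _ lam1_hom] irreducible_gmoduleD(1)[OF F.irr] by blast
  then obtain \<iota> p where ind: "\<And>\<chi>. \<chi> \<in> Irr ?S \<Longrightarrow> ind_struct ?M ?I (?X \<chi>) (?C \<chi>) (\<iota> \<chi>) (p \<chi>)" by metis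
  interpret R: regular_decomposition ?S "TYPE('f)" U ?M ?H ?I ?\<pi> lam1 ?C \<iota> p
  proof (rule regular_decomposition.intro[OF F.irreducible_family_axioms], rule regular_decomposition_axioms.intro)
    show "?\<pi> \<in> hom (?M\<lparr>carrier := ?I\<rparr>) ?S" "?\<pi> ` ?I = carrier ?S" by (rule \<pi>(1), rule \<pi>(2))
    show "?\<pi> x = \<one>\<^bsub>?S\<^esub> \<longleftrightarrow> x \<in> ?H" if "x \<in> ?I" for x by (rule \<pi>(3)[OF that])
    show "ind_struct ?M ?I (?X \<chi>) (?C \<chi>) (\<iota> \<chi>) (p \<chi>)" if "\<chi> \<in> Irr ?S" for \<chi> by (rule ind[OF that])
  qed (rule group_mclain subgroup_H H_sub_I[OF D] subgroup_I[OF D] lam1_hom)+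
  have total: "\<exists>\<iota> p. ind_struct ?M ?H (char_module (lambda_char D f)) R.total \<iota> p"
    by (rule R.ind_struct_total[OF lam_hom]) (simp add: lam1_ext)
  have basic: "\<exists>\<iota> p. ind_struct ?M ?H (char_module (lambda_char D f)) (basic_module D f) \<iota> p"
    by (rule ind_struct_basic[OF D linear_char_if_right_primitive[OF rp] lam_hom])
  have 1: "gmod_isomorphic ?M (basic_module D f) R.total"
  proof -
    obtain \<iota>1 p1 where t: "ind_struct ?M ?H (char_module (lambda_char D f)) R.total \<iota>1 p1" using total by blast
    obtain \<iota>2 p2 where b: "ind_struct ?M ?H (char_module (lambda_char D f)) (basic_module D f) \<iota>2 p2"
      using basic by blast
    show ?thesis by (rule ind_struct_unique[OF b t])
  qed
  have sep: "separated_ind ?M ?I (?X \<chi>) (?C \<chi>) (\<iota> \<chi>) (p \<chi>) ?H (lambda_char D f)" if \<chi>: "\<chi> \<in> Irr ?S" for \<chi>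
  proof (intro separated_ind.intro separated_ind_axioms.intro ind[OF \<chi>] subgroup_H H_sub_I[OF D] lam_hom)
    interpret U: gmodule ?S "U \<chi>" by (rule irreducible_gmoduleD(1)[OF F.irr[OF \<chi>]])
    \<comment> \<open>H is the kernel of I -> S, so it acts on the coefficient module through the
      twist alone.\<close>
    show "act (?X \<chi>) h x = lambda_char D f h \<odot>\<^bsub>?X \<chi>\<^esub> x" if "h \<in> ?H" "x \<in> carrier (?X \<chi>)" for h x
      using that \<pi>(3)[OF HI[OF that(1)]] lam1_ext U.act_one by simp
    show "irreducible_gmodule (?M\<lparr>carrier := ?I\<rparr>) (?X \<chi>)"
      by (rule irreducible_twist_pullback[OF F.irr[OF \<chi>] gI \<pi>(1) _ lam1_hom]) (simp add: \<pi>(2))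
    show "\<exists>k\<in>?H. \<exists>k'\<in>?H. k \<otimes>\<^bsub>?M\<^esub> g = g \<otimes>\<^bsub>?M\<^esub> k' \<and> lambda_char D f k \<noteq> lambda_char D f k'"
      if "g \<in> carrier ?M" "g \<notin> ?I" for g
      by (rule lambda_separates[OF D rp that])
    show "\<exists>K. subgroup K ?M \<and> A \<subseteq> K \<and> K \<subseteq> ?H \<and> finite K \<and> of_nat (card K) \<noteq> (0 :: 'f)"
      if A: "finite A" "A \<subseteq> ?H" for A
    proof -
      obtain K n where "subgroup K ?M" "A \<subseteq> K" "K \<subseteq> ?H" "finite K" "card K = card (UNIV :: 'r set) ^ n"
        using H_locally_finite[OF fin A] by blast
      then show ?thesis using q by (intro exI[of _ K]) simp
    qed
  qed
  have 2: "irreducible_gmodule ?M (?C \<chi>)" if "\<chi> \<in> Irr ?S" for \<chi>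
    by (rule separated_ind.irreducible[OF sep[OF that]])
  have 3: "\<not> gmod_isomorphic ?M (?C \<chi>) (?C \<chi>')" if "\<chi> \<in> Irr ?S" "\<chi>' \<in> Irr ?S" "\<chi> \<noteq> \<chi>'" for \<chi> \<chi>'
  proof
    assume "gmod_isomorphic ?M (?C \<chi>) (?C \<chi>')"
    then have "gmod_isomorphic (?M\<lparr>carrier := ?I\<rparr>) (?X \<chi>) (?X \<chi>')"
      by (rule separated_ind_isomorphic[OF sep[OF that(1)] sep[OF that(2)]])
    then have "gmod_isomorphic ?S (U \<chi>) (U \<chi>')"
      by (rule isomorphic_twist_pullback[OF _ irreducible_gmoduleD(1)[OF F.irr[OF that(1)]]
            irreducible_gmoduleD(1)[OF F.irr[OF that(2)]] _ lam1_hom]) (simp add: \<pi>(2))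
    then show False using F.not_isomorphic[OF that] by blast
  qed
  show ?thesis using 1 2 3 unfolding R.total_def by blast
qed

end
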